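(* Suppose $(\lambda_h,\boldsymbol\sigma_h,u_h)$ is an eigenpair of the discrete mixed eigenvalue problem and $(\lambda,\boldsymbol\sigma,u)$ is the corresponding eigenpair of the continuous mixed eigenvalue problem, with $u\in H^5(\Omega)$. Then, as $h\to0$, $$\lambda_h-\lambda=-\frac1{12}\sum_{K_{i,j}\in\mathcal T_h}\Big(h_{x_i}^2\int_{K_{i,j}}u_{xxx}u_x\,dx\,dy+h_{y_j}^2\int_{K_{i,j}}u_{yyy}u_y\,dx\,dy\Big)+O(h^4).$$
   Context: $\Omega\subset\mathbb R^2$ is a connected bounded domain that can be divided into non-overlapping axis-parallel rectangles without hanging nodes. $\mathcal T_h$ is a rectangular mesh of $\overline\Omega$ obtained from grid lines $x_0<\dots<x_{n_1}$, $y_0<\dots<y_{n_2}$: its elements are the cells $K_{i,j}=[x_{i-1},x_i]\times[y_{j-1},y_j]$ contained in $\overline\Omega$, with $h_{x_i}=x_i-x_{i-1}$, $h_{y_j}=y_j-y_{j-1}$, and $h=\max\{h_{x_i},h_{y_j}\}$. One considers a family of such meshes with $h\to0$. $(\cdot,\cdot)$ and $\|\cdot\|_0$ are the $L^2(\Omega)$ inner product and norm. $\boldsymbol\Sigma=\boldsymbol H(\operatorname{div},\Omega)$, $V=L^2(\Omega)$. With $Q_{mn}=\operatorname{span}\{x^iy^j:0\le i\le m,0\le j\le n\}$, $\boldsymbol\Sigma_h=\{\boldsymbol\tau_h\in\boldsymbol\Sigma:\boldsymbol\tau_h|_K\in Q_{10}(K)\times Q_{01}(K)\ \forall K\in\mathcal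 T_h\}$ and $V_h=\{v_h\in V: v_h|_K \text{ constant }\forall K\in\mathcal T_h\}$. Continuous problem (mixed form of $-\Delta u=\lambda u$ in $\Omega$, $u=0$ on $\partial\Omega$, with $\boldsymbol\sigma=-\nabla u$): find $(\lambda,\boldsymbol\sigma,u)\in\mathbb R\times\boldsymbol\Sigma\times V$ with $(\boldsymbol\sigma,\boldsymbol\tau)-(\operatorname{div}\boldsymbol\tau,u)=0$ and $(\operatorname{div}\boldsymbol\sigma,v)=\lambda(u,v)$ for all $(\boldsymbol\tau,v)\in\boldsymbol\Sigma\times V$; eigenvalues $0<\lambda_1\le\lambda_2\le\cdots$, $L^2$-orthonormal $u_k$. Discrete problem: find $(\lambda_h,\boldsymbol\sigma_h,u_h)\in\mathbb R\times\boldsymbol\Sigma_h\times V_h$ with $(\boldsymbol\sigma_h,\boldsymbol\tau_h)-(\operatorname{div}\boldsymbol\tau_h,u_h)=0$ and $(\operatorname{div}\boldsymbol\sigma_h,v_h)=\lambda_h(u_h,v_h)$ for all $(\boldsymbol\tau_h,v_h)\in\boldsymbol\Sigma_h\times V_h$; eigenvalues $0<\lambda_{1,h}\le\lambda_{2,h}\le\cdots$, $L^2$-orthonormal $u_{k,h}$. "Corresponding": for a fixed index $k$, $(\lambda_h,\boldsymbol\sigma_h,u_h)=(\lambda_{k,h},\boldsymbol\sigma_{k,h},u_{k,h})$, $\lambda=\lambda_k$, and $u$ is the element of the eigenspace $E_k=\operatorname{span}\{u_j:\lambda_j=\lambda_k\}$ with $\|u\|_0=1$ whose $L^2$-orthogonal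 projection onto $E_{k,h}=\operatorname{span}\{u_{j,h}:\lambda_j=\lambda_k\}$ is a positive multiple of $u_{k,h}$ (for a simple eigenvalue this just fixes the sign; for a multiple eigenvalue $u$ may depend on $h$); $\boldsymbol\sigma=-\nabla u$. The standard a priori estimates $\lambda_h-\lambda=O(h^2)$, $\|\boldsymbol\sigma_h-\boldsymbol\sigma\|_0=O(h)$, $\|u_h-u\|_0=O(h)$ are taken as known. $O(h^p)$ denotes a quantity bounded by $Ch^p$ for all sufficiently small $h$, with $C$ independent of $h$ ($k$ fixed). *)

theory Defs
  imports "HOL-Analysis.Analysis" "HOL-Library.Landau_Symbols"
begin

section \<open>Square-integrable functions\<close>

text \<open>
  Elements of function spaces are represented by functions on the whole plane. Values outside
  \<open>\<Omega>\<close> and on null sets are irrelevant: all notions below are invariant under changing a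
  representative almost everywhere. The value type covers scalar functions (where \<open>\<bullet>\<close> is
  multiplication) and vector fields alike.
\<close>

type_synonym plane = "real \<times> real"

definition L2_space :: "plane set \<Rightarrow> (plane \<Rightarrow> 'b::euclidean_space) set" where
  "L2_space \<Omega> = {f. f \<in> borel_measurable (lebesgue_on \<Omega>) \<and>
                    integrable (lebesgue_on \<Omega>) (\<lambda>p. (norm (f p))\<^sup>2)}"

definition L2_inner :: "plane set \<Rightarrow> (plane \<Rightarrow> 'b::euclidean_space) \<Rightarrow> (plane \<Rightarrow> 'b) \<Rightarrow> real" where
  "L2_inner \<Omega> f g = (LINT p|lebesgue_on \<Omega>. f p \<bullet> g p)"

definition L2_norm :: "plane set \<Rightarrow> (plane \<Rightarrow> 'b::euclidean_space) \<Rightarrow> real" where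
  "L2_norm \<Omega> f = sqrt (L2_inner \<Omega> f f)"

definition L2_span :: "plane set \<Rightarrow> (nat \<Rightarrow> plane \<Rightarrow> real) \<Rightarrow> nat set \<Rightarrow> (plane \<Rightarrow> real) set" where
  "L2_span \<Omega> u J = {w \<in> L2_space \<Omega>.
     \<exists>c::nat \<Rightarrow> real. AE p in lebesgue_on \<Omega>. w p = (\<Sum>j\<in>J. c j * u j p)}"

definition is_L2_projection ::
  "plane set \<Rightarrow> (plane \<Rightarrow> real) set \<Rightarrow> (plane \<Rightarrow> real) \<Rightarrow> (plane \<Rightarrow> real) \<Rightarrow> bool" where
  "is_L2_projection \<Omega> E f g \<longleftrightarrow> g \<in> E \<and> (\<forall>v\<in>E. L2_inner \<Omega> (\<lambda>p. f p - g p) v = 0)"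

section \<open>Test functions and weak derivatives\<close>

definition dx :: "(plane \<Rightarrow> real) \<Rightarrow> plane \<Rightarrow> real" where
  "dx f p = deriv (\<lambda>t. f (t, snd p)) (fst p)"

definition dy :: "(plane \<Rightarrow> real) \<Rightarrow> plane \<Rightarrow> real" where
  "dy f p = deriv (\<lambda>t. f (fst p, t)) (snd p)"

fun cont_diff :: "nat \<Rightarrow> (plane \<Rightarrow> real) \<Rightarrow> bool" where
  "cont_diff 0 f = continuous_on UNIV f"
| "cont_diff (Suc m) f = (f differentiable_on UNIV \<and> cont_diff m (dx f) \<and> cont_diff m (dy f))"

definition test_functions :: "plane set \<Rightarrow> (plane \<Rightarrow> real) set" where
  "test_functions \<Omega> = {\<phi>. (\<forall>m. cont_diff m \<phi>) \<and>
     compact (closure {p. \<phi> p \<noteq> 0}) \<and> closure {p. \<phi> p \<noteq> 0} \<subseteq> \<Omega>}"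

definition is_weak_deriv ::
  "plane set \<Rightarrow> nat \<Rightarrow> nat \<Rightarrow> (plane \<Rightarrow> real) \<Rightarrow> (plane \<Rightarrow> real) \<Rightarrow> bool" where
  "is_weak_deriv \<Omega> a b u w \<longleftrightarrow>
     (\<forall>\<phi>\<in>test_functions \<Omega>.
        L2_inner \<Omega> u ((dx ^^ a) ((dy ^^ b) \<phi>)) = (-1) ^ (a + b) * L2_inner \<Omega> w \<phi>)"

text \<open>A representative of the weak derivative, which is unique almost everywhere in \<open>\<Omega>\<close>;
  meaningful only if a square-integrable weak derivative exists. The same convention is used
  for the weak divergence.\<close>

definition weak_deriv :: "plane set \<Rightarrow> nat \<Rightarrow> nat \<Rightarrow> (plane \<Rightarrow> real) \<Rightarrow> plane \<Rightarrow> real" where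
  "weak_deriv \<Omega> a b u = (SOME w. w \<in> L2_space \<Omega> \<and> is_weak_deriv \<Omega> a b u w)"

definition sobolev_H :: "nat \<Rightarrow> plane set \<Rightarrow> (plane \<Rightarrow> real) set" where
  "sobolev_H m \<Omega> = {u \<in> L2_space \<Omega>.
     \<forall>a b. a + b \<le> m \<longrightarrow> (\<exists>w\<in>L2_space \<Omega>. is_weak_deriv \<Omega> a b u w)}"

definition is_weak_div :: "plane set \<Rightarrow> (plane \<Rightarrow> plane) \<Rightarrow> (plane \<Rightarrow> real) \<Rightarrow> bool" where
  "is_weak_div \<Omega> \<tau> w \<longleftrightarrow>
     (\<forall>\<phi>\<in>test_functions \<Omega>. L2_inner \<Omega> \<tau> (\<lambda>p. (dx \<phi> p, dy \<phi> p)) = - L2_inner \<Omega> w \<phi>)"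

definition H_div :: "plane set \<Rightarrow> (plane \<Rightarrow> plane) set" where
  "H_div \<Omega> = {\<tau> \<in> L2_space \<Omega>. \<exists>w\<in>L2_space \<Omega>. is_weak_div \<Omega> \<tau> w}"

definition weak_div :: "plane set \<Rightarrow> (plane \<Rightarrow> plane) \<Rightarrow> plane \<Rightarrow> real" where
  "weak_div \<Omega> \<tau> = (SOME w. w \<in> L2_space \<Omega> \<and> is_weak_div \<Omega> \<tau> w)"

section \<open>Rectangular domains and meshes\<close>

record grid =
  nx :: nat
  ny :: nat
  gx :: "nat \<Rightarrow> real"
  gy :: "nat \<Rightarrow> real"

definition hx :: "grid \<Rightarrow> nat \<Rightarrow> real" where
  "hx G i = gx G i - gx G (i - 1)"

definition hy :: "grid \<Rightarrow> nat \<Rightarrow> real" where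
  "hy G j = gy G j - gy G (j - 1)"

definition mesh_size :: "grid \<Rightarrow> real" where
  "mesh_size G = Max (hx G ` {1..nx G} \<union> hy G ` {1..ny G})"

definition cell :: "grid \<Rightarrow> nat \<times> nat \<Rightarrow> plane set" where
  "cell G = (\<lambda>(i, j). {gx G (i - 1)..gx G i} \<times> {gy G (j - 1)..gy G j})"

text \<open>An element is represented by its pair of indices.\<close>

definition elements :: "plane set \<Rightarrow> grid \<Rightarrow> (nat \<times> nat) set" where
  "elements \<Omega> G = {ij \<in> {1..nx G} \<times> {1..ny G}. cell G ij \<subseteq> closure \<Omega>}"

definition rect_mesh :: "plane set \<Rightarrow> grid \<Rightarrow> bool" where
  "rect_mesh \<Omega> G \<longleftrightarrow>
     strict_mono_on {0..nx G} (gx G) \<and> strict_mono_on {0..ny G} (gy G) \<and>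
     (\<Union>ij\<in>elements \<Omega> G. cell G ij) = closure \<Omega>"

text \<open>The condition \<open>interior (closure \<Omega>) = \<Omega>\<close> says that \<open>\<Omega>\<close> is the interior of the union of
  the closed rectangles into which it is divided; it excludes slits and punctures, which
  the closure does not see.\<close>

definition rect_domain :: "plane set \<Rightarrow> bool" where
  "rect_domain \<Omega> \<longleftrightarrow>
     open \<Omega> \<and> connected \<Omega> \<and> bounded \<Omega> \<and> \<Omega> \<noteq> {} \<and> interior (closure \<Omega>) = \<Omega> \<and>
     (\<exists>G. rect_mesh \<Omega> G)"

section \<open>Finite element spaces\<close>

definition Q_poly :: "nat \<Rightarrow> nat \<Rightarrow> (plane \<Rightarrow> real) set" where
  "Q_poly m n = {q. \<exists>c::nat \<Rightarrow> nat \<Rightarrow> real.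
     \<forall>x y. q (x, y) = (\<Sum>i\<le>m. \<Sum>j\<le>n. c i j * x ^ i * y ^ j)}"

definition Sigma_h :: "plane set \<Rightarrow> grid \<Rightarrow> (plane \<Rightarrow> plane) set" where
  "Sigma_h \<Omega> G = {\<tau> \<in> H_div \<Omega>. \<forall>ij\<in>elements \<Omega> G.
     \<exists>q\<in>Q_poly 1 0. \<exists>r\<in>Q_poly 0 1. AE p in lebesgue_on (cell G ij). \<tau> p = (q p, r p)}"

definition V_h :: "plane set \<Rightarrow> grid \<Rightarrow> (plane \<Rightarrow> real) set" where
  "V_h \<Omega> G = {v \<in> L2_space \<Omega>. \<forall>ij\<in>elements \<Omega> G.
     \<exists>c. AE p in lebesgue_on (cell G ij). v p = c}"

section \<open>Mixed eigenvalue problems\<close>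

text \<open>The continuous problem is the case \<open>S = H_div \<Omega>\<close>, \<open>V = L2_space \<Omega>\<close>; the discrete one is
  \<open>S = Sigma_h \<Omega> G\<close>, \<open>V = V_h \<Omega> G\<close>. In the continuous case the first equation forces
  \<open>\<sigma> = -\<nabla>u\<close> almost everywhere and \<open>u = 0\<close> on the boundary.\<close>

definition mixed_eigenpair ::
  "plane set \<Rightarrow> (plane \<Rightarrow> plane) set \<Rightarrow> (plane \<Rightarrow> real) set \<Rightarrow>
   real \<Rightarrow> (plane \<Rightarrow> plane) \<Rightarrow> (plane \<Rightarrow> real) \<Rightarrow> bool" where
  "mixed_eigenpair \<Omega> S V lam \<sigma> u \<longleftrightarrow>
     \<sigma> \<in> S \<and> u \<in> V \<and> L2_norm \<Omega> u \<noteq> 0 \<and>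
     (\<forall>\<tau>\<in>S. L2_inner \<Omega> \<sigma> \<tau> - L2_inner \<Omega> (weak_div \<Omega> \<tau>) u = 0) \<and>
     (\<forall>v\<in>V. L2_inner \<Omega> (weak_div \<Omega> \<sigma>) v = lam * L2_inner \<Omega> u v)"

text \<open>An enumeration of all eigenvalues in nondecreasing order, repeated according to their
  (finite) multiplicity, with orthonormal eigenfunctions. The last two clauses state that
  the eigenspace of any eigenvalue \<open>\<mu>\<close> is spanned by the finitely many listed eigenfunctions
  belonging to \<open>\<mu>\<close>; in particular \<open>\<mu>\<close> occurs in the list.\<close>

definition eigensystem ::
  "plane set \<Rightarrow> (plane \<Rightarrow> plane) set \<Rightarrow> (plane \<Rightarrow> real) set \<Rightarrow> nat set \<Rightarrow>
   (nat \<Rightarrow> real) \<Rightarrow> (nat \<Rightarrow> plane \<Rightarrow> plane) \<Rightarrow> (nat \<Rightarrow> plane \<Rightarrow> real) \<Rightarrow> bool" where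
  "eigensystem \<Omega> S V I lam \<sigma> u \<longleftrightarrow>
     (\<forall>j\<in>I. 0 < lam j \<and> mixed_eigenpair \<Omega> S V (lam j) (\<sigma> j) (u j)) \<and>
     mono_on I lam \<and>
     (\<forall>i\<in>I. \<forall>j\<in>I. L2_inner \<Omega> (u i) (u j) = (if i = j then 1 else 0)) \<and>
     (\<forall>\<mu>. finite {j\<in>I. lam j = \<mu>}) \<and>
     (\<forall>\<mu> \<tau> w. mixed_eigenpair \<Omega> S V \<mu> \<tau> w \<longrightarrow> w \<in> L2_span \<Omega> u {j\<in>I. lam j = \<mu>})"

text \<open>\<open>(lam k, \<sigma>, u)\<close> is the continuous eigenpair corresponding to the \<open>k\<close>-th discrete one, where
  \<open>lam\<close>, \<open>us\<close> enumerate the continuous eigenvalues and eigenfunctions, and \<open>N\<close>, \<open>uh\<close> are the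
  number of discrete eigenvalues and the discrete eigenfunctions. Note that the discrete
  cluster is selected by the equality of the continuous eigenvalues.\<close>

definition corresponding ::
  "plane set \<Rightarrow> (nat \<Rightarrow> real) \<Rightarrow> (nat \<Rightarrow> plane \<Rightarrow> real) \<Rightarrow> nat \<Rightarrow> (nat \<Rightarrow> plane \<Rightarrow> real) \<Rightarrow> nat \<Rightarrow>
   (plane \<Rightarrow> plane) \<Rightarrow> (plane \<Rightarrow> real) \<Rightarrow> bool" where
  "corresponding \<Omega> lam us N uh k \<sigma> u \<longleftrightarrow>
     k \<in> {1..N} \<and>
     mixed_eigenpair \<Omega> (H_div \<Omega>) (L2_space \<Omega>) (lam k) \<sigma> u \<and>
     u \<in> L2_span \<Omega> us {j\<in>{1..}. lam j = lam k} \<and>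
     L2_norm \<Omega> u = 1 \<and>
     (\<exists>\<alpha>>0. is_L2_projection \<Omega> (L2_span \<Omega> uh {j\<in>{1..N}. lam j = lam k}) u (\<lambda>p. \<alpha> * uh k p))"

end

theory Submission
  imports Defs "HOL-Computational_Algebra.Polynomial" "HOL-Real_Asymp.Real_Asymp"
begin

text \<open>
  Let \<open>\<rho>\<close> be the lowest-order Raviart-Thomas interpolant of \<open>\<sigma> = -\<nabla>u\<close>, which has the mean normal
  fluxes of \<open>\<sigma>\<close> on the edges, so that \<open>div \<rho>\<close> is the projection of \<open>div \<sigma>\<close> onto \<open>V\<^sub>h\<close>, and let
  \<open>r = \<sigma> - \<rho>\<close>. Testing the two problems with each other gives
  \<open>(\<lambda>\<^sub>j\<^sub>,\<^sub>h - \<lambda>) (u, u\<^sub>j\<^sub>,\<^sub>h) = (r, \<sigma>\<^sub>j\<^sub>,\<^sub>h)\<close> for all \<open>j\<close>. On an element, \<open>r\<close> is the error of linear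
  interpolation in each coordinate direction, hence of order \<open>h\<^sup>2\<close> when tested with affine
  functions, and \<open>(r, \<tau>) \<le> C h\<^sup>2 \<parallel>\<tau>\<parallel>\<close> for \<open>\<tau> \<in> \<Sigma>\<^sub>h\<close>. The discrete eigenfunctions span \<open>V\<^sub>h\<close> and
  \<open>\<sigma>\<^sub>j\<^sub>,\<^sub>h / \<surd>\<lambda>\<^sub>j\<^sub>,\<^sub>h\<close> are orthonormal, so Bessel's inequality and the spectral gap bound the
  components of \<open>u\<close> outside the cluster of \<open>\<lambda>\<close>; together with the choice of \<open>u\<close> inside the cluster
  this yields the superclose estimate \<open>\<parallel>\<sigma>\<^sub>h - \<rho>\<parallel> = O(h\<^sup>2)\<close>. Consequently
  \<open>\<lambda>\<^sub>h - \<lambda> = (r, \<rho>) + O(h\<^sup>4)\<close>, and \<open>(r, \<rho>)\<close> is evaluated on each element with the Peano kernels of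
  the trapezoidal rule, a Poincare inequality controlling the mixed derivative that remains. The
  constants are uniform because \<open>u\<close> ranges over the unit ball of a finite-dimensional subspace of
  \<open>H\<^sup>5\<close>.
\<close>

section \<open>Smooth functions of one variable\<close>

text \<open>The identity for (r, \<sigma>_{j,h}) involves no auxiliary problem: the first equation
  lets the continuous flux act on a discrete field \<tau> only through (div \<tau>, u), and div
  \<tau> lies in V_h. So no duality argument and no regularity theory on a possibly nonconvex domain
  enters; stability comes from the completeness of the discrete eigenfunctions, which allows norms
  in V_h to be read off from coefficients. The obstacle is that the a priori estimates alone give
  \<sigma>_h - \<rho> = O(h) and hence (r, \<sigma>_h - \<rho>) = O(h^3) only; this is why
  supercloseness is needed. The factor -1/12 is the mean of the first Peano kernel of the
  trapezoidal rule divided by h^2, and u_xxx u_x is f'' f for f = -u_x; the remainder contains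
  f'''', which is a fifth derivative of u. Traces are avoided throughout: edge means are written as
  integrals over cells, weak derivatives are tested only with products of functions of one variable,
  and the Poincare inequality comes from repeated bisection of a rectangle.\<close>

fun ndiff :: "nat \<Rightarrow> (real \<Rightarrow> real) \<Rightarrow> bool" where
  "ndiff 0 p = True"
| "ndiff (Suc n) p = ((\<forall>x. p differentiable (at x)) \<and> ndiff n (deriv p))"

text \<open>Stated with iterated \<open>deriv\<close> because \<open>dx\<close> and
  \<open>dy\<close> are defined by \<open>deriv\<close> along coordinate lines; a product of two
  such functions, one in each variable, then satisfies \<open>cont_diff\<close> of every order by a
  plain induction.\<close>

definition smooth :: "(real \<Rightarrow> real) \<Rightarrow> bool" where
  "smooth p \<longleftrightarrow> (\<forall>n. ndiff n p)"

lemma ndiff_Suc_imp: "ndiff (Suc n) p \<Longrightarrow> ndiff n p"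
proof (induction n arbitrary: p)
  case (Suc n)
  then show ?case by (metis ndiff.simps(2))
qed simp

lemma smooth_deriv: "smooth p \<Longrightarrow> smooth (deriv p)"
  unfolding smooth_def by (metis ndiff.simps(2))

lemma smooth_has_deriv: "smooth p \<Longrightarrow> (p has_real_derivative deriv p x) (at x)"
  unfolding smooth_def by (metis DERIV_deriv_iff_real_differentiable ndiff.simps(2))

lemma smoothI:
  assumes "\<And>x. (p has_real_derivative q x) (at x)" "smooth q"
  shows "smooth p"
proof -
  have q: "deriv p = q" using assms(1) DERIV_imp_deriv by blast
  have "ndiff n p" for n
  proof (cases n)
    case (Suc m)
    have "\<forall>x. p differentiable (at x)" using assms(1) real_differentiable_def by blast
    then show ?thesis using Suc q assms(2) by (simp add: smooth_def)
  qed simp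
  then show ?thesis by (simp add: smooth_def)
qed

lemma ndiff_const: "ndiff n (\<lambda>_. c)"
proof (induction n arbitrary: c)
  case (Suc n)
  have "deriv (\<lambda>_::real. c) = (\<lambda>_. 0)" by (simp add: fun_eq_iff)
  then show ?case using Suc by simp
qed simp

lemma smooth_const [simp]: "smooth (\<lambda>_. c)"
  by (simp add: smooth_def ndiff_const)

lemma smooth_ident [simp]: "smooth (\<lambda>x. x)"
  by (rule smoothI[where q="\<lambda>_. 1"]) auto

lemma ndiff_add: "ndiff n p \<Longrightarrow> ndiff n q \<Longrightarrow> ndiff n (\<lambda>x. p x + q x)"
proof (induction n arbitrary: p q)
  case (Suc n)
  have d: "(p has_real_derivative deriv p x) (at x)" "(q has_real_derivative deriv q x) (at x)" for x
    using Suc.prems by (simp_all add: DERIV_deriv_iff_real_differentiable)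
  have D: "((\<lambda>x. p x + q x) has_real_derivative deriv p x + deriv q x) (at x)" for x
    using d DERIV_add by blast
  then have "deriv (\<lambda>x. p x + q x) = (\<lambda>x. deriv p x + deriv q x)"
    using DERIV_imp_deriv by blast
  moreover have "(\<lambda>x. p x + q x) differentiable (at x)" for x
    using D real_differentiable_def by blast
  ultimately show ?case using Suc by simp
qed simp

lemma ndiff_mult: "ndiff n p \<Longrightarrow> ndiff n q \<Longrightarrow> ndiff n (\<lambda>x. p x * q x)"
proof (induction n arbitrary: p q)
  case (Suc n)
  have d: "(p has_real_derivative deriv p x) (at x)" "(q has_real_derivative deriv q x) (at x)" for x
    using Suc.prems by (simp_all add: DERIV_deriv_iff_real_differentiable)
  have D: "((\<lambda>x. p x * q x) has_real_derivative deriv p x * q x + p x * deriv q x) (at x)" for x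
    using DERIV_mult[OF d(1) d(2), of x] by (simp add: algebra_simps)
  then have "deriv (\<lambda>x. p x * q x) = (\<lambda>x. deriv p x * q x + p x * deriv q x)"
    using DERIV_imp_deriv by blast
  moreover have "(\<lambda>x. p x * q x) differentiable (at x)" for x
    using D real_differentiable_def by blast
  moreover have "ndiff n p" "ndiff n q" using Suc.prems ndiff_Suc_imp by blast+
  ultimately show ?case using Suc ndiff_add by simp
qed simp

lemma smooth_add [simp]: "smooth p \<Longrightarrow> smooth q \<Longrightarrow> smooth (\<lambda>x. p x + q x)"
  and smooth_mult [simp]: "smooth p \<Longrightarrow> smooth q \<Longrightarrow> smooth (\<lambda>x. p x * q x)"
  by (simp_all add: smooth_def ndiff_add ndiff_mult)

lemma smooth_power [simp]: "smooth p \<Longrightarrow> smooth (\<lambda>x. p x ^ n)"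
  by (induction n) simp_all

lemma smooth_cmult [simp]: "smooth p \<Longrightarrow> smooth (\<lambda>x. c * p x)"
  using smooth_mult[OF smooth_const] by blast

lemma smooth_diff [simp]: "smooth p \<Longrightarrow> smooth q \<Longrightarrow> smooth (\<lambda>x. p x - q x)"
  using smooth_add[of p "\<lambda>x. (-1) * q x"] smooth_cmult[of q "-1"] by simp

lemma smooth_divide [simp]: "smooth p \<Longrightarrow> smooth (\<lambda>x. p x / c)"
  using smooth_cmult[of p "1 / c"] by simp

lemma smooth_affine: "smooth p \<Longrightarrow> smooth (\<lambda>x. p (c * x + d))"
proof -
  have "ndiff n p \<Longrightarrow> ndiff n (\<lambda>x. p (c * x + d))" for n
  proof (induction n arbitrary: p)
    case (Suc n)
    have D: "((\<lambda>x. p (c * x + d)) has_real_derivative c * deriv p (c * x + d)) (at x)" for x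
    proof -
      have "(p has_real_derivative deriv p (c * x + d)) (at (c * x + d))"
        using Suc.prems by (simp add: DERIV_deriv_iff_real_differentiable)
      moreover have "((\<lambda>x. c * x + d) has_real_derivative c) (at x)"
        by (auto intro!: derivative_eq_intros)
      ultimately show ?thesis using DERIV_chain2[of p "deriv p (c * x + d)" "\<lambda>x. c * x + d" x c UNIV]
        by (simp add: mult.commute)
    qed
    then have "deriv (\<lambda>x. p (c * x + d)) = (\<lambda>x. c * deriv p (c * x + d))"
      using DERIV_imp_deriv by blast
    moreover have "(\<lambda>x. p (c * x + d)) differentiable (at x)" for x
      using D real_differentiable_def by blast
    ultimately show ?case using Suc ndiff_mult[OF ndiff_const] by simp
  qed simp
  then show "smooth p \<Longrightarrow> smooth (\<lambda>x. p (c * x + d))" by (simp add: smooth_def)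
qed

lemma smooth_continuous_on: "smooth p \<Longrightarrow> continuous_on S p"
  by (meson DERIV_isCont continuous_at_imp_continuous_on smooth_has_deriv)

text \<open>A bound for the derivative on the compact interval makes the function Lipschitz, and it
  vanishes at both ends. The linear decay is what later absorbs the derivative of a cutoff, which is
  of the size of the reciprocal distance to an end.\<close>

lemma smooth_boundary_bound:
  assumes "smooth p" "p a = 0" "p b = 0" "a < b"
  obtains L where "L \<ge> 0" "\<And>x. x \<in> {a..b} \<Longrightarrow> \<bar>p x\<bar> \<le> L * (x - a)"
    "\<And>x. x \<in> {a..b} \<Longrightarrow> \<bar>p x\<bar> \<le> L * (b - x)"
proof -
  have "compact (deriv p ` {a..b})"
    by (rule compact_continuous_image[OF smooth_continuous_on[OF smooth_deriv[OF assms(1)]] compact_Icc])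
  then obtain L0 where L0: "\<And>x. x \<in> {a..b} \<Longrightarrow> norm (deriv p x) \<le> L0"
    using compact_imp_bounded bounded_iff by (metis imageI)
  define L where "L = max L0 0"
  have Lip: "\<bar>p x - p y\<bar> \<le> L * \<bar>x - y\<bar>" if "x \<in> {a..b}" "y \<in> {a..b}" for x y
  proof -
    have "norm (p x - p y) \<le> L * norm (x - y)"
    proof (rule field_differentiable_bound[where S="{a..b}" and f'="deriv p"])
      show "(p has_field_derivative deriv p z) (at z within {a..b})" if "z \<in> {a..b}" for z
        using smooth_has_deriv[OF assms(1)] has_field_derivative_at_within by blast
      show "norm (deriv p z) \<le> L" if "z \<in> {a..b}" for z
        using L0[OF that] by (simp add: L_def)
    qed (use that in auto)
    then show ?thesis by simp
  qed
  show ?thesis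
  proof (rule that[of L])
    show "\<bar>p x\<bar> \<le> L * (x - a)" if "x \<in> {a..b}" for x
      using Lip[OF that, of a] that assms by simp
    show "\<bar>p x\<bar> \<le> L * (b - x)" if "x \<in> {a..b}" for x
      using Lip[OF that, of b] that assms by (simp add: abs_minus_commute)
  qed (simp add: L_def)
qed

section \<open>Smooth cutoff functions built from exp(-1/x)\<close>

definition flat :: "real poly \<Rightarrow> real \<Rightarrow> real" where
  "flat P x = (if x \<le> 0 then 0 else poly P (1 / x) * exp (- 1 / x))"

lemma poly_div_exp_tendsto_0: "((\<lambda>t::real. poly P t * exp (- t)) \<longlongrightarrow> 0) at_top"
proof -
  have "((\<lambda>t::real. \<Sum>i\<le>degree P. coeff P i * (t ^ i / exp t)) \<longlongrightarrow> (\<Sum>i\<le>degree P. coeff P i * 0)) at_top"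
    by (intro tendsto_sum tendsto_mult tendsto_const tendsto_power_div_exp_0)
  moreover have "(\<lambda>t::real. \<Sum>i\<le>degree P. coeff P i * (t ^ i / exp t)) = (\<lambda>t. poly P t * exp (- t))"
    by (rule ext) (simp add: poly_altdef exp_minus sum_distrib_right divide_inverse mult.assoc)
  ultimately show ?thesis by simp
qed

text \<open>For positive x the derivative of P(1/x) exp(-1/x) is x^(-2) (P - P')(1/x) exp(-1/x), and
  \<open>[:0, 0, 1:]\<close> is the polynomial s^2 for s = 1/x. The family over all P is thus closed
  under differentiation, which turns smoothness into an induction with P arbitrary.\<close>

lemma flat_has_deriv: "(flat P has_real_derivative flat ([:0, 0, 1:] * (P - pderiv P)) x) (at x)"
proof (cases x "0::real" rule: linorder_cases)
  case less
  have "((\<lambda>_. 0) has_real_derivative 0) (at x)" by simp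
  moreover have "eventually (\<lambda>y. y < 0) (nhds x)"
    using less eventually_nhds_in_open[of "{..<0}" x] by auto
  then have "eventually (\<lambda>y. flat P y = 0) (nhds x)"
    by (rule eventually_mono) (simp add: flat_def)
  ultimately show ?thesis using less
    by (subst DERIV_cong_ev[OF refl]) (auto simp: flat_def)
next
  case greater
  have ev: "eventually (\<lambda>y. flat P y = poly P (1 / y) * exp (- 1 / y)) (nhds x)"
  proof -
    have "eventually (\<lambda>y. y > 0) (nhds x)"
      using greater eventually_nhds_in_open[of "{0<..}" x] by auto
    then show ?thesis by (rule eventually_mono) (simp add: flat_def)
  qed
  have P: "((\<lambda>y. poly P (1 / y)) has_real_derivative poly (pderiv P) (1 / x) * (- 1 / x^2)) (at x)"
    using greater by (intro DERIV_chain2[OF poly_DERIV] derivative_eq_intros) (auto simp: power2_eq_square)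
  have E: "((\<lambda>y. exp (- 1 / y)) has_real_derivative exp (- 1 / x) * (1 / x^2)) (at x)"
    using greater by (intro DERIV_chain2[OF DERIV_exp] derivative_eq_intros) (auto simp: power2_eq_square)
  have "((\<lambda>y. poly P (1 / y) * exp (- 1 / y)) has_real_derivative
        flat ([:0, 0, 1:] * (P - pderiv P)) x) (at x)"
    using greater DERIV_mult[OF P E] by (simp add: flat_def field_simps power2_eq_square)
  then show ?thesis using DERIV_cong_ev[OF refl ev refl] by blast
next
  case equal
  have R: "((\<lambda>h. flat P h / h) \<longlongrightarrow> 0) (at_right 0)"
  proof -
    \<comment> \<open>The difference quotient at 0 is s P(s) exp(-s) with s = 1/h, and
      \<open>pCons 0 P\<close> is the polynomial s P(s).\<close>
    have "((\<lambda>h::real. poly (pCons 0 P) (inverse h) * exp (- inverse h)) \<longlongrightarrow> 0) (at_right 0)"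
      by (rule filterlim_compose[OF poly_div_exp_tendsto_0 filterlim_inverse_at_top_right])
    moreover have "eventually (\<lambda>h. poly (pCons 0 P) (inverse h) * exp (- inverse h) = flat P h / h) (at_right 0)"
      unfolding eventually_at_right_field
      by (intro exI[of _ 1]) (auto simp: flat_def field_simps)
    ultimately show ?thesis by (rule Lim_transform_eventually)
  qed
  have "eventually (\<lambda>h. 0 = flat P h / h) (at_left (0::real))"
    unfolding eventually_at_left_field by (intro exI[of _ "-1"]) (auto simp: flat_def)
  then have L: "((\<lambda>h. flat P h / h) \<longlongrightarrow> 0) (at_left 0)"
    by (rule Lim_transform_eventually[OF tendsto_const])
  have "((\<lambda>h. flat P h / h) \<longlongrightarrow> 0) (at 0)" using L R filterlim_split_at by blast
  then show ?thesis using equal by (simp add: DERIV_def flat_def)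
qed

lemma smooth_flat: "smooth (flat P)"
proof -
  have "ndiff n (flat P)" for n
  proof (induction n arbitrary: P)
    case (Suc n)
    have "deriv (flat P) = flat ([:0, 0, 1:] * (P - pderiv P))"
      using flat_has_deriv DERIV_imp_deriv by blast
    moreover have "flat P differentiable (at x)" for x
      using flat_has_deriv real_differentiable_def by blast
    ultimately show ?case using Suc by simp
  qed simp
  then show ?thesis by (simp add: smooth_def)
qed

text \<open>This is exp(-1/t) for positive t. It tends to 1 at infinity without ever reaching it, so
  the cutoffs built from it converge to 1 only pointwise; dominated convergence makes that
  sufficient.\<close>

definition ramp :: "real \<Rightarrow> real" where "ramp = flat 1"

lemma smooth_ramp: "smooth ramp" by (simp add: ramp_def smooth_flat)

lemma ramp_bounds: "0 \<le> ramp t" "ramp t \<le> 1" and ramp_eq_0: "t \<le> 0 \<Longrightarrow> ramp t = 0"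
  by (simp_all add: ramp_def flat_def)

lemma ramp_has_deriv: "(ramp has_real_derivative flat [:0, 0, 1:] t) (at t)"
  using flat_has_deriv[of 1 t] by (simp add: ramp_def)

lemma ramp_tendsto: "(ramp \<longlongrightarrow> 1) at_top"
proof -
  have "((\<lambda>t::real. exp (- 1 / t)) \<longlongrightarrow> 1) at_top" by real_asymp
  moreover have "eventually (\<lambda>t. exp (- 1 / t) = ramp t) at_top"
    using eventually_gt_at_top[of 0] by eventually_elim (simp add: ramp_def flat_def)
  ultimately show ?thesis by (rule Lim_transform_eventually)
qed

text \<open>With s = 1/t the product is (s + s^2) exp(-s), and 2 exp(s) dominates s + s^2 by the
  quadratic Taylor bound. The factor t + 1 is there because \<open>cutoff\<close> evaluates the ramp
  at t = n z - 1 with z the distance to an end, so that t + 1 = n z.\<close>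

lemma ramp_deriv_bound: "\<bar>(t + 1) * flat [:0, 0, 1:] t\<bar> \<le> 2"
proof (cases "t \<le> 0")
  case False
  define s where "s = 1 / t"
  have s: "s > 0" "t = 1 / s" using False by (simp_all add: s_def)
  have "(t + 1) * flat [:0, 0, 1:] t = (s + s^2) * exp (- s)"
  proof -
    have "flat [:0, 0, 1:] t = s * s * exp (- s)" using s by (simp add: flat_def)
    show ?thesis unfolding \<open>flat [:0, 0, 1:] t = _\<close> using s by (simp add: field_simps power2_eq_square)
  qed
  also have "\<dots> \<le> 2"
  proof -
    have "1 + s + s^2 / 2 \<le> exp s" using exp_lower_Taylor_quadratic[of s] s by simp
    then have "s + s^2 \<le> 2 * exp s" using s by (simp add: add_pos_pos)
    then show ?thesis by (simp add: exp_minus field_simps)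
  qed
  finally show ?thesis using False by (simp add: flat_def)
qed (simp add: flat_def)

lemma ramp_deriv_tendsto: "((\<lambda>t. (t + 1) * flat [:0, 0, 1:] t) \<longlongrightarrow> 0) at_top"
proof -
  have "((\<lambda>t::real. (t + 1) * (1 / t * (1 / t) * exp (- 1 / t))) \<longlongrightarrow> 0) at_top" by real_asymp
  moreover have "eventually (\<lambda>t. (t + 1) * (1 / t * (1 / t) * exp (- 1 / t)) = (t + 1) * flat [:0, 0, 1:] t) at_top"
    using eventually_gt_at_top[of 0] by eventually_elim (simp add: flat_def)
  ultimately show ?thesis by (rule Lim_transform_eventually)
qed

text \<open>The shift by 1 makes the function vanish within distance 1/n of both ends, so that its
  support is compact in the open interval. For n = 0 both arguments are -1 and the function is
  identically zero.\<close>

definition cutoff :: "real \<Rightarrow> real \<Rightarrow> nat \<Rightarrow> real \<Rightarrow> real" where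
  "cutoff a b n x = ramp (real n * (x - a) - 1) * ramp (real n * (b - x) - 1)"

lemma smooth_cutoff: "smooth (cutoff a b n)"
proof -
  have "smooth (\<lambda>x. ramp (real n * x + (- (real n * a) - 1)) * ramp ((- real n) * x + (real n * b - 1)))"
    by (intro smooth_mult smooth_affine smooth_ramp)
  then show ?thesis by (simp add: cutoff_def[abs_def] algebra_simps)
qed

lemma cutoff_bounds: "0 \<le> cutoff a b n x" "cutoff a b n x \<le> 1"
  using ramp_bounds by (simp_all add: cutoff_def mult_le_one)

lemma cutoff_support:
  assumes "cutoff a b n x \<noteq> 0"
  shows "n > 0" "x \<in> {a + 1 / real n..b - 1 / real n}"
proof -
  have *: "real n * (x - a) > 1" "real n * (b - x) > 1"
    using assms ramp_eq_0 unfolding cutoff_def by (smt (verit) mult_eq_0_iff)+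
  then show n: "n > 0" by (cases n) auto
  show "x \<in> {a + 1 / real n..b - 1 / real n}" using * n by (auto simp: field_simps)
qed

lemma cutoff_eq_0:
  assumes "x \<notin> {a<..<b}"
  shows "cutoff a b n x = 0"
proof (rule ccontr)
  assume nz: "cutoff a b n x \<noteq> 0"
  have "1 / real n > 0" using cutoff_support(1)[OF nz] by simp
  then show False using cutoff_support(2)[OF nz] assms
    by (smt (verit) atLeastAtMost_iff greaterThanLessThan_iff)
qed

lemma cutoff_tendsto: "x \<in> {a<..<b} \<Longrightarrow> (\<lambda>n. cutoff a b n x) \<longlonglongrightarrow> 1"
proof -
  have "(\<lambda>n. ramp (real n * c - 1)) \<longlonglongrightarrow> 1" if "c > 0" for c
    by (rule filterlim_compose[OF ramp_tendsto]) (use that in real_asymp)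
  from tendsto_mult[OF this this] show "x \<in> {a<..<b} \<Longrightarrow> ?thesis" by (simp add: cutoff_def)
qed

lemma deriv_cutoff: "deriv (cutoff a b n) x =
    real n * flat [:0, 0, 1:] (real n * (x - a) - 1) * ramp (real n * (b - x) - 1)
    - ramp (real n * (x - a) - 1) * (real n * flat [:0, 0, 1:] (real n * (b - x) - 1))"
proof -
  have 1: "((\<lambda>x. ramp (real n * (x - a) - 1)) has_real_derivative
        flat [:0, 0, 1:] (real n * (x - a) - 1) * real n) (at x)"
    by (rule DERIV_chain2[OF ramp_has_deriv]) (auto intro!: derivative_eq_intros)
  have 2: "((\<lambda>x. ramp (real n * (b - x) - 1)) has_real_derivative
        flat [:0, 0, 1:] (real n * (b - x) - 1) * (- real n)) (at x)"
    by (rule DERIV_chain2[OF ramp_has_deriv]) (auto intro!: derivative_eq_intros)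
  have "(cutoff a b n has_real_derivative
     (flat [:0, 0, 1:] (real n * (x - a) - 1) * real n) * ramp (real n * (b - x) - 1)
     + (flat [:0, 0, 1:] (real n * (b - x) - 1) * (- real n)) * ramp (real n * (x - a) - 1)) (at x)"
    using DERIV_mult[OF 1 2] by (simp add: cutoff_def[abs_def])
  then show ?thesis by (simp add: DERIV_imp_deriv algebra_simps)
qed

text \<open>Each of the two factors of the cutoff contributes at most 2 L, by
  \<open>ramp_deriv_bound\<close>. The bound does not depend on n and serves as the majorant in the
  limit of \<open>weak_partial_ibp\<close>.\<close>

lemma mult_deriv_cutoff_bound:
  assumes L: "L \<ge> 0" "\<bar>y\<bar> \<le> L * (x - a)" "\<bar>y\<bar> \<le> L * (b - x)"
  shows "\<bar>y * deriv (cutoff a b n) x\<bar> \<le> 4 * L"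
proof -
  have *: "\<bar>y * (real n * flat [:0, 0, 1:] (real n * z - 1))\<bar> \<le> L * 2" if "\<bar>y\<bar> \<le> L * z" for z
  proof -
    have "\<bar>y * (real n * flat [:0, 0, 1:] (real n * z - 1))\<bar> \<le> (L * z) * \<bar>real n * flat [:0, 0, 1:] (real n * z - 1)\<bar>"
      unfolding abs_mult using that by (intro mult_right_mono) auto
    also have "\<dots> \<le> L * \<bar>(real n * z - 1 + 1) * flat [:0, 0, 1:] (real n * z - 1)\<bar>"
    proof -
      have "L * z \<le> L * \<bar>z\<bar>" using L by (intro mult_left_mono) auto
      then have "(L * z) * \<bar>real n * flat [:0, 0, 1:] (real n * z - 1)\<bar> \<le> (L * \<bar>z\<bar>) * \<bar>real n * flat [:0, 0, 1:] (real n * z - 1)\<bar>"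
        by (rule mult_right_mono) simp
      then show ?thesis by (simp add: abs_mult mult_ac)
    qed
    also have "\<dots> \<le> L * 2" by (rule mult_left_mono[OF ramp_deriv_bound]) (fact L)
    finally show ?thesis .
  qed
  have r: "\<bar>ramp t\<bar> \<le> 1" for t using ramp_bounds[of t] by simp
  have "\<bar>y * deriv (cutoff a b n) x\<bar> \<le>
     \<bar>y * (real n * flat [:0, 0, 1:] (real n * (x - a) - 1))\<bar> * \<bar>ramp (real n * (b - x) - 1)\<bar>
     + \<bar>y * (real n * flat [:0, 0, 1:] (real n * (b - x) - 1))\<bar> * \<bar>ramp (real n * (x - a) - 1)\<bar>"
    unfolding deriv_cutoff abs_mult[symmetric] by (rule order_trans[OF _ abs_triangle_ineq4]) (simp add: algebra_simps)
  also have "\<dots> \<le> (L * 2) * 1 + (L * 2) * 1"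
    by (intro add_mono mult_mono *[OF L(2)] *[OF L(3)] r) (use L in auto)
  finally show ?thesis by simp
qed

lemma deriv_cutoff_tendsto: "x \<in> {a<..<b} \<Longrightarrow> (\<lambda>n. deriv (cutoff a b n) x) \<longlonglongrightarrow> 0"
proof -
  assume x: "x \<in> {a<..<b}"
  have R: "(\<lambda>n. ramp (real n * c - 1)) \<longlonglongrightarrow> 1" if "c > 0" for c
    by (rule filterlim_compose[OF ramp_tendsto]) (use that in real_asymp)
  have D: "(\<lambda>n. real n * flat [:0, 0, 1:] (real n * c - 1)) \<longlonglongrightarrow> 0" if "c > 0" for c
  proof -
    have "(\<lambda>n. (real n * c - 1 + 1) * flat [:0, 0, 1:] (real n * c - 1)) \<longlonglongrightarrow> 0"
      by (rule filterlim_compose[OF ramp_deriv_tendsto]) (use that in real_asymp)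
    from tendsto_mult[OF tendsto_const[of "1 / c"] this] show ?thesis using that by simp
  qed
  have "(\<lambda>n. deriv (cutoff a b n) x) \<longlonglongrightarrow> 0 * 1 - 1 * 0"
    unfolding deriv_cutoff using x by (intro tendsto_diff tendsto_mult D R) auto
  then show ?thesis by simp
qed

section \<open>Tensor product test functions\<close>

lemma smooth_deriv_funpow: "smooth p \<Longrightarrow> smooth ((deriv ^^ n) p)"
  by (induction n) (simp_all add: smooth_deriv)

lemma dx_tensor: "smooth p \<Longrightarrow> dx (\<lambda>z. p (fst z) * q (snd z)) = (\<lambda>z. deriv p (fst z) * q (snd z))"
proof -
  assume "smooth p"
  then have "((\<lambda>t. p t * q s) has_real_derivative deriv p x * q s) (at x)" for x s
    using DERIV_cmult_right smooth_has_deriv by blast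
  then show ?thesis by (simp add: dx_def fun_eq_iff DERIV_imp_deriv)
qed

lemma dy_tensor: "smooth q \<Longrightarrow> dy (\<lambda>z. p (fst z) * q (snd z)) = (\<lambda>z. p (fst z) * deriv q (snd z))"
proof -
  assume "smooth q"
  then have "((\<lambda>t. p s * q t) has_real_derivative p s * deriv q x) (at x)" for x s
    using DERIV_cmult smooth_has_deriv by blast
  then show ?thesis by (simp add: dy_def fun_eq_iff DERIV_imp_deriv)
qed

lemma dx_dy_tensor:
  assumes "smooth p" "smooth q"
  shows "(dx ^^ a) ((dy ^^ b) (\<lambda>z. p (fst z) * q (snd z))) = (\<lambda>z. (deriv ^^ a) p (fst z) * (deriv ^^ b) q (snd z))"
proof -
  have "(dy ^^ b) (\<lambda>z. p (fst z) * q (snd z)) = (\<lambda>z. p (fst z) * (deriv ^^ b) q (snd z))"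
    by (induction b) (simp_all add: dy_tensor smooth_deriv_funpow assms)
  moreover have "(dx ^^ a) (\<lambda>z. p (fst z) * (deriv ^^ b) q (snd z)) = (\<lambda>z. (deriv ^^ a) p (fst z) * (deriv ^^ b) q (snd z))"
    by (induction a) (simp_all add: dx_tensor smooth_deriv_funpow assms)
  ultimately show ?thesis by simp
qed

lemma tensor_differentiable:
  assumes "smooth p" "smooth q"
  shows "(\<lambda>z. p (fst z) * q (snd z)) differentiable_on (UNIV :: plane set)"
proof -
  have d: "r differentiable (at x)" if "smooth r" for r x
    using smooth_has_deriv[OF that] real_differentiable_def by blast
  have "(p \<circ> fst) differentiable (at z)" "(q \<circ> snd) differentiable (at z)" for z :: plane
    by (intro differentiable_chain_at bounded_linear_imp_differentiable bounded_linear_fst bounded_linear_snd d assms)+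
  then have "(\<lambda>z. (p \<circ> fst) z * (q \<circ> snd) z) differentiable (at z)" for z :: plane
    using differentiable_mult by blast
  then show ?thesis by (simp add: differentiable_on_def differentiable_at_withinI)
qed

lemma tensor_test_function:
  assumes "smooth p" "smooth q"
    and "\<And>x. p x \<noteq> 0 \<Longrightarrow> x \<in> {a..b}" "\<And>y. q y \<noteq> 0 \<Longrightarrow> y \<in> {c..d}" "{a..b} \<times> {c..d} \<subseteq> \<Omega>"
  shows "(\<lambda>z. p (fst z) * q (snd z)) \<in> test_functions \<Omega>"
proof -
  have "cont_diff m (\<lambda>z. p (fst z) * q (snd z))" for m
    using assms(1,2)
  proof (induction m arbitrary: p q)
    case 0
    then show ?case using tensor_differentiable differentiable_imp_continuous_on by auto
  next
    case (Suc m)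
    then show ?case by (simp add: tensor_differentiable dx_tensor dy_tensor smooth_deriv)
  qed
  moreover have K: "closure {z. p (fst z) * q (snd z) \<noteq> 0} \<subseteq> {a..b} \<times> {c..d}"
    using assms(3,4) by (intro closure_minimal closed_Times) auto
  moreover have "compact (closure {z. p (fst z) * q (snd z) \<noteq> 0})"
    using K compact_Times[OF compact_Icc compact_Icc] closed_closure compact_closure
    by (meson bounded_subset compact_eq_bounded_closed)
  ultimately show ?thesis using assms(5) by (auto simp: test_functions_def)
qed

section \<open>Square-integrable functions\<close>

lemma L2_measurable: "f \<in> L2_space S \<Longrightarrow> f \<in> borel_measurable (lebesgue_on S)"
  and L2_integrable_sq: "f \<in> L2_space S \<Longrightarrow> integrable (lebesgue_on S) (\<lambda>p. (norm (f p))\<^sup>2)"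
  by (simp_all add: L2_space_def)

lemma L2_integrable_inner:
  assumes "f \<in> L2_space S" "g \<in> L2_space S"
  shows "integrable (lebesgue_on S) (\<lambda>p. f p \<bullet> g p)"
proof (rule Bochner_Integration.integrable_bound)
  show "integrable (lebesgue_on S) (\<lambda>p. (norm (f p))\<^sup>2 + (norm (g p))\<^sup>2)"
    using assms by (simp add: L2_space_def)
  show "(\<lambda>p. f p \<bullet> g p) \<in> borel_measurable (lebesgue_on S)"
    using L2_measurable[OF assms(1)] L2_measurable[OF assms(2)] by measurable
  have "\<bar>x \<bullet> y\<bar> \<le> \<bar>(norm x)\<^sup>2 + (norm y)\<^sup>2\<bar>" for x y :: 'a
  proof -
    have "\<bar>x \<bullet> y\<bar> \<le> norm x * norm y" by (rule Cauchy_Schwarz_ineq2)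
    also have "2 * (norm x * norm y) \<le> (norm x)\<^sup>2 + (norm y)\<^sup>2"
      using sum_squares_bound[of "norm x" "norm y"] by simp
    finally show ?thesis by (simp add: abs_le_iff) (smt (verit) zero_le_power2)
  qed
  then show "AE p in lebesgue_on S. norm (f p \<bullet> g p) \<le> norm ((norm (f p))\<^sup>2 + (norm (g p))\<^sup>2)"
    by simp
qed

lemma L2_integrable_mult:
  fixes f g :: "plane \<Rightarrow> real"
  assumes "f \<in> L2_space S" "g \<in> L2_space S"
  shows "integrable (lebesgue_on S) (\<lambda>p. f p * g p)"
  using L2_integrable_inner[OF assms] by simp

lemma L2_scaleR [intro]: "f \<in> L2_space S \<Longrightarrow> (\<lambda>p. c *\<^sub>R f p) \<in> L2_space S"
  by (auto simp: L2_space_def power_mult_distrib)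

lemma L2_cmult [intro]: "f \<in> L2_space S \<Longrightarrow> (\<lambda>p. (c::real) * f p) \<in> L2_space S"
  using L2_scaleR[of f S c] by simp

lemma L2_zero [simp, intro]: "(\<lambda>_. 0) \<in> L2_space S"
  by (simp add: L2_space_def)

lemma L2_add [intro]:
  assumes "f \<in> L2_space S" "g \<in> L2_space S"
  shows "(\<lambda>p. f p + g p) \<in> L2_space S"
proof -
  have "integrable (lebesgue_on S) (\<lambda>p. (norm (f p))\<^sup>2 + 2 * (f p \<bullet> g p) + (norm (g p))\<^sup>2)"
    using L2_integrable_sq[OF assms(1)] L2_integrable_sq[OF assms(2)] L2_integrable_inner[OF assms]
    by (intro Bochner_Integration.integrable_add integrable_mult_right)
  moreover have "(norm (f p + g p))\<^sup>2 = (norm (f p))\<^sup>2 + 2 * (f p \<bullet> g p) + (norm (g p))\<^sup>2" for p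
    by (simp add: power2_norm_eq_inner algebra_simps inner_commute)
  moreover have "(\<lambda>p. f p + g p) \<in> borel_measurable (lebesgue_on S)"
    using L2_measurable[OF assms(1)] L2_measurable[OF assms(2)] by measurable
  ultimately show ?thesis by (simp add: L2_space_def)
qed

lemma L2_diff [intro]: "f \<in> L2_space S \<Longrightarrow> g \<in> L2_space S \<Longrightarrow> (\<lambda>p. f p - g p) \<in> L2_space S"
  using L2_add[of f S "\<lambda>p. (-1) *\<^sub>R g p"] L2_scaleR[of g S "-1"] by simp

lemma L2_minus [intro]: "f \<in> L2_space S \<Longrightarrow> (\<lambda>p. - f p) \<in> L2_space S"
  using L2_scaleR[of f S "-1"] by simp

lemma L2_sum [intro]: "(\<And>i. i \<in> I \<Longrightarrow> f i \<in> L2_space S) \<Longrightarrow> (\<lambda>p. \<Sum>i\<in>I. f i p) \<in> L2_space S"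
  by (induction I rule: infinite_finite_induct) auto

lemma L2_inner_commute: "L2_inner S f g = L2_inner S g f"
  by (simp add: L2_inner_def inner_commute)

lemma L2_inner_add_left:
  assumes "f \<in> L2_space S" "g \<in> L2_space S" "k \<in> L2_space S"
  shows "L2_inner S (\<lambda>p. f p + g p) k = L2_inner S f k + L2_inner S g k"
  using assms by (simp add: L2_inner_def inner_add_left L2_integrable_inner)

lemma L2_inner_diff_left:
  assumes "f \<in> L2_space S" "g \<in> L2_space S" "k \<in> L2_space S"
  shows "L2_inner S (\<lambda>p. f p - g p) k = L2_inner S f k - L2_inner S g k"
  using assms by (simp add: L2_inner_def inner_diff_left L2_integrable_inner)

lemma L2_inner_scaleR_left: "L2_inner S (\<lambda>p. c *\<^sub>R f p) k = c * L2_inner S f k"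
  by (simp add: L2_inner_def)

lemma L2_inner_add_right:
  assumes "f \<in> L2_space S" "g \<in> L2_space S" "k \<in> L2_space S"
  shows "L2_inner S k (\<lambda>p. f p + g p) = L2_inner S k f + L2_inner S k g"
  using assms by (simp add: L2_inner_def inner_add_right L2_integrable_inner)

lemma L2_inner_diff_right:
  assumes "f \<in> L2_space S" "g \<in> L2_space S" "k \<in> L2_space S"
  shows "L2_inner S k (\<lambda>p. f p - g p) = L2_inner S k f - L2_inner S k g"
  using assms by (simp add: L2_inner_def inner_diff_right L2_integrable_inner)

lemma L2_inner_scaleR_right: "L2_inner S k (\<lambda>p. c *\<^sub>R f p) = c * L2_inner S k f"
  by (simp add: L2_inner_def)

lemma L2_inner_cmult_left: "L2_inner S (\<lambda>p. c * f p) k = c * L2_inner S f k"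
  and L2_inner_cmult_right: "L2_inner S k (\<lambda>p. c * f p) = c * L2_inner S k f" for f :: "plane \<Rightarrow> real"
  using L2_inner_scaleR_left[of S c f k] L2_inner_scaleR_right[of S k c f] by simp_all

lemma L2_inner_zero [simp]: "L2_inner S (\<lambda>_. 0) k = 0" "L2_inner S k (\<lambda>_. 0) = 0"
  by (simp_all add: L2_inner_def)

lemma L2_inner_sum_left:
  assumes "\<And>i. i \<in> I \<Longrightarrow> f i \<in> L2_space S" "k \<in> L2_space S"
  shows "L2_inner S (\<lambda>p. \<Sum>i\<in>I. f i p) k = (\<Sum>i\<in>I. L2_inner S (f i) k)"
  using assms by (simp add: L2_inner_def inner_sum_left L2_integrable_inner)

lemma L2_inner_AE_cong:
  assumes "AE p in lebesgue_on S. f p = f' p" "AE p in lebesgue_on S. k p = k' p"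
    "f \<in> L2_space S" "f' \<in> L2_space S" "k \<in> L2_space S" "k' \<in> L2_space S"
  shows "L2_inner S f k = L2_inner S f' k'"
  unfolding L2_inner_def
proof (rule integral_cong_AE)
  show "AE p in lebesgue_on S. f p \<bullet> k p = f' p \<bullet> k' p" using assms(1,2) by eventually_elim simp
qed (use assms L2_measurable in measurable)

lemma L2_inner_self: "L2_inner S f f = (LINT p|lebesgue_on S. (norm (f p))\<^sup>2)"
  by (simp add: L2_inner_def power2_norm_eq_inner)

lemma L2_inner_self_nonneg [simp]: "0 \<le> L2_inner S f f"
  by (simp add: L2_inner_self)

lemma L2_norm_nonneg [simp]: "0 \<le> L2_norm S f"
  by (simp add: L2_norm_def)

lemma L2_norm_power2: "(L2_norm S f)\<^sup>2 = L2_inner S f f"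
  by (simp add: L2_norm_def)

lemma L2_norm_scaleR: "L2_norm S (\<lambda>p. c *\<^sub>R f p) = \<bar>c\<bar> * L2_norm S f"
proof -
  have "L2_inner S (\<lambda>p. c *\<^sub>R f p) (\<lambda>p. c *\<^sub>R f p) = c\<^sup>2 * L2_inner S f f"
    by (simp only: L2_inner_scaleR_left L2_inner_scaleR_right power2_eq_square mult.assoc)
  then show ?thesis by (simp add: L2_norm_def real_sqrt_mult)
qed

lemma L2_norm_eq_0_iff:
  assumes "f \<in> L2_space S"
  shows "L2_norm S f = 0 \<longleftrightarrow> (AE p in lebesgue_on S. f p = 0)"
  using integral_nonneg_eq_0_iff_AE[OF L2_integrable_sq[OF assms]]
  by (simp add: L2_norm_def L2_inner_self)

lemma L2_norm_AE_cong:
  assumes "AE p in lebesgue_on S. f p = g p" "f \<in> L2_space S" "g \<in> L2_space S"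
  shows "L2_norm S f = L2_norm S g"
  using L2_inner_AE_cong[OF assms(1,1) assms(2,3,2,3)] by (simp add: L2_norm_def)

lemma L2_Cauchy_Schwarz:
  assumes f: "f \<in> L2_space S" and g: "g \<in> L2_space S"
  shows "\<bar>L2_inner S f g\<bar> \<le> L2_norm S f * L2_norm S g"
proof (cases "L2_inner S f f = 0")
  case True
  then have "AE p in lebesgue_on S. f p = 0"
    using L2_norm_eq_0_iff[OF f] by (simp add: L2_norm_def)
  then have "L2_inner S f g = L2_inner S (\<lambda>_. 0) g"
    by (intro L2_inner_AE_cong) (use f g in auto)
  then show ?thesis by simp
next
  case False
  define a b c where "a = L2_inner S f f" and "b = L2_inner S f g" and "c = L2_inner S g g"
  have a: "a > 0" using False L2_inner_self_nonneg[of S f] unfolding a_def by linarith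
  have "0 \<le> L2_inner S (\<lambda>p. g p - (b / a) *\<^sub>R f p) (\<lambda>p. g p - (b / a) *\<^sub>R f p)" by simp
  also have "\<dots> = c - (b / a) * b - (b / a) * (b - (b / a) * a)"
    using f g L2_scaleR[OF f] L2_diff[OF g L2_scaleR[OF f]] unfolding a_def b_def c_def
    by (simp add: L2_inner_diff_left L2_inner_diff_right L2_inner_scaleR_left L2_inner_scaleR_right
        L2_inner_commute[of S g f] algebra_simps)
  also have "\<dots> = c - b\<^sup>2 / a" using a by (simp add: power2_eq_square)
  finally have "b\<^sup>2 \<le> a * c" using a by (simp add: field_simps)
  then have "sqrt (b\<^sup>2) \<le> sqrt (a * c)" by (rule real_sqrt_le_mono)
  then show ?thesis by (simp add: a_def b_def c_def L2_norm_def real_sqrt_mult)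
qed

lemma L2_norm_triangle:
  assumes f: "f \<in> L2_space S" and g: "g \<in> L2_space S"
  shows "L2_norm S (\<lambda>p. f p + g p) \<le> L2_norm S f + L2_norm S g"
proof (rule power2_le_imp_le)
  have "(L2_norm S (\<lambda>p. f p + g p))\<^sup>2 = L2_inner S f f + 2 * L2_inner S f g + L2_inner S g g"
    using f g L2_add[OF f g]
    by (simp add: L2_norm_power2 L2_inner_add_left L2_inner_add_right L2_inner_commute[of S g f])
  also have "\<dots> \<le> (L2_norm S f + L2_norm S g)\<^sup>2"
    using L2_Cauchy_Schwarz[OF f g] by (simp add: power2_sum L2_norm_power2)
  finally show "(L2_norm S (\<lambda>p. f p + g p))\<^sup>2 \<le> (L2_norm S f + L2_norm S g)\<^sup>2" .
qed simp

lemma L2_norm_triangle_diff: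
  assumes f: "f \<in> L2_space S" and g: "g \<in> L2_space S"
  shows "L2_norm S (\<lambda>p. f p - g p) \<le> L2_norm S f + L2_norm S g"
  using L2_norm_triangle[OF f L2_minus[OF g]] by (simp add: L2_norm_def L2_inner_self)

lemma L2_norm_sum_le:
  assumes "\<And>i. i \<in> I \<Longrightarrow> f i \<in> L2_space S"
  shows "L2_norm S (\<lambda>p. \<Sum>i\<in>I. f i p) \<le> (\<Sum>i\<in>I. L2_norm S (f i))"
  using assms
proof (induction I rule: infinite_finite_induct)
  case (insert i I)
  then have "L2_norm S (\<lambda>p. f i p + (\<Sum>i\<in>I. f i p)) \<le> L2_norm S (f i) + L2_norm S (\<lambda>p. \<Sum>i\<in>I. f i p)"
    by (intro L2_norm_triangle L2_sum) auto
  then show ?case using insert by (simp add: order_trans)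
qed (simp_all add: L2_norm_def)

lemma L2_integrable:
  fixes f :: "plane \<Rightarrow> real"
  assumes f: "f \<in> L2_space S" and fin: "finite_measure (lebesgue_on S)"
  shows "integrable (lebesgue_on S) f"
proof -
  interpret finite_measure "lebesgue_on S" by (rule fin)
  have "(\<lambda>_. 1::real) \<in> L2_space S" by (simp add: L2_space_def)
  from L2_integrable_mult[OF f this] show ?thesis by simp
qed

lemma L2_bounded_mult:
  fixes f g :: "plane \<Rightarrow> real"
  assumes f: "f \<in> L2_space S" and g: "g \<in> borel_measurable (lebesgue_on S)"
    and bd: "\<And>p. p \<in> S \<Longrightarrow> \<bar>g p\<bar> \<le> C"
  shows "(\<lambda>p. f p * g p) \<in> L2_space S"
proof -
  have "integrable (lebesgue_on S) (\<lambda>p. (norm (f p * g p))\<^sup>2)"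
  proof (rule Bochner_Integration.integrable_bound)
    show "integrable (lebesgue_on S) (\<lambda>p. C\<^sup>2 * (norm (f p))\<^sup>2)" using L2_integrable_sq[OF f] by simp
    show "(\<lambda>p. (norm (f p * g p))\<^sup>2) \<in> borel_measurable (lebesgue_on S)"
      using L2_measurable[OF f] g by measurable
    show "AE p in lebesgue_on S. norm ((norm (f p * g p))\<^sup>2) \<le> norm (C\<^sup>2 * (norm (f p))\<^sup>2)"
    proof (rule AE_I2)
      fix p assume "p \<in> space (lebesgue_on S)"
      then have "\<bar>g p\<bar> \<le> C" using bd by (simp add: space_restrict_space)
      then have "(g p)\<^sup>2 \<le> C\<^sup>2" by (metis abs_ge_zero abs_le_square_iff abs_of_nonneg order_trans)
      then show "norm ((norm (f p * g p))\<^sup>2) \<le> norm (C\<^sup>2 * (norm (f p))\<^sup>2)"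
        using mult_right_mono[of "(g p)\<^sup>2" "C\<^sup>2" "(f p)\<^sup>2"] by (simp add: power_mult_distrib mult.commute)
    qed
  qed
  then show ?thesis using L2_measurable[OF f] g by (simp add: L2_space_def)
qed

lemma L2_bounded:
  fixes g :: "plane \<Rightarrow> real"
  assumes "finite_measure (lebesgue_on S)" "g \<in> borel_measurable (lebesgue_on S)"
    and "\<And>p. p \<in> S \<Longrightarrow> \<bar>g p\<bar> \<le> C"
  shows "g \<in> L2_space S"
proof -
  interpret finite_measure "lebesgue_on S" by (rule assms)
  have "(\<lambda>_. 1::real) \<in> L2_space S" by (simp add: L2_space_def)
  from L2_bounded_mult[OF this assms(2,3)] show ?thesis by simp
qed

subsection \<open>Changing the domain by a null set\<close>

text \<open>The closed cells of a mesh stick out of the open domain by pieces of its boundary, which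
  are null sets. Functions on the domain therefore have to be transported to sets that are contained
  in it only up to a null set; \<open>measurable_on\<close> is insensitive to such changes.\<close>

lemma borel_measurable_negligible_mono:
  fixes f :: "plane \<Rightarrow> 'b::euclidean_space"
  assumes S: "S \<in> sets lebesgue" and T: "T \<in> sets lebesgue" and neg: "negligible (S - T)"
    and f: "f \<in> borel_measurable (lebesgue_on T)"
  shows "f \<in> borel_measurable (lebesgue_on S)"
proof -
  have "f \<in> borel_measurable (lebesgue_on (S \<inter> T))"
    by (rule measurable_restrict_mono[OF f]) blast
  then have "f measurable_on (S \<inter> T)" using S T by (simp add: measurable_on_iff_borel_measurable)
  moreover have "negligible ((S \<inter> T - S) \<union> (S - S \<inter> T))"
    using neg by (rule negligible_subset) auto
  ultimately have "f measurable_on S" by (rule measurable_on_spike_set)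
  then show ?thesis using S by (simp add: measurable_on_iff_borel_measurable)
qed

lemma AE_not_in_negligible: "negligible N \<Longrightarrow> AE p in lebesgue. p \<notin> N"
  by (rule AE_not_in) (simp add: negligible_iff_null_sets)

lemma AE_lebesgue_on_mono:
  assumes S: "S \<in> sets lebesgue" and T: "T \<in> sets lebesgue" and neg: "negligible (S - T)"
    and P: "AE p in lebesgue_on T. P p"
  shows "AE p in lebesgue_on S. P p"
proof -
  have "AE p in lebesgue. p \<notin> S - T"
    by (rule AE_not_in_negligible[OF neg])
  moreover have "AE p in lebesgue. p \<in> T \<longrightarrow> P p" using P T by (simp add: AE_restrict_space_iff)
  ultimately have "AE p in lebesgue. p \<in> S \<longrightarrow> P p" by eventually_elim auto
  then show ?thesis using S by (simp add: AE_restrict_space_iff)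
qed

lemma integral_lebesgue_on_indicator:
  fixes f :: "plane \<Rightarrow> real"
  assumes "S \<in> sets lebesgue"
  shows "(LINT p|lebesgue_on S. f p) = (LINT p|lebesgue. indicator S p * f p)"
    and "integrable (lebesgue_on S) f \<longleftrightarrow> integrable lebesgue (\<lambda>p. indicator S p * f p)"
  using integral_restrict_space[of S lebesgue f] integrable_restrict_space[of S lebesgue f] assms by simp_all

lemma integrable_lebesgue_on_mono:
  fixes f :: "plane \<Rightarrow> real"
  assumes S: "S \<in> sets lebesgue" and T: "T \<in> sets lebesgue" and neg: "negligible (S - T)"
    and f: "integrable (lebesgue_on T) f"
  shows "integrable (lebesgue_on S) f"
proof -
  have "integrable lebesgue (\<lambda>p. indicator S p * f p)"
  proof (rule Bochner_Integration.integrable_bound)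
    show "integrable lebesgue (\<lambda>p. indicator T p * f p)"
      using f T by (simp add: integral_lebesgue_on_indicator)
    have "f \<in> borel_measurable (lebesgue_on S)"
      using borel_measurable_negligible_mono[OF S T neg] f by auto
    then show "(\<lambda>p. indicator S p * f p) \<in> borel_measurable lebesgue"
      using S borel_measurable_restrict_space_iff[of S lebesgue f] by simp
    have "AE p in lebesgue. p \<notin> S - T"
      by (rule AE_not_in_negligible[OF neg])
    then show "AE p in lebesgue. norm (indicator S p * f p) \<le> norm (indicator T p * f p)"
      by eventually_elim (auto simp: indicator_def)
  qed
  then show ?thesis using S by (simp add: integral_lebesgue_on_indicator)
qed

lemma integral_lebesgue_on_cong_set:
  fixes f :: "plane \<Rightarrow> real"
  assumes S: "S \<in> sets lebesgue" and T: "T \<in> sets lebesgue"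
    and neg: "negligible (S - T)" "negligible (T - S)"
  shows "(LINT p|lebesgue_on S. f p) = (LINT p|lebesgue_on T. f p)"
proof (cases "integrable (lebesgue_on T) f")
  case True
  have "AE p in lebesgue. p \<notin> S - T" "AE p in lebesgue. p \<notin> T - S"
    using AE_not_in_negligible[OF neg(1)] AE_not_in_negligible[OF neg(2)] by blast+
  then have "AE p in lebesgue. indicator S p * f p = indicator T p * f p"
    by eventually_elim (auto simp: indicator_def)
  moreover have "integrable (lebesgue_on S) f" by (rule integrable_lebesgue_on_mono[OF S T neg(1) True])
  ultimately show ?thesis using S T True
    by (simp add: integral_lebesgue_on_indicator) (intro integral_cong_AE; simp add: borel_measurable_integrable)
next
  case False
  then have "\<not> integrable (lebesgue_on S) f" using integrable_lebesgue_on_mono[OF T S neg(2)] by blast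
  then show ?thesis using False by (simp add: not_integrable_integral_eq)
qed

lemma L2_mono:
  assumes S: "S \<in> sets lebesgue" and T: "T \<in> sets lebesgue" and neg: "negligible (S - T)"
    and f: "f \<in> L2_space T"
  shows "f \<in> L2_space S"
  using borel_measurable_negligible_mono[OF S T neg L2_measurable[OF f]]
    integrable_lebesgue_on_mono[OF S T neg L2_integrable_sq[OF f]]
  by (simp add: L2_space_def)

lemma L2_subset:
  assumes "S \<in> sets lebesgue" "T \<in> sets lebesgue" "S \<subseteq> T" "f \<in> L2_space T"
  shows "f \<in> L2_space S"
proof (rule L2_mono[OF assms(1,2) _ assms(4)])
  have "S - T = {}" using assms(3) by blast
  then show "negligible (S - T)" by simp
qed

lemma integral_lebesgue_on_union:
  fixes f :: "plane \<Rightarrow> real"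
  assumes I: "finite I" "\<And>i. i \<in> I \<Longrightarrow> S i \<in> sets lebesgue"
    and disj: "\<And>i j. i \<in> I \<Longrightarrow> j \<in> I \<Longrightarrow> i \<noteq> j \<Longrightarrow> negligible (S i \<inter> S j)"
    and f: "integrable (lebesgue_on (\<Union>i\<in>I. S i)) f"
  shows "(LINT p|lebesgue_on (\<Union>i\<in>I. S i). f p) = (\<Sum>i\<in>I. LINT p|lebesgue_on (S i). f p)"
  using assms
proof (induction I rule: finite_induct)
  case empty
  then show ?case by (simp add: integral_lebesgue_on_indicator)
next
  case (insert i I)
  have m: "(\<Union>i\<in>I. S i) \<in> sets lebesgue" "S i \<in> sets lebesgue" using insert by auto
  have f: "integrable (lebesgue_on (\<Union>i\<in>I. S i)) f" "integrable (lebesgue_on (S i)) f"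
    by (rule integrable_lebesgue_on_mono[OF _ _ _ insert.prems(3)]; use insert m in \<open>auto simp: Diff_eq_empty_iff[THEN iffD2]\<close>)+
  have "negligible (\<Union>j\<in>I. S i \<inter> S j)"
    using insert by (intro negligible_Union) auto
  then have "AE p in lebesgue. p \<notin> (\<Union>j\<in>I. S i \<inter> S j)"
    by (rule AE_not_in_negligible)
  then have "AE p in lebesgue. \<not> (p \<in> S i \<and> p \<in> (\<Union>i\<in>I. S i))" by eventually_elim auto
  then have "(LINT p:(S i \<union> (\<Union>i\<in>I. S i))|lebesgue. f p)
      = (LINT p:S i|lebesgue. f p) + (LINT p:(\<Union>i\<in>I. S i)|lebesgue. f p)"
    using m f by (intro set_integral_Un_AE) (simp_all add: set_integrable_def integral_lebesgue_on_indicator)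
  moreover have "(LINT p|lebesgue_on (\<Union>i\<in>I. S i). f p) = (\<Sum>i\<in>I. LINT p|lebesgue_on (S i). f p)"
    using insert f by auto
  ultimately show ?case using insert m
    by (simp add: integral_lebesgue_on_indicator set_lebesgue_integral_def sets.Un)
qed

section \<open>Orthonormal families\<close>

definition orthonormal :: "plane set \<Rightarrow> 'i set \<Rightarrow> ('i \<Rightarrow> plane \<Rightarrow> 'b::euclidean_space) \<Rightarrow> bool" where
  "orthonormal S I e \<longleftrightarrow> finite I \<and> (\<forall>i\<in>I. e i \<in> L2_space S) \<and>
     (\<forall>i\<in>I. \<forall>j\<in>I. L2_inner S (e i) (e j) = (if i = j then 1 else 0))"

definition expansion :: "plane set \<Rightarrow> 'i set \<Rightarrow> ('i \<Rightarrow> plane \<Rightarrow> 'b::euclidean_space) \<Rightarrow> (plane \<Rightarrow> 'b) \<Rightarrow> plane \<Rightarrow> 'b" where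
  "expansion S I e f = (\<lambda>p. \<Sum>i\<in>I. L2_inner S f (e i) *\<^sub>R e i p)"

lemma L2_inner_lincomb:
  assumes "\<And>i. i \<in> I \<Longrightarrow> e i \<in> L2_space S" "k \<in> L2_space S"
  shows "L2_inner S (\<lambda>p. \<Sum>i\<in>I. c i *\<^sub>R e i p) k = (\<Sum>i\<in>I. c i * L2_inner S (e i) k)"
  using assms by (subst L2_inner_sum_left) (auto simp: L2_inner_scaleR_left)

lemma orthonormal_lincomb_coeff:
  assumes "orthonormal S I e" "j \<in> I"
  shows "L2_inner S (\<lambda>p. \<Sum>i\<in>I. c i *\<^sub>R e i p) (e j) = c j"
proof -
  have "L2_inner S (\<lambda>p. \<Sum>i\<in>I. c i *\<^sub>R e i p) (e j) = (\<Sum>i\<in>I. c i * L2_inner S (e i) (e j))"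
    using assms by (intro L2_inner_lincomb) (auto simp: orthonormal_def)
  also have "\<dots> = (\<Sum>i\<in>I. if i = j then c i else 0)"
    using assms by (intro sum.cong) (auto simp: orthonormal_def)
  finally show ?thesis using assms by (simp add: orthonormal_def)
qed

lemma orthonormal_lincomb_inner:
  assumes "orthonormal S I e"
  shows "L2_inner S (\<lambda>p. \<Sum>i\<in>I. c i *\<^sub>R e i p) (\<lambda>p. \<Sum>i\<in>I. d i *\<^sub>R e i p) = (\<Sum>i\<in>I. c i * d i)"
proof -
  have "L2_inner S (\<lambda>p. \<Sum>i\<in>I. c i *\<^sub>R e i p) (\<lambda>p. \<Sum>i\<in>I. d i *\<^sub>R e i p)
      = (\<Sum>i\<in>I. c i * L2_inner S (e i) (\<lambda>p. \<Sum>i\<in>I. d i *\<^sub>R e i p))"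
    using assms by (intro L2_inner_lincomb) (auto simp: orthonormal_def intro!: L2_sum L2_scaleR)
  also have "\<dots> = (\<Sum>i\<in>I. c i * d i)"
    by (intro sum.cong refl) (subst L2_inner_commute, simp add: orthonormal_lincomb_coeff[OF assms])
  finally show ?thesis .
qed

lemma L2_lincomb:
  assumes "orthonormal S I e"
  shows "(\<lambda>p. \<Sum>i\<in>I. c i *\<^sub>R e i p) \<in> L2_space S"
  using assms by (auto simp: orthonormal_def intro!: L2_sum L2_scaleR)

lemma expansion_residual:
  assumes e: "orthonormal S I e" and f: "f \<in> L2_space S"
  shows "(L2_norm S (\<lambda>p. f p - expansion S I e f p))\<^sup>2 = (L2_norm S f)\<^sup>2 - (\<Sum>i\<in>I. (L2_inner S f (e i))\<^sup>2)"
    and "expansion S I e f \<in> L2_space S"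
    and "j \<in> I \<Longrightarrow> L2_inner S (\<lambda>p. f p - expansion S I e f p) (e j) = 0"
proof -
  show E: "expansion S I e f \<in> L2_space S" unfolding expansion_def by (rule L2_lincomb[OF e])
  have 1: "L2_inner S (expansion S I e f) f = (\<Sum>i\<in>I. (L2_inner S f (e i))\<^sup>2)"
    unfolding expansion_def using e f
    by (subst L2_inner_lincomb) (auto simp: orthonormal_def power2_eq_square L2_inner_commute[of S f])
  have 2: "L2_inner S (expansion S I e f) (expansion S I e f) = (\<Sum>i\<in>I. (L2_inner S f (e i))\<^sup>2)"
    unfolding expansion_def by (simp add: orthonormal_lincomb_inner[OF e] power2_eq_square)
  show "(L2_norm S (\<lambda>p. f p - expansion S I e f p))\<^sup>2 = (L2_norm S f)\<^sup>2 - (\<Sum>i\<in>I. (L2_inner S f (e i))\<^sup>2)"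
    unfolding L2_norm_power2 using f E L2_diff[OF f E] 1 2
    by (simp add: L2_inner_diff_left L2_inner_diff_right L2_inner_commute[of S f "expansion S I e f"])
  show "j \<in> I \<Longrightarrow> L2_inner S (\<lambda>p. f p - expansion S I e f p) (e j) = 0"
    using e f E orthonormal_lincomb_coeff[OF e, of j "\<lambda>i. L2_inner S f (e i)"]
    by (subst L2_inner_diff_left) (auto simp: orthonormal_def expansion_def)
qed

lemma Bessel:
  assumes "orthonormal S I e" "f \<in> L2_space S"
  shows "(\<Sum>i\<in>I. (L2_inner S f (e i))\<^sup>2) \<le> (L2_norm S f)\<^sup>2"
  using expansion_residual(1)[OF assms] zero_le_power2[of "L2_norm S (\<lambda>p. f p - expansion S I e f p)"] by linarith

section \<open>Subspaces, dual bounds and finite orthonormal bases\<close>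

definition L2_subspace :: "plane set \<Rightarrow> (plane \<Rightarrow> 'b::euclidean_space) set \<Rightarrow> bool" where
  "L2_subspace S X \<longleftrightarrow> X \<subseteq> L2_space S \<and> (\<lambda>_. 0) \<in> X \<and>
     (\<forall>f\<in>X. \<forall>g\<in>X. (\<lambda>p. f p + g p) \<in> X) \<and> (\<forall>f\<in>X. \<forall>c. (\<lambda>p. c *\<^sub>R f p) \<in> X)"

lemma L2_subspace_add: "L2_subspace S X \<Longrightarrow> f \<in> X \<Longrightarrow> g \<in> X \<Longrightarrow> (\<lambda>p. f p + g p) \<in> X"
  and L2_subspace_scaleR: "L2_subspace S X \<Longrightarrow> f \<in> X \<Longrightarrow> (\<lambda>p. c *\<^sub>R f p) \<in> X"
  and L2_subspace_zero: "L2_subspace S X \<Longrightarrow> (\<lambda>_. 0) \<in> X"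
  and L2_subspace_L2: "L2_subspace S X \<Longrightarrow> f \<in> X \<Longrightarrow> f \<in> L2_space S"
  by (simp_all add: L2_subspace_def subset_iff)

lemma L2_subspace_lincomb:
  assumes "L2_subspace S X" "\<And>i. i \<in> I \<Longrightarrow> e i \<in> X"
  shows "(\<lambda>p. \<Sum>i\<in>I. c i *\<^sub>R e i p) \<in> X"
  using assms(2)
  by (induction I rule: infinite_finite_induct)
     (simp_all add: L2_subspace_add[OF assms(1)] L2_subspace_scaleR[OF assms(1)] L2_subspace_zero[OF assms(1)])

lemma L2_subspace_diff:
  assumes "L2_subspace S X" "f \<in> X" "g \<in> X"
  shows "(\<lambda>p. f p - g p) \<in> X"
  using L2_subspace_add[OF assms(1,2) L2_subspace_scaleR[OF assms(1,3), of "-1"]] by simp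

text \<open>Pairing r with its own expansion yields T, the sum in question, while the norm of the
  expansion is sqrt T; hence T \<le> M sqrt T. Since M measures the action of r on \<open>X\<close>
  alone, it may be of higher order in h than the norm of r.\<close>

lemma dual_bound_Bessel:
  assumes e: "orthonormal S I e" "\<And>i. i \<in> I \<Longrightarrow> e i \<in> X" and X: "L2_subspace S X"
    and r: "r \<in> L2_space S" "\<And>\<tau>. \<tau> \<in> X \<Longrightarrow> \<bar>L2_inner S r \<tau>\<bar> \<le> M * L2_norm S \<tau>" and M: "M \<ge> 0"
  shows "(\<Sum>i\<in>I. (L2_inner S r (e i))\<^sup>2) \<le> M\<^sup>2"
proof -
  define T where "T = (\<Sum>i\<in>I. (L2_inner S r (e i))\<^sup>2)"
  have T0: "T \<ge> 0" by (simp add: T_def sum_nonneg)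
  have "expansion S I e r \<in> X" unfolding expansion_def by (rule L2_subspace_lincomb[OF X e(2)])
  then have "\<bar>L2_inner S r (expansion S I e r)\<bar> \<le> M * L2_norm S (expansion S I e r)" by (rule r)
  moreover have "L2_inner S r (expansion S I e r) = T"
    unfolding expansion_def T_def using e r
    by (subst L2_inner_commute, subst L2_inner_lincomb)
       (auto simp: orthonormal_def power2_eq_square L2_inner_commute[of S r])
  moreover have "L2_norm S (expansion S I e r) = sqrt T"
    unfolding expansion_def L2_norm_def T_def by (simp add: orthonormal_lincomb_inner[OF e(1)] power2_eq_square)
  ultimately have "T \<le> M * sqrt T" by simp
  then have "T * T \<le> (M * sqrt T) * (M * sqrt T)" by (intro mult_mono) (use T0 M in auto)
  then have "T * T \<le> M\<^sup>2 * T" using T0 by (simp add: power2_eq_square mult_ac)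
  then have "T \<le> M\<^sup>2"
    using T0 M by (cases "T = 0") auto
  then show ?thesis by (simp add: T_def)
qed

text \<open>The dimension is bounded by the trace of a dominating finite family: an orthonormal family
  in \<open>X\<close> cannot have more than \<open>\<Sum>\<^sub>d (norm \<phi>\<^sub>d)\<^sup>2\<close> members.\<close>

lemma orthonormal_basis_exists:
  assumes X: "L2_subspace S X" and D: "finite D" "\<And>d. d \<in> D \<Longrightarrow> \<phi> d \<in> L2_space S"
    and dom: "\<And>x. x \<in> X \<Longrightarrow> (L2_norm S x)\<^sup>2 \<le> (\<Sum>d\<in>D. (L2_inner S x (\<phi> d))\<^sup>2)"
  obtains n :: nat and e where "orthonormal S {..<n} e" "\<And>i. i < n \<Longrightarrow> e i \<in> X"
    "\<And>x. x \<in> X \<Longrightarrow> AE p in lebesgue_on S. x p = expansion S {..<n} e x p"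
proof -
  define P where "P n \<longleftrightarrow> (\<exists>e. orthonormal S {..<n::nat} e \<and> (\<forall>i<n. e i \<in> X))" for n
  define C where "C = (\<Sum>d\<in>D. (L2_norm S (\<phi> d))\<^sup>2)"
  have bound: "real n \<le> C" if Pn: "P n" for n
  proof -
    obtain e where e: "orthonormal S {..<n} e" "\<And>i. i < n \<Longrightarrow> e i \<in> X" using Pn unfolding P_def by blast
    have "real n = (\<Sum>i<n. (L2_norm S (e i))\<^sup>2)"
      using e by (simp add: L2_norm_power2 orthonormal_def)
    also have "\<dots> \<le> (\<Sum>i<n. \<Sum>d\<in>D. (L2_inner S (e i) (\<phi> d))\<^sup>2)"
      using e dom by (intro sum_mono) auto
    also have "\<dots> = (\<Sum>d\<in>D. \<Sum>i<n. (L2_inner S (\<phi> d) (e i))\<^sup>2)"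
      by (subst sum.swap) (simp add: L2_inner_commute)
    also have "\<dots> \<le> C" unfolding C_def by (intro sum_mono Bessel e D)
    finally show ?thesis .
  qed
  have P0: "P 0" by (auto simp: P_def orthonormal_def)
  have fin: "y \<le> nat \<lceil>C\<rceil>" if "P y" for y using bound[OF that] by (meson le_nat_iff le_of_int_ceiling nat_le_real_less of_nat_le_iff order_trans real_nat_ceiling_ge)
  define n where "n = (GREATEST n. P n)"
  have Pn: "P n" unfolding n_def by (rule GreatestI_nat[of P 0, OF P0 fin])
  have max: "\<not> P (Suc n)" using Greatest_le_nat[of P "Suc n", OF _ fin] unfolding n_def by fastforce
  obtain e where e: "orthonormal S {..<n} e" "\<And>i. i < n \<Longrightarrow> e i \<in> X" using Pn unfolding P_def by blast
  show ?thesis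
  proof (rule that[OF e])
    fix x assume x: "x \<in> X"
    define r where "r = (\<lambda>p. x p - expansion S {..<n} e x p)"
    have rX: "r \<in> X" unfolding r_def expansion_def
      by (intro L2_subspace_diff[OF X x] L2_subspace_lincomb[OF X]) (use e in auto)
    have xL: "x \<in> L2_space S" and rL: "r \<in> L2_space S" using x rX X by (auto simp: L2_subspace_def)
    have "L2_norm S r = 0"
    proof (rule ccontr)
      assume nz: "L2_norm S r \<noteq> 0"
      define e' where "e' = e(n := \<lambda>p. (1 / L2_norm S r) *\<^sub>R r p)"
      have orth: "L2_inner S r (e j) = 0" if "j < n" for j
        unfolding r_def using expansion_residual(3)[OF e(1) xL, of j] that by simp
      have "L2_inner S (e' i) (e' j) = (if i = j then 1 else 0)" if ij: "i < Suc n" "j < Suc n" for i j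
      proof -
        consider "i = n" "j = n" | "i = n" "j < n" | "i < n" "j = n" | "i < n" "j < n" using ij less_Suc_eq by auto
        then show ?thesis
        proof cases
          case 1
          have "L2_inner S r r = (L2_norm S r)\<^sup>2" by (simp add: L2_norm_power2)
          then show ?thesis using 1 nz
            by (simp add: e'_def L2_inner_scaleR_left L2_inner_scaleR_right power2_eq_square)
        next
          case 2 then show ?thesis by (simp add: e'_def L2_inner_scaleR_left orth)
        next
          case 3 then show ?thesis by (simp add: e'_def L2_inner_scaleR_right orth L2_inner_commute[of S "e i" r])
        next
          case 4 then show ?thesis using e by (simp add: e'_def orthonormal_def)
        qed
      qed
      moreover have "e' i \<in> X" if "i < Suc n" for i
        using that e(2) rX X by (auto simp: e'_def L2_subspace_def less_Suc_eq)
      ultimately have "P (Suc n)"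
        unfolding P_def orthonormal_def using X by (intro exI[of _ e']) (auto simp: L2_subspace_def)
      with max show False ..
    qed
    then have "AE p in lebesgue_on S. r p = 0" using L2_norm_eq_0_iff[OF rL] by simp
    then show "AE p in lebesgue_on S. x p = expansion S {..<n} e x p"
      by eventually_elim (simp add: r_def)
  qed
qed

subsection \<open>The largest eigenvalue of a form on a finite-dimensional space\<close>

text \<open>The form is maximised over the unit sphere of the coordinate space, which is compact in the
  product topology of \<open>nat \<Rightarrow> real\<close>.\<close>

lemma quadratic_form_max:
  fixes a :: "nat \<Rightarrow> nat \<Rightarrow> real"
  assumes "n > 0"
  obtains c where "(\<Sum>i<n. (c i)\<^sup>2) = 1"
    "\<And>d. (\<Sum>i<n. \<Sum>j<n. a i j * d i * d j) \<le> (\<Sum>i<n. \<Sum>j<n. a i j * c i * c j) * (\<Sum>i<n. (d i)\<^sup>2)"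
proof -
  define Q where "Q c = (\<Sum>i<n. \<Sum>j<n. a i j * c i * c j)" for c :: "nat \<Rightarrow> real"
  define N where "N c = (\<Sum>i<n. (c i)\<^sup>2)" for c :: "nat \<Rightarrow> real"
  \<comment> \<open>Coordinates with index n and above are frozen at 0. This makes \<open>B\<close>
    a product of compact factors over all naturals, to which compactness of products
    applies.\<close>
  define B where "B = PiE UNIV (\<lambda>i. if i < n then {-1..1::real} else {0})"
  have "compactin (product_topology (\<lambda>_. euclidean) UNIV) B"
    unfolding B_def compactin_PiE by (auto simp: compactin_euclidean_iff)
  then have cB: "compact B" by (simp add: euclidean_product_topology compactin_euclidean_iff)
  have coord: "continuous_on UNIV (\<lambda>c :: nat \<Rightarrow> real. c i)" for i by simp
  have cN: "continuous_on UNIV N" unfolding N_def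
    by (intro continuous_on_sum continuous_on_power coord)
  have cQ: "continuous_on UNIV Q" unfolding Q_def
    by (intro continuous_on_sum continuous_on_mult coord continuous_on_const)
  have "closed {c. N c = 1}"
    by (rule closed_Collect_eq[OF cN continuous_on_const])
  then have K: "compact (B \<inter> {c. N c = 1})" using cB by (rule compact_Int_closed[rotated])
  have ne: "(\<lambda>i. if i = 0 then 1 else 0) \<in> B \<inter> {c. N c = 1}"
  proof -
    have "N (\<lambda>i. if i = 0 then 1 else 0) = (\<Sum>i<n. if i = 0 then 1 else 0)"
      unfolding N_def by (intro sum.cong) auto
    then show ?thesis using assms by (auto simp: B_def)
  qed
  obtain c where c: "c \<in> B" "N c = 1" and cmax: "\<And>d. d \<in> B \<Longrightarrow> N d = 1 \<Longrightarrow> Q d \<le> Q c"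
    using continuous_attains_sup[OF K _ continuous_on_subset[OF cQ subset_UNIV]] ne by (auto simp: Int_def)
  have "Q d \<le> Q c * N d" for d
  proof (cases "N d = 0")
    case True
    then have "\<forall>i<n. d i = 0" by (auto simp: N_def sum_nonneg_eq_0_iff)
    then have "Q d = 0" by (simp add: Q_def)
    with True show ?thesis by simp
  next
    case False
    have Np: "N d > 0" using False by (simp add: N_def order_less_le sum_nonneg)
    define d' where "d' i = (if i < n then d i / sqrt (N d) else 0)" for i
    have N1: "N d' = 1"
    proof -
      have "N d' = (\<Sum>i<n. (d i)\<^sup>2 / N d)" unfolding N_def[of d'] d'_def
        using Np by (intro sum.cong) (auto simp: power_divide)
      also have "\<dots> = N d / N d" by (simp only: sum_divide_distrib[symmetric] N_def[of d])
      finally show ?thesis using Np by simp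
    qed
    have d1: "\<bar>d' i\<bar> \<le> 1" if "i < n" for i
    proof -
      have "(d' i)\<^sup>2 \<le> N d'" unfolding N_def using that by (intro member_le_sum) auto
      then show ?thesis using N1 abs_square_le_1 by force
    qed
    have "d' \<in> B"
      unfolding B_def
    proof (rule PiE_I)
      fix i
      show "d' i \<in> (if i < n then {- 1..1} else {0})"
      proof (cases "i < n")
        case True
        then have "\<bar>d' i\<bar> \<le> 1" by (rule d1)
        then have "- 1 \<le> d' i" "d' i \<le> 1" by linarith+
        then show ?thesis using True by simp
      qed (simp add: d'_def)
    qed simp
    then have "Q d' \<le> Q c" using N1 cmax by blast
    moreover have "Q d' = Q d / N d"
    proof -
      have "Q d' = (\<Sum>i<n. \<Sum>j<n. a i j * d i * d j / N d)"
        unfolding Q_def d'_def using Np by (intro sum.cong refl) (simp add: field_simps flip: real_sqrt_mult power2_eq_square)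
      then show ?thesis by (simp add: Q_def sum_divide_distrib)
    qed
    ultimately show ?thesis using Np by (simp add: field_simps)
  qed
  then show ?thesis using that[of c] c(2) by (simp add: Q_def N_def)
qed

text \<open>A quadratic polynomial in t without constant term that is never positive has a maximum
  at 0, so its slope there vanishes. The witness t = a/c with c = |b| + 1 makes the linear term
  dominate the quadratic one.\<close>

lemma nonpos_quadratic_imp_linear_zero:
  fixes a b :: real
  assumes "\<And>t. 2 * t * a + t\<^sup>2 * b \<le> 0"
  shows "a = 0"
proof (rule ccontr)
  assume "a \<noteq> 0"
  define c where "c = \<bar>b\<bar> + 1"
  have c: "c > 0" "2 * c + b > 0" by (simp_all add: c_def)
  define t where "t = a / c"
  have "2 * t * a + t\<^sup>2 * b = a\<^sup>2 / c\<^sup>2 * (2 * c + b)"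
    unfolding t_def power2_eq_square using c(1) by (simp add: field_simps)
  moreover have "a\<^sup>2 / c\<^sup>2 * (2 * c + b) > 0"
    using \<open>a \<noteq> 0\<close> c by (intro mult_pos_pos divide_pos_pos) auto
  ultimately show False using assms[of t] by linarith
qed

text \<open>A maximiser of the Rayleigh quotient is a critical point. The form is required to
  respect equality almost everywhere, since the expansion in \<open>e\<close> holds only in that
  sense and the intended form is built from \<open>weak_div\<close>, a representative picked by
  choice.\<close>

lemma form_eigenvector_exists:
  fixes B :: "(plane \<Rightarrow> 'b::euclidean_space) \<Rightarrow> (plane \<Rightarrow> 'b) \<Rightarrow> real"
  assumes X: "L2_subspace S X" and e: "orthonormal S {..<n::nat} e" "\<And>i. i < n \<Longrightarrow> e i \<in> X"
    and span: "\<And>x. x \<in> X \<Longrightarrow> AE p in lebesgue_on S. x p = expansion S {..<n} e x p"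
    and add: "\<And>x y z. x \<in> X \<Longrightarrow> y \<in> X \<Longrightarrow> z \<in> X \<Longrightarrow> B (\<lambda>p. x p + y p) z = B x z + B y z"
    and scale: "\<And>x z c. x \<in> X \<Longrightarrow> z \<in> X \<Longrightarrow> B (\<lambda>p. c *\<^sub>R x p) z = c * B x z"
    and sym: "\<And>x y. x \<in> X \<Longrightarrow> y \<in> X \<Longrightarrow> B x y = B y x"
    and ae: "\<And>x y z. x \<in> X \<Longrightarrow> y \<in> X \<Longrightarrow> z \<in> X \<Longrightarrow> AE p in lebesgue_on S. x p = y p \<Longrightarrow> B x z = B y z"
    and pos: "x0 \<in> X" "B x0 x0 > 0"
  obtains x \<mu> where "x \<in> X" "\<mu> > 0" "L2_inner S x x = 1" "\<And>z. z \<in> X \<Longrightarrow> B x z = \<mu> * L2_inner S x z"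
proof -
  define lc where "lc c = (\<lambda>p. \<Sum>i<n. c i *\<^sub>R e i p)" for c :: "nat \<Rightarrow> real"
  have lcX: "lc c \<in> X" for c unfolding lc_def by (rule L2_subspace_lincomb[OF X]) (use e in auto)
  have B_lincomb: "B (\<lambda>p. \<Sum>i\<in>J. c i *\<^sub>R e i p) z = (\<Sum>i\<in>J. c i * B (e i) z)"
    if "J \<subseteq> {..<n}" "z \<in> X" for J c z
  proof -
    have "finite J" using that finite_subset by blast
    then show ?thesis using that
    proof (induction J rule: finite_induct)
      case empty
      have "B (\<lambda>p. 0 *\<^sub>R z p) z = 0 * B z z" by (rule scale) (use empty in auto)
      then show ?case by simp
    next
      case (insert i J)
      have "B (\<lambda>p. c i *\<^sub>R e i p + (\<Sum>i\<in>J. c i *\<^sub>R e i p)) z = B (\<lambda>p. c i *\<^sub>R e i p) z + B (\<lambda>p. \<Sum>i\<in>J. c i *\<^sub>R e i p) z"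
        using insert e X by (intro add L2_subspace_lincomb[OF X]) (auto simp: L2_subspace_def)
      then show ?case using insert scale e(2) by simp
    qed
  qed
  have Blc: "B (lc c) (lc d) = (\<Sum>i<n. \<Sum>j<n. B (e i) (e j) * c i * d j)" for c d
  proof -
    have "B (lc c) (lc d) = (\<Sum>i<n. c i * B (lc d) (e i))"
      unfolding lc_def[of c] using B_lincomb[of "{..<n}" "lc d" c] lcX e sym by simp
    also have "\<dots> = (\<Sum>i<n. c i * (\<Sum>j<n. d j * B (e j) (e i)))"
      unfolding lc_def using B_lincomb[of "{..<n}" _ d] e by simp
    also have "\<dots> = (\<Sum>i<n. \<Sum>j<n. B (e i) (e j) * c i * d j)"
      unfolding sum_distrib_left using e sym by (intro sum.cong refl) (simp add: mult_ac)
    finally show ?thesis .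
  qed
  have Nlc: "L2_inner S (lc c) (lc d) = (\<Sum>i<n. c i * d i)" for c d
    unfolding lc_def by (rule orthonormal_lincomb_inner[OF e(1)])
  have rep: "B x y = B (lc (\<lambda>i. L2_inner S x (e i))) (lc (\<lambda>i. L2_inner S y (e i)))" if "x \<in> X" "y \<in> X" for x y
  proof -
    have x: "AE p in lebesgue_on S. x p = lc (\<lambda>i. L2_inner S x (e i)) p" if "x \<in> X" for x
      using span[OF that] by (simp add: lc_def expansion_def)
    show ?thesis using ae[OF that(1) lcX that(2) x[OF that(1)]]
      sym[OF lcX that(2)] ae[OF that(2) lcX lcX x[OF that(2)]] sym[OF lcX lcX] by metis
  qed
  have n: "n > 0"
  proof (rule ccontr)
    assume "\<not> 0 < n"
    then have "B x0 x0 = 0" using rep[OF pos(1) pos(1)] Blc by simp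
    with pos show False by simp
  qed
  obtain c where c: "(\<Sum>i<n. (c i)\<^sup>2) = 1"
    "\<And>d. (\<Sum>i<n. \<Sum>j<n. B (e i) (e j) * d i * d j) \<le> (\<Sum>i<n. \<Sum>j<n. B (e i) (e j) * c i * c j) * (\<Sum>i<n. (d i)\<^sup>2)"
    using quadratic_form_max[OF n, of "\<lambda>i j. B (e i) (e j)"] by blast
  define \<mu> where "\<mu> = B (lc c) (lc c)"
  have max: "B (lc d) (lc d) \<le> \<mu> * (\<Sum>i<n. (d i)\<^sup>2)" for d
    using c(2)[of d] by (simp add: \<mu>_def Blc)
  have mu: "\<mu> > 0"
  proof (rule ccontr)
    assume "\<not> \<mu> > 0"
    then have "\<mu> * (\<Sum>i<n. (L2_inner S x0 (e i))\<^sup>2) \<le> 0" by (intro mult_nonpos_nonneg sum_nonneg) auto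
    then show False using max[of "\<lambda>i. L2_inner S x0 (e i)"] rep[OF pos(1) pos(1)] pos(2) by linarith
  qed
  have crit: "B (lc c) (lc d) = \<mu> * (\<Sum>i<n. c i * d i)" for d
  proof -
    \<comment> \<open>The maximiser c is perturbed to c + t d: the constant terms cancel because c
      has unit length and attains \<open>\<mu>\<close>, and a nonpositive quadratic polynomial in t
      remains.\<close>
    have "2 * t * (B (lc c) (lc d) - \<mu> * (\<Sum>i<n. c i * d i)) + t\<^sup>2 * (B (lc d) (lc d) - \<mu> * (\<Sum>i<n. (d i)\<^sup>2)) \<le> 0" for t
    proof -
      have sc: "lc (\<lambda>i. c i + t * d i) = (\<lambda>p. lc c p + t *\<^sub>R lc d p)"
        by (simp add: lc_def scaleR_add_left sum.distrib scaleR_sum_right)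
      have tX: "(\<lambda>p. t *\<^sub>R lc d p) \<in> X" "(\<lambda>p. lc c p + t *\<^sub>R lc d p) \<in> X"
        using lcX X unfolding L2_subspace_def by auto
      have "B (lc (\<lambda>i. c i + t * d i)) (lc (\<lambda>i. c i + t * d i))
          = B (lc c) (lc c) + 2 * t * B (lc c) (lc d) + t\<^sup>2 * B (lc d) (lc d)"
      proof -
        have 1: "B (\<lambda>p. lc c p + t *\<^sub>R lc d p) z = B (lc c) z + t * B (lc d) z" if "z \<in> X" for z
          using add[OF lcX tX(1) that] scale[OF lcX that] by simp
        have "B (\<lambda>p. lc c p + t *\<^sub>R lc d p) (\<lambda>p. lc c p + t *\<^sub>R lc d p)
          = B (\<lambda>p. lc c p + t *\<^sub>R lc d p) (lc c) + t * B (\<lambda>p. lc c p + t *\<^sub>R lc d p) (lc d)"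
          using 1[OF tX(2)] sym[OF lcX tX(2)] by simp
        then show ?thesis unfolding sc 1[OF lcX] using sym[OF lcX lcX, of d c] by (simp add: power2_eq_square algebra_simps)
      qed
      moreover have "(\<Sum>i<n. (c i + t * d i)\<^sup>2) = 1 + 2 * t * (\<Sum>i<n. c i * d i) + t\<^sup>2 * (\<Sum>i<n. (d i)\<^sup>2)"
        unfolding c(1)[symmetric] by (simp add: power2_sum sum.distrib sum_distrib_left power_mult_distrib algebra_simps)
      ultimately show ?thesis using max[of "\<lambda>i. c i + t * d i"] by (simp add: \<mu>_def algebra_simps)
    qed
    then have "B (lc c) (lc d) - \<mu> * (\<Sum>i<n. c i * d i) = 0" by (rule nonpos_quadratic_imp_linear_zero)
    then show ?thesis by simp
  qed
  show ?thesis
  proof (rule that[OF lcX mu])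
    show "L2_inner S (lc c) (lc c) = 1" using c(1) by (simp add: Nlc power2_eq_square)
    fix z assume z: "z \<in> X"
    have zae: "AE p in lebesgue_on S. z p = lc (\<lambda>i. L2_inner S z (e i)) p"
      using span[OF z] by (simp add: lc_def expansion_def)
    have "B (lc c) z = B (lc c) (lc (\<lambda>i. L2_inner S z (e i)))"
      using ae[OF z lcX lcX zae] sym[OF lcX z] sym[OF lcX lcX] by metis
    also have "\<dots> = \<mu> * L2_inner S (lc c) (lc (\<lambda>i. L2_inner S z (e i)))" by (simp add: crit Nlc)
    also have "L2_inner S (lc c) (lc (\<lambda>i. L2_inner S z (e i))) = L2_inner S (lc c) z"
      using zae z lcX X by (intro L2_inner_AE_cong) (auto simp: L2_subspace_def elim: eventually_mono)
    finally show "B (lc c) z = \<mu> * L2_inner S (lc c) z" .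
  qed
qed

section \<open>Density of continuous functions\<close>

text \<open>Truncating f at a high level costs little in the square mean. The bounded truncation is
  a limit almost everywhere of continuous functions; clamping these to the same range supplies a
  constant majorant, so that the pointwise convergence becomes convergence in the square
  mean.\<close>

lemma L2_dense_continuous:
  fixes f :: "plane \<Rightarrow> real"
  assumes S: "S \<in> lmeasurable" and f: "f \<in> L2_space S" and e: "e > 0"
  obtains \<phi> where "continuous_on UNIV \<phi>" "\<phi> \<in> L2_space S"
    "(LINT p|lebesgue_on S. (f p - \<phi> p)\<^sup>2) \<le> e"
proof -
  interpret finite_measure "lebesgue_on S" by (rule finite_measure_lebesgue_on[OF S])
  have S': "S \<in> sets lebesgue" using S by (simp add: fmeasurableD)
  define cl where "cl m x = max (- m) (min m x)" for m x :: real
  have cl_bound: "\<bar>cl m x\<bar> \<le> m" if "m \<ge> 0" for m x using that by (auto simp: cl_def)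
  have cl_id: "cl m x = x" if "\<bar>x\<bar> \<le> m" for m x using that by (auto simp: cl_def)
  have cl_cont: "continuous_on UNIV (cl m)" for m unfolding cl_def[abs_def] by (intro continuous_intros)
  have cl_meas: "(\<lambda>p. cl m (k p)) \<in> borel_measurable M" if "k \<in> borel_measurable M" for m k and M :: "plane measure"
    unfolding cl_def using that by measurable
  note fm = L2_measurable[OF f]
  have "(\<lambda>n. LINT p|lebesgue_on S. (f p - cl (real n) (f p))\<^sup>2) \<longlonglongrightarrow> (LINT p|lebesgue_on S. 0)"
  proof (rule integral_dominated_convergence)
    show "integrable (lebesgue_on S) (\<lambda>p. (norm (f p))\<^sup>2)" by (rule L2_integrable_sq[OF f])
    show "(\<lambda>p. (f p - cl (real n) (f p))\<^sup>2) \<in> borel_measurable (lebesgue_on S)" for n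
      using fm cl_meas[OF fm] by measurable
    show "AE p in lebesgue_on S. (\<lambda>n. (f p - cl (real n) (f p))\<^sup>2) \<longlonglongrightarrow> 0"
    proof (rule AE_I2)
      fix p
      have "eventually (\<lambda>n. (f p - cl (real n) (f p))\<^sup>2 = 0) sequentially"
        using eventually_ge_at_top[of "nat \<lceil>\<bar>f p\<bar>\<rceil>"] by eventually_elim (simp add: cl_id nat_ceiling_le_eq)
      then show "(\<lambda>n. (f p - cl (real n) (f p))\<^sup>2) \<longlonglongrightarrow> 0" by (rule tendsto_eventually)
    qed
    show "AE p in lebesgue_on S. norm ((f p - cl (real n) (f p))\<^sup>2) \<le> (norm (f p))\<^sup>2" for n
    proof (rule AE_I2)
      fix p
      have "\<bar>f p - cl (real n) (f p)\<bar> \<le> \<bar>f p\<bar>" by (auto simp: cl_def)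
      then show "norm ((f p - cl (real n) (f p))\<^sup>2) \<le> (norm (f p))\<^sup>2" by (simp add: abs_le_square_iff)
    qed
  qed simp
  then have "eventually (\<lambda>n. (LINT p|lebesgue_on S. (f p - cl (real n) (f p))\<^sup>2) < e / 4) sequentially"
    by (rule order_tendstoD(2)) (use e in simp)
  then obtain m where m: "(LINT p|lebesgue_on S. (f p - cl (real m) (f p))\<^sup>2) < e / 4"
    by (auto simp: eventually_sequentially)
  define F where "F p = cl (real m) (f p)" for p
  have Fm: "F \<in> borel_measurable (lebesgue_on S)" unfolding F_def[abs_def] by (rule cl_meas[OF fm])
  have Fb: "\<bar>F p\<bar> \<le> real m" for p unfolding F_def by (rule cl_bound) simp
  have "F measurable_on S" using Fm S' by (simp add: measurable_on_iff_borel_measurable)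
  then obtain K g where K: "negligible K" and g: "\<And>n. continuous_on UNIV (g n)"
    and lim: "\<And>x. x \<notin> K \<Longrightarrow> (\<lambda>n. g n x) \<longlonglongrightarrow> (if x \<in> S then F x else 0)"
    unfolding measurable_on_def by blast
  define \<phi> where "\<phi> n p = cl (real m) (g n p)" for n p
  have \<phi>c: "continuous_on UNIV (\<phi> n)" for n
    unfolding \<phi>_def[abs_def] by (rule continuous_on_compose2[OF cl_cont g]) simp
  have \<phi>m: "\<phi> n \<in> borel_measurable (lebesgue_on S)" for n
    by (rule continuous_imp_measurable_on_sets_lebesgue[OF continuous_on_subset[OF \<phi>c subset_UNIV] S'])
  have \<phi>b: "\<bar>\<phi> n p\<bar> \<le> real m" for n p unfolding \<phi>_def by (rule cl_bound) simp
  have \<phi>L: "\<phi> n \<in> L2_space S" for n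
    by (rule L2_bounded[OF finite_measure_lebesgue_on[OF S] \<phi>m \<phi>b])
  have FL: "F \<in> L2_space S" by (rule L2_bounded[OF finite_measure_lebesgue_on[OF S] Fm Fb])
  have "(\<lambda>n. LINT p|lebesgue_on S. (F p - \<phi> n p)\<^sup>2) \<longlonglongrightarrow> (LINT p|lebesgue_on S. 0)"
  proof (rule integral_dominated_convergence)
    show "integrable (lebesgue_on S) (\<lambda>p. (2 * real m)\<^sup>2)" by simp
    show "(\<lambda>p. (F p - \<phi> n p)\<^sup>2) \<in> borel_measurable (lebesgue_on S)" for n using Fm \<phi>m[of n] by measurable
    have "AE p in lebesgue. p \<in> S \<longrightarrow> p \<notin> K" using AE_not_in_negligible[OF K] by eventually_elim simp
    then have "AE p in lebesgue_on S. p \<notin> K" using S' by (simp add: AE_restrict_space_iff)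
    moreover have "AE p in lebesgue_on S. p \<in> S" by (rule AE_I2) (simp add: space_restrict_space)
    ultimately show "AE p in lebesgue_on S. (\<lambda>n. (F p - \<phi> n p)\<^sup>2) \<longlonglongrightarrow> 0"
    proof eventually_elim
      case (elim p)
      have "(\<lambda>n. \<phi> n p) \<longlonglongrightarrow> cl (real m) (F p)"
        unfolding \<phi>_def using lim[OF elim(1)] elim(2) cl_cont
        by (intro isCont_tendsto_compose[of _ "cl (real m)"]) (auto simp: continuous_on_eq_continuous_at)
      moreover have "cl (real m) (F p) = F p" by (rule cl_id[OF Fb])
      ultimately have "(\<lambda>n. (F p - \<phi> n p)\<^sup>2) \<longlonglongrightarrow> (F p - F p)\<^sup>2" by (intro tendsto_intros) simp
      then show ?case by simp
    qed
    show "AE p in lebesgue_on S. norm ((F p - \<phi> n p)\<^sup>2) \<le> (2 * real m)\<^sup>2" for n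
    proof (rule AE_I2)
      fix p
      have "\<bar>F p - \<phi> n p\<bar> \<le> \<bar>2 * real m\<bar>" using Fb[of p] \<phi>b[of n p] by linarith
      then have "\<bar>F p - \<phi> n p\<bar>\<^sup>2 \<le> \<bar>2 * real m\<bar>\<^sup>2" by (rule power_mono) simp
      then show "norm ((F p - \<phi> n p)\<^sup>2) \<le> (2 * real m)\<^sup>2" by (simp only: power2_abs real_norm_def abs_power2)
    qed
  qed simp
  then have "eventually (\<lambda>n. (LINT p|lebesgue_on S. (F p - \<phi> n p)\<^sup>2) < e / 4) sequentially"
    by (rule order_tendstoD(2)) (use e in simp)
  then obtain n where n: "(LINT p|lebesgue_on S. (F p - \<phi> n p)\<^sup>2) < e / 4"
    by (auto simp: eventually_sequentially)
  have sq: "integrable (lebesgue_on S) (\<lambda>p. (k p)\<^sup>2)" if "k \<in> L2_space S" for k :: "plane \<Rightarrow> real"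
    using L2_integrable_sq[OF that] by simp
  have "(LINT p|lebesgue_on S. (f p - \<phi> n p)\<^sup>2) \<le> (LINT p|lebesgue_on S. 2 * (f p - F p)\<^sup>2 + 2 * (F p - \<phi> n p)\<^sup>2)"
  proof (rule integral_mono)
    show "integrable (lebesgue_on S) (\<lambda>p. (f p - \<phi> n p)\<^sup>2)" by (intro sq L2_diff f \<phi>L)
    show "integrable (lebesgue_on S) (\<lambda>p. 2 * (f p - F p)\<^sup>2 + 2 * (F p - \<phi> n p)\<^sup>2)"
      by (intro Bochner_Integration.integrable_add integrable_mult_right sq L2_diff f FL \<phi>L)
    have "(x - z)\<^sup>2 \<le> 2 * (x - y)\<^sup>2 + 2 * (y - z)\<^sup>2" for x y z :: real
      using zero_le_power2[of "(x - y) - (y - z)"] by (simp add: power2_eq_square algebra_simps)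
    then show "(f p - \<phi> n p)\<^sup>2 \<le> 2 * (f p - F p)\<^sup>2 + 2 * (F p - \<phi> n p)\<^sup>2" for p .
  qed
  also have "\<dots> = 2 * (LINT p|lebesgue_on S. (f p - F p)\<^sup>2) + 2 * (LINT p|lebesgue_on S. (F p - \<phi> n p)\<^sup>2)"
    by (subst Bochner_Integration.integral_add) (auto intro!: sq L2_diff f FL \<phi>L)
  finally have "(LINT p|lebesgue_on S. (f p - \<phi> n p)\<^sup>2) \<le> e" using m n unfolding F_def by linarith
  with that[OF \<phi>c \<phi>L] show ?thesis by blast
qed

section \<open>Weak partial derivatives on rectangles\<close>

text \<open>The two coordinate directions are treated at once: \<open>(s, t)\<close> is \<open>(fst, snd)\<close> or \<open>(snd, fst)\<close>,
  and derivatives are taken in the direction of \<open>s\<close>.\<close>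

definition crect :: "(plane \<Rightarrow> real) \<Rightarrow> (plane \<Rightarrow> real) \<Rightarrow> real \<Rightarrow> real \<Rightarrow> real \<Rightarrow> real \<Rightarrow> plane set" where
  "crect s t a b c d = {z. s z \<in> {a..b} \<and> t z \<in> {c..d}}"

definition orect :: "(plane \<Rightarrow> real) \<Rightarrow> (plane \<Rightarrow> real) \<Rightarrow> real \<Rightarrow> real \<Rightarrow> real \<Rightarrow> real \<Rightarrow> plane set" where
  "orect s t a b c d = {z. s z \<in> {a<..<b} \<and> t z \<in> {c<..<d}}"

text \<open>Products of functions of one variable suffice as test functions: they separate
  square-integrable functions and permit integration by parts in one direction. The support is
  confined by a closed rectangle inside \<open>U\<close> instead of by a topological
  closure.\<close>

definition tensor_test :: "(plane \<Rightarrow> real) \<Rightarrow> (plane \<Rightarrow> real) \<Rightarrow> plane set \<Rightarrow> (real \<Rightarrow> real) \<Rightarrow> (real \<Rightarrow> real) \<Rightarrow> bool" where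
  "tensor_test s t U p q \<longleftrightarrow> smooth p \<and> smooth q \<and>
     (\<exists>a b c d. (\<forall>x. p x \<noteq> 0 \<longrightarrow> x \<in> {a..b}) \<and> (\<forall>x. q x \<noteq> 0 \<longrightarrow> x \<in> {c..d}) \<and> crect s t a b c d \<subseteq> U)"

text \<open>\<open>is_weak_deriv\<close> refers every derivative to the undifferentiated function.
  Here two functions are related by a single differentiation, so that derivatives of consecutive
  orders can be chained.\<close>

definition weak_partial :: "(plane \<Rightarrow> real) \<Rightarrow> (plane \<Rightarrow> real) \<Rightarrow> plane set \<Rightarrow> (plane \<Rightarrow> real) \<Rightarrow> (plane \<Rightarrow> real) \<Rightarrow> bool" where
  "weak_partial s t U f g \<longleftrightarrow> (\<forall>p q. tensor_test s t U p q \<longrightarrow>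
     (LINT z|lebesgue_on U. f z * (deriv p (s z) * q (t z))) = - (LINT z|lebesgue_on U. g z * (p (s z) * q (t z))))"

lemma deriv_eq_0_outside:
  assumes "smooth p" "\<And>x. p x \<noteq> 0 \<Longrightarrow> x \<in> {a..b}" "x \<notin> {a..b}"
  shows "deriv p x = 0"
proof -
  have "eventually (\<lambda>y. y \<in> - {a..b}) (nhds x)"
    using assms(3) by (intro eventually_nhds_in_open) auto
  then have "eventually (\<lambda>y. p y = 0) (nhds x)" by eventually_elim (use assms(2) in auto)
  then have "deriv p x = deriv (\<lambda>_. 0) x" by (rule deriv_cong_ev) simp
  then show ?thesis by simp
qed

lemma integral_supported:
  fixes f :: "plane \<Rightarrow> real"
  assumes "U \<in> sets lebesgue" "V \<in> sets lebesgue" "V \<subseteq> U" "\<And>z. z \<notin> V \<Longrightarrow> f z = 0"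
  shows "(LINT z|lebesgue_on U. f z) = (LINT z|lebesgue_on V. f z)"
proof -
  have "(\<lambda>z. indicator U z * f z) = (\<lambda>z. indicator V z * f z)"
  proof
    show "indicator U z * f z = indicator V z * f z" for z
      using assms(3,4) by (cases "z \<in> V") (auto simp: indicator_def)
  qed
  then show ?thesis
    by (simp only: integral_lebesgue_on_indicator(1)[OF assms(1)] integral_lebesgue_on_indicator(1)[OF assms(2)])
qed

lemma weak_partial_mono:
  assumes w: "weak_partial s t U f g" and U: "U \<in> sets lebesgue" "V \<in> sets lebesgue" "V \<subseteq> U"
  shows "weak_partial s t V f g"
  unfolding weak_partial_def
proof (intro allI impI)
  fix p q assume t: "tensor_test s t V p q"
  then obtain a b c d where *: "smooth p" "\<And>x. p x \<noteq> 0 \<Longrightarrow> x \<in> {a..b}" "\<And>x. q x \<noteq> 0 \<Longrightarrow> x \<in> {c..d}" "crect s t a b c d \<subseteq> V"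
    unfolding tensor_test_def by blast
  have z: "p (s z) * q (t z) = 0 \<and> deriv p (s z) * q (t z) = 0" if "z \<notin> V" for z
  proof -
    have "s z \<notin> {a..b} \<or> t z \<notin> {c..d}" using that *(4) by (auto simp: crect_def)
    then show ?thesis using *(2)[of "s z"] *(3)[of "t z"] deriv_eq_0_outside[OF *(1,2), of "s z"] by auto
  qed
  have "tensor_test s t U p q" using t U(3) unfolding tensor_test_def by blast
  then have "(LINT z|lebesgue_on U. f z * (deriv p (s z) * q (t z))) = - (LINT z|lebesgue_on U. g z * (p (s z) * q (t z)))"
    using w unfolding weak_partial_def by blast
  then show "(LINT z|lebesgue_on V. f z * (deriv p (s z) * q (t z))) = - (LINT z|lebesgue_on V. g z * (p (s z) * q (t z)))"
    using z by (subst (asm) (1 2) integral_supported[OF U]) auto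
qed

lemma tensor_test_fst_snd:
  assumes "tensor_test fst snd U p q"
  shows "(\<lambda>z. p (fst z) * q (snd z)) \<in> test_functions U"
proof -
  obtain a b c d where *: "smooth p" "smooth q" "\<And>x. p x \<noteq> 0 \<Longrightarrow> x \<in> {a..b}" "\<And>x. q x \<noteq> 0 \<Longrightarrow> x \<in> {c..d}" "crect fst snd a b c d \<subseteq> U"
    using assms unfolding tensor_test_def by blast
  have "crect fst snd a b c d = {a..b} \<times> {c..d}" by (auto simp: crect_def)
  then show ?thesis using tensor_test_function[OF *(1-4)] *(5) by simp
qed

lemma tensor_test_swap: "tensor_test s t U p q \<longleftrightarrow> tensor_test t s U q p"
proof -
  have "crect s t a b c d = crect t s c d a b" for a b c d by (auto simp: crect_def)
  then show ?thesis unfolding tensor_test_def by auto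
qed

lemma tensor_test_deriv: "tensor_test s t U p q \<Longrightarrow> tensor_test s t U (deriv p) q"
  unfolding tensor_test_def using deriv_eq_0_outside smooth_deriv by (metis (no_types, lifting))

text \<open>The relation for order a, tested with the derivative of p, and the relation for order a
  + 1, tested with p, have the same left-hand side.\<close>

lemma weak_deriv_weak_partial_fst:
  assumes "is_weak_deriv U a b u v" "is_weak_deriv U (Suc a) b u w"
  shows "weak_partial fst snd U v w"
  unfolding weak_partial_def
proof (intro allI impI)
  fix p q assume t: "tensor_test fst snd U p q"
  have s: "smooth p" "smooth q" using t by (auto simp: tensor_test_def)
  note p = tensor_test_fst_snd[OF t] tensor_test_fst_snd[OF tensor_test_deriv[OF t]]
  have "L2_inner U u (\<lambda>z. (deriv ^^ a) (deriv p) (fst z) * (deriv ^^ b) q (snd z)) = (-1) ^ (a + b) * L2_inner U v (\<lambda>z. deriv p (fst z) * q (snd z))"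
    using assms(1)[unfolded is_weak_deriv_def, rule_format, OF p(2)] unfolding dx_dy_tensor[OF smooth_deriv[OF s(1)] s(2), of a b] .
  moreover have "L2_inner U u (\<lambda>z. (deriv ^^ Suc a) p (fst z) * (deriv ^^ b) q (snd z)) = (-1) ^ (Suc a + b) * L2_inner U w (\<lambda>z. p (fst z) * q (snd z))"
    using assms(2)[unfolded is_weak_deriv_def, rule_format, OF p(1)] unfolding dx_dy_tensor[OF s, of "Suc a" b] .
  ultimately have "(-1) ^ (a + b) * L2_inner U v (\<lambda>z. deriv p (fst z) * q (snd z)) = (-1) ^ (a + b) * (- L2_inner U w (\<lambda>z. p (fst z) * q (snd z)))"
    by (simp add: funpow_swap1)
  then have "L2_inner U v (\<lambda>z. deriv p (fst z) * q (snd z)) = - L2_inner U w (\<lambda>z. p (fst z) * q (snd z))"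
    by (subst (asm) mult_left_cancel) auto
  then show "(LINT z|lebesgue_on U. v z * (deriv p (fst z) * q (snd z))) = - (LINT z|lebesgue_on U. w z * (p (fst z) * q (snd z)))"
    by (simp add: L2_inner_def)
qed

lemma weak_deriv_weak_partial_snd:
  assumes "is_weak_deriv U a b u v" "is_weak_deriv U a (Suc b) u w"
  shows "weak_partial snd fst U v w"
  unfolding weak_partial_def
proof (intro allI impI)
  fix q p assume t': "tensor_test snd fst U q p"
  then have t: "tensor_test fst snd U p q" using tensor_test_swap by blast
  have s: "smooth p" "smooth q" using t by (auto simp: tensor_test_def)
  have p: "(\<lambda>z. p (fst z) * q (snd z)) \<in> test_functions U" "(\<lambda>z. p (fst z) * deriv q (snd z)) \<in> test_functions U"
    using tensor_test_fst_snd[OF t] tensor_test_fst_snd tensor_test_swap tensor_test_deriv[OF t'] by blast+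
  have "L2_inner U u (\<lambda>z. (deriv ^^ a) p (fst z) * (deriv ^^ b) (deriv q) (snd z)) = (-1) ^ (a + b) * L2_inner U v (\<lambda>z. p (fst z) * deriv q (snd z))"
    using assms(1)[unfolded is_weak_deriv_def, rule_format, OF p(2)] unfolding dx_dy_tensor[OF s(1) smooth_deriv[OF s(2)], of a b] .
  moreover have "L2_inner U u (\<lambda>z. (deriv ^^ a) p (fst z) * (deriv ^^ Suc b) q (snd z)) = (-1) ^ (a + Suc b) * L2_inner U w (\<lambda>z. p (fst z) * q (snd z))"
    using assms(2)[unfolded is_weak_deriv_def, rule_format, OF p(1)] unfolding dx_dy_tensor[OF s, of a "Suc b"] .
  ultimately have "(-1) ^ (a + b) * L2_inner U v (\<lambda>z. p (fst z) * deriv q (snd z)) = (-1) ^ (a + b) * (- L2_inner U w (\<lambda>z. p (fst z) * q (snd z)))"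
    by (simp add: funpow_swap1)
  then have "L2_inner U v (\<lambda>z. p (fst z) * deriv q (snd z)) = - L2_inner U w (\<lambda>z. p (fst z) * q (snd z))"
    by (subst (asm) mult_left_cancel) auto
  then show "(LINT z|lebesgue_on U. v z * (deriv q (snd z) * p (fst z))) = - (LINT z|lebesgue_on U. w z * (q (snd z) * p (fst z)))"
    by (simp add: L2_inner_def mult_ac)
qed

locale coords =
  fixes s t :: "plane \<Rightarrow> real"
  assumes coords: "s = fst \<and> t = snd \<or> s = snd \<and> t = fst"
begin

lemma coords_swap: "coords t s" using coords by unfold_locales auto

lemma continuous_coords: "continuous_on S s" "continuous_on S t"
  using coords by (auto intro: continuous_intros)

lemma crect_swap: "crect s t a b c d = crect t s c d a b"
  by (auto simp: crect_def)

lemma crect_cbox: "crect s t a b c d = (if s = fst then cbox (a, c) (b, d) else cbox (c, a) (d, b))"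
proof -
  have ne: "(snd :: plane \<Rightarrow> real) \<noteq> fst" by (metis fst_conv snd_conv zero_neq_one)
  have "crect fst snd a b c d = cbox (a, c) (b, d)" "crect snd fst a b c d = cbox (c, a) (d, b)" for a b c d
    by (auto simp: crect_def cbox_Pair_eq)
  then show ?thesis using coords ne by (elim disjE) simp_all
qed

lemma crect_lmeasurable [simp]: "crect s t a b c d \<in> lmeasurable"
  and crect_sets [simp]: "crect s t a b c d \<in> sets lebesgue"
  and crect_compact: "compact (crect s t a b c d)"
  by (simp_all add: crect_cbox)

lemma measure_crect: "a \<le> b \<Longrightarrow> c \<le> d \<Longrightarrow> measure lebesgue (crect s t a b c d) = (b - a) * (d - c)"
  by (auto simp: crect_cbox content_Pair)

lemma orect_open: "open (orect s t a b c d)"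
  unfolding orect_def using continuous_coords
  by (auto intro!: open_Collect_conj open_Collect_less continuous_intros)

lemma orect_sets [simp]: "orect s t a b c d \<in> sets lebesgue"
  using orect_open by (simp add: borel_open)

lemma orect_subset_crect: "orect s t a b c d \<subseteq> crect s t a b c d"
  by (auto simp: orect_def crect_def)

lemma negligible_line: "negligible {z. s z = a}" "negligible {z. t z = a}"
proof -
  have "negligible {z :: plane. z \<bullet> (1, 0) = a}" "negligible {z :: plane. z \<bullet> (0, 1) = a}"
    by (intro negligible_standard_hyperplane; simp add: Basis_prod_def)+
  then have "negligible {z :: plane. fst z = a}" "negligible {z :: plane. snd z = a}"
    by (simp_all add: inner_prod_def)
  then show "negligible {z. s z = a}" "negligible {z. t z = a}" using coords by auto
qed

lemma negligible_crect_orect: "negligible (crect s t a b c d - orect s t a b c d)"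
proof (rule negligible_subset)
  show "negligible (({z. s z = a} \<union> {z. s z = b}) \<union> ({z. t z = c} \<union> {z. t z = d}))"
    by (intro negligible_Un negligible_line)
qed (auto simp: crect_def orect_def)

lemma finite_measure_crect: "finite_measure (lebesgue_on (crect s t a b c d))"
  by (rule finite_measure_lebesgue_on) simp

lemma measurable_coord:
  assumes "continuous_on UNIV p" "S \<in> sets lebesgue"
  shows "(\<lambda>z. p (s z)) \<in> borel_measurable (lebesgue_on S)" "(\<lambda>z. p (t z)) \<in> borel_measurable (lebesgue_on S)"
  by (intro continuous_imp_measurable_on_sets_lebesgue assms continuous_on_compose2[OF assms(1) continuous_coords(1)]
      continuous_on_compose2[OF assms(1) continuous_coords(2)]; simp)+

lemma integral_orect: "(LINT z|lebesgue_on (orect s t a b c d). f z) = (LINT z|lebesgue_on (crect s t a b c d). (f z :: real))"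
proof (rule integral_lebesgue_on_cong_set)
  have "orect s t a b c d - crect s t a b c d = {}" using orect_subset_crect by blast
  then show "negligible (orect s t a b c d - crect s t a b c d)" by simp
qed (simp_all add: negligible_crect_orect)

lemma AE_orect: "AE z in lebesgue_on (crect s t a b c d). z \<in> orect s t a b c d"
  by (rule AE_lebesgue_on_mono[OF _ orect_sets negligible_crect_orect]) (auto simp: AE_restrict_space_iff)

lemma cutoff_tensor_test:
  assumes "smooth p"
  shows "tensor_test s t (orect s t a b c d) (\<lambda>x. p x * cutoff a b n x) (cutoff c d n)"
proof (cases "n > 0")
  case True
  have pos: "0 < 1 / real n" using True by simp
  have "crect s t (a + 1 / real n) (b - 1 / real n) (c + 1 / real n) (d - 1 / real n) \<subseteq> orect s t a b c d"
    unfolding crect_def orect_def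
    by (intro Collect_mono) (use pos in \<open>simp only: atLeastAtMost_iff greaterThanLessThan_iff, linarith\<close>)
  then show ?thesis unfolding tensor_test_def using assms smooth_cutoff cutoff_support
    by (intro conjI smooth_mult exI[of _ "a + 1 / real n"] exI[of _ "b - 1 / real n"] exI[of _ "c + 1 / real n"] exI[of _ "d - 1 / real n"])
       (auto simp del: atLeastAtMost_iff)
next
  case False
  then have "cutoff x y n z = 0" for x y z using cutoff_support(1) by blast
  then show ?thesis unfolding tensor_test_def using assms smooth_cutoff
    by (intro conjI smooth_mult exI[of _ 1] exI[of _ 0]) (auto simp: crect_def)
qed

text \<open>The product of p with cutoffs in both directions is an admissible test function, and n
  tends to infinity. As p vanishes linearly at the ends, p times the derivative of the cutoff stays
  bounded and tends to 0; the cutoff in the direction t is not differentiated at all. Boundary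
  values of f thus never occur.\<close>

lemma weak_partial_ibp:
  assumes ab: "a < b" and wp: "weak_partial s t (orect s t a b c d) f g"
    and f: "f \<in> L2_space (crect s t a b c d)" and g: "g \<in> L2_space (crect s t a b c d)"
    and p: "smooth p" "p a = 0" "p b = 0"
  shows "(LINT z|lebesgue_on (crect s t a b c d). f z * deriv p (s z))
    = - (LINT z|lebesgue_on (crect s t a b c d). g z * p (s z))"
proof -
  let ?R = "crect s t a b c d"
  obtain L where L: "L \<ge> 0" "\<And>x. x \<in> {a..b} \<Longrightarrow> \<bar>p x\<bar> \<le> L * (x - a)" "\<And>x. x \<in> {a..b} \<Longrightarrow> \<bar>p x\<bar> \<le> L * (b - x)"
    using smooth_boundary_bound[OF p ab] by blast
  have "compact (deriv p ` {a..b})"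
    by (rule compact_continuous_image[OF smooth_continuous_on[OF smooth_deriv[OF p(1)]] compact_Icc])
  then obtain D where D: "\<And>x. x \<in> {a..b} \<Longrightarrow> norm (deriv p x) \<le> D"
    using compact_imp_bounded bounded_iff by (metis imageI)
  define P where "P n x = p x * cutoff a b n x" for n x
  have sP: "smooth (P n)" for n unfolding P_def[abs_def] by (intro smooth_mult p smooth_cutoff)
  have dP: "deriv (P n) x = deriv p x * cutoff a b n x + p x * deriv (cutoff a b n) x" for n x
  proof -
    have "(P n has_real_derivative deriv p x * cutoff a b n x + deriv (cutoff a b n) x * p x) (at x)"
      unfolding P_def[abs_def] by (rule DERIV_mult[OF smooth_has_deriv[OF p(1)] smooth_has_deriv[OF smooth_cutoff]])
    then show ?thesis by (simp add: DERIV_imp_deriv mult.commute)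
  qed
  have fi: "integrable (lebesgue_on ?R) f" and gi: "integrable (lebesgue_on ?R) g"
    using f g finite_measure_crect L2_integrable by blast+
  have m: "(\<lambda>z. q (s z)) \<in> borel_measurable (lebesgue_on ?R)" "(\<lambda>z. q (t z)) \<in> borel_measurable (lebesgue_on ?R)" if "smooth q" for q
    using measurable_coord[OF smooth_continuous_on[OF that] crect_sets] by auto
  have eq: "(LINT z|lebesgue_on ?R. f z * (deriv (P n) (s z) * cutoff c d n (t z)))
      = - (LINT z|lebesgue_on ?R. g z * (P n (s z) * cutoff c d n (t z)))" for n
    using wp cutoff_tensor_test[OF p(1), of a b c d n] unfolding weak_partial_def P_def[abs_def] integral_orect by blast
  have 1: "(\<lambda>n. LINT z|lebesgue_on ?R. f z * (deriv (P n) (s z) * cutoff c d n (t z)))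
     \<longlonglongrightarrow> (LINT z|lebesgue_on ?R. f z * deriv p (s z))"
  proof (rule integral_dominated_convergence)
    show "integrable (lebesgue_on ?R) (\<lambda>z. \<bar>f z\<bar> * (D + 4 * L))" using fi by simp
    show "(\<lambda>z. f z * deriv p (s z)) \<in> borel_measurable (lebesgue_on ?R)"
      using m[OF smooth_deriv[OF p(1)]] fi by measurable
    show "(\<lambda>z. f z * (deriv (P n) (s z) * cutoff c d n (t z))) \<in> borel_measurable (lebesgue_on ?R)" for n
      using m(1)[OF smooth_deriv[OF sP[of n]]] m(2)[OF smooth_cutoff[of c d n]] fi by measurable
    show "AE z in lebesgue_on ?R. (\<lambda>n. f z * (deriv (P n) (s z) * cutoff c d n (t z))) \<longlonglongrightarrow> f z * deriv p (s z)"
      using AE_orect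
    proof eventually_elim
      case (elim z)
      then have st: "s z \<in> {a<..<b}" "t z \<in> {c<..<d}" by (auto simp: orect_def)
      have "(\<lambda>n. f z * ((deriv p (s z) * cutoff a b n (s z) + p (s z) * deriv (cutoff a b n) (s z)) * cutoff c d n (t z)))
         \<longlonglongrightarrow> f z * ((deriv p (s z) * 1 + p (s z) * 0) * 1)"
        by (intro tendsto_intros cutoff_tendsto deriv_cutoff_tendsto st)
      then show ?case by (simp add: dP)
    qed
    show "AE z in lebesgue_on ?R. norm (f z * (deriv (P n) (s z) * cutoff c d n (t z))) \<le> \<bar>f z\<bar> * (D + 4 * L)" for n
    proof (rule AE_I2)
      fix z assume "z \<in> space (lebesgue_on ?R)"
      then have z: "s z \<in> {a..b}" by (simp add: crect_def)
      have c1: "\<bar>cutoff x y n w\<bar> \<le> 1" for x y w using cutoff_bounds[of x y n w] by simp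
      have "\<bar>deriv (P n) (s z)\<bar> \<le> \<bar>deriv p (s z)\<bar> * \<bar>cutoff a b n (s z)\<bar> + \<bar>p (s z) * deriv (cutoff a b n) (s z)\<bar>"
        unfolding dP abs_mult[symmetric] by (rule abs_triangle_ineq)
      also have "\<dots> \<le> D * 1 + 4 * L"
        using D[OF z] by (intro add_mono mult_mono c1 mult_deriv_cutoff_bound L z) auto
      finally have "\<bar>deriv (P n) (s z)\<bar> * \<bar>cutoff c d n (t z)\<bar> \<le> (D + 4 * L) * 1"
        by (intro mult_mono c1) auto
      then show "norm (f z * (deriv (P n) (s z) * cutoff c d n (t z))) \<le> \<bar>f z\<bar> * (D + 4 * L)"
        by (simp add: abs_mult mult_left_mono)
    qed
  qed
  have 2: "(\<lambda>n. LINT z|lebesgue_on ?R. g z * (P n (s z) * cutoff c d n (t z)))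
     \<longlonglongrightarrow> (LINT z|lebesgue_on ?R. g z * p (s z))"
  proof (rule integral_dominated_convergence)
    show "integrable (lebesgue_on ?R) (\<lambda>z. \<bar>g z\<bar> * (L * (b - a)))" using gi by simp
    show "(\<lambda>z. g z * p (s z)) \<in> borel_measurable (lebesgue_on ?R)"
      using m[OF p(1)] gi by measurable
    show "(\<lambda>z. g z * (P n (s z) * cutoff c d n (t z))) \<in> borel_measurable (lebesgue_on ?R)" for n
      using m(1)[OF sP[of n]] m(2)[OF smooth_cutoff[of c d n]] gi by measurable
    show "AE z in lebesgue_on ?R. (\<lambda>n. g z * (P n (s z) * cutoff c d n (t z))) \<longlonglongrightarrow> g z * p (s z)"
      using AE_orect
    proof eventually_elim
      case (elim z)
      then have st: "s z \<in> {a<..<b}" "t z \<in> {c<..<d}" by (auto simp: orect_def)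
      have "(\<lambda>n. g z * ((p (s z) * cutoff a b n (s z)) * cutoff c d n (t z))) \<longlonglongrightarrow> g z * ((p (s z) * 1) * 1)"
        by (intro tendsto_intros cutoff_tendsto st)
      then show ?case by (simp add: P_def)
    qed
    show "AE z in lebesgue_on ?R. norm (g z * (P n (s z) * cutoff c d n (t z))) \<le> \<bar>g z\<bar> * (L * (b - a))" for n
    proof (rule AE_I2)
      fix z assume "z \<in> space (lebesgue_on ?R)"
      then have z: "s z \<in> {a..b}" by (simp add: crect_def)
      have c1: "\<bar>cutoff x y n w\<bar> \<le> 1" for x y w using cutoff_bounds[of x y n w] by simp
      have "L * (s z - a) \<le> L * (b - a)" using L(1) z by (intro mult_left_mono) auto
      then have "\<bar>p (s z)\<bar> * \<bar>cutoff a b n (s z)\<bar> \<le> (L * (b - a)) * 1"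
        using L(2)[OF z] by (intro mult_mono c1) auto
      then have "\<bar>P n (s z)\<bar> * \<bar>cutoff c d n (t z)\<bar> \<le> (L * (b - a)) * 1"
        using L(1) ab by (intro mult_mono c1) (auto simp: P_def abs_mult)
      then show "norm (g z * (P n (s z) * cutoff c d n (t z))) \<le> \<bar>g z\<bar> * (L * (b - a))"
        by (simp add: abs_mult mult_left_mono)
    qed
  qed
  from tendsto_minus[OF 2] have "(\<lambda>n. LINT z|lebesgue_on ?R. f z * (deriv (P n) (s z) * cutoff c d n (t z)))
     \<longlonglongrightarrow> - (LINT z|lebesgue_on ?R. g z * p (s z))" by (simp add: eq)
  with 1 show ?thesis by (rule LIMSEQ_unique)
qed

lemma integral_cutoff_limit:
  assumes f: "f \<in> L2_space (crect s t a b c d)"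
  shows "(\<lambda>n. LINT z|lebesgue_on (crect s t a b c d). f z * (cutoff a b n (s z) * cutoff c d n (t z)))
     \<longlonglongrightarrow> (LINT z|lebesgue_on (crect s t a b c d). f z)"
proof (rule integral_dominated_convergence)
  let ?R = "crect s t a b c d"
  have fi: "integrable (lebesgue_on ?R) f" using f finite_measure_crect L2_integrable by blast
  show "integrable (lebesgue_on ?R) (\<lambda>z. \<bar>f z\<bar>)" using fi by simp
  show "f \<in> borel_measurable (lebesgue_on ?R)" using fi by simp
  show "(\<lambda>z. f z * (cutoff a b n (s z) * cutoff c d n (t z))) \<in> borel_measurable (lebesgue_on ?R)" for n
    using measurable_coord[OF smooth_continuous_on[OF smooth_cutoff] crect_sets] fi by measurable
  show "AE z in lebesgue_on ?R. (\<lambda>n. f z * (cutoff a b n (s z) * cutoff c d n (t z))) \<longlonglongrightarrow> f z"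
    using AE_orect
  proof eventually_elim
    case (elim z)
    then have st: "s z \<in> {a<..<b}" "t z \<in> {c<..<d}" by (auto simp: orect_def)
    have "(\<lambda>n. f z * (cutoff a b n (s z) * cutoff c d n (t z))) \<longlonglongrightarrow> f z * (1 * 1)"
      by (intro tendsto_intros cutoff_tendsto st)
    then show ?case by simp
  qed
  have "\<bar>cutoff a b n x * cutoff c d n y\<bar> \<le> 1" for n x y
    using cutoff_bounds by (simp add: abs_mult mult_le_one)
  then show "AE z in lebesgue_on ?R. norm (f z * (cutoff a b n (s z) * cutoff c d n (t z))) \<le> \<bar>f z\<bar>" for n
    by (simp add: abs_mult[of "f _"] mult_left_le)
qed

lemma L2_crect_mono:
  assumes "f \<in> L2_space (crect s t a b c d)" "a \<le> a'" "b' \<le> b" "c \<le> c'" "d' \<le> d"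
  shows "f \<in> L2_space (crect s t a' b' c' d')"
proof -
  have "crect s t a' b' c' d' \<subseteq> crect s t a b c d" using assms by (auto simp: crect_def)
  from L2_subset[OF crect_sets crect_sets this assms(1)] show ?thesis .
qed

lemma weak_partial_orect_mono:
  assumes "weak_partial s t (orect s t a b c d) f g" "a \<le> a'" "b' \<le> b" "c \<le> c'" "d' \<le> d"
  shows "weak_partial s t (orect s t a' b' c' d') f g"
proof -
  have "orect s t a' b' c' d' \<subseteq> orect s t a b c d" using assms by (auto simp: orect_def)
  from weak_partial_mono[OF assms(1) orect_sets orect_sets this] show ?thesis .
qed

lemma integral_crect_split:
  fixes f :: "plane \<Rightarrow> real"
  assumes "a \<le> m" "m \<le> b" and f: "integrable (lebesgue_on (crect s t a b c d)) f"
  shows "(LINT z|lebesgue_on (crect s t a b c d). f z)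
    = (LINT z|lebesgue_on (crect s t a m c d). f z) + (LINT z|lebesgue_on (crect s t m b c d). f z)"
proof -
  define S where "S i = (if i then crect s t a m c d else crect s t m b c d)" for i
  have U: "(\<Union>i\<in>UNIV. S i) = crect s t a b c d" using assms by (auto simp: S_def crect_def split: if_splits)
  have "negligible (crect s t a m c d \<inter> crect s t m b c d)"
    by (rule negligible_subset[OF negligible_line(1)[of m]]) (auto simp: crect_def)
  then have "(LINT p|lebesgue_on (\<Union>i\<in>UNIV. S i). f p) = (\<Sum>i\<in>UNIV. LINT p|lebesgue_on (S i). f p)"
    using f unfolding U[symmetric] by (intro integral_lebesgue_on_union) (auto simp: S_def Int_commute)
  then show ?thesis unfolding U by (simp add: UNIV_bool S_def)
qed

lemma L2_mult_smooth:
  assumes f: "f \<in> L2_space (crect s t a b c d)" and q: "smooth q"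
  shows "(\<lambda>z. f z * q (s z)) \<in> L2_space (crect s t a b c d)"
proof -
  have "compact (q ` {a..b})" by (rule compact_continuous_image[OF smooth_continuous_on[OF q] compact_Icc])
  then obtain C where "\<And>r. r \<in> {a..b} \<Longrightarrow> norm (q r) \<le> C"
    using compact_imp_bounded bounded_iff by (metis imageI)
  then show ?thesis
    using measurable_coord(1)[OF smooth_continuous_on[OF q] crect_sets]
    by (intro L2_bounded_mult[OF f]) (auto simp: crect_def)
qed

text \<open>The flux of \<open>f\<close> through the common edge is the same seen from both sides. Both expressions come
  from testing with a quadratic bubble on the whole rectangle and on its two parts; the
  difference of these bubbles is a hat function.\<close>

lemma flux_continuity:
  assumes am: "a < m" "m < b"
    and wp: "weak_partial s t (orect s t a b c d) f g"
    and f: "f \<in> L2_space (crect s t a b c d)" and g: "g \<in> L2_space (crect s t a b c d)"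
  shows "(b - m) * ((LINT z|lebesgue_on (crect s t a m c d). f z) + (LINT z|lebesgue_on (crect s t a m c d). g z * (s z - a)))
       = (m - a) * ((LINT z|lebesgue_on (crect s t m b c d). f z) - (LINT z|lebesgue_on (crect s t m b c d). g z * (b - s z)))"
proof -
  have bubble: "(LINT z|lebesgue_on (crect s t x y c d). f z * (x + y - 2 * s z))
      = - (LINT z|lebesgue_on (crect s t x y c d). g z * ((s z - x) * (y - s z)))"
    if "x < y" "a \<le> x" "y \<le> b" for x y
  proof -
    have D: "deriv (\<lambda>r. (r - x) * (y - r)) r = x + y - 2 * r" for r
      by (rule DERIV_imp_deriv) (auto intro!: derivative_eq_intros)
    have "smooth (\<lambda>r. (r - x) * (y - r))" by simp
    from weak_partial_ibp[OF that(1) weak_partial_orect_mono[OF wp that(2,3)] L2_crect_mono[OF f that(2,3)] L2_crect_mono[OF g that(2,3)] this]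
    show ?thesis by (simp add: D)
  qed
  have int: "integrable (lebesgue_on (crect s t x y c d)) (\<lambda>z. k z * q (s z))"
    if "k = f \<or> k = g" "smooth q" "a \<le> x" "y \<le> b" for k q x y
  proof -
    have k: "k \<in> L2_space (crect s t x y c d)" using that L2_crect_mono[OF f, of x y c d] L2_crect_mono[OF g, of x y c d] by auto
    have "(\<lambda>z. k z * q (s z)) \<in> L2_space (crect s t x y c d)" by (rule L2_mult_smooth[OF k that(2)])
    then show ?thesis using finite_measure_crect L2_integrable by blast
  qed
  have q: "smooth (\<lambda>r. x + y - 2 * r)" "smooth (\<lambda>r. (r - x) * (y - r))" "smooth (\<lambda>r. r - x)" "smooth (\<lambda>r. y - r)" "smooth (\<lambda>r. 1)" for x y by simp_all
  have fq: "integrable (lebesgue_on (crect s t x y c d)) (\<lambda>z. k z * (r + r' - 2 * s z))"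
       "integrable (lebesgue_on (crect s t x y c d)) (\<lambda>z. k z * ((s z - r) * (r' - s z)))"
       "integrable (lebesgue_on (crect s t x y c d)) (\<lambda>z. k z * (s z - r))"
       "integrable (lebesgue_on (crect s t x y c d)) (\<lambda>z. k z * (r - s z))"
       "integrable (lebesgue_on (crect s t x y c d)) (\<lambda>z. k z)"
    if "k = f \<or> k = g" "a \<le> x" "y \<le> b" for k x y r r'
    using int[OF that(1) q(1)[of r r'] that(2,3)] int[OF that(1) q(2)[of r r'] that(2,3)] int[OF that(1) q(3)[of r] that(2,3)]
      int[OF that(1) q(4)[of r] that(2,3)] int[OF that(1) q(5) that(2,3)] by simp_all
  let ?I = "\<lambda>x y h. (LINT z|lebesgue_on (crect s t x y c d). h z) :: real"
  have W: "?I a m (\<lambda>z. f z * (a + b - 2 * s z)) + ?I m b (\<lambda>z. f z * (a + b - 2 * s z))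
     = - ?I a m (\<lambda>z. g z * ((s z - a) * (b - s z))) - ?I m b (\<lambda>z. g z * ((s z - a) * (b - s z)))"
    using bubble[of a b] am integral_crect_split[of a m b c d "\<lambda>z. f z * (a + b - 2 * s z)"]
      integral_crect_split[of a m b c d "\<lambda>z. g z * ((s z - a) * (b - s z))"] fq by simp
  \<comment> \<open>On the left part (s - a)(b - s) exceeds the bubble of that part by (b - m)(s -
    a), on the right part by (m - a)(b - s). Subtracting the identities for the partial bubbles
    leaves this hat function, whose slopes are b - m and -(m - a).\<close>
  have 1: "?I a m (\<lambda>z. f z * (a + b - 2 * s z)) = ?I a m (\<lambda>z. f z * (a + m - 2 * s z)) + (b - m) * ?I a m f"
  proof -
    have "?I a m (\<lambda>z. f z * (a + b - 2 * s z)) = ?I a m (\<lambda>z. f z * (a + m - 2 * s z) + (b - m) * f z)"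
      by (intro Bochner_Integration.integral_cong) (simp_all add: algebra_simps)
    also have "\<dots> = ?I a m (\<lambda>z. f z * (a + m - 2 * s z)) + (b - m) * ?I a m f"
      using am fq by (subst Bochner_Integration.integral_add) auto
    finally show ?thesis .
  qed
  have 2: "?I m b (\<lambda>z. f z * (a + b - 2 * s z)) = ?I m b (\<lambda>z. f z * (m + b - 2 * s z)) - (m - a) * ?I m b f"
  proof -
    have "?I m b (\<lambda>z. f z * (a + b - 2 * s z)) = ?I m b (\<lambda>z. f z * (m + b - 2 * s z) - (m - a) * f z)"
      by (intro Bochner_Integration.integral_cong) (simp_all add: algebra_simps)
    also have "\<dots> = ?I m b (\<lambda>z. f z * (m + b - 2 * s z)) - (m - a) * ?I m b f"
      using am fq by (subst Bochner_Integration.integral_diff) auto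
    finally show ?thesis .
  qed
  have 3: "?I a m (\<lambda>z. g z * ((s z - a) * (b - s z))) = ?I a m (\<lambda>z. g z * ((s z - a) * (m - s z))) + (b - m) * ?I a m (\<lambda>z. g z * (s z - a))"
  proof -
    have "?I a m (\<lambda>z. g z * ((s z - a) * (b - s z))) = ?I a m (\<lambda>z. g z * ((s z - a) * (m - s z)) + (b - m) * (g z * (s z - a)))"
      by (intro Bochner_Integration.integral_cong) (simp_all add: algebra_simps)
    also have "\<dots> = ?I a m (\<lambda>z. g z * ((s z - a) * (m - s z))) + (b - m) * ?I a m (\<lambda>z. g z * (s z - a))"
      using am fq by (subst Bochner_Integration.integral_add) auto
    finally show ?thesis .
  qed
  have 4: "?I m b (\<lambda>z. g z * ((s z - a) * (b - s z))) = ?I m b (\<lambda>z. g z * ((s z - m) * (b - s z))) + (m - a) * ?I m b (\<lambda>z. g z * (b - s z))"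
  proof -
    have "?I m b (\<lambda>z. g z * ((s z - a) * (b - s z))) = ?I m b (\<lambda>z. g z * ((s z - m) * (b - s z)) + (m - a) * (g z * (b - s z)))"
      by (intro Bochner_Integration.integral_cong) (simp_all add: algebra_simps)
    also have "\<dots> = ?I m b (\<lambda>z. g z * ((s z - m) * (b - s z))) + (m - a) * ?I m b (\<lambda>z. g z * (b - s z))"
      using am fq by (subst Bochner_Integration.integral_add) auto
    finally show ?thesis .
  qed
  show ?thesis using W bubble[of a m] bubble[of m b] am unfolding 1 2 3 4 by (simp add: algebra_simps)
qed

end

section \<open>The Poincare inequality on a rectangle\<close>

text \<open>The squared deviation from the mean, integrated but not divided by the measure; in this
  normalisation the values on the pieces of a partition can be compared with the value on the whole
  by plain addition.\<close>

definition var :: "plane set \<Rightarrow> (plane \<Rightarrow> real) \<Rightarrow> real" where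
  "var S f = (LINT z|lebesgue_on S. (f z)\<^sup>2) - (LINT z|lebesgue_on S. f z)\<^sup>2 / measure lebesgue S"

lemma integral_sq_diff_const:
  fixes f :: "plane \<Rightarrow> real"
  assumes S: "S \<in> lmeasurable" and f: "f \<in> L2_space S"
  shows "(LINT z|lebesgue_on S. (f z - k)\<^sup>2) = (LINT z|lebesgue_on S. (f z)\<^sup>2) - 2 * k * (LINT z|lebesgue_on S. f z) + k\<^sup>2 * measure lebesgue S"
proof -
  interpret finite_measure "lebesgue_on S" by (rule finite_measure_lebesgue_on[OF S])
  have i: "integrable (lebesgue_on S) (\<lambda>z. (f z)\<^sup>2)" "integrable (lebesgue_on S) f"
    using L2_integrable_sq[OF f] L2_integrable[OF f finite_measure_lebesgue_on[OF S]] by simp_all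
  have "(LINT z|lebesgue_on S. (f z - k)\<^sup>2) = (LINT z|lebesgue_on S. (f z)\<^sup>2 - (2 * k) * f z + k\<^sup>2)"
    by (intro Bochner_Integration.integral_cong) (simp_all add: power2_eq_square algebra_simps)
  also have "\<dots> = (LINT z|lebesgue_on S. (f z)\<^sup>2) - 2 * k * (LINT z|lebesgue_on S. f z) + k\<^sup>2 * measure lebesgue S"
    using i S by (simp add: measure_restrict_space fmeasurableD)
  finally show ?thesis .
qed

lemma var_le:
  assumes S: "S \<in> lmeasurable" and f: "f \<in> L2_space S" and pos: "measure lebesgue S > 0"
  shows "var S f \<le> (LINT z|lebesgue_on S. (f z - k)\<^sup>2)"
proof -
  let ?I = "LINT z|lebesgue_on S. f z" and ?m = "measure lebesgue S"
  have "(LINT z|lebesgue_on S. (f z - k)\<^sup>2) - var S f = (?I - k * ?m)\<^sup>2 / ?m"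
    unfolding integral_sq_diff_const[OF S f] var_def using pos by (simp add: field_simps power2_eq_square)
  also have "\<dots> \<ge> 0" using pos by simp
  finally show ?thesis by simp
qed

lemma var_eq_mean:
  assumes S: "S \<in> lmeasurable" and f: "f \<in> L2_space S" and pos: "measure lebesgue S > 0"
  shows "(LINT z|lebesgue_on S. (f z - (LINT z|lebesgue_on S. f z) / measure lebesgue S)\<^sup>2) = var S f"
  unfolding integral_sq_diff_const[OF S f] var_def using pos by (simp add: field_simps power2_eq_square)

lemma integral_abs_sq_le:
  fixes g :: "plane \<Rightarrow> real"
  assumes S: "S \<in> lmeasurable" and g: "g \<in> L2_space S"
  shows "(LINT z|lebesgue_on S. \<bar>g z\<bar>)\<^sup>2 \<le> measure lebesgue S * (LINT z|lebesgue_on S. (g z)\<^sup>2)"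
proof -
  interpret finite_measure "lebesgue_on S" by (rule finite_measure_lebesgue_on[OF S])
  have 1: "(\<lambda>_. 1::real) \<in> L2_space S" by (simp add: L2_space_def)
  have "(\<lambda>z. \<bar>g z\<bar>) \<in> borel_measurable (lebesgue_on S)" using L2_measurable[OF g] by measurable
  then have a: "(\<lambda>z. \<bar>g z\<bar>) \<in> L2_space S" using g by (simp add: L2_space_def)
  have "\<bar>L2_inner S (\<lambda>z. \<bar>g z\<bar>) (\<lambda>_. 1)\<bar> \<le> L2_norm S (\<lambda>z. \<bar>g z\<bar>) * L2_norm S (\<lambda>_. 1::real)"
    by (rule L2_Cauchy_Schwarz[OF a 1])
  then have "\<bar>L2_inner S (\<lambda>z. \<bar>g z\<bar>) (\<lambda>_. 1)\<bar>\<^sup>2 \<le> (L2_norm S (\<lambda>z. \<bar>g z\<bar>) * L2_norm S (\<lambda>_. 1::real))\<^sup>2"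
    by (rule power_mono) simp
  then show ?thesis using S
    by (simp add: power_mult_distrib L2_norm_power2 L2_inner_self measure_restrict_space fmeasurableD)
       (simp add: L2_inner_def mult.commute measure_restrict_space fmeasurableD)
qed

lemma abs_integral_le:
  fixes f g :: "'a \<Rightarrow> real"
  assumes "integrable M f" "integrable M g" "\<And>x. x \<in> space M \<Longrightarrow> \<bar>f x\<bar> \<le> g x"
  shows "\<bar>integral\<^sup>L M f\<bar> \<le> integral\<^sup>L M g"
proof -
  have "\<bar>integral\<^sup>L M f\<bar> \<le> (LINT x|M. \<bar>f x\<bar>)" by (rule integral_abs_bound)
  also have "\<dots> \<le> integral\<^sup>L M g" using assms by (intro integral_mono) auto
  finally show ?thesis .
qed

lemma tensor_test_mono: "tensor_test s t U p q \<Longrightarrow> U \<subseteq> V \<Longrightarrow> tensor_test s t V p q"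
  unfolding tensor_test_def by blast

text \<open>Unfolded, this is a sum over 4^n congruent subrectangles; the recursive form turns
  statements about it into inductions on the depth n.\<close>

fun bisect_sum :: "(plane \<Rightarrow> real) \<Rightarrow> (plane \<Rightarrow> real) \<Rightarrow> (plane set \<Rightarrow> real) \<Rightarrow> nat \<Rightarrow> real \<Rightarrow> real \<Rightarrow> real \<Rightarrow> real \<Rightarrow> real" where
  "bisect_sum s t V 0 a b c d = V (crect s t a b c d)"
| "bisect_sum s t V (Suc n) a b c d =
     bisect_sum s t V n a ((a + b) / 2) c ((c + d) / 2) + bisect_sum s t V n ((a + b) / 2) b c ((c + d) / 2) +
     bisect_sum s t V n a ((a + b) / 2) ((c + d) / 2) d + bisect_sum s t V n ((a + b) / 2) b ((c + d) / 2) d"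

context coords
begin

lemma integrable_crect_mono:
  assumes "integrable (lebesgue_on (crect s t a b c d)) (f :: plane \<Rightarrow> real)" "a \<le> a'" "b' \<le> b" "c \<le> c'" "d' \<le> d"
  shows "integrable (lebesgue_on (crect s t a' b' c' d')) f"
proof (rule integrable_lebesgue_on_mono[OF _ _ _ assms(1)])
  have "crect s t a' b' c' d' - crect s t a b c d = {}" using assms by (auto simp: crect_def)
  then show "negligible (crect s t a' b' c' d' - crect s t a b c d)" by simp
qed simp_all

lemma integral_crect_split_t:
  assumes "c \<le> m" "m \<le> d" and f: "integrable (lebesgue_on (crect s t a b c d)) (f :: plane \<Rightarrow> real)"
  shows "(LINT z|lebesgue_on (crect s t a b c d). f z)
    = (LINT z|lebesgue_on (crect s t a b c m). f z) + (LINT z|lebesgue_on (crect s t a b m d). f z)"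
proof -
  interpret sw: coords t s by (rule coords_swap)
  show ?thesis using sw.integral_crect_split[OF assms(1,2), of a b f] f by (simp add: crect_swap)
qed

lemma integral_crect_quad:
  fixes f :: "plane \<Rightarrow> real"
  assumes "a \<le> m" "m \<le> b" "c \<le> l" "l \<le> d" and f: "integrable (lebesgue_on (crect s t a b c d)) f"
  shows "(LINT z|lebesgue_on (crect s t a b c d). f z)
    = (LINT z|lebesgue_on (crect s t a m c l). f z) + (LINT z|lebesgue_on (crect s t m b c l). f z)
    + (LINT z|lebesgue_on (crect s t a m l d). f z) + (LINT z|lebesgue_on (crect s t m b l d). f z)"
  using integral_crect_split_t[OF assms(3,4) f]
    integral_crect_split[OF assms(1,2) integrable_crect_mono[OF f, of a b c l]]
    integral_crect_split[OF assms(1,2) integrable_crect_mono[OF f, of a b l d]] assms by simp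

text \<open>Splitting lowers the variance by (I1 - I2)^2 / ((b - a)(d - c)), with I1 and I2 the
  integrals over the halves. \<open>flux_continuity\<close> bounds I1 - I2 by half the width times
  the integral of |g|, and the area from the Cauchy-Schwarz inequality cancels the
  denominator.\<close>

lemma var_bisect:
  assumes ab: "a < b" "c < d"
    and wp: "weak_partial s t (orect s t a b c d) f g"
    and f: "f \<in> L2_space (crect s t a b c d)" and g: "g \<in> L2_space (crect s t a b c d)"
  shows "var (crect s t a b c d) f \<le> var (crect s t a ((a + b) / 2) c d) f + var (crect s t ((a + b) / 2) b c d) f
     + (b - a)\<^sup>2 / 4 * (LINT z|lebesgue_on (crect s t a b c d). (g z)\<^sup>2)"
proof -
  define m where "m = (a + b) / 2"
  have m: "a < m" "m < b" "b - m = (b - a) / 2" "m - a = (b - a) / 2" using ab by (auto simp: m_def field_simps)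
  let ?I = "\<lambda>x y h. (LINT z|lebesgue_on (crect s t x y c d). h z) :: real"
  define I1 I2 G where "I1 = ?I a m f" and "I2 = ?I m b f" and "G = ?I a b (\<lambda>z. (g z)\<^sup>2)"
  have fi: "integrable (lebesgue_on (crect s t a b c d)) f" and gi: "integrable (lebesgue_on (crect s t a b c d)) g"
    and fsq: "integrable (lebesgue_on (crect s t a b c d)) (\<lambda>z. (f z)\<^sup>2)"
    using f g finite_measure_crect L2_integrable L2_integrable_sq[OF f] by auto
  have gi': "integrable (lebesgue_on (crect s t x y c d)) (\<lambda>z. \<bar>g z\<bar>)" if "a \<le> x" "y \<le> b" for x y
    using integrable_crect_mono[OF gi that, of c d] by simp
  \<comment> \<open>At the midpoint the weights b - m and m - a agree and cancel.\<close>
  have flux: "I1 + ?I a m (\<lambda>z. g z * (s z - a)) = I2 - ?I m b (\<lambda>z. g z * (b - s z))"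
    using flux_continuity[OF m(1,2) wp f g] ab unfolding m(3,4) I1_def I2_def by simp
  have b1: "\<bar>?I a m (\<lambda>z. g z * (s z - a))\<bar> \<le> (b - a) / 2 * ?I a m (\<lambda>z. \<bar>g z\<bar>)"
  proof -
    have "\<bar>?I a m (\<lambda>z. g z * (s z - a))\<bar> \<le> ?I a m (\<lambda>z. (b - a) / 2 * \<bar>g z\<bar>)"
    proof (rule abs_integral_le)
      show "\<bar>g z * (s z - a)\<bar> \<le> (b - a) / 2 * \<bar>g z\<bar>" if "z \<in> space (lebesgue_on (crect s t a m c d))" for z
      proof -
        have "\<bar>s z - a\<bar> \<le> (b - a) / 2" using that m(4) by (auto simp: crect_def)
        from mult_right_mono[OF this, of "\<bar>g z\<bar>"] show ?thesis by (simp add: abs_mult mult_ac)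
      qed
      show "integrable (lebesgue_on (crect s t a m c d)) (\<lambda>z. g z * (s z - a))"
      proof -
        have "(\<lambda>z. g z * (s z - a)) \<in> L2_space (crect s t a m c d)"
          using L2_mult_smooth[OF L2_crect_mono[OF g], of a m c d "\<lambda>r. r - a"] m by simp
        then show ?thesis using finite_measure_crect L2_integrable by blast
      qed
    qed (use gi' m in auto)
    then show ?thesis by simp
  qed
  have b2: "\<bar>?I m b (\<lambda>z. g z * (b - s z))\<bar> \<le> (b - a) / 2 * ?I m b (\<lambda>z. \<bar>g z\<bar>)"
  proof -
    have "\<bar>?I m b (\<lambda>z. g z * (b - s z))\<bar> \<le> ?I m b (\<lambda>z. (b - a) / 2 * \<bar>g z\<bar>)"
    proof (rule abs_integral_le)
      show "\<bar>g z * (b - s z)\<bar> \<le> (b - a) / 2 * \<bar>g z\<bar>" if "z \<in> space (lebesgue_on (crect s t m b c d))" for z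
      proof -
        have "\<bar>b - s z\<bar> \<le> (b - a) / 2" using that m(3) by (auto simp: crect_def)
        from mult_right_mono[OF this, of "\<bar>g z\<bar>"] show ?thesis by (simp add: abs_mult mult_ac)
      qed
      show "integrable (lebesgue_on (crect s t m b c d)) (\<lambda>z. g z * (b - s z))"
      proof -
        have "(\<lambda>z. g z * (b - s z)) \<in> L2_space (crect s t m b c d)"
          using L2_mult_smooth[OF L2_crect_mono[OF g], of m b c d "\<lambda>r. b - r"] m by simp
        then show ?thesis using finite_measure_crect L2_integrable by blast
      qed
    qed (use gi' m in auto)
    then show ?thesis by simp
  qed
  have "?I a b (\<lambda>z. \<bar>g z\<bar>) = ?I a m (\<lambda>z. \<bar>g z\<bar>) + ?I m b (\<lambda>z. \<bar>g z\<bar>)"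
    using m gi by (intro integral_crect_split) auto
  then have "\<bar>I1 - I2\<bar> \<le> (b - a) / 2 * ?I a b (\<lambda>z. \<bar>g z\<bar>)"
    using flux b1 b2 by (simp add: distrib_left)
  then have "\<bar>I1 - I2\<bar>\<^sup>2 \<le> ((b - a) / 2 * ?I a b (\<lambda>z. \<bar>g z\<bar>))\<^sup>2" by (rule power_mono) simp
  also have "\<dots> = ((b - a) / 2)\<^sup>2 * (?I a b (\<lambda>z. \<bar>g z\<bar>))\<^sup>2" by (rule power_mult_distrib)
  also have "\<dots> \<le> ((b - a) / 2)\<^sup>2 * (((b - a) * (d - c)) * G)"
    using integral_abs_sq_le[OF crect_lmeasurable g] ab by (intro mult_left_mono) (auto simp: measure_crect G_def)
  finally have key: "(I1 - I2)\<^sup>2 / ((b - a) * (d - c)) \<le> (b - a)\<^sup>2 / 4 * G"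
    using ab by (simp add: divide_le_eq power_divide mult_ac)
  have s1: "?I a b f = I1 + I2" unfolding I1_def I2_def using m fi by (intro integral_crect_split) auto
  have s2: "?I a b (\<lambda>z. (f z)\<^sup>2) = ?I a m (\<lambda>z. (f z)\<^sup>2) + ?I m b (\<lambda>z. (f z)\<^sup>2)" using m fsq by (intro integral_crect_split) auto
  have "I1\<^sup>2 / ((b - a) / 2 * (d - c)) + I2\<^sup>2 / ((b - a) / 2 * (d - c)) - (I1 + I2)\<^sup>2 / ((b - a) * (d - c))
      = (I1 - I2)\<^sup>2 / ((b - a) * (d - c))"
  proof -
    define w where "w = (b - a) * (d - c)"
    have w: "w > 0" "(b - a) / 2 * (d - c) = w / 2" using ab by (simp_all add: w_def)
    show ?thesis unfolding w(2) w_def[symmetric] using w(1) by (simp add: field_simps power2_eq_square)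
  qed
  moreover have "measure lebesgue (crect s t a b c d) = (b - a) * (d - c)"
    "measure lebesgue (crect s t a m c d) = (b - a) / 2 * (d - c)"
    "measure lebesgue (crect s t m b c d) = (b - a) / 2 * (d - c)"
    using m ab by (simp_all add: measure_crect)
  ultimately show ?thesis using key
    unfolding var_def m_def[symmetric] G_def[symmetric] s1 s2 I1_def[symmetric] I2_def[symmetric]
    by (simp only:)
qed

lemma orect_swap: "orect s t a b c d = orect t s c d a b"
  by (auto simp: orect_def)

lemma var_quad:
  assumes ab: "a < b" "c < d"
    and wp: "weak_partial s t (orect s t a b c d) f g" "weak_partial t s (orect s t a b c d) f h"
    and f: "f \<in> L2_space (crect s t a b c d)" and g: "g \<in> L2_space (crect s t a b c d)" and h: "h \<in> L2_space (crect s t a b c d)"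
  shows "var (crect s t a b c d) f \<le>
     var (crect s t a ((a + b) / 2) c ((c + d) / 2)) f + var (crect s t ((a + b) / 2) b c ((c + d) / 2)) f +
     var (crect s t a ((a + b) / 2) ((c + d) / 2) d) f + var (crect s t ((a + b) / 2) b ((c + d) / 2) d) f
     + ((b - a)\<^sup>2 * (LINT z|lebesgue_on (crect s t a b c d). (g z)\<^sup>2)
      + (d - c)\<^sup>2 * (LINT z|lebesgue_on (crect s t a b c d). (h z)\<^sup>2)) / 4"
proof -
  interpret sw: coords t s by (rule coords_swap)
  define m where "m = (a + b) / 2"
  have m: "a < m" "m < b" using ab by (auto simp: m_def)
  have *: "var (crect s t x y c d) f \<le> var (crect s t x y c ((c + d) / 2)) f + var (crect s t x y ((c + d) / 2) d) f
     + (d - c)\<^sup>2 / 4 * (LINT z|lebesgue_on (crect s t x y c d). (h z)\<^sup>2)" if "x < y" "a \<le> x" "y \<le> b" for x y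
  proof -
    have "weak_partial t s (orect t s c d x y) f h"
      by (rule sw.weak_partial_orect_mono[where a=c and b=d and c=a and d=b]) (use wp(2) that orect_swap in auto)
    then show ?thesis
      using sw.var_bisect[OF ab(2) that(1), of f h] L2_crect_mono[OF f that(2,3), of c d] L2_crect_mono[OF h that(2,3), of c d]
      by (simp add: crect_swap)
  qed
  have "(LINT z|lebesgue_on (crect s t a b c d). (h z)\<^sup>2) = (LINT z|lebesgue_on (crect s t a m c d). (h z)\<^sup>2) + (LINT z|lebesgue_on (crect s t m b c d). (h z)\<^sup>2)"
    using m L2_integrable_sq[OF h] by (intro integral_crect_split) auto
  then show ?thesis using var_bisect[OF ab wp(1) f g] *[of a m] *[of m b] m
    unfolding m_def[symmetric] by (simp add: field_simps)
qed

text \<open>One bisection in both directions costs a quarter of the weighted integrals, and the next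
  level works with halved sides. The constant is the geometric series 1/4 + 1/16 + ... =
  1/3.\<close>

lemma var_le_bisect_sum:
  assumes ab: "a < b" "c < d"
    and wp: "weak_partial s t (orect s t a b c d) f g" "weak_partial t s (orect s t a b c d) f h"
    and f: "f \<in> L2_space (crect s t a b c d)" and g: "g \<in> L2_space (crect s t a b c d)" and h: "h \<in> L2_space (crect s t a b c d)"
  shows "var (crect s t a b c d) f \<le> bisect_sum s t (\<lambda>S. var S f) n a b c d
     + ((b - a)\<^sup>2 * (LINT z|lebesgue_on (crect s t a b c d). (g z)\<^sup>2)
      + (d - c)\<^sup>2 * (LINT z|lebesgue_on (crect s t a b c d). (h z)\<^sup>2)) / 3"
  using assms
proof (induction n arbitrary: a b c d)
  case 0
  then show ?case by simp
next
  case (Suc n)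
  interpret sw: coords t s by (rule coords_swap)
  define m l where "m = (a + b) / 2" and "l = (c + d) / 2"
  have m: "a < m" "m < b" "c < l" "l < d" "m - a = (b - a) / 2" "b - m = (b - a) / 2" "l - c = (d - c) / 2" "d - l = (d - c) / 2"
    using Suc.prems(1,2) by (auto simp: m_def l_def field_simps)
  let ?I = "\<lambda>x y u v k. (LINT z|lebesgue_on (crect s t x y u v). (k z)\<^sup>2) :: real"
  have IH: "var (crect s t x y u v) f \<le> bisect_sum s t (\<lambda>S. var S f) n x y u v
     + ((b - a)\<^sup>2 * ?I x y u v g + (d - c)\<^sup>2 * ?I x y u v h) / 12"
    if "x < y" "u < v" "a \<le> x" "y \<le> b" "c \<le> u" "v \<le> d" "y - x = (b - a) / 2" "v - u = (d - c) / 2" for x y u v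
  proof -
    have "weak_partial t s (orect s t x y u v) f h"
      using sw.weak_partial_orect_mono[of c d a b f h u v x y] Suc.prems(4) that orect_swap by simp
    then show ?thesis
      using Suc.IH[OF that(1,2) weak_partial_orect_mono[OF Suc.prems(3) that(3-6)] _ L2_crect_mono[OF Suc.prems(5) that(3-6)]
        L2_crect_mono[OF Suc.prems(6) that(3-6)] L2_crect_mono[OF Suc.prems(7) that(3-6)]]
      unfolding that(7,8) by (simp add: power_divide field_simps)
  qed
  have split: "?I a b c d k = ?I a m c l k + ?I m b c l k + ?I a m l d k + ?I m b l d k" if "k = g \<or> k = h" for k
    using m L2_integrable_sq[OF Suc.prems(6)] L2_integrable_sq[OF Suc.prems(7)] that by (intro integral_crect_quad) auto
  show ?case
    using var_quad[OF Suc.prems] IH[of a m c l] IH[of m b c l] IH[of a m l d] IH[of m b l d] m split[of g] split[of h]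
    unfolding m_def[symmetric] l_def[symmetric] bisect_sum.simps by (simp add: field_simps)
qed

text \<open>The mean is the best constant, so on each of the smallest rectangles the variance is at
  most the squared distance of f to the value of \<open>\<phi>\<close> at one point; there
  \<open>\<phi>\<close> oscillates by at most \<open>\<eta>\<close>.\<close>

lemma bisect_sum_var_le:
  assumes "a < b" "c < d" and f: "f \<in> L2_space (crect s t a b c d)"
    and \<phi>: "\<phi> \<in> L2_space (crect s t a b c d)" and \<eta>: "\<eta> \<ge> 0"
    and osc: "\<And>p q. p \<in> crect s t a b c d \<Longrightarrow> q \<in> crect s t a b c d \<Longrightarrow> \<bar>s p - s q\<bar> \<le> \<delta> \<Longrightarrow> \<bar>t p - t q\<bar> \<le> \<delta> \<Longrightarrow> \<bar>\<phi> p - \<phi> q\<bar> \<le> \<eta>"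
    and small: "b - a \<le> \<delta> * 2 ^ n" "d - c \<le> \<delta> * 2 ^ n"
  shows "bisect_sum s t (\<lambda>S. var S f) n a b c d
    \<le> 2 * (LINT z|lebesgue_on (crect s t a b c d). (f z - \<phi> z)\<^sup>2) + 2 * \<eta>\<^sup>2 * ((b - a) * (d - c))"
  using assms
proof (induction n arbitrary: a b c d)
  case 0
  let ?S = "crect s t a b c d"
  have sq: "integrable (lebesgue_on ?S) (\<lambda>z. (k z)\<^sup>2)" if "k \<in> L2_space ?S" for k :: "plane \<Rightarrow> real"
    using L2_integrable_sq[OF that] by simp
  interpret finite_measure "lebesgue_on ?S" by (rule finite_measure_crect)
  obtain z0 where z0: "z0 \<in> ?S"
    using 0 coords by (auto simp: crect_def intro: that[of "(a, c)"] that[of "(c, a)"])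
  have c1: "(\<lambda>_. \<phi> z0) \<in> L2_space ?S" by (simp add: L2_space_def)
  have "var ?S f \<le> (LINT z|lebesgue_on ?S. (f z - \<phi> z0)\<^sup>2)"
    using 0 by (intro var_le) (auto simp: measure_crect)
  also have "\<dots> \<le> (LINT z|lebesgue_on ?S. 2 * (f z - \<phi> z)\<^sup>2 + 2 * \<eta>\<^sup>2)"
  proof (rule integral_mono)
    show "integrable (lebesgue_on ?S) (\<lambda>z. (f z - \<phi> z0)\<^sup>2)" by (intro sq L2_diff 0 c1)
    show "integrable (lebesgue_on ?S) (\<lambda>z. 2 * (f z - \<phi> z)\<^sup>2 + 2 * \<eta>\<^sup>2)"
      using sq[OF L2_diff[OF 0(3,4)]] by simp
    fix z assume "z \<in> space (lebesgue_on ?S)"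
    then have z: "z \<in> ?S" by simp
    have "\<bar>s z - s z0\<bar> \<le> \<delta>" "\<bar>t z - t z0\<bar> \<le> \<delta>" using z z0 0(7,8) by (auto simp: crect_def)
    then have "\<bar>\<phi> z - \<phi> z0\<bar> \<le> \<bar>\<eta>\<bar>" using 0(6)[OF z z0] 0(5) by simp
    then have "(\<phi> z - \<phi> z0)\<^sup>2 \<le> \<eta>\<^sup>2" by (simp add: abs_le_square_iff)
    moreover have "(x - k)\<^sup>2 \<le> 2 * (x - y)\<^sup>2 + 2 * (y - k)\<^sup>2" for x y k :: real
      using zero_le_power2[of "(x - y) - (y - k)"] by (simp add: power2_eq_square algebra_simps)
    ultimately show "(f z - \<phi> z0)\<^sup>2 \<le> 2 * (f z - \<phi> z)\<^sup>2 + 2 * \<eta>\<^sup>2" by (smt (verit))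
  qed
  also have "\<dots> = 2 * (LINT z|lebesgue_on ?S. (f z - \<phi> z)\<^sup>2) + 2 * \<eta>\<^sup>2 * ((b - a) * (d - c))"
    using sq[OF L2_diff[OF 0(3,4)]] 0(1,2) by (simp add: measure_restrict_space measure_crect)
  finally show ?case by simp
next
  case (Suc n)
  define m l where "m = (a + b) / 2" and "l = (c + d) / 2"
  have m: "a < m" "m < b" "c < l" "l < d" "m - a = (b - a) / 2" "b - m = (b - a) / 2" "l - c = (d - c) / 2" "d - l = (d - c) / 2"
    using Suc.prems(1,2) by (auto simp: m_def l_def field_simps)
  let ?I = "\<lambda>x y u v. (LINT z|lebesgue_on (crect s t x y u v). (f z - \<phi> z)\<^sup>2) :: real"
  have IH: "bisect_sum s t (\<lambda>S. var S f) n x y u v \<le> 2 * ?I x y u v + \<eta>\<^sup>2 * ((b - a) * (d - c)) / 2"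
    if "x < y" "u < v" "a \<le> x" "y \<le> b" "c \<le> u" "v \<le> d" "y - x = (b - a) / 2" "v - u = (d - c) / 2" for x y u v
  proof -
    have "crect s t x y u v \<subseteq> crect s t a b c d" using that by (auto simp: crect_def)
    then have "\<bar>\<phi> p - \<phi> q\<bar> \<le> \<eta>" if "p \<in> crect s t x y u v" "q \<in> crect s t x y u v" "\<bar>s p - s q\<bar> \<le> \<delta>" "\<bar>t p - t q\<bar> \<le> \<delta>" for p q
      using Suc.prems(6)[of p q] that by blast
    moreover have "y - x \<le> \<delta> * 2 ^ n" "v - u \<le> \<delta> * 2 ^ n" using Suc.prems(7,8) that by simp_all
    ultimately show ?thesis
      using Suc.IH[OF that(1,2) L2_crect_mono[OF Suc.prems(3) that(3-6)] L2_crect_mono[OF Suc.prems(4) that(3-6)] Suc.prems(5)]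
      unfolding that(7,8) by (simp add: field_simps)
  qed
  have split: "?I a b c d = ?I a m c l + ?I m b c l + ?I a m l d + ?I m b l d"
    using m L2_integrable_sq[OF L2_diff[OF Suc.prems(3,4)]] by (intro integral_crect_quad) auto
  show ?case
    using IH[of a m c l] IH[of m b c l] IH[of a m l d] IH[of m b l d] m split
    unfolding m_def[symmetric] l_def[symmetric] bisect_sum.simps by simp
qed

text \<open>Continuous functions are uniformly continuous on the compact rectangle, and by density
  the conclusion passes to every square-integrable f. This replaces a smoothing of f or an extension
  across the boundary in the proof of the Poincare inequality.\<close>

lemma bisect_sum_var_small:
  assumes ab: "a < b" "c < d" and f: "f \<in> L2_space (crect s t a b c d)" and e: "e > 0"
  obtains n where "bisect_sum s t (\<lambda>S. var S f) n a b c d \<le> e"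
proof -
  let ?S = "crect s t a b c d"
  obtain \<phi> where \<phi>: "continuous_on UNIV \<phi>" "\<phi> \<in> L2_space ?S" "(LINT z|lebesgue_on ?S. (f z - \<phi> z)\<^sup>2) \<le> e / 4"
    using L2_dense_continuous[OF crect_lmeasurable f, of "e / 4"] e by auto
  define w where "w = (b - a) * (d - c)"
  have w: "w > 0" using ab by (simp add: w_def)
  \<comment> \<open>Chosen such that twice its square times the area is e/2; the approximation of f
    by \<open>\<phi>\<close> takes the other half.\<close>
  define \<eta> where "\<eta> = sqrt (e / (4 * w))"
  have \<eta>: "\<eta> > 0" "\<eta>\<^sup>2 = e / (4 * w)" using e w by (simp_all add: \<eta>_def)
  have "uniformly_continuous_on ?S \<phi>"
    by (rule compact_uniformly_continuous[OF continuous_on_subset[OF \<phi>(1) subset_UNIV] crect_compact])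
  then obtain \<delta> where \<delta>: "\<delta> > 0" "\<And>p q. p \<in> ?S \<Longrightarrow> q \<in> ?S \<Longrightarrow> dist q p < \<delta> \<Longrightarrow> dist (\<phi> q) (\<phi> p) < \<eta>"
    unfolding uniformly_continuous_on_def using \<eta>(1) by meson
  \<comment> \<open>The distance in the plane is at most the sum of the two coordinate differences,
    hence at most two thirds of \<open>\<delta>\<close>.\<close>
  have osc: "\<bar>\<phi> p - \<phi> q\<bar> \<le> \<eta>" if "p \<in> ?S" "q \<in> ?S" "\<bar>s p - s q\<bar> \<le> \<delta> / 3" "\<bar>t p - t q\<bar> \<le> \<delta> / 3" for p q
  proof -
    have "dist p q \<le> \<bar>fst p - fst q\<bar> + \<bar>snd p - snd q\<bar>"
      using norm_Pair_le[of "fst p - fst q" "snd p - snd q"] by (simp add: dist_norm minus_prod_def)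
    also have "\<dots> < \<delta>" using that(3,4) coords \<delta>(1) by auto
    finally show ?thesis using \<delta>(2)[OF that(2,1)] by (simp add: dist_real_def)
  qed
  obtain n where n: "((b - a) + (d - c)) / (\<delta> / 3) < 2 ^ n"
    using real_arch_pow[of 2] by auto
  have "(b - a) + (d - c) < \<delta> / 3 * 2 ^ n" using n \<delta>(1) by (simp add: field_simps)
  then have "b - a \<le> \<delta> / 3 * 2 ^ n" "d - c \<le> \<delta> / 3 * 2 ^ n" using ab by linarith+
  from bisect_sum_var_le[OF ab f \<phi>(2) _ osc this] \<eta>(1)
  have "bisect_sum s t (\<lambda>S. var S f) n a b c d \<le> 2 * (LINT z|lebesgue_on ?S. (f z - \<phi> z)\<^sup>2) + 2 * \<eta>\<^sup>2 * w"
    by (simp add: w_def)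
  also have "2 * \<eta>\<^sup>2 * w = e / 2" using w by (simp add: \<eta>(2))
  finally show ?thesis using \<phi>(3) that[of n] by simp
qed

text \<open>\<open>var_le_bisect_sum\<close> holds for every depth n, and its remainder over the
  smallest rectangles becomes arbitrarily small.\<close>

theorem poincare:
  assumes ab: "a < b" "c < d"
    and wp: "weak_partial s t (orect s t a b c d) f g" "weak_partial t s (orect s t a b c d) f h"
    and f: "f \<in> L2_space (crect s t a b c d)" and g: "g \<in> L2_space (crect s t a b c d)" and h: "h \<in> L2_space (crect s t a b c d)"
  shows "var (crect s t a b c d) f \<le> ((b - a)\<^sup>2 * (LINT z|lebesgue_on (crect s t a b c d). (g z)\<^sup>2)
      + (d - c)\<^sup>2 * (LINT z|lebesgue_on (crect s t a b c d). (h z)\<^sup>2)) / 3"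
proof (rule field_le_epsilon)
  fix e :: real assume "e > 0"
  then obtain n where "bisect_sum s t (\<lambda>S. var S f) n a b c d \<le> e"
    using bisect_sum_var_small[OF ab f] by blast
  then show "var (crect s t a b c d) f \<le> ((b - a)\<^sup>2 * (LINT z|lebesgue_on (crect s t a b c d). (g z)\<^sup>2)
      + (d - c)\<^sup>2 * (LINT z|lebesgue_on (crect s t a b c d). (h z)\<^sup>2)) / 3 + e"
    using var_le_bisect_sum[OF assms, of n] by linarith
qed

text \<open>With all rectangle integrals zero, the variance on each subrectangle is the full
  integral of the square. The sum over a subdivision then does not depend on its depth, although it
  becomes arbitrarily small.\<close>

lemma AE_zero_if_rect_integrals_zero:
  fixes f :: "plane \<Rightarrow> real"
  assumes ab: "a < b" "c < d" and f: "f \<in> L2_space (crect s t a b c d)"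
    and z: "\<And>a' b' c' d'. a \<le> a' \<Longrightarrow> a' < b' \<Longrightarrow> b' \<le> b \<Longrightarrow> c \<le> c' \<Longrightarrow> c' < d' \<Longrightarrow> d' \<le> d \<Longrightarrow>
      (LINT z|lebesgue_on (crect s t a' b' c' d'). f z) = 0"
  shows "AE z in lebesgue_on (crect s t a b c d). f z = 0"
proof -
  have sq: "integrable (lebesgue_on (crect s t a b c d)) (\<lambda>z. (f z)\<^sup>2)" using L2_integrable_sq[OF f] by simp
  have eq: "bisect_sum s t (\<lambda>S. var S f) n a' b' c' d' = (LINT z|lebesgue_on (crect s t a' b' c' d'). (f z)\<^sup>2)"
    if "a \<le> a'" "a' < b'" "b' \<le> b" "c \<le> c'" "c' < d'" "d' \<le> d" for n a' b' c' d'
    using that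
  proof (induction n arbitrary: a' b' c' d')
    case 0
    then show ?case using z[OF 0] by (simp add: var_def)
  next
    case (Suc n)
    define m l where "m = (a' + b') / 2" and "l = (c' + d') / 2"
    have m: "a' < m" "m < b'" "c' < l" "l < d'" using Suc.prems by (auto simp: m_def l_def)
    have "(LINT z|lebesgue_on (crect s t a' b' c' d'). (f z)\<^sup>2)
     = (LINT z|lebesgue_on (crect s t a' m c' l). (f z)\<^sup>2) + (LINT z|lebesgue_on (crect s t m b' c' l). (f z)\<^sup>2)
     + (LINT z|lebesgue_on (crect s t a' m l d'). (f z)\<^sup>2) + (LINT z|lebesgue_on (crect s t m b' l d'). (f z)\<^sup>2)"
      using m integrable_crect_mono[OF sq, of a' b' c' d'] Suc.prems by (intro integral_crect_quad) auto
    then show ?case using m Suc.prems unfolding bisect_sum.simps m_def[symmetric] l_def[symmetric]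
      by (simp add: Suc.IH)
  qed
  have "(LINT z|lebesgue_on (crect s t a b c d). (f z)\<^sup>2) \<le> 0"
  proof (rule field_le_epsilon)
    fix e :: real assume "e > 0"
    then obtain n where "bisect_sum s t (\<lambda>S. var S f) n a b c d \<le> e"
      using bisect_sum_var_small[OF ab f] by blast
    then show "(LINT z|lebesgue_on (crect s t a b c d). (f z)\<^sup>2) \<le> 0 + e" using eq[of a b c d n] ab by simp
  qed
  then have "(LINT z|lebesgue_on (crect s t a b c d). (f z)\<^sup>2) = 0"
    by (intro antisym) simp_all
  then show ?thesis using integral_nonneg_eq_0_iff_AE[OF sq] by simp
qed

text \<open>The fundamental lemma of the calculus of variations for products: cutoffs of a
  subrectangle converge to its indicator almost everywhere, so the integrals over all subrectangles
  vanish.\<close>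

lemma AE_zero_if_tensor_tests_zero:
  assumes ab: "a < b" "c < d" and f: "f \<in> L2_space (crect s t a b c d)"
    and z: "\<And>p q. tensor_test s t (orect s t a b c d) p q \<Longrightarrow> (LINT z|lebesgue_on (orect s t a b c d). f z * (p (s z) * q (t z))) = 0"
  shows "AE z in lebesgue_on (crect s t a b c d). f z = 0"
proof (rule AE_zero_if_rect_integrals_zero[OF ab f])
  fix a' b' c' d' assume le: "a \<le> a'" "a' < b'" "b' \<le> b" "c \<le> c'" "c' < d'" "d' \<le> d"
  have sub: "orect s t a' b' c' d' \<subseteq> orect s t a b c d" using le by (auto simp: orect_def)
  have "(LINT z|lebesgue_on (crect s t a' b' c' d'). f z * (cutoff a' b' n (s z) * cutoff c' d' n (t z))) = 0" for n
  proof -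
    have "tensor_test s t (orect s t a b c d) (\<lambda>x. 1 * cutoff a' b' n x) (cutoff c' d' n)"
      by (rule tensor_test_mono[OF cutoff_tensor_test[OF smooth_const] sub])
    then have "(LINT z|lebesgue_on (orect s t a b c d). f z * (cutoff a' b' n (s z) * cutoff c' d' n (t z))) = 0"
      using z by force
    moreover have "(LINT z|lebesgue_on (orect s t a b c d). f z * (cutoff a' b' n (s z) * cutoff c' d' n (t z)))
      = (LINT z|lebesgue_on (orect s t a' b' c' d'). f z * (cutoff a' b' n (s z) * cutoff c' d' n (t z)))"
      by (rule integral_supported[OF orect_sets orect_sets sub]) (auto simp: orect_def cutoff_eq_0)
    ultimately show ?thesis by (simp add: integral_orect)
  qed
  then show "(LINT z|lebesgue_on (crect s t a' b' c' d'). f z) = 0"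
    using integral_cutoff_limit[OF L2_crect_mono[OF f le(1,3,4,6)]] LIMSEQ_unique[OF _ tendsto_const] by simp
qed

end

section \<open>Interpolation error on one element\<close>

context coords
begin

definition pt :: "real \<Rightarrow> real \<Rightarrow> plane" where "pt x y = (if s = fst then (x, y) else (y, x))"

lemma coord_pt [simp]: "s (pt x y) = x" "t (pt x y) = y"
proof -
  have ne: "(snd :: plane \<Rightarrow> real) \<noteq> fst" by (metis fst_conv snd_conv zero_neq_one)
  show "s (pt x y) = x" "t (pt x y) = y" using coords ne by (auto simp: pt_def)
qed

lemma integrable_crect_continuous:
  assumes "continuous_on UNIV F"
  shows "integrable (lebesgue_on (crect s t a b c d)) (F :: plane \<Rightarrow> real)"
proof -
  have "set_integrable lebesgue (crect s t a b c d) F"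
    unfolding crect_cbox by (auto intro!: absolutely_integrable_continuous continuous_on_subset[OF assms])
  then show ?thesis by (simp add: set_integrable_def integral_lebesgue_on_indicator(2))
qed

lemma integral_crect_iterated:
  fixes F :: "plane \<Rightarrow> real"
  assumes F: "continuous_on UNIV F"
  shows "(LINT z|lebesgue_on (crect s t a b c d). F z) = integral {c..d} (\<lambda>y. integral {a..b} (\<lambda>x. F (pt x y)))"
proof -
  have ne: "(snd :: plane \<Rightarrow> real) \<noteq> fst" by (metis fst_conv snd_conv zero_neq_one)
  have F': "continuous_on S F" for S using F continuous_on_subset by blast
  have "(LINT z|lebesgue_on (crect s t a b c d). F z) = integral (crect s t a b c d) F"
    by (rule lebesgue_integral_eq_integral[OF integrable_crect_continuous[OF F]]) simp
  also have "\<dots> = integral {c..d} (\<lambda>y. integral {a..b} (\<lambda>x. F (pt x y)))"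
    using coords
  proof
    assume st: "s = fst \<and> t = snd"
    have "integral (cbox (a, c) (b, d)) F = integral (cbox a b) (\<lambda>x. integral (cbox c d) (\<lambda>y. F (x, y)))"
      by (rule integral_prod_continuous[OF F'])
    also have "\<dots> = integral (cbox c d) (\<lambda>y. integral (cbox a b) (\<lambda>x. F (x, y)))"
      by (rule integral_swap_continuous) (simp add: F' case_prod_unfold)
    finally show ?thesis unfolding pt_def crect_cbox using st by simp
  next
    assume st: "s = snd \<and> t = fst"
    then show ?thesis unfolding pt_def crect_cbox using integral_prod_continuous[OF F', of c a d b] ne by simp
  qed
  finally show ?thesis .
qed

lemma integral_crect_partial:
  assumes ab: "a \<le> b" and F: "continuous_on UNIV F"
    and G: "\<And>x y. ((\<lambda>x. G (pt x y)) has_real_derivative F (pt x y)) (at x)"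
  shows "(LINT z|lebesgue_on (crect s t a b c d). F z) = integral {c..d} (\<lambda>y. G (pt b y) - G (pt a y))"
proof -
  have "integral {a..b} (\<lambda>x. F (pt x y)) = G (pt b y) - G (pt a y)" for y
  proof (rule integral_unique, rule fundamental_theorem_of_calculus[OF ab])
    show "((\<lambda>x. G (pt x y)) has_vector_derivative F (pt x y)) (at x within {a..b})" for x
      using G[of y x] has_real_derivative_iff_has_vector_derivative has_vector_derivative_at_within by blast
  qed
  then show ?thesis by (simp add: integral_crect_iterated[OF F])
qed

lemma integral_crect_deriv:
  assumes "a \<le> b" "c \<le> d" and q: "\<And>x. (q has_real_derivative p x) (at x)" and p: "continuous_on UNIV p"
  shows "(LINT z|lebesgue_on (crect s t a b c d). p (s z)) = (d - c) * (q b - q a)"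
proof -
  have "continuous_on UNIV (\<lambda>z. p (s z))"
    by (rule continuous_on_compose2[OF p continuous_coords(1)]) simp
  from integral_crect_partial[OF assms(1) this, of "\<lambda>z. q (s z)" c d] show ?thesis
    using assms by (simp add: q mult.commute)
qed

lemma L2_weight_bound:
  assumes k: "k \<in> L2_space (crect s t a b c d)" and q: "smooth q" and B: "\<And>x. x \<in> {a..b} \<Longrightarrow> \<bar>q x\<bar> \<le> B" "B \<ge> 0"
    and ab: "a < b" "c < d"
  shows "\<bar>LINT z|lebesgue_on (crect s t a b c d). k z * q (s z)\<bar> \<le> B * sqrt ((b - a) * (d - c)) * L2_norm (crect s t a b c d) k"
proof -
  let ?R = "crect s t a b c d"
  have ki: "integrable (lebesgue_on ?R) k" using k finite_measure_crect L2_integrable by blast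
  have "\<bar>LINT z|lebesgue_on ?R. k z * q (s z)\<bar> \<le> (LINT z|lebesgue_on ?R. B * \<bar>k z\<bar>)"
  proof (rule abs_integral_le)
    show "integrable (lebesgue_on ?R) (\<lambda>z. k z * q (s z))"
      using L2_mult_smooth[OF k q] finite_measure_crect L2_integrable by blast
    show "\<bar>k z * q (s z)\<bar> \<le> B * \<bar>k z\<bar>" if "z \<in> space (lebesgue_on ?R)" for z
    proof -
      have "\<bar>q (s z)\<bar> \<le> B" using that by (intro B) (simp add: crect_def)
      from mult_right_mono[OF this, of "\<bar>k z\<bar>"] show ?thesis by (simp add: abs_mult mult.commute)
    qed
  qed (use ki in simp)
  also have "\<dots> = B * (LINT z|lebesgue_on ?R. \<bar>k z\<bar>)" by simp
  also have "(LINT z|lebesgue_on ?R. \<bar>k z\<bar>) \<le> sqrt ((b - a) * (d - c)) * L2_norm ?R k"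
  proof (rule power2_le_imp_le)
    show "(LINT z|lebesgue_on ?R. \<bar>k z\<bar>)\<^sup>2 \<le> (sqrt ((b - a) * (d - c)) * L2_norm ?R k)\<^sup>2"
      using integral_abs_sq_le[OF crect_lmeasurable k] ab
      by (simp add: power_mult_distrib L2_norm_power2 L2_inner_self measure_crect)
    show "0 \<le> sqrt ((b - a) * (d - c)) * L2_norm ?R k" using ab by simp
  qed
  finally show ?thesis using B(2) by (simp add: mult_left_mono mult.assoc)
qed

end

text \<open>A function on one element together with its weak derivatives in the direction \<open>s\<close>. The
  interpolant is affine in \<open>s\<close> and has the edge means \<open>edge_lo\<close>, \<open>edge_hi\<close>, which are expressed by
  integrals over the element, so that no traces are needed.\<close>

locale element = coords +
  fixes a b c d :: real and f f1 f2 :: "plane \<Rightarrow> real"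
  assumes ab: "a < b" and cd: "c < d"
    and L2: "f \<in> L2_space (crect s t a b c d)" "f1 \<in> L2_space (crect s t a b c d)" "f2 \<in> L2_space (crect s t a b c d)"
    and wp: "weak_partial s t (orect s t a b c d) f f1" "weak_partial s t (orect s t a b c d) f1 f2"
begin

abbreviation "R \<equiv> crect s t a b c d"
abbreviation I :: "(plane \<Rightarrow> real) \<Rightarrow> real" where "I k \<equiv> LINT z|lebesgue_on R. k z"
definition "h = b - a"
definition "w = (b - a) * (d - c)"
definition "mid = (a + b) / 2"

definition "edge_lo = (I f - I (\<lambda>z. f1 z * (b - s z))) / w"
definition "edge_hi = (I f + I (\<lambda>z. f1 z * (s z - a))) / w"
definition "slope = I f1 / w"
text \<open>The mean of the two edge values, not the mean of f over the element. The correction by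
  the first moment of \<open>f1\<close> arises when the value at an edge is written as the value at
  s plus the integral of \<open>f1\<close> from s to the edge, and this is averaged over s.\<close>

definition "avg = (I f + I (\<lambda>z. f1 z * (s z - mid))) / w"
definition "interp z = avg + slope * (s z - mid)"
definition "resid z = f z - interp z"

lemma hw: "h > 0" "w > 0" "w = h * (d - c)" "measure lebesgue R = w"
  using ab cd by (simp_all add: h_def w_def measure_crect)

lemma mult_smooth_integrable:
  assumes "k \<in> L2_space R" "smooth q"
  shows "integrable (lebesgue_on R) (\<lambda>z. k z * q (s z))"
  using L2_mult_smooth[OF assms] finite_measure_crect L2_integrable by blast

lemma L2_integrable': "k \<in> L2_space R \<Longrightarrow> integrable (lebesgue_on R) (k :: plane \<Rightarrow> real)"
  by (rule L2_integrable[OF _ finite_measure_crect])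

lemma one_L2: "(\<lambda>_. k :: real) \<in> L2_space R"
proof -
  interpret finite_measure "lebesgue_on R" by (rule finite_measure_crect)
  show ?thesis by (simp add: L2_space_def)
qed

lemma smooth_L2: "smooth q \<Longrightarrow> (\<lambda>z. q (s z)) \<in> L2_space R"
  using L2_mult_smooth[OF one_L2, of q 1] by simp

lemma edges_interp: "edge_lo = avg - slope * h / 2" "edge_hi = avg + slope * h / 2"
proof -
  have i: "integrable (lebesgue_on R) f1" "integrable (lebesgue_on R) (\<lambda>z. f1 z * (s z - mid))"
    using L2 L2_integrable' mult_smooth_integrable[of f1 "\<lambda>x. x - mid"] by simp_all
  have "I (\<lambda>z. f1 z * (b - s z)) = I (\<lambda>z. h / 2 * f1 z - f1 z * (s z - mid))"
    by (intro Bochner_Integration.integral_cong) (simp_all add: h_def mid_def field_simps)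
  also have "\<dots> = h / 2 * I f1 - I (\<lambda>z. f1 z * (s z - mid))" using i by simp
  finally have e: "I (\<lambda>z. f1 z * (b - s z)) = h / 2 * I f1 - I (\<lambda>z. f1 z * (s z - mid))" .
  show "edge_lo = avg - slope * h / 2"
    unfolding edge_lo_def avg_def slope_def e by (simp add: add_divide_distrib diff_divide_distrib mult.commute)
  have "I (\<lambda>z. f1 z * (s z - a)) = I (\<lambda>z. f1 z * (s z - mid) + h / 2 * f1 z)"
    by (intro Bochner_Integration.integral_cong) (simp_all add: h_def mid_def field_simps)
  also have "\<dots> = I (\<lambda>z. f1 z * (s z - mid)) + h / 2 * I f1" using i by simp
  finally have e: "I (\<lambda>z. f1 z * (s z - a)) = I (\<lambda>z. f1 z * (s z - mid)) + h / 2 * I f1" .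
  show "edge_hi = avg + slope * h / 2"
    unfolding edge_hi_def avg_def slope_def e by (simp add: add_divide_distrib mult.commute)
qed

lemma interp_edges: "interp z = edge_lo + (edge_hi - edge_lo) / h * (s z - a)"
  unfolding edges_interp interp_def using hw(1) by (simp add: h_def mid_def field_simps)

lemma interp_L2: "interp \<in> L2_space R" "resid \<in> L2_space R"
proof -
  show "interp \<in> L2_space R" using smooth_L2[of "\<lambda>x. avg + slope * (x - mid)"] by (simp add: interp_def[abs_def])
  then show "resid \<in> L2_space R" unfolding resid_def[abs_def] using L2(1) by (rule L2_diff[rotated])
qed

text \<open>\<open>E\<close> and \<open>F\<close> are the Peano kernels of the trapezoidal rule: \<open>E' = s - mid\<close>, \<open>F'' = E + h\<^sup>2/12\<close>,
  and \<open>E\<close>, \<open>F\<close>, \<open>F'\<close> vanish at both ends.\<close>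

definition "E x = ((x - mid)\<^sup>2 - h\<^sup>2 / 4) / 2"
definition "F x = ((x - mid)\<^sup>2 - h\<^sup>2 / 4)\<^sup>2 / 24"
definition "Fd x = ((x - mid)\<^sup>2 - h\<^sup>2 / 4) * (x - mid) / 6"

lemma kernels_smooth: "smooth E" "smooth F" "smooth Fd" "smooth (\<lambda>x. x - mid)"
  by (simp_all add: E_def[abs_def] F_def[abs_def] Fd_def[abs_def])

lemma kernels_deriv: "deriv E x = x - mid" "deriv F x = Fd x" "deriv Fd x = E x + h\<^sup>2 / 12"
proof -
  show "deriv E x = x - mid" unfolding E_def[abs_def]
    by (rule DERIV_imp_deriv) (auto intro!: derivative_eq_intros)
  show "deriv F x = Fd x" unfolding F_def[abs_def] Fd_def
    by (rule DERIV_imp_deriv) (auto intro!: derivative_eq_intros)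
  show "deriv Fd x = E x + h\<^sup>2 / 12" unfolding Fd_def[abs_def] E_def
    by (rule DERIV_imp_deriv) (auto intro!: derivative_eq_intros simp: field_simps power2_eq_square)
qed

lemma ends: "(a - mid)\<^sup>2 = h\<^sup>2 / 4" "(b - mid)\<^sup>2 = h\<^sup>2 / 4"
  by (simp_all add: h_def mid_def power2_eq_square field_simps)

lemma kernels_zero: "E a = 0" "E b = 0" "F a = 0" "F b = 0" "Fd a = 0" "Fd b = 0"
  by (simp_all add: E_def F_def Fd_def ends)

lemma kernels_bound:
  assumes "x \<in> {a..b}"
  shows "\<bar>E x\<bar> \<le> h\<^sup>2 / 8" "\<bar>F x\<bar> \<le> h ^ 4 / 384" "\<bar>Fd x\<bar> \<le> h ^ 3 / 48"
proof -
  have x: "\<bar>x - mid\<bar> \<le> h / 2" using assms unfolding h_def mid_def abs_le_iff by (simp add: field_simps)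
  then have "\<bar>x - mid\<bar>\<^sup>2 \<le> (h / 2)\<^sup>2" by (rule power_mono) simp
  then have y: "\<bar>(x - mid)\<^sup>2 - h\<^sup>2 / 4\<bar> \<le> h\<^sup>2 / 4" by (simp add: power_divide)
  then show "\<bar>E x\<bar> \<le> h\<^sup>2 / 8" by (simp add: E_def)
  have "\<bar>(x - mid)\<^sup>2 - h\<^sup>2 / 4\<bar>\<^sup>2 \<le> (h\<^sup>2 / 4)\<^sup>2" using y by (rule power_mono) simp
  also have "(h\<^sup>2 / 4)\<^sup>2 = h ^ 4 / 16" by (simp add: power_divide)
  finally show "\<bar>F x\<bar> \<le> h ^ 4 / 384" by (simp add: F_def)
  have "\<bar>(x - mid)\<^sup>2 - h\<^sup>2 / 4\<bar> * \<bar>x - mid\<bar> \<le> h\<^sup>2 / 4 * (h / 2)" using y x by (intro mult_mono) auto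
  then show "\<bar>Fd x\<bar> \<le> h ^ 3 / 48" by (simp add: Fd_def abs_mult power2_eq_square power3_eq_cube mult_ac)
qed

text \<open>E has mean \<open>- h\<^sup>2 / 12\<close> over the interval. Subtracting this mean
  produces a function whose antiderivative \<open>Fd\<close> vanishes at both ends, so the third
  identity exposes the factor 1/12 of the final expansion.\<close>

lemma ibp:
  assumes "weak_partial s t (orect s t a b c d) k k'" "k \<in> L2_space R" "k' \<in> L2_space R"
  shows "I (\<lambda>z. k z * (s z - mid)) = - I (\<lambda>z. k' z * E (s z))"
    and "I (\<lambda>z. k z * Fd (s z)) = - I (\<lambda>z. k' z * F (s z))"
    and "I (\<lambda>z. k z * E (s z)) + h\<^sup>2 / 12 * I k = - I (\<lambda>z. k' z * Fd (s z))"
proof -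
  note * = weak_partial_ibp[OF ab assms]
  show "I (\<lambda>z. k z * (s z - mid)) = - I (\<lambda>z. k' z * E (s z))"
    using *[OF kernels_smooth(1)] by (simp add: kernels_deriv kernels_zero)
  show "I (\<lambda>z. k z * Fd (s z)) = - I (\<lambda>z. k' z * F (s z))"
    using *[OF kernels_smooth(2)] by (simp add: kernels_deriv kernels_zero)
  have "I (\<lambda>z. k z * (E (s z) + h\<^sup>2 / 12)) = I (\<lambda>z. k z * E (s z) + h\<^sup>2 / 12 * k z)"
    by (intro Bochner_Integration.integral_cong) (simp_all add: field_simps)
  also have "\<dots> = I (\<lambda>z. k z * E (s z)) + h\<^sup>2 / 12 * I k"
    using mult_smooth_integrable[OF assms(2) kernels_smooth(1)] L2_integrable'[OF assms(2)] by simp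
  finally show "I (\<lambda>z. k z * E (s z)) + h\<^sup>2 / 12 * I k = - I (\<lambda>z. k' z * Fd (s z))"
    using *[OF kernels_smooth(3)] by (simp add: kernels_deriv kernels_zero)
qed

lemma moments: "I (\<lambda>z. s z - mid) = 0" "I (\<lambda>z. (s z - mid)\<^sup>2) = w * h\<^sup>2 / 12" "I (\<lambda>z. 1) = w"
proof -
  have "I (\<lambda>z. s z - mid) = (d - c) * ((b - mid)\<^sup>2 / 2 - (a - mid)\<^sup>2 / 2)"
    using ab cd by (intro integral_crect_deriv) (auto intro!: derivative_eq_intros continuous_intros)
  then show "I (\<lambda>z. s z - mid) = 0" by (simp add: ends)
  have "I (\<lambda>z. (s z - mid)\<^sup>2) = (d - c) * ((b - mid) ^ 3 / 3 - (a - mid) ^ 3 / 3)"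
    using ab cd by (intro integral_crect_deriv) (auto intro!: derivative_eq_intros continuous_intros)
  also have "\<dots> = w * h\<^sup>2 / 12"
  proof -
    have m: "b - mid = h / 2" "a - mid = - h / 2" by (simp_all add: h_def mid_def field_simps)
    show ?thesis unfolding m by (simp add: hw(3) power2_eq_square power3_eq_cube)
  qed
  finally show "I (\<lambda>z. (s z - mid)\<^sup>2) = w * h\<^sup>2 / 12" .
  show "I (\<lambda>z. 1) = w" using hw(4) by (simp add: measure_restrict_space)
qed

lemma integral_affine: "I (\<lambda>z. \<alpha> + \<gamma> * (s z - mid)) = \<alpha> * w"
  and integral_affine_moment: "I (\<lambda>z. (\<alpha> + \<gamma> * (s z - mid)) * (s z - mid)) = \<gamma> * (w * h\<^sup>2 / 12)"
  and integral_affine_sq: "I (\<lambda>z. (\<alpha> + \<gamma> * (s z - mid))\<^sup>2) = w * (\<alpha>\<^sup>2 + \<gamma>\<^sup>2 * h\<^sup>2 / 12)"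
proof -
  have i: "integrable (lebesgue_on R) (\<lambda>z. 1 :: real)" "integrable (lebesgue_on R) (\<lambda>z. s z - mid)" "integrable (lebesgue_on R) (\<lambda>z. (s z - mid)\<^sup>2)"
    using L2_integrable'[OF one_L2] L2_integrable'[OF smooth_L2[of "\<lambda>x. x - mid"]] L2_integrable'[OF smooth_L2[of "\<lambda>x. (x - mid)\<^sup>2"]] by simp_all
  have "I (\<lambda>z. \<alpha> + \<gamma> * (s z - mid)) = I (\<lambda>z. \<alpha> * 1 + \<gamma> * (s z - mid))" by simp
  also have "\<dots> = \<alpha> * I (\<lambda>z. 1) + \<gamma> * I (\<lambda>z. s z - mid)" using i by (simp only: Bochner_Integration.integral_add integrable_mult_right integral_mult_right_zero)
  finally show "I (\<lambda>z. \<alpha> + \<gamma> * (s z - mid)) = \<alpha> * w" by (simp only: moments)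
  have "I (\<lambda>z. (\<alpha> + \<gamma> * (s z - mid)) * (s z - mid)) = I (\<lambda>z. \<alpha> * (s z - mid) + \<gamma> * (s z - mid)\<^sup>2)"
    by (intro Bochner_Integration.integral_cong) (simp_all add: power2_eq_square algebra_simps)
  also have "\<dots> = \<alpha> * I (\<lambda>z. s z - mid) + \<gamma> * I (\<lambda>z. (s z - mid)\<^sup>2)" using i by (simp only: Bochner_Integration.integral_add integrable_mult_right integral_mult_right_zero)
  finally show "I (\<lambda>z. (\<alpha> + \<gamma> * (s z - mid)) * (s z - mid)) = \<gamma> * (w * h\<^sup>2 / 12)" by (simp add: moments)
  have "I (\<lambda>z. (\<alpha> + \<gamma> * (s z - mid))\<^sup>2) = I (\<lambda>z. \<alpha>\<^sup>2 * 1 + (2 * \<alpha> * \<gamma>) * (s z - mid) + \<gamma>\<^sup>2 * (s z - mid)\<^sup>2)"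
    by (intro Bochner_Integration.integral_cong) (simp_all add: power2_eq_square algebra_simps)
  also have "\<dots> = \<alpha>\<^sup>2 * I (\<lambda>z. 1) + (2 * \<alpha> * \<gamma>) * I (\<lambda>z. s z - mid) + \<gamma>\<^sup>2 * I (\<lambda>z. (s z - mid)\<^sup>2)" using i by (simp only: Bochner_Integration.integral_add Bochner_Integration.integrable_add integrable_mult_right integral_mult_right_zero)
  finally show "I (\<lambda>z. (\<alpha> + \<gamma> * (s z - mid))\<^sup>2) = w * (\<alpha>\<^sup>2 + \<gamma>\<^sup>2 * h\<^sup>2 / 12)"
    unfolding moments by (simp add: field_simps)
qed

text \<open>The interpolant matches f on the edges in the mean, so its moments are quadrature values
  of trapezoidal type, and the errors are integrals of the second derivative weighted with E and
  \<open>Fd\<close>. These weights are of size h^2 for the mean and h^3 for the first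
  moment.\<close>

lemma resid_moments:
  "I resid = I (\<lambda>z. f2 z * E (s z))" "I (\<lambda>z. resid z * (s z - mid)) = I (\<lambda>z. f2 z * Fd (s z))"
proof -
  have "I resid = I f - I interp"
    unfolding resid_def[abs_def] using L2_integrable'[OF L2(1)] L2_integrable'[OF interp_L2(1)] by simp
  also have "I interp = avg * w" unfolding interp_def[abs_def] by (rule integral_affine)
  also have "avg * w = I f + I (\<lambda>z. f1 z * (s z - mid))" using hw(2) by (simp add: avg_def)
  finally show "I resid = I (\<lambda>z. f2 z * E (s z))" using ibp(1)[OF wp(2) L2(2,3)] by simp
  have "I (\<lambda>z. resid z * (s z - mid)) = I (\<lambda>z. f z * (s z - mid) - interp z * (s z - mid))"
    by (intro Bochner_Integration.integral_cong) (simp_all add: resid_def algebra_simps)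
  also have "\<dots> = I (\<lambda>z. f z * (s z - mid)) - I (\<lambda>z. interp z * (s z - mid))"
    using mult_smooth_integrable[OF L2(1) kernels_smooth(4)] mult_smooth_integrable[OF interp_L2(1) kernels_smooth(4)] by simp
  also have "I (\<lambda>z. interp z * (s z - mid)) = slope * (w * h\<^sup>2 / 12)" unfolding interp_def by (rule integral_affine_moment)
  also have "slope * (w * h\<^sup>2 / 12) = h\<^sup>2 / 12 * I f1" using hw(2) by (simp add: slope_def)
  finally show "I (\<lambda>z. resid z * (s z - mid)) = I (\<lambda>z. f2 z * Fd (s z))"
    using ibp(1)[OF wp(1) L2(1,2)] ibp(3)[OF wp(2) L2(2,3)] by simp
qed

lemma resid_affine: "I (\<lambda>z. resid z * (\<alpha> + \<gamma> * (s z - mid))) = \<alpha> * I resid + \<gamma> * I (\<lambda>z. resid z * (s z - mid))"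
proof -
  have "I (\<lambda>z. resid z * (\<alpha> + \<gamma> * (s z - mid))) = I (\<lambda>z. \<alpha> * resid z + \<gamma> * (resid z * (s z - mid)))"
    by (intro Bochner_Integration.integral_cong) (simp_all add: algebra_simps)
  then show ?thesis
    using L2_integrable'[OF interp_L2(2)] mult_smooth_integrable[OF interp_L2(2) kernels_smooth(4)] by simp
qed

lemma weight_bound:
  assumes "k \<in> L2_space R"
  shows "\<bar>I (\<lambda>z. k z * E (s z))\<bar> \<le> h\<^sup>2 / 8 * sqrt w * L2_norm R k"
    "\<bar>I (\<lambda>z. k z * F (s z))\<bar> \<le> h ^ 4 / 384 * sqrt w * L2_norm R k"
    "\<bar>I (\<lambda>z. k z * Fd (s z))\<bar> \<le> h ^ 3 / 48 * sqrt w * L2_norm R k"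
    "\<bar>I (\<lambda>z. k z * (s z - mid))\<bar> \<le> h / 2 * sqrt w * L2_norm R k"
    "\<bar>I k\<bar> \<le> sqrt w * L2_norm R k"
proof -
  note * = L2_weight_bound[OF assms _ _ _ ab cd, folded w_def]
  have h0: "h > 0" by (rule hw)
  show "\<bar>I (\<lambda>z. k z * E (s z))\<bar> \<le> h\<^sup>2 / 8 * sqrt w * L2_norm R k"
    by (rule *[OF kernels_smooth(1) kernels_bound(1)]) auto
  show "\<bar>I (\<lambda>z. k z * F (s z))\<bar> \<le> h ^ 4 / 384 * sqrt w * L2_norm R k"
    by (rule *[OF kernels_smooth(2) kernels_bound(2)]) auto
  show "\<bar>I (\<lambda>z. k z * Fd (s z))\<bar> \<le> h ^ 3 / 48 * sqrt w * L2_norm R k"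
    by (rule *[OF kernels_smooth(3) kernels_bound(3)]) (use h0 in auto)
  have "\<bar>x - mid\<bar> \<le> h / 2" if "x \<in> {a..b}" for x
    using that unfolding h_def mid_def abs_le_iff by (simp add: field_simps)
  then show "\<bar>I (\<lambda>z. k z * (s z - mid))\<bar> \<le> h / 2 * sqrt w * L2_norm R k"
    using h0 by (intro *[OF kernels_smooth(4)]) auto
  show "\<bar>I k\<bar> \<le> sqrt w * L2_norm R k" using *[of "\<lambda>_. 1" 1] by simp
qed

text \<open>The squared norm of the affine function is w (\<alpha>^2 + \<gamma>^2 h^2 / 12), so both
  \<alpha> and \<gamma> h are controlled by that norm; the additional power of h in the first moment
  of the residual compensates for \<gamma> alone.\<close>

lemma resid_affine_bound:
  "\<bar>I (\<lambda>z. resid z * (\<alpha> + \<gamma> * (s z - mid)))\<bar> \<le> h\<^sup>2 * L2_norm R f2 * L2_norm R (\<lambda>z. \<alpha> + \<gamma> * (s z - mid))"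
proof -
  define N Q where "N = L2_norm R f2" and "Q = sqrt (\<alpha>\<^sup>2 + \<gamma>\<^sup>2 * h\<^sup>2 / 12)"
  have n: "L2_norm R (\<lambda>z. \<alpha> + \<gamma> * (s z - mid)) = sqrt w * Q"
    unfolding L2_norm_def L2_inner_self Q_def by (simp add: integral_affine_sq real_sqrt_mult)
  have Q: "Q \<ge> 0" "\<bar>\<alpha>\<bar> \<le> Q" "\<bar>\<gamma>\<bar> * h \<le> 4 * Q"
  proof -
    show "Q \<ge> 0" by (simp add: Q_def)
    show "\<bar>\<alpha>\<bar> \<le> Q" unfolding Q_def by (rule real_le_rsqrt) simp
    \<comment> \<open>4 is a round number above sqrt 12, so that 1/16 is below the available
      1/12.\<close>
    have "(\<bar>\<gamma>\<bar> * h / 4)\<^sup>2 = \<gamma>\<^sup>2 * h\<^sup>2 / 16" by (simp add: power_divide power_mult_distrib)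
    moreover have "0 \<le> \<gamma>\<^sup>2 * h\<^sup>2" "0 \<le> \<alpha>\<^sup>2" by simp_all
    ultimately have "(\<bar>\<gamma>\<bar> * h / 4)\<^sup>2 \<le> \<alpha>\<^sup>2 + \<gamma>\<^sup>2 * h\<^sup>2 / 12" by linarith
    then have "\<bar>\<gamma>\<bar> * h / 4 \<le> Q" unfolding Q_def by (rule real_le_rsqrt)
    then show "\<bar>\<gamma>\<bar> * h \<le> 4 * Q" by simp
  qed
  have "\<bar>I (\<lambda>z. resid z * (\<alpha> + \<gamma> * (s z - mid)))\<bar> \<le> \<bar>\<alpha>\<bar> * \<bar>I resid\<bar> + \<bar>\<gamma>\<bar> * \<bar>I (\<lambda>z. resid z * (s z - mid))\<bar>"
    unfolding resid_affine by (rule order_trans[OF abs_triangle_ineq]) (simp add: abs_mult)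
  also have "\<dots> \<le> Q * (h\<^sup>2 / 8 * sqrt w * N) + \<bar>\<gamma>\<bar> * (h ^ 3 / 48 * sqrt w * N)"
    unfolding resid_moments N_def using weight_bound(1,3)[OF L2(3)] Q by (intro add_mono mult_mono) auto
  also have "\<bar>\<gamma>\<bar> * (h ^ 3 / 48 * sqrt w * N) = (\<bar>\<gamma>\<bar> * h) * (h\<^sup>2 / 48 * sqrt w * N)"
    by (simp add: power2_eq_square power3_eq_cube)
  also have "\<dots> \<le> (4 * Q) * (h\<^sup>2 / 48 * sqrt w * N)"
    using Q hw by (intro mult_right_mono) (auto simp: N_def)
  also have "Q * (h\<^sup>2 / 8 * sqrt w * N) + (4 * Q) * (h\<^sup>2 / 48 * sqrt w * N) \<le> h\<^sup>2 * N * (sqrt w * Q)"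
  proof -
    have "0 \<le> h\<^sup>2 * N * (sqrt w * Q)" using Q hw by (simp add: N_def)
    then show ?thesis by (simp add: field_simps)
  qed
  finally show ?thesis unfolding n N_def by simp
qed

end

text \<open>\<open>f3\<close> and \<open>f4\<close> continue the chain of derivatives in the
  direction s; g is the transversal derivative of \<open>f2\<close>, for the Poincare inequality.
  With f a component of the flux, \<open>f4\<close> and g are derivatives of u of order five and
  four.\<close>

locale smooth_element = element +
  fixes f3 f4 g :: "plane \<Rightarrow> real"
  assumes L2': "f3 \<in> L2_space R" "f4 \<in> L2_space R" "g \<in> L2_space R"
    and wp': "weak_partial s t (orect s t a b c d) f2 f3" "weak_partial s t (orect s t a b c d) f3 f4"
      "weak_partial t s (orect s t a b c d) f2 g"
begin

text \<open>The product of \<open>avg\<close> with the integral of \<open>f2\<close> appears twice: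
  in the zeroth moment of the residual, and in the integral of f2 f after substituting f = resid +
  interp. These parts cancel. What remains are terms with kernels of fourth order in total and the
  product of \<open>f2\<close> with the residual, where the mean of \<open>f2\<close> is split off
  because only the fluctuation around it is small.\<close>

lemma resid_interp_expansion:
  "I (\<lambda>z. resid z * interp z) + h\<^sup>2 / 12 * I (\<lambda>z. f2 z * f z)
   = avg * I (\<lambda>z. f4 z * F (s z)) - slope * I (\<lambda>z. f3 z * F (s z)) - h\<^sup>2 / 12 * (slope * I (\<lambda>z. f3 z * E (s z)))
     + h\<^sup>2 / 12 * (I (\<lambda>z. (f2 z - I f2 / w) * resid z) + I f2 / w * I (\<lambda>z. f2 z * E (s z)))"
proof -
  have r: "I (\<lambda>z. resid z * interp z) = avg * I (\<lambda>z. f2 z * E (s z)) + slope * I (\<lambda>z. f2 z * Fd (s z))"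
    unfolding interp_def resid_affine resid_moments ..
  \<comment> \<open>The mean of E gives the leading term; the rest is integrated by parts twice,
    onto \<open>f4\<close> with the kernel F.\<close>
  have 1: "I (\<lambda>z. f2 z * E (s z)) = - (h\<^sup>2 / 12 * I f2) + I (\<lambda>z. f4 z * F (s z))"
    using ibp(3)[OF wp'(1) L2(3) L2'(1)] ibp(2)[OF wp'(2) L2'(1,2)] by simp
  have 2: "I (\<lambda>z. f2 z * Fd (s z)) = - I (\<lambda>z. f3 z * F (s z))" by (rule ibp(2)[OF wp'(1) L2(3) L2'(1)])
  have 3: "I (\<lambda>z. f2 z * (s z - mid)) = - I (\<lambda>z. f3 z * E (s z))" by (rule ibp(1)[OF wp'(1) L2(3) L2'(1)])
  have i: "integrable (lebesgue_on R) (\<lambda>z. f2 z * resid z)" "integrable (lebesgue_on R) (\<lambda>z. f2 z * (s z - mid))"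
     "integrable (lebesgue_on R) f2" "integrable (lebesgue_on R) resid"
    using L2_integrable_mult[OF L2(3) interp_L2(2)] mult_smooth_integrable[OF L2(3) kernels_smooth(4)] L2_integrable' L2 interp_L2 by simp_all
  have "I (\<lambda>z. f2 z * f z) = I (\<lambda>z. f2 z * resid z + (avg * f2 z + slope * (f2 z * (s z - mid))))"
    by (intro Bochner_Integration.integral_cong) (simp_all add: resid_def interp_def algebra_simps)
  also have "\<dots> = I (\<lambda>z. f2 z * resid z) + (avg * I f2 + slope * I (\<lambda>z. f2 z * (s z - mid)))"
    using i by (simp only: Bochner_Integration.integral_add Bochner_Integration.integrable_add integrable_mult_right integral_mult_right_zero)
  finally have 4: "I (\<lambda>z. f2 z * f z) = I (\<lambda>z. f2 z * resid z) + (avg * I f2 - slope * I (\<lambda>z. f3 z * E (s z)))"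
    using 3 by simp
  have "I (\<lambda>z. (f2 z - I f2 / w) * resid z) = I (\<lambda>z. f2 z * resid z - I f2 / w * resid z)"
    by (intro Bochner_Integration.integral_cong) (simp_all add: algebra_simps)
  also have "\<dots> = I (\<lambda>z. f2 z * resid z) - I f2 / w * I resid" using i by simp
  finally have 5: "I (\<lambda>z. f2 z * resid z) = I (\<lambda>z. (f2 z - I f2 / w) * resid z) + I f2 / w * I (\<lambda>z. f2 z * E (s z))"
    by (simp add: resid_moments)
  show ?thesis unfolding r 2 4 5 by (subst (1) 1) (simp add: algebra_simps)
qed

text \<open>Every term carries four powers of the size except h^2 times the integral of (f2 - mean)
  times the residual. There the Poincare inequality gains one power, and Young's inequality leaves
  the squared norm of the residual with the factor H^2. \<open>H\<close> bounds both side lengths,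
  as the transversal one enters through the Poincare inequality.\<close>

lemma resid_interp_bound:
  assumes H: "h \<le> H" "d - c \<le> H" "H \<le> 1"
  shows "\<bar>I (\<lambda>z. resid z * interp z) + h\<^sup>2 / 12 * I (\<lambda>z. f2 z * f z)\<bar>
    \<le> 3 * H ^ 4 * (L2_inner R f f + L2_inner R f1 f1 + L2_inner R f2 f2 + L2_inner R f3 f3 + L2_inner R f4 f4 + L2_inner R g g)
      + H\<^sup>2 * L2_inner R resid resid"
proof -
  define n0 n1 n2 n3 n4 ng nr where "n0 = L2_norm R f" and "n1 = L2_norm R f1" and "n2 = L2_norm R f2"
    and "n3 = L2_norm R f3" and "n4 = L2_norm R f4" and "ng = L2_norm R g" and "nr = L2_norm R resid"
  note ns = n0_def n1_def n2_def n3_def n4_def ng_def nr_def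
  have nn: "n0 \<ge> 0" "n1 \<ge> 0" "n2 \<ge> 0" "n3 \<ge> 0" "n4 \<ge> 0" "ng \<ge> 0" "nr \<ge> 0" by (simp_all add: ns)
  have sw: "sqrt w > 0" "sqrt w * sqrt w = w" "w > 0" using hw by simp_all
  have h: "0 < h" "h \<le> 1" "0 \<le> H" using hw H by auto
  \<comment> \<open>Averages such as \<open>avg\<close> and \<open>slope\<close> carry 1/w, while
    the weighted integrals carry only sqrt w. Multiplied with this sqrt w, the averages are bounded
    by plain norms.\<close>
  have cancel: "x * sqrt w \<le> u" if "x * w \<le> sqrt w * u" for x u
  proof -
    have "(x * sqrt w) * sqrt w \<le> u * sqrt w" using that sw(2) by (simp only: mult.assoc mult.commute[of u])
    then show ?thesis using sw(1) by (rule mult_right_le_imp_le)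
  qed
  have avg: "\<bar>avg\<bar> * sqrt w \<le> n0 + n1"
  proof (rule cancel)
    have "\<bar>avg\<bar> * w = \<bar>I f + I (\<lambda>z. f1 z * (s z - mid))\<bar>" using hw(2) by (simp add: avg_def)
    also have "\<dots> \<le> \<bar>I f\<bar> + \<bar>I (\<lambda>z. f1 z * (s z - mid))\<bar>" by (rule abs_triangle_ineq)
    also have "\<dots> \<le> sqrt w * n0 + h / 2 * sqrt w * n1"
      unfolding ns using weight_bound(5)[OF L2(1)] weight_bound(4)[OF L2(2)] by (rule add_mono)
    also have "\<dots> \<le> sqrt w * n0 + 1 * sqrt w * n1" using h sw nn by (intro add_left_mono mult_right_mono) auto
    finally show "\<bar>avg\<bar> * w \<le> sqrt w * (n0 + n1)" by (simp add: distrib_left)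
  qed
  have slope: "\<bar>slope\<bar> * sqrt w \<le> n1"
    by (rule cancel) (use weight_bound(5)[OF L2(2)] hw(2) in \<open>simp add: slope_def n1_def\<close>)
  have cbar: "\<bar>I f2 / w\<bar> * sqrt w \<le> n2"
    by (rule cancel) (use weight_bound(5)[OF L2(3)] hw(2) in \<open>simp add: n2_def\<close>)
  have prod: "\<bar>x * y\<bar> \<le> B * u * v" if "\<bar>x\<bar> * sqrt w \<le> u" "\<bar>y\<bar> \<le> B * sqrt w * v" "v \<ge> 0" "B \<ge> 0" for x y B u v :: real
  proof -
    have "\<bar>x * y\<bar> \<le> \<bar>x\<bar> * (B * sqrt w * v)" using that by (simp add: abs_mult mult_left_mono)
    also have "\<dots> = (\<bar>x\<bar> * sqrt w) * (B * v)" by simp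
    also have "\<dots> \<le> u * (B * v)" using that by (intro mult_right_mono) auto
    finally show ?thesis by (simp add: mult_ac)
  qed
  have t1: "\<bar>avg * I (\<lambda>z. f4 z * F (s z))\<bar> \<le> h ^ 4 / 384 * (n0 + n1) * n4"
    using prod[OF avg weight_bound(2)[OF L2'(2), folded ns]] nn by simp
  have t2: "\<bar>slope * I (\<lambda>z. f3 z * F (s z))\<bar> \<le> h ^ 4 / 384 * n1 * n3"
    using prod[OF slope weight_bound(2)[OF L2'(1), folded ns]] nn by simp
  have t3: "\<bar>slope * I (\<lambda>z. f3 z * E (s z))\<bar> \<le> h\<^sup>2 / 8 * n1 * n3"
    using prod[OF slope weight_bound(1)[OF L2'(1), folded ns]] nn by simp
  have t4: "\<bar>I f2 / w * I (\<lambda>z. f2 z * E (s z))\<bar> \<le> h\<^sup>2 / 8 * n2 * n2"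
    using prod[OF cbar weight_bound(1)[OF L2(3), folded ns]] nn by simp
  define v where "v = L2_norm R (\<lambda>z. f2 z - I f2 / w)"
  have v: "v \<ge> 0" "v \<le> H * n3 + H * ng"
  proof -
    show "v \<ge> 0" by (simp add: v_def)
    have "v\<^sup>2 = var R f2"
      using var_eq_mean[OF crect_lmeasurable L2(3)] hw by (simp add: v_def L2_norm_power2 L2_inner_self)
    also have "\<dots> \<le> (h\<^sup>2 * n3\<^sup>2 + (d - c)\<^sup>2 * ng\<^sup>2) / 3"
      using poincare[OF ab cd wp'(1,3) L2(3) L2'(1,3)] by (simp add: ns L2_norm_power2 L2_inner_self h_def)
    also have "\<dots> \<le> (H\<^sup>2 * n3\<^sup>2 + H\<^sup>2 * ng\<^sup>2) / 3"
      using H hw cd by (intro divide_right_mono add_mono mult_right_mono power_mono) auto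
    also have "\<dots> \<le> (H * n3 + H * ng)\<^sup>2"
    proof -
      have "0 \<le> (H * n3)\<^sup>2" "0 \<le> (H * ng)\<^sup>2" "0 \<le> (H * n3) * (H * ng)" using h nn by simp_all
      then show ?thesis unfolding power2_sum power_mult_distrib[symmetric] by argo
    qed
    finally show "v \<le> H * n3 + H * ng" by (rule power2_le_imp_le) (use h nn in auto)
  qed
  have t5: "\<bar>I (\<lambda>z. (f2 z - I f2 / w) * resid z)\<bar> \<le> v * nr"
    using L2_Cauchy_Schwarz[OF L2_diff[OF L2(3) one_L2] interp_L2(2)] by (simp add: v_def ns L2_inner_def)
  have hH: "h ^ 4 \<le> H ^ 4" "h\<^sup>2 \<le> H\<^sup>2" using h H by (auto intro!: power_mono)
  have "\<bar>I (\<lambda>z. resid z * interp z) + h\<^sup>2 / 12 * I (\<lambda>z. f2 z * f z)\<bar>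
     \<le> h ^ 4 / 384 * (n0 + n1) * n4 + h ^ 4 / 384 * n1 * n3 + h\<^sup>2 / 12 * (h\<^sup>2 / 8 * n1 * n3) + h\<^sup>2 / 12 * (v * nr + h\<^sup>2 / 8 * n2 * n2)"
  proof -
    have "\<bar>h\<^sup>2 / 12 * (slope * I (\<lambda>z. f3 z * E (s z)))\<bar> \<le> h\<^sup>2 / 12 * (h\<^sup>2 / 8 * n1 * n3)"
      unfolding abs_mult[of "h\<^sup>2 / 12"] using mult_left_mono[OF t3, of "\<bar>h\<^sup>2 / 12\<bar>"] by simp
    moreover have "\<bar>h\<^sup>2 / 12 * (I (\<lambda>z. (f2 z - I f2 / w) * resid z) + I f2 / w * I (\<lambda>z. f2 z * E (s z)))\<bar> \<le> h\<^sup>2 / 12 * (v * nr + h\<^sup>2 / 8 * n2 * n2)"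
    proof -
      have "\<bar>I (\<lambda>z. (f2 z - I f2 / w) * resid z) + I f2 / w * I (\<lambda>z. f2 z * E (s z))\<bar> \<le> v * nr + h\<^sup>2 / 8 * n2 * n2"
        using t4 t5 by linarith
      then show ?thesis unfolding abs_mult[of "h\<^sup>2 / 12"] by (simp add: mult_left_mono)
    qed
    ultimately show ?thesis unfolding resid_interp_expansion using t1 t2 by linarith
  qed
  also have "\<dots> \<le> h ^ 4 * ((n0 + n1) * n4 + 2 * (n1 * n3) + n2 * n2) + h\<^sup>2 * (v * nr)"
  proof -
    have "h\<^sup>2 / 12 * (h\<^sup>2 / 8 * n1 * n3) = h ^ 4 * (n1 * n3) / 96" "h\<^sup>2 / 12 * (h\<^sup>2 / 8 * n2 * n2) = h ^ 4 * (n2 * n2) / 96"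
      by (simp_all add: power2_eq_square power4_eq_xxxx)
    moreover have "0 \<le> h ^ 4 * ((n0 + n1) * n4)" "0 \<le> h ^ 4 * (n1 * n3)" "0 \<le> h ^ 4 * (n2 * n2)" "0 \<le> h\<^sup>2 * (v * nr)"
      using nn v h by simp_all
    ultimately show ?thesis by (simp only: distrib_left) argo
  qed
  also have "\<dots> \<le> H ^ 4 * ((n0 + n1) * n4 + 2 * (n1 * n3) + n2 * n2) + H\<^sup>2 * ((H * n3 + H * ng) * nr)"
    using hH v nn h by (intro add_mono mult_mono) auto
  also have "\<dots> \<le> 3 * H ^ 4 * (n0\<^sup>2 + n1\<^sup>2 + n2\<^sup>2 + n3\<^sup>2 + n4\<^sup>2 + ng\<^sup>2) + H\<^sup>2 * nr\<^sup>2"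
  proof -
    have A: "(n0 + n1) * n4 + 2 * (n1 * n3) + n2 * n2 \<le> 2 * (n0\<^sup>2 + n1\<^sup>2 + n2\<^sup>2 + n3\<^sup>2 + n4\<^sup>2 + ng\<^sup>2)"
    proof -
      have "2 * (n0 * n4) \<le> n0\<^sup>2 + n4\<^sup>2" "2 * (n1 * n4) \<le> n1\<^sup>2 + n4\<^sup>2" "2 * (n1 * n3) \<le> n1\<^sup>2 + n3\<^sup>2"
        using sum_squares_bound[of n0 n4] sum_squares_bound[of n1 n4] sum_squares_bound[of n1 n3] by simp_all
      moreover have "0 \<le> n0\<^sup>2" "0 \<le> n1\<^sup>2" "0 \<le> n2\<^sup>2" "0 \<le> n3\<^sup>2" "0 \<le> n4\<^sup>2" "0 \<le> ng\<^sup>2" by simp_all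
      moreover have "n2 * n2 = n2\<^sup>2" by (simp add: power2_eq_square)
      ultimately show ?thesis unfolding distrib_right by argo
    qed
    \<comment> \<open>Young's inequality, from the squares of H n3 - nr and H ng - nr.\<close>
    have B: "(H * n3 + H * ng) * nr \<le> H\<^sup>2 * (n0\<^sup>2 + n1\<^sup>2 + n2\<^sup>2 + n3\<^sup>2 + n4\<^sup>2 + ng\<^sup>2) + nr\<^sup>2"
    proof -
      have "0 \<le> (H * n3 - nr)\<^sup>2" "0 \<le> (H * ng - nr)\<^sup>2" "0 \<le> H\<^sup>2 * n3\<^sup>2" "0 \<le> H\<^sup>2 * ng\<^sup>2" "0 \<le> H\<^sup>2 * (n0\<^sup>2 + n1\<^sup>2 + n2\<^sup>2 + n4\<^sup>2)" by simp_all
      then show ?thesis unfolding power2_diff power_mult_distrib distrib_left distrib_right by argo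
    qed
    have "H ^ 4 * ((n0 + n1) * n4 + 2 * (n1 * n3) + n2 * n2) \<le> H ^ 4 * (2 * (n0\<^sup>2 + n1\<^sup>2 + n2\<^sup>2 + n3\<^sup>2 + n4\<^sup>2 + ng\<^sup>2))"
      using A h by (intro mult_left_mono) auto
    moreover have "H\<^sup>2 * ((H * n3 + H * ng) * nr) \<le> H\<^sup>2 * (H\<^sup>2 * (n0\<^sup>2 + n1\<^sup>2 + n2\<^sup>2 + n3\<^sup>2 + n4\<^sup>2 + ng\<^sup>2) + nr\<^sup>2)"
      using B by (intro mult_left_mono) auto
    moreover have "H\<^sup>2 * H\<^sup>2 = H ^ 4" by (simp flip: power_add)
    ultimately show ?thesis by (simp add: algebra_simps)
  qed
  finally show ?thesis by (simp add: ns L2_norm_power2)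
qed

end

section \<open>Vector fields and the weak divergence\<close>

interpretation xy: coords fst snd by unfold_locales simp
interpretation yx: coords snd fst by unfold_locales simp

context coords
begin

text \<open>The derivative of (\<alpha> + \<beta> s) p(s) q(t) is integrated over the closed
  rectangle; the boundary terms vanish as the support of the test function lies in the open one.
  This yields the divergence of a discrete field on a cell.\<close>

lemma weak_partial_affine: "weak_partial s t (orect s t a b c d) (\<lambda>z. \<alpha> + \<beta> * s z) (\<lambda>_. \<beta>)"
  unfolding weak_partial_def
proof (intro allI impI)
  fix p q assume tt: "tensor_test s t (orect s t a b c d) p q"
  then obtain a' b' c' d' where p: "smooth p" "smooth q" "\<And>x. p x \<noteq> 0 \<Longrightarrow> x \<in> {a'..b'}" "\<And>x. q x \<noteq> 0 \<Longrightarrow> x \<in> {c'..d'}"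
    and sub: "crect s t a' b' c' d' \<subseteq> orect s t a b c d" unfolding tensor_test_def by blast
  have z: "p x * q y = 0" if "x \<le> a \<or> b \<le> x" for x y
  proof (rule ccontr)
    assume "p x * q y \<noteq> 0"
    then have "x \<in> {a'..b'}" "y \<in> {c'..d'}" using p by auto
    then have "pt x y \<in> crect s t a' b' c' d'" by (simp add: crect_def)
    then have "pt x y \<in> orect s t a b c d" using sub by blast
    then show False using that by (auto simp: orect_def)
  qed
  have cont: "continuous_on UNIV (\<lambda>z. r (s z))" "continuous_on UNIV (\<lambda>z. r (t z))" if "smooth r" for r
    using smooth_continuous_on[OF that] continuous_coords by (auto intro: continuous_on_compose2)
  define F1 F2 where "F1 z = (\<alpha> + \<beta> * s z) * (deriv p (s z) * q (t z))" and "F2 z = \<beta> * (p (s z) * q (t z))" for z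
  have F: "continuous_on UNIV F1" "continuous_on UNIV F2"
    unfolding F1_def[abs_def] F2_def[abs_def]
    by (intro continuous_intros cont continuous_coords smooth_deriv p)+
  have "(LINT z|lebesgue_on (crect s t a b c d). F1 z + F2 z) = 0"
  proof (cases "a \<le> b")
    case True
    have "(LINT z|lebesgue_on (crect s t a b c d). F1 z + F2 z)
       = integral {c..d} (\<lambda>y. (\<alpha> + \<beta> * b) * (p b * q y) - (\<alpha> + \<beta> * a) * (p a * q y))"
    proof (subst integral_crect_partial[OF True, where G="\<lambda>z. (\<alpha> + \<beta> * s z) * (p (s z) * q (t z))"])
      show "continuous_on UNIV (\<lambda>z. F1 z + F2 z)" using F by (rule continuous_on_add)
      fix x y
      have "((\<lambda>x. (\<alpha> + \<beta> * x) * (p x * q y)) has_real_derivative \<beta> * (p x * q y) + deriv p x * q y * (\<alpha> + \<beta> * x)) (at x)"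
        by (rule DERIV_mult[OF _ DERIV_cmult_right[OF smooth_has_deriv[OF p(1)]]]) (auto intro!: derivative_eq_intros)
      then show "((\<lambda>x. (\<alpha> + \<beta> * s (pt x y)) * (p (s (pt x y)) * q (t (pt x y)))) has_real_derivative F1 (pt x y) + F2 (pt x y)) (at x)"
        by (simp add: F1_def F2_def algebra_simps)
    qed simp
    then show ?thesis by (simp add: z)
  next
    case False
    then have "crect s t a b c d = {}" by (auto simp: crect_def)
    then show ?thesis by (simp add: integral_lebesgue_on_indicator)
  qed
  then have "(LINT z|lebesgue_on (crect s t a b c d). F1 z) = - (LINT z|lebesgue_on (crect s t a b c d). F2 z)"
    using F by (subst (asm) Bochner_Integration.integral_add) (auto intro: integrable_crect_continuous)
  then show "(LINT z|lebesgue_on (orect s t a b c d). (\<alpha> + \<beta> * s z) * (deriv p (s z) * q (t z))) =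
     - (LINT z|lebesgue_on (orect s t a b c d). \<beta> * (p (s z) * q (t z)))"
    unfolding integral_orect F1_def F2_def .
qed

end

lemma L2_Pair:
  fixes f g :: "plane \<Rightarrow> real"
  assumes "f \<in> L2_space S" "g \<in> L2_space S"
  shows "(\<lambda>p. (f p, g p)) \<in> L2_space S"
proof -
  have "(\<lambda>p. (f p, g p)) \<in> borel_measurable (lebesgue_on S)"
    using L2_measurable[OF assms(1)] L2_measurable[OF assms(2)] by (rule borel_measurable_Pair)
  moreover have "integrable (lebesgue_on S) (\<lambda>p. (norm (f p))\<^sup>2 + (norm (g p))\<^sup>2)"
    using L2_integrable_sq[OF assms(1)] L2_integrable_sq[OF assms(2)] by (rule Bochner_Integration.integrable_add)
  ultimately show ?thesis by (simp add: L2_space_def norm_Pair)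
qed

lemma L2_fst: "\<tau> \<in> L2_space S \<Longrightarrow> (\<lambda>p. fst (\<tau> p)) \<in> L2_space S"
  and L2_snd: "\<tau> \<in> L2_space S \<Longrightarrow> (\<lambda>p. snd (\<tau> p)) \<in> L2_space S" for \<tau> :: "plane \<Rightarrow> plane"
proof -
  assume \<tau>: "\<tau> \<in> L2_space S"
  have m: "(\<lambda>p. fst (\<tau> p)) \<in> borel_measurable (lebesgue_on S)" "(\<lambda>p. snd (\<tau> p)) \<in> borel_measurable (lebesgue_on S)"
    by (intro measurable_compose[OF L2_measurable[OF \<tau>]] borel_measurable_continuous_onI continuous_intros)+
  have i: "integrable (lebesgue_on S) (\<lambda>p. (norm (\<tau> p))\<^sup>2)" by (rule L2_integrable_sq[OF \<tau>])
  have n: "(norm (fst x))\<^sup>2 \<le> (norm x)\<^sup>2" "(norm (snd x))\<^sup>2 \<le> (norm x)\<^sup>2" for x :: plane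
    by (cases x; simp add: norm_Pair)+
  have "integrable (lebesgue_on S) (\<lambda>p. (norm (fst (\<tau> p)))\<^sup>2)" "integrable (lebesgue_on S) (\<lambda>p. (norm (snd (\<tau> p)))\<^sup>2)"
    by (rule Bochner_Integration.integrable_bound[OF i]; use m n in \<open>simp\<close>)+
  then show "(\<lambda>p. fst (\<tau> p)) \<in> L2_space S" "(\<lambda>p. snd (\<tau> p)) \<in> L2_space S" using m by (simp_all add: L2_space_def)
qed

lemma L2_inner_components:
  fixes \<sigma> \<tau> :: "plane \<Rightarrow> plane"
  assumes "\<sigma> \<in> L2_space S" "\<tau> \<in> L2_space S"
  shows "L2_inner S \<sigma> \<tau> = L2_inner S (\<lambda>p. fst (\<sigma> p)) (\<lambda>p. fst (\<tau> p)) + L2_inner S (\<lambda>p. snd (\<sigma> p)) (\<lambda>p. snd (\<tau> p))"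
proof -
  have "L2_inner S \<sigma> \<tau> = (LINT p|lebesgue_on S. fst (\<sigma> p) * fst (\<tau> p) + snd (\<sigma> p) * snd (\<tau> p))"
    by (simp add: L2_inner_def inner_prod_def)
  also have "\<dots> = (LINT p|lebesgue_on S. fst (\<sigma> p) * fst (\<tau> p)) + (LINT p|lebesgue_on S. snd (\<sigma> p) * snd (\<tau> p))"
    using assms by (intro Bochner_Integration.integral_add L2_integrable_mult L2_fst L2_snd)
  finally show ?thesis by (simp add: L2_inner_def)
qed

lemma test_function_continuous:
  assumes "\<phi> \<in> test_functions U"
  shows "continuous_on UNIV \<phi>" "continuous_on UNIV (dx \<phi>)" "continuous_on UNIV (dy \<phi>)"
proof -
  have "cont_diff (Suc 0) \<phi>" "cont_diff 0 \<phi>" using assms unfolding test_functions_def by blast+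
  then show "continuous_on UNIV \<phi>" "continuous_on UNIV (dx \<phi>)" "continuous_on UNIV (dy \<phi>)" by simp_all
qed

lemma test_function_zero:
  assumes "\<phi> \<in> test_functions U" "z \<notin> U"
  shows "\<phi> z = 0"
proof -
  have "z \<notin> closure {p. \<phi> p \<noteq> 0}" using assms unfolding test_functions_def by blast
  then show ?thesis using closure_subset[of "{p. \<phi> p \<noteq> 0}"] by blast
qed

lemma test_function_deriv:
  assumes "\<phi> \<in> test_functions U"
  shows "((\<lambda>x. \<phi> (x, y)) has_real_derivative dx \<phi> (x, y)) (at x)" "((\<lambda>y. \<phi> (x, y)) has_real_derivative dy \<phi> (x, y)) (at y)"
proof -
  have "cont_diff (Suc 0) \<phi>" using assms unfolding test_functions_def by blast
  then have d: "\<phi> differentiable (at z)" for z unfolding cont_diff.simps differentiable_on_def by blast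
  have "(\<phi> \<circ> (\<lambda>x. (x, y))) differentiable (at x)" "(\<phi> \<circ> (\<lambda>y. (x, y))) differentiable (at y)"
    by (intro differentiable_chain_at d; auto simp: differentiable_def intro!: derivative_eq_intros exI)+
  then show "((\<lambda>x. \<phi> (x, y)) has_real_derivative dx \<phi> (x, y)) (at x)" "((\<lambda>y. \<phi> (x, y)) has_real_derivative dy \<phi> (x, y)) (at y)"
    by (simp_all add: dx_def dy_def DERIV_deriv_iff_real_differentiable comp_def)
qed

lemma continuous_L2:
  fixes f :: "plane \<Rightarrow> real"
  assumes "continuous_on UNIV f" "bounded S" "S \<in> sets lebesgue"
  shows "f \<in> L2_space S"
proof -
  have "compact (f ` closure S)"
    using assms by (intro compact_continuous_image continuous_on_subset[OF assms(1)]) (auto simp: compact_closure)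
  then obtain C where "\<And>x. x \<in> closure S \<Longrightarrow> norm (f x) \<le> C"
    using compact_imp_bounded bounded_iff by (metis imageI)
  then have "\<And>x. x \<in> S \<Longrightarrow> \<bar>f x\<bar> \<le> C" using closure_subset by fastforce
  moreover have "finite_measure (lebesgue_on S)"
    using assms bounded_set_imp_lmeasurable finite_measure_lebesgue_on by blast
  ultimately show ?thesis
    using assms continuous_imp_measurable_on_sets_lebesgue continuous_on_subset
    by (intro L2_bounded) blast+
qed

section \<open>The mesh\<close>

locale meshed =
  fixes \<Omega> :: "plane set" and G :: grid
  assumes dom: "rect_domain \<Omega>" and mesh: "rect_mesh \<Omega> G"
begin

definition "EL = elements \<Omega> G"
definition "X i = gx G i"
definition "Y j = gy G j"
text \<open>The cell written as \<open>crect\<close>, so that it can be read in either order of the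
  coordinates. Indices of elements start at 1, hence the truncated subtraction is harmless.\<close>

definition "K ij = crect fst snd (X (fst ij - 1)) (X (fst ij)) (Y (snd ij - 1)) (Y (snd ij))"
definition "OK ij = orect fst snd (X (fst ij - 1)) (X (fst ij)) (Y (snd ij - 1)) (Y (snd ij))"

lemma cell_eq: "cell G ij = K ij"
  by (cases ij) (auto simp: cell_def K_def X_def Y_def crect_def)

lemma cell_K: "cell G = K"
  by (rule ext) (rule cell_eq)

lemma K_swap: "K ij = crect snd fst (Y (snd ij - 1)) (Y (snd ij)) (X (fst ij - 1)) (X (fst ij))"
  and OK_swap: "OK ij = orect snd fst (Y (snd ij - 1)) (Y (snd ij)) (X (fst ij - 1)) (X (fst ij))"
  by (auto simp: K_def OK_def crect_def orect_def)

lemma finite_EL: "finite EL"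
proof -
  have "EL \<subseteq> {1..nx G} \<times> {1..ny G}" by (auto simp: EL_def elements_def)
  then show ?thesis by (rule finite_subset) simp
qed

lemma X_less: "i < j \<Longrightarrow> j \<le> nx G \<Longrightarrow> X i < X j"
  and Y_less: "i < j \<Longrightarrow> j \<le> ny G \<Longrightarrow> Y i < Y j"
  using mesh by (auto simp: rect_mesh_def X_def Y_def strict_mono_on_def)

lemma EL_bounds:
  assumes "ij \<in> EL"
  shows "1 \<le> fst ij" "fst ij \<le> nx G" "1 \<le> snd ij" "snd ij \<le> ny G"
    "X (fst ij - 1) < X (fst ij)" "Y (snd ij - 1) < Y (snd ij)" "K ij \<subseteq> closure \<Omega>"
proof -
  show "1 \<le> fst ij" "fst ij \<le> nx G" "1 \<le> snd ij" "snd ij \<le> ny G" "K ij \<subseteq> closure \<Omega>"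
    using assms by (auto simp: EL_def elements_def cell_eq)
  then show "X (fst ij - 1) < X (fst ij)" "Y (snd ij - 1) < Y (snd ij)" using X_less Y_less by simp_all
qed

lemma \<Omega>_open: "open \<Omega>" and \<Omega>_bounded: "bounded \<Omega>" and interior_closure: "interior (closure \<Omega>) = \<Omega>"
  using dom by (auto simp: rect_domain_def)

lemma \<Omega>_sets [simp]: "\<Omega> \<in> sets lebesgue"
  using \<Omega>_open by (simp add: borel_open)

lemma \<Omega>_finite_measure: "finite_measure (lebesgue_on \<Omega>)"
  using \<Omega>_bounded bounded_set_imp_lmeasurable finite_measure_lebesgue_on \<Omega>_sets by blast

lemma K_sets [simp]: "K ij \<in> sets lebesgue" "OK ij \<in> sets lebesgue" "K ij \<in> lmeasurable"
  by (simp_all add: K_def OK_def)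

text \<open>This is where \<open>interior (closure \<Omega>) = \<Omega>\<close> enters: the open
  rectangle formed by two neighbouring elements, including the relative interior of their common
  edge, belongs to the domain.\<close>

lemma open_subset_\<Omega>: "open U \<Longrightarrow> U \<subseteq> closure \<Omega> \<Longrightarrow> U \<subseteq> \<Omega>"
  using interior_maximal[of U "closure \<Omega>"] interior_closure by simp

lemma OK_subset: "ij \<in> EL \<Longrightarrow> OK ij \<subseteq> \<Omega>"
proof -
  assume ij: "ij \<in> EL"
  have "OK ij \<subseteq> K ij" unfolding K_def OK_def by (rule xy.orect_subset_crect)
  then show "OK ij \<subseteq> \<Omega>"
    using EL_bounds(7)[OF ij] by (intro open_subset_\<Omega>) (auto simp: OK_def xy.orect_open)
qed

lemma negligible_K_diff: "ij \<in> EL \<Longrightarrow> negligible (K ij - \<Omega>)"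
proof -
  assume "ij \<in> EL"
  then have "K ij - \<Omega> \<subseteq> K ij - OK ij" using OK_subset by blast
  then show ?thesis unfolding K_def OK_def by (rule negligible_subset[OF xy.negligible_crect_orect])
qed

lemma \<Omega>_subset: "\<Omega> \<subseteq> (\<Union>ij\<in>EL. K ij)"
  using mesh closure_subset by (auto simp: rect_mesh_def EL_def cell_eq)

lemma negligible_UK_diff: "negligible ((\<Union>ij\<in>EL. K ij) - \<Omega>)"
proof -
  have "(\<Union>ij\<in>EL. K ij) - \<Omega> = (\<Union>ij\<in>EL. K ij - \<Omega>)" by blast
  moreover have "negligible (\<Union>ij\<in>EL. K ij - \<Omega>)"
    using finite_EL negligible_K_diff by (intro negligible_Union) auto
  ultimately show ?thesis by simp
qed

text \<open>Two different cells of the grid are separated by a grid line in at least one direction,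
  so their intersection lies on a line.\<close>

lemma negligible_K_Int:
  assumes "ij \<in> {1..nx G} \<times> {1..ny G}" "kl \<in> {1..nx G} \<times> {1..ny G}" "ij \<noteq> kl"
  shows "negligible (K ij \<inter> K kl)"
proof -
  have *: "X i \<le> X (k - 1)" if "i < k" "k \<le> nx G" for i k
  proof -
    have "i = k - 1 \<or> i < k - 1" "k - 1 \<le> nx G" using that by arith+
    then show ?thesis using X_less[of i "k - 1"] by auto
  qed
  have **: "Y i \<le> Y (k - 1)" if "i < k" "k \<le> ny G" for i k
  proof -
    have "i = k - 1 \<or> i < k - 1" "k - 1 \<le> ny G" using that by arith+
    then show ?thesis using Y_less[of i "k - 1"] by auto
  qed
  consider "fst ij < fst kl" | "fst kl < fst ij" | "snd ij < snd kl" | "snd kl < snd ij"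
    using assms(3) by (metis linorder_neq_iff prod.expand)
  then show ?thesis
  proof cases
    case 1
    then show ?thesis using *[OF 1] assms by (intro negligible_subset[OF xy.negligible_line(1)[of "X (fst ij)"]]) (auto simp: K_def crect_def)
  next
    case 2
    then show ?thesis using *[OF 2] assms by (intro negligible_subset[OF xy.negligible_line(1)[of "X (fst kl)"]]) (auto simp: K_def crect_def)
  next
    case 3
    then show ?thesis using **[OF 3] assms by (intro negligible_subset[OF xy.negligible_line(2)[of "Y (snd ij)"]]) (auto simp: K_def crect_def)
  next
    case 4
    then show ?thesis using **[OF 4] assms by (intro negligible_subset[OF xy.negligible_line(2)[of "Y (snd kl)"]]) (auto simp: K_def crect_def)
  qed
qed

lemma UK_sets [simp]: "(\<Union>ij\<in>EL. K ij) \<in> sets lebesgue"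
  using finite_EL by (intro sets.finite_UN) auto

lemma integral_\<Omega>_UK: "(LINT p|lebesgue_on \<Omega>. f p) = (LINT p|lebesgue_on (\<Union>ij\<in>EL. K ij). (f p :: real))"
proof (rule integral_lebesgue_on_cong_set)
  have "\<Omega> - (\<Union>ij\<in>EL. K ij) = {}" using \<Omega>_subset by blast
  then show "negligible (\<Omega> - (\<Union>ij\<in>EL. K ij))" by simp
qed (simp_all add: negligible_UK_diff)

lemma integral_\<Omega>:
  fixes f :: "plane \<Rightarrow> real"
  assumes "integrable (lebesgue_on \<Omega>) f"
  shows "(LINT p|lebesgue_on \<Omega>. f p) = (\<Sum>ij\<in>EL. LINT p|lebesgue_on (K ij). f p)"
  unfolding integral_\<Omega>_UK
proof (rule integral_lebesgue_on_union[OF finite_EL])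
  show "negligible (K i \<inter> K j)" if "i \<in> EL" "j \<in> EL" "i \<noteq> j" for i j
    by (rule negligible_K_Int) (use that EL_bounds in \<open>auto simp: mem_Times_iff\<close>)
  show "integrable (lebesgue_on (\<Union>ij\<in>EL. K ij)) f"
    by (rule integrable_lebesgue_on_mono[OF UK_sets \<Omega>_sets negligible_UK_diff assms])
qed simp

lemma L2_K: "f \<in> L2_space \<Omega> \<Longrightarrow> ij \<in> EL \<Longrightarrow> f \<in> L2_space (K ij)"
  by (rule L2_mono[OF K_sets(1) \<Omega>_sets negligible_K_diff])

lemma AE_K: "AE p in lebesgue_on \<Omega>. P p \<Longrightarrow> ij \<in> EL \<Longrightarrow> AE p in lebesgue_on (K ij). P p"
  by (rule AE_lebesgue_on_mono[OF K_sets(1) \<Omega>_sets negligible_K_diff])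

lemma AE_\<Omega>:
  assumes "\<And>ij. ij \<in> EL \<Longrightarrow> AE p in lebesgue_on (K ij). P p"
  shows "AE p in lebesgue_on \<Omega>. P p"
proof -
  have "AE p in lebesgue. \<forall>ij\<in>EL. p \<in> K ij \<longrightarrow> P p"
    using assms by (intro AE_finite_allI finite_EL) (simp add: AE_restrict_space_iff)
  then have "AE p in lebesgue. p \<in> \<Omega> \<longrightarrow> P p" by eventually_elim (use \<Omega>_subset in blast)
  then show ?thesis by (simp add: AE_restrict_space_iff)
qed

lemma L2_inner_\<Omega>:
  fixes f g :: "plane \<Rightarrow> 'b::euclidean_space"
  assumes "f \<in> L2_space \<Omega>" "g \<in> L2_space \<Omega>"
  shows "L2_inner \<Omega> f g = (\<Sum>ij\<in>EL. L2_inner (K ij) f g)"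
  unfolding L2_inner_def by (rule integral_\<Omega>[OF L2_integrable_inner[OF assms]])

lemma AE_zero_\<Omega>:
  fixes f :: "plane \<Rightarrow> real"
  assumes f: "f \<in> L2_space \<Omega>"
    and z: "\<And>p q. tensor_test fst snd \<Omega> p q \<Longrightarrow> (LINT z|lebesgue_on \<Omega>. f z * (p (fst z) * q (snd z))) = 0"
  shows "AE p in lebesgue_on \<Omega>. f p = 0"
proof (rule AE_\<Omega>)
  fix ij assume ij: "ij \<in> EL"
  show "AE p in lebesgue_on (K ij). f p = 0"
    unfolding K_def
  proof (rule xy.AE_zero_if_tensor_tests_zero)
    show "f \<in> L2_space (crect fst snd (X (fst ij - 1)) (X (fst ij)) (Y (snd ij - 1)) (Y (snd ij)))"
      using L2_K[OF f ij] by (simp add: K_def)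
    fix p q assume t: "tensor_test fst snd (orect fst snd (X (fst ij - 1)) (X (fst ij)) (Y (snd ij - 1)) (Y (snd ij))) p q"
    then have tO: "tensor_test fst snd (OK ij) p q" by (simp add: OK_def)
    have "(LINT z|lebesgue_on \<Omega>. f z * (p (fst z) * q (snd z))) = (LINT z|lebesgue_on (OK ij). f z * (p (fst z) * q (snd z)))"
      using test_function_zero[OF tensor_test_fst_snd[OF tO]] OK_subset[OF ij] by (intro integral_supported) auto
    then show "(LINT z|lebesgue_on (orect fst snd (X (fst ij - 1)) (X (fst ij)) (Y (snd ij - 1)) (Y (snd ij))). f z * (p (fst z) * q (snd z))) = 0"
      using z[OF tensor_test_mono[OF tO OK_subset[OF ij]]] by (simp add: OK_def)
  qed (use EL_bounds[OF ij] in auto)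
qed

lemma test_function_L2:
  assumes "\<phi> \<in> test_functions \<Omega>"
  shows "\<phi> \<in> L2_space \<Omega>" "(\<lambda>p. (dx \<phi> p, dy \<phi> p)) \<in> L2_space \<Omega>"
  using test_function_continuous[OF assms] continuous_L2[OF _ \<Omega>_bounded \<Omega>_sets] L2_Pair by blast+

section \<open>Uniqueness and linearity of the weak divergence\<close>

lemma weak_div_unique:
  assumes "is_weak_div \<Omega> \<tau> v" "is_weak_div \<Omega> \<tau> w" "v \<in> L2_space \<Omega>" "w \<in> L2_space \<Omega>"
  shows "AE p in lebesgue_on \<Omega>. v p = w p"
proof -
  have "AE p in lebesgue_on \<Omega>. v p - w p = 0"
  proof (rule AE_zero_\<Omega>[OF L2_diff[OF assms(3,4)]])
    fix p q assume t: "tensor_test fst snd \<Omega> p q"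
    note \<phi> = tensor_test_fst_snd[OF t]
    have "L2_inner \<Omega> v (\<lambda>z. p (fst z) * q (snd z)) = L2_inner \<Omega> w (\<lambda>z. p (fst z) * q (snd z))"
      using assms(1,2) \<phi> unfolding is_weak_div_def by fastforce
    then have "L2_inner \<Omega> (\<lambda>z. v z - w z) (\<lambda>z. p (fst z) * q (snd z)) = 0"
      using L2_inner_diff_left[OF assms(3,4) test_function_L2(1)[OF \<phi>]] by simp
    then show "(LINT z|lebesgue_on \<Omega>. (v z - w z) * (p (fst z) * q (snd z))) = 0" by (simp add: L2_inner_def)
  qed
  then show ?thesis by eventually_elim simp
qed

lemma weak_div_props:
  assumes "\<tau> \<in> H_div \<Omega>"
  shows "weak_div \<Omega> \<tau> \<in> L2_space \<Omega>" "is_weak_div \<Omega> \<tau> (weak_div \<Omega> \<tau>)" "\<tau> \<in> L2_space \<Omega>"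
proof -
  have ex: "\<exists>w. w \<in> L2_space \<Omega> \<and> is_weak_div \<Omega> \<tau> w" and L: "\<tau> \<in> L2_space \<Omega>" using assms by (auto simp: H_div_def)
  have "weak_div \<Omega> \<tau> \<in> L2_space \<Omega> \<and> is_weak_div \<Omega> \<tau> (weak_div \<Omega> \<tau>)"
    unfolding weak_div_def by (rule someI_ex[OF ex])
  with L show "weak_div \<Omega> \<tau> \<in> L2_space \<Omega>" "is_weak_div \<Omega> \<tau> (weak_div \<Omega> \<tau>)" "\<tau> \<in> L2_space \<Omega>" by auto
qed

lemma weak_div_AE:
  assumes "is_weak_div \<Omega> \<tau> w" "w \<in> L2_space \<Omega>" "\<tau> \<in> L2_space \<Omega>"
  shows "AE p in lebesgue_on \<Omega>. weak_div \<Omega> \<tau> p = w p" "\<tau> \<in> H_div \<Omega>"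
proof -
  show H: "\<tau> \<in> H_div \<Omega>" using assms by (auto simp: H_div_def)
  show "AE p in lebesgue_on \<Omega>. weak_div \<Omega> \<tau> p = w p"
    by (rule weak_div_unique[OF weak_div_props(2)[OF H] assms(1) weak_div_props(1)[OF H] assms(2)])
qed

lemma weak_div_add:
  assumes "\<sigma> \<in> H_div \<Omega>" "\<tau> \<in> H_div \<Omega>"
  shows "(\<lambda>p. \<sigma> p + \<tau> p) \<in> H_div \<Omega>"
    "AE p in lebesgue_on \<Omega>. weak_div \<Omega> (\<lambda>p. \<sigma> p + \<tau> p) p = weak_div \<Omega> \<sigma> p + weak_div \<Omega> \<tau> p"
proof -
  note 1 = weak_div_props[OF assms(1)] and 2 = weak_div_props[OF assms(2)]
  have w: "is_weak_div \<Omega> (\<lambda>p. \<sigma> p + \<tau> p) (\<lambda>p. weak_div \<Omega> \<sigma> p + weak_div \<Omega> \<tau> p)"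
    unfolding is_weak_div_def
  proof
    fix \<phi> assume \<phi>: "\<phi> \<in> test_functions \<Omega>"
    note L = test_function_L2[OF \<phi>]
    show "L2_inner \<Omega> (\<lambda>p. \<sigma> p + \<tau> p) (\<lambda>p. (dx \<phi> p, dy \<phi> p)) = - L2_inner \<Omega> (\<lambda>p. weak_div \<Omega> \<sigma> p + weak_div \<Omega> \<tau> p) \<phi>"
      using 1(2) 2(2) \<phi> L2_inner_add_left[OF 1(3) 2(3) L(2)] L2_inner_add_left[OF 1(1) 2(1) L(1)]
      unfolding is_weak_div_def by simp
  qed
  show "(\<lambda>p. \<sigma> p + \<tau> p) \<in> H_div \<Omega>"
    "AE p in lebesgue_on \<Omega>. weak_div \<Omega> (\<lambda>p. \<sigma> p + \<tau> p) p = weak_div \<Omega> \<sigma> p + weak_div \<Omega> \<tau> p"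
    using weak_div_AE[OF w L2_add[OF 1(1) 2(1)] L2_add[OF 1(3) 2(3)]] by auto
qed

lemma weak_div_scaleR:
  assumes "\<tau> \<in> H_div \<Omega>"
  shows "(\<lambda>p. c *\<^sub>R \<tau> p) \<in> H_div \<Omega>"
    "AE p in lebesgue_on \<Omega>. weak_div \<Omega> (\<lambda>p. c *\<^sub>R \<tau> p) p = c * weak_div \<Omega> \<tau> p"
proof -
  note 1 = weak_div_props[OF assms]
  have w: "is_weak_div \<Omega> (\<lambda>p. c *\<^sub>R \<tau> p) (\<lambda>p. c * weak_div \<Omega> \<tau> p)"
    unfolding is_weak_div_def
  proof
    fix \<phi> assume \<phi>: "\<phi> \<in> test_functions \<Omega>"
    show "L2_inner \<Omega> (\<lambda>p. c *\<^sub>R \<tau> p) (\<lambda>p. (dx \<phi> p, dy \<phi> p)) = - L2_inner \<Omega> (\<lambda>p. c * weak_div \<Omega> \<tau> p) \<phi>"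
      using 1(2) \<phi> unfolding is_weak_div_def L2_inner_scaleR_left L2_inner_cmult_left by simp
  qed
  show "(\<lambda>p. c *\<^sub>R \<tau> p) \<in> H_div \<Omega>"
    "AE p in lebesgue_on \<Omega>. weak_div \<Omega> (\<lambda>p. c *\<^sub>R \<tau> p) p = c * weak_div \<Omega> \<tau> p"
    using weak_div_AE[OF w L2_cmult[OF 1(1)] L2_scaleR[OF 1(3)]] by auto
qed

lemma weak_div_zero: "(\<lambda>_. 0) \<in> H_div \<Omega>" "AE p in lebesgue_on \<Omega>. weak_div \<Omega> (\<lambda>_. 0) p = 0"
proof -
  have "is_weak_div \<Omega> (\<lambda>_. 0) (\<lambda>_. 0)" by (simp add: is_weak_div_def)
  from weak_div_AE[OF this] show "(\<lambda>_. 0) \<in> H_div \<Omega>" "AE p in lebesgue_on \<Omega>. weak_div \<Omega> (\<lambda>_. 0) p = 0" by auto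
qed

lemma weak_div_diff:
  assumes "\<sigma> \<in> H_div \<Omega>" "\<tau> \<in> H_div \<Omega>"
  shows "(\<lambda>p. \<sigma> p - \<tau> p) \<in> H_div \<Omega>"
    "AE p in lebesgue_on \<Omega>. weak_div \<Omega> (\<lambda>p. \<sigma> p - \<tau> p) p = weak_div \<Omega> \<sigma> p - weak_div \<Omega> \<tau> p"
proof -
  note m = weak_div_scaleR[OF assms(2), of "-1"]
  note a = weak_div_add[OF assms(1) m(1)]
  show "(\<lambda>p. \<sigma> p - \<tau> p) \<in> H_div \<Omega>" using a(1) by simp
  show "AE p in lebesgue_on \<Omega>. weak_div \<Omega> (\<lambda>p. \<sigma> p - \<tau> p) p = weak_div \<Omega> \<sigma> p - weak_div \<Omega> \<tau> p"
    using a(2) m(2) by eventually_elim simp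
qed

subsection \<open>The finite element spaces\<close>

lemma Sigma_h_alt: "\<tau> \<in> Sigma_h \<Omega> G \<longleftrightarrow> \<tau> \<in> H_div \<Omega> \<and>
    (\<forall>ij\<in>EL. \<exists>\<alpha> \<beta> \<gamma> \<delta>. AE p in lebesgue_on (K ij). \<tau> p = (\<alpha> + \<beta> * fst p, \<gamma> + \<delta> * snd p))"
proof -
  have "(\<exists>q\<in>Q_poly 1 0. \<exists>r\<in>Q_poly 0 1. AE p in M. \<tau> p = (q p, r p)) \<longleftrightarrow>
     (\<exists>\<alpha> \<beta> \<gamma> \<delta>. AE p in M. \<tau> p = (\<alpha> + \<beta> * fst p, \<gamma> + \<delta> * snd p))" for M
  proof
    assume "\<exists>q\<in>Q_poly 1 0. \<exists>r\<in>Q_poly 0 1. AE p in M. \<tau> p = (q p, r p)"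
    then obtain q r where qr: "q \<in> Q_poly 1 0" "r \<in> Q_poly 0 1" "AE p in M. \<tau> p = (q p, r p)" by blast
    from qr(1) obtain c where c: "\<And>x y. q (x, y) = (\<Sum>i\<le>1. \<Sum>j\<le>0. c i j * x ^ i * y ^ j)" by (auto simp: Q_poly_def)
    from qr(2) obtain e where e: "\<And>x y. r (x, y) = (\<Sum>i\<le>0. \<Sum>j\<le>1. e i j * x ^ i * y ^ j)" by (auto simp: Q_poly_def)
    have "q p = c 0 0 + c 1 0 * fst p" "r p = e 0 0 + e 0 1 * snd p" for p
      using c[of "fst p" "snd p"] e[of "fst p" "snd p"] by simp_all
    then show "\<exists>\<alpha> \<beta> \<gamma> \<delta>. AE p in M. \<tau> p = (\<alpha> + \<beta> * fst p, \<gamma> + \<delta> * snd p)" using qr(3) by auto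
  next
    assume "\<exists>\<alpha> \<beta> \<gamma> \<delta>. AE p in M. \<tau> p = (\<alpha> + \<beta> * fst p, \<gamma> + \<delta> * snd p)"
    then obtain \<alpha> \<beta> \<gamma> \<delta> where *: "AE p in M. \<tau> p = (\<alpha> + \<beta> * fst p, \<gamma> + \<delta> * snd p)" by blast
    have "(\<lambda>p. \<alpha> + \<beta> * fst p) \<in> Q_poly 1 0"
      unfolding Q_poly_def by (intro CollectI exI[of _ "\<lambda>i j. if i = 0 then \<alpha> else \<beta>"]) simp
    moreover have "(\<lambda>p. \<gamma> + \<delta> * snd p) \<in> Q_poly 0 1"
      unfolding Q_poly_def by (intro CollectI exI[of _ "\<lambda>i j. if j = 0 then \<gamma> else \<delta>"]) simp
    ultimately show "\<exists>q\<in>Q_poly 1 0. \<exists>r\<in>Q_poly 0 1. AE p in M. \<tau> p = (q p, r p)"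
      using * by (intro bexI[of _ "\<lambda>p. \<alpha> + \<beta> * fst p"] bexI[of _ "\<lambda>p. \<gamma> + \<delta> * snd p"])
  qed
  then show ?thesis unfolding Sigma_h_def EL_def cell_K by blast
qed

lemma V_h_alt: "v \<in> V_h \<Omega> G \<longleftrightarrow> v \<in> L2_space \<Omega> \<and> (\<forall>ij\<in>EL. \<exists>c. AE p in lebesgue_on (K ij). v p = c)"
  unfolding V_h_def EL_def cell_K by blast

lemma Sigma_h_subspace: "L2_subspace \<Omega> (Sigma_h \<Omega> G)"
  unfolding L2_subspace_def
proof (intro conjI ballI allI)
  show "Sigma_h \<Omega> G \<subseteq> L2_space \<Omega>" by (auto simp: Sigma_h_def H_div_def)
  have "AE p in lebesgue_on (K ij). (0 :: plane) = (0 + 0 * fst p, 0 + 0 * snd p)" for ij by (simp add: zero_prod_def)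
  then show "(\<lambda>_. 0) \<in> Sigma_h \<Omega> G" unfolding Sigma_h_alt using weak_div_zero(1) by blast
  show "(\<lambda>p. \<sigma> p + \<tau> p) \<in> Sigma_h \<Omega> G" if \<sigma>\<tau>: "\<sigma> \<in> Sigma_h \<Omega> G" "\<tau> \<in> Sigma_h \<Omega> G" for \<sigma> \<tau>
    unfolding Sigma_h_alt
  proof (intro conjI ballI)
    show "(\<lambda>p. \<sigma> p + \<tau> p) \<in> H_div \<Omega>" using \<sigma>\<tau> weak_div_add(1) by (auto simp: Sigma_h_alt)
    fix ij assume ij: "ij \<in> EL"
    obtain \<alpha> \<beta> \<gamma> \<delta> where 1: "AE p in lebesgue_on (K ij). \<sigma> p = (\<alpha> + \<beta> * fst p, \<gamma> + \<delta> * snd p)"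
      using \<sigma>\<tau>(1) ij unfolding Sigma_h_alt by blast
    obtain \<alpha>' \<beta>' \<gamma>' \<delta>' where 2: "AE p in lebesgue_on (K ij). \<tau> p = (\<alpha>' + \<beta>' * fst p, \<gamma>' + \<delta>' * snd p)"
      using \<sigma>\<tau>(2) ij unfolding Sigma_h_alt by blast
    have "AE p in lebesgue_on (K ij). \<sigma> p + \<tau> p = ((\<alpha> + \<alpha>') + (\<beta> + \<beta>') * fst p, (\<gamma> + \<gamma>') + (\<delta> + \<delta>') * snd p)"
      using 1 2 by eventually_elim (simp add: algebra_simps)
    then show "\<exists>\<alpha> \<beta> \<gamma> \<delta>. AE p in lebesgue_on (K ij). \<sigma> p + \<tau> p = (\<alpha> + \<beta> * fst p, \<gamma> + \<delta> * snd p)" by blast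
  qed
  show "(\<lambda>p. c *\<^sub>R \<tau> p) \<in> Sigma_h \<Omega> G" if \<tau>: "\<tau> \<in> Sigma_h \<Omega> G" for \<tau> c
    unfolding Sigma_h_alt
  proof (intro conjI ballI)
    show "(\<lambda>p. c *\<^sub>R \<tau> p) \<in> H_div \<Omega>" using \<tau> weak_div_scaleR(1) by (auto simp: Sigma_h_alt)
    fix ij assume ij: "ij \<in> EL"
    obtain \<alpha> \<beta> \<gamma> \<delta> where 1: "AE p in lebesgue_on (K ij). \<tau> p = (\<alpha> + \<beta> * fst p, \<gamma> + \<delta> * snd p)"
      using \<tau> ij unfolding Sigma_h_alt by blast
    have "AE p in lebesgue_on (K ij). c *\<^sub>R \<tau> p = (c * \<alpha> + (c * \<beta>) * fst p, c * \<gamma> + (c * \<delta>) * snd p)"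
      using 1 by eventually_elim (simp add: algebra_simps)
    then show "\<exists>\<alpha> \<beta> \<gamma> \<delta>. AE p in lebesgue_on (K ij). c *\<^sub>R \<tau> p = (\<alpha> + \<beta> * fst p, \<gamma> + \<delta> * snd p)" by blast
  qed
qed

lemma V_h_subspace: "L2_subspace \<Omega> (V_h \<Omega> G)"
  unfolding L2_subspace_def
proof (intro conjI ballI allI)
  show "V_h \<Omega> G \<subseteq> L2_space \<Omega>" "(\<lambda>_. 0) \<in> V_h \<Omega> G" by (auto simp: V_h_alt)
  show "(\<lambda>p. u p + v p) \<in> V_h \<Omega> G" if uv: "u \<in> V_h \<Omega> G" "v \<in> V_h \<Omega> G" for u v
    unfolding V_h_alt
  proof (intro conjI ballI)
    show "(\<lambda>p. u p + v p) \<in> L2_space \<Omega>" using uv by (auto simp: V_h_alt)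
    fix ij assume ij: "ij \<in> EL"
    obtain c c' where "AE p in lebesgue_on (K ij). u p = c" "AE p in lebesgue_on (K ij). v p = c'"
      using uv ij unfolding V_h_alt by blast
    then have "AE p in lebesgue_on (K ij). u p + v p = c + c'" by eventually_elim simp
    then show "\<exists>c. AE p in lebesgue_on (K ij). u p + v p = c" by blast
  qed
  show "(\<lambda>p. c *\<^sub>R v p) \<in> V_h \<Omega> G" if v: "v \<in> V_h \<Omega> G" for v c
    unfolding V_h_alt
  proof (intro conjI ballI)
    show "(\<lambda>p. c *\<^sub>R v p) \<in> L2_space \<Omega>" using v by (auto simp: V_h_alt)
    fix ij assume ij: "ij \<in> EL"
    obtain c' where "AE p in lebesgue_on (K ij). v p = c'"
      using v ij unfolding V_h_alt by blast
    then have "AE p in lebesgue_on (K ij). c *\<^sub>R v p = c * c'" by eventually_elim simp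
    then show "\<exists>c'. AE p in lebesgue_on (K ij). c *\<^sub>R v p = c'" by blast
  qed
qed

text \<open>A test function supported in one open cell sees only the derivatives of the components
  on that cell. The globally chosen \<open>weak_div\<close> is thereby computed cell by
  cell.\<close>

lemma weak_div_local:
  assumes \<tau>: "\<tau> \<in> H_div \<Omega>" and ij: "ij \<in> EL"
    and f: "f1 \<in> L2_space (K ij)" "f2 \<in> L2_space (K ij)"
    and wp: "weak_partial fst snd (OK ij) (\<lambda>p. fst (\<tau> p)) f1" "weak_partial snd fst (OK ij) (\<lambda>p. snd (\<tau> p)) f2"
  shows "AE p in lebesgue_on (K ij). weak_div \<Omega> \<tau> p = f1 p + f2 p"
proof -
  note W = weak_div_props[OF \<tau>]
  have OK_K: "f \<in> L2_space (OK ij)" if "f \<in> L2_space (K ij)" for f :: "plane \<Rightarrow> real"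
    by (rule L2_subset[OF K_sets(2,1) _ that]) (auto simp: K_def OK_def xy.orect_subset_crect)
  have "AE p in lebesgue_on (K ij). weak_div \<Omega> \<tau> p - (f1 p + f2 p) = 0"
    unfolding K_def
  proof (rule xy.AE_zero_if_tensor_tests_zero)
    show "(\<lambda>p. weak_div \<Omega> \<tau> p - (f1 p + f2 p)) \<in> L2_space (crect fst snd (X (fst ij - 1)) (X (fst ij)) (Y (snd ij - 1)) (Y (snd ij)))"
      using L2_diff[OF L2_K[OF W(1) ij] L2_add[OF f]] by (simp add: K_def)
    fix p q assume "tensor_test fst snd (orect fst snd (X (fst ij - 1)) (X (fst ij)) (Y (snd ij - 1)) (Y (snd ij))) p q"
    then have t: "tensor_test fst snd (OK ij) p q" by (simp add: OK_def)
    then have t': "tensor_test snd fst (OK ij) q p" using tensor_test_swap by blast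
    define \<phi> where "\<phi> = (\<lambda>z :: plane. p (fst z) * q (snd z))"
    have sm: "smooth p" "smooth q" using t by (auto simp: tensor_test_def)
    have \<phi>O: "\<phi> \<in> test_functions (OK ij)" unfolding \<phi>_def by (rule tensor_test_fst_snd[OF t])
    have \<phi>\<Omega>: "\<phi> \<in> test_functions \<Omega>" unfolding \<phi>_def by (rule tensor_test_fst_snd[OF tensor_test_mono[OF t OK_subset[OF ij]]])
    have d: "dx \<phi> = (\<lambda>z. deriv p (fst z) * q (snd z))" "dy \<phi> = (\<lambda>z. p (fst z) * deriv q (snd z))"
      unfolding \<phi>_def by (simp_all add: dx_tensor dy_tensor sm)
    have tx: "(\<lambda>z. deriv p (fst z) * q (snd z)) \<in> test_functions (OK ij)"
      by (rule tensor_test_fst_snd[OF tensor_test_deriv[OF t]])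
    have ty: "(\<lambda>z. p (fst z) * deriv q (snd z)) \<in> test_functions (OK ij)"
      using tensor_test_fst_snd tensor_test_swap tensor_test_deriv[OF t'] by blast
    have z: "\<phi> z = 0" "dx \<phi> z = 0" "dy \<phi> z = 0" if "z \<notin> OK ij" for z
      using test_function_zero[OF \<phi>O that] test_function_zero[OF tx that] test_function_zero[OF ty that] by (simp_all add: d)
    have bO: "bounded (OK ij)" by (rule bounded_subset[OF \<Omega>_bounded OK_subset[OF ij]])
    have cO: "f \<in> L2_space (OK ij)" if "continuous_on UNIV f" for f :: "plane \<Rightarrow> real"
      by (rule continuous_L2[OF that bO]) simp
    note cont = test_function_continuous[OF \<phi>O]
    have \<tau>O: "(\<lambda>p. fst (\<tau> p)) \<in> L2_space (OK ij)" "(\<lambda>p. snd (\<tau> p)) \<in> L2_space (OK ij)" "weak_div \<Omega> \<tau> \<in> L2_space (OK ij)"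
      using L2_subset[OF K_sets(2) \<Omega>_sets OK_subset[OF ij]] L2_fst[OF W(3)] L2_snd[OF W(3)] W(1) by blast+
    let ?J = "\<lambda>k. (LINT z|lebesgue_on (OK ij). k z) :: real"
    have "L2_inner \<Omega> \<tau> (\<lambda>p. (dx \<phi> p, dy \<phi> p)) = - L2_inner \<Omega> (weak_div \<Omega> \<tau>) \<phi>"
      using W(2) \<phi>\<Omega> unfolding is_weak_div_def by blast
    moreover have "L2_inner \<Omega> \<tau> (\<lambda>p. (dx \<phi> p, dy \<phi> p)) = ?J (\<lambda>z. fst (\<tau> z) * dx \<phi> z + snd (\<tau> z) * dy \<phi> z)"
      unfolding L2_inner_def by (subst integral_supported[OF \<Omega>_sets K_sets(2) OK_subset[OF ij]]) (auto simp: z inner_prod_def)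
    moreover have "\<dots> = ?J (\<lambda>z. fst (\<tau> z) * dx \<phi> z) + ?J (\<lambda>z. snd (\<tau> z) * dy \<phi> z)"
      by (intro Bochner_Integration.integral_add L2_integrable_mult \<tau>O cO cont)
    moreover have "L2_inner \<Omega> (weak_div \<Omega> \<tau>) \<phi> = ?J (\<lambda>z. weak_div \<Omega> \<tau> z * \<phi> z)"
      unfolding L2_inner_def by (subst integral_supported[OF \<Omega>_sets K_sets(2) OK_subset[OF ij]]) (auto simp: z)
    moreover have "?J (\<lambda>z. fst (\<tau> z) * dx \<phi> z) = - ?J (\<lambda>z. f1 z * \<phi> z)"
      unfolding d unfolding \<phi>_def using wp(1) t unfolding weak_partial_def by blast
    moreover have "?J (\<lambda>z. snd (\<tau> z) * dy \<phi> z) = - ?J (\<lambda>z. f2 z * \<phi> z)"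
      unfolding d unfolding \<phi>_def using wp(2) t' unfolding weak_partial_def by (simp add: mult.commute)
    ultimately have "?J (\<lambda>z. weak_div \<Omega> \<tau> z * \<phi> z) = ?J (\<lambda>z. f1 z * \<phi> z) + ?J (\<lambda>z. f2 z * \<phi> z)" by simp
    moreover have "?J (\<lambda>z. (weak_div \<Omega> \<tau> z - (f1 z + f2 z)) * \<phi> z) = ?J (\<lambda>z. weak_div \<Omega> \<tau> z * \<phi> z) - (?J (\<lambda>z. f1 z * \<phi> z) + ?J (\<lambda>z. f2 z * \<phi> z))"
    proof -
      have "?J (\<lambda>z. (weak_div \<Omega> \<tau> z - (f1 z + f2 z)) * \<phi> z) = ?J (\<lambda>z. weak_div \<Omega> \<tau> z * \<phi> z - (f1 z * \<phi> z + f2 z * \<phi> z))"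
        by (intro Bochner_Integration.integral_cong) (simp_all add: algebra_simps)
      also have "\<dots> = ?J (\<lambda>z. weak_div \<Omega> \<tau> z * \<phi> z) - (?J (\<lambda>z. f1 z * \<phi> z) + ?J (\<lambda>z. f2 z * \<phi> z))"
        using L2_integrable_mult[OF \<tau>O(3) cO[OF cont(1)]] L2_integrable_mult[OF OK_K[OF f(1)] cO[OF cont(1)]]
          L2_integrable_mult[OF OK_K[OF f(2)] cO[OF cont(1)]] by simp
      finally show ?thesis .
    qed
    ultimately show "(LINT z|lebesgue_on (orect fst snd (X (fst ij - 1)) (X (fst ij)) (Y (snd ij - 1)) (Y (snd ij))).
        (weak_div \<Omega> \<tau> z - (f1 z + f2 z)) * (p (fst z) * q (snd z))) = 0"
      by (simp add: OK_def \<phi>_def)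
  qed (use EL_bounds[OF ij] in auto)
  then show ?thesis by eventually_elim simp
qed

lemma weak_partial_AE_cong:
  assumes "weak_partial s t U f g" "AE p in lebesgue_on U. f' p = f p"
    "f \<in> borel_measurable (lebesgue_on U)" "f' \<in> borel_measurable (lebesgue_on U)" and "coords s t" "U \<in> sets lebesgue"
  shows "weak_partial s t U f' g"
  unfolding weak_partial_def
proof (intro allI impI)
  fix p q assume t: "tensor_test s t U p q"
  interpret coords s t by fact
  have m: "(\<lambda>z. deriv p (s z)) \<in> borel_measurable (lebesgue_on U)" "(\<lambda>z. q (t z)) \<in> borel_measurable (lebesgue_on U)"
    using t assms(6) by (auto simp: tensor_test_def intro!: measurable_coord smooth_continuous_on smooth_deriv)
  have "(LINT z|lebesgue_on U. f' z * (deriv p (s z) * q (t z))) = (LINT z|lebesgue_on U. f z * (deriv p (s z) * q (t z)))"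
  proof (rule integral_cong_AE)
    show "AE z in lebesgue_on U. f' z * (deriv p (s z) * q (t z)) = f z * (deriv p (s z) * q (t z))"
      using assms(2) by eventually_elim simp
  qed (use m assms(3,4) in measurable)
  then show "(LINT z|lebesgue_on U. f' z * (deriv p (s z) * q (t z))) = - (LINT z|lebesgue_on U. g z * (p (s z) * q (t z)))"
    using assms(1) t unfolding weak_partial_def by simp
qed

lemma Sigma_h_affine:
  assumes \<tau>: "\<tau> \<in> Sigma_h \<Omega> G" and ij: "ij \<in> EL"
  obtains \<alpha> \<beta> \<gamma> \<delta> where "AE p in lebesgue_on (K ij). \<tau> p = (\<alpha> + \<beta> * fst p, \<gamma> + \<delta> * snd p)"
    "AE p in lebesgue_on (K ij). weak_div \<Omega> \<tau> p = \<beta> + \<delta>"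
proof -
  obtain \<alpha> \<beta> \<gamma> \<delta> where 1: "AE p in lebesgue_on (K ij). \<tau> p = (\<alpha> + \<beta> * fst p, \<gamma> + \<delta> * snd p)"
    using \<tau> ij unfolding Sigma_h_alt by blast
  have H: "\<tau> \<in> H_div \<Omega>" using \<tau> by (simp add: Sigma_h_alt)
  have OKK: "OK ij - K ij = {}" using xy.orect_subset_crect by (auto simp: K_def OK_def)
  have ae: "AE p in lebesgue_on (OK ij). \<tau> p = (\<alpha> + \<beta> * fst p, \<gamma> + \<delta> * snd p)"
    by (rule AE_lebesgue_on_mono[OF K_sets(2,1) _ 1]) (simp add: OKK)
  have mO: "f \<in> borel_measurable (lebesgue_on (OK ij))" if "f \<in> L2_space \<Omega>" for f :: "plane \<Rightarrow> real"
    using L2_measurable[OF L2_subset[OF K_sets(2) \<Omega>_sets OK_subset[OF ij] that]] .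
  have ax: "weak_partial fst snd (OK ij) (\<lambda>z. \<alpha> + \<beta> * fst z) (\<lambda>_. \<beta>)"
    unfolding OK_def by (rule xy.weak_partial_affine)
  have ay: "weak_partial snd fst (OK ij) (\<lambda>z. \<gamma> + \<delta> * snd z) (\<lambda>_. \<delta>)"
    unfolding OK_swap by (rule yx.weak_partial_affine)
  have "weak_partial fst snd (OK ij) (\<lambda>p. fst (\<tau> p)) (\<lambda>_. \<beta>)"
  proof (rule weak_partial_AE_cong[OF ax])
    show "AE p in lebesgue_on (OK ij). fst (\<tau> p) = \<alpha> + \<beta> * fst p" using ae by eventually_elim simp
    show "(\<lambda>z. \<alpha> + \<beta> * fst z) \<in> borel_measurable (lebesgue_on (OK ij))"
      by (intro continuous_imp_measurable_on_sets_lebesgue continuous_intros) simp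
    show "(\<lambda>p. fst (\<tau> p)) \<in> borel_measurable (lebesgue_on (OK ij))"
      by (rule mO[OF L2_fst[OF weak_div_props(3)[OF H]]])
  qed (simp_all add: xy.coords_axioms)
  moreover have "weak_partial snd fst (OK ij) (\<lambda>p. snd (\<tau> p)) (\<lambda>_. \<delta>)"
  proof (rule weak_partial_AE_cong[OF ay])
    show "AE p in lebesgue_on (OK ij). snd (\<tau> p) = \<gamma> + \<delta> * snd p" using ae by eventually_elim simp
    show "(\<lambda>z. \<gamma> + \<delta> * snd z) \<in> borel_measurable (lebesgue_on (OK ij))"
      by (intro continuous_imp_measurable_on_sets_lebesgue continuous_intros) simp
    show "(\<lambda>p. snd (\<tau> p)) \<in> borel_measurable (lebesgue_on (OK ij))"
      by (rule mO[OF L2_snd[OF weak_div_props(3)[OF H]]])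
  qed (simp_all add: yx.coords_axioms)
  ultimately have "AE p in lebesgue_on (K ij). weak_div \<Omega> \<tau> p = \<beta> + \<delta>"
  proof (rule weak_div_local[OF H ij, rotated 2])
    show "(\<lambda>_. \<beta>) \<in> L2_space (K ij)" "(\<lambda>_. \<delta>) \<in> L2_space (K ij)"
      by (rule L2_bounded[OF finite_measure_lebesgue_on[OF K_sets(3)]]; auto)+
  qed
  with 1 show ?thesis using that by blast
qed

lemma weak_div_V_h: "\<tau> \<in> Sigma_h \<Omega> G \<Longrightarrow> weak_div \<Omega> \<tau> \<in> V_h \<Omega> G"
proof -
  assume \<tau>: "\<tau> \<in> Sigma_h \<Omega> G"
  then have "weak_div \<Omega> \<tau> \<in> L2_space \<Omega>" using weak_div_props(1) by (simp add: Sigma_h_alt)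
  moreover have "\<exists>c. AE p in lebesgue_on (K ij). weak_div \<Omega> \<tau> p = c" if "ij \<in> EL" for ij
    using Sigma_h_affine[OF \<tau> that] by metis
  ultimately show ?thesis by (simp add: V_h_alt)
qed

end

section \<open>Completeness of the discrete eigenfunctions\<close>

text \<open>Parseval's identity for the orthonormal basis 1/sqrt w, sqrt(12/(w h^2)) (s - mid) of
  the functions affine in s; the second constant normalises s - mid, whose squared norm is w h^2 /
  12.\<close>

lemma (in coords) affine_norm_moments:
  assumes "a < b" "c < d"
  shows "(LINT z|lebesgue_on (crect s t a b c d). (\<alpha> + \<beta> * s z)\<^sup>2)
    = (LINT z|lebesgue_on (crect s t a b c d). (\<alpha> + \<beta> * s z) * (1 / sqrt ((b - a) * (d - c))))\<^sup>2
    + (LINT z|lebesgue_on (crect s t a b c d). (\<alpha> + \<beta> * s z) * (sqrt (12 / ((b - a) * (d - c) * (b - a)\<^sup>2)) * (s z - (a + b) / 2)))\<^sup>2"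
proof -
  \<comment> \<open>The zero functions are placeholders; only the moment formulas of the locale are
    wanted.\<close>
  interpret el: element s t a b c d "\<lambda>_. 0" "\<lambda>_. 0" "\<lambda>_. 0"
    by unfold_locales (simp_all add: assms weak_partial_def)
  define \<alpha>' where "\<alpha>' = \<alpha> + \<beta> * el.mid"
  have aff: "\<alpha> + \<beta> * s z = \<alpha>' + \<beta> * (s z - el.mid)" for z by (simp add: \<alpha>'_def algebra_simps)
  have w: "el.w > 0" "el.h > 0" by (rule el.hw)+
  have 1: "el.I (\<lambda>z. (\<alpha> + \<beta> * s z)\<^sup>2) = el.w * (\<alpha>'\<^sup>2 + \<beta>\<^sup>2 * el.h\<^sup>2 / 12)"
    unfolding aff by (rule el.integral_affine_sq)
  have 2: "el.I (\<lambda>z. (\<alpha> + \<beta> * s z) * (1 / sqrt el.w)) = \<alpha>' * el.w / sqrt el.w"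
    using el.integral_affine[of \<alpha>' \<beta>] unfolding aff by simp
  have 3: "el.I (\<lambda>z. (\<alpha> + \<beta> * s z) * (sqrt (12 / (el.w * el.h\<^sup>2)) * (s z - el.mid))) = sqrt (12 / (el.w * el.h\<^sup>2)) * (\<beta> * (el.w * el.h\<^sup>2 / 12))"
  proof -
    have "el.I (\<lambda>z. (\<alpha> + \<beta> * s z) * (sqrt (12 / (el.w * el.h\<^sup>2)) * (s z - el.mid)))
        = el.I (\<lambda>z. sqrt (12 / (el.w * el.h\<^sup>2)) * ((\<alpha>' + \<beta> * (s z - el.mid)) * (s z - el.mid)))"
      unfolding aff by (simp add: mult_ac)
    also have "\<dots> = sqrt (12 / (el.w * el.h\<^sup>2)) * (\<beta> * (el.w * el.h\<^sup>2 / 12))"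
      using el.integral_affine_moment[of \<alpha>' \<beta>] by simp
    finally show ?thesis .
  qed
  have 4: "(\<alpha>' * el.w / sqrt el.w)\<^sup>2 = \<alpha>'\<^sup>2 * el.w"
    using w by (simp add: power_divide power_mult_distrib power2_eq_square)
  have 5: "(sqrt (12 / (el.w * el.h\<^sup>2)) * (\<beta> * (el.w * el.h\<^sup>2 / 12)))\<^sup>2 = \<beta>\<^sup>2 * (el.w * el.h\<^sup>2) / 12"
  proof -
    define q where "q = el.w * el.h\<^sup>2"
    have q: "q > 0" using w by (simp add: q_def)
    have "(sqrt (12 / q) * (\<beta> * (q / 12)))\<^sup>2 = (12 / q) * (\<beta> * (q / 12))\<^sup>2"
      unfolding power_mult_distrib using q by (simp only: real_sqrt_pow2 divide_nonneg_pos zero_le_numeral)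
    also have "\<dots> = \<beta>\<^sup>2 * q / 12" using q by (simp add: power2_eq_square)
    finally show ?thesis by (simp add: q_def)
  qed
  have "el.I (\<lambda>z. (\<alpha> + \<beta> * s z)\<^sup>2) = (el.I (\<lambda>z. (\<alpha> + \<beta> * s z) * (1 / sqrt el.w)))\<^sup>2
    + (el.I (\<lambda>z. (\<alpha> + \<beta> * s z) * (sqrt (12 / (el.w * el.h\<^sup>2)) * (s z - el.mid))))\<^sup>2"
    unfolding 1 2 3 4 5 by (simp add: algebra_simps)
  then show ?thesis unfolding el.w_def el.h_def el.mid_def .
qed

context meshed
begin

section \<open>The discrete fields as a finite-dimensional space\<close>

lemma K_ext:
  fixes k :: "plane \<Rightarrow> real"
  assumes ij: "ij \<in> EL" and k: "continuous_on UNIV k"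
  shows "(\<lambda>p. if p \<in> K ij then k p else 0) \<in> L2_space \<Omega>"
    and "f \<in> L2_space \<Omega> \<Longrightarrow> (LINT p|lebesgue_on \<Omega>. f p * (if p \<in> K ij then k p else 0)) = (LINT p|lebesgue_on (K ij). f p * k p)"
proof -
  have kL: "k \<in> L2_space (K ij)" using k by (intro continuous_L2) (auto simp: K_def xy.crect_cbox)
  have "(\<lambda>p. if p \<in> K ij then k p else 0) = (\<lambda>p. indicator (K ij) p *\<^sub>R k p)" by (auto simp: indicator_def)
  moreover have "(\<lambda>p. indicator (K ij) p *\<^sub>R k p) \<in> borel_measurable (lebesgue_on \<Omega>)"
    using L2_measurable[OF kL] borel_measurable_restrict_space_iff[of "K ij" lebesgue k]
    by (intro measurable_restrict_space1) simp
  ultimately have m: "(\<lambda>p. if p \<in> K ij then k p else 0) \<in> borel_measurable (lebesgue_on \<Omega>)" by simp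
  have "compact (k ` K ij)" using k by (intro compact_continuous_image) (auto simp: K_def xy.crect_compact intro: continuous_on_subset)
  then obtain C where C: "\<And>p. p \<in> K ij \<Longrightarrow> norm (k p) \<le> C" using compact_imp_bounded bounded_iff by (metis imageI)
  show "(\<lambda>p. if p \<in> K ij then k p else 0) \<in> L2_space \<Omega>"
    by (rule L2_bounded[OF \<Omega>_finite_measure m, where C="max C 0"]) (use C in force)
  assume f: "f \<in> L2_space \<Omega>"
  have s: "\<Omega> \<inter> K ij \<in> sets lebesgue" by (rule sets.Int) simp_all
  have "(LINT p|lebesgue_on \<Omega>. f p * (if p \<in> K ij then k p else 0)) = (LINT p|lebesgue. indicator \<Omega> p * (f p * (if p \<in> K ij then k p else 0)))"
    by (rule integral_lebesgue_on_indicator) simp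
  also have "\<dots> = (LINT p|lebesgue. indicator (\<Omega> \<inter> K ij) p * (f p * k p))"
    by (intro Bochner_Integration.integral_cong) (auto simp: indicator_def)
  also have "\<dots> = (LINT p|lebesgue_on (\<Omega> \<inter> K ij). f p * k p)"
    by (rule integral_lebesgue_on_indicator(1)[OF s, symmetric])
  also have "\<dots> = (LINT p|lebesgue_on (K ij). f p * k p)"
  proof (rule integral_lebesgue_on_cong_set)
    have "\<Omega> \<inter> K ij - K ij = {}" by blast
    then show "negligible (\<Omega> \<inter> K ij - K ij)" by simp
    have "K ij - \<Omega> \<inter> K ij = K ij - \<Omega>" by blast
    then show "negligible (K ij - \<Omega> \<inter> K ij)" using negligible_K_diff[OF ij] by simp
  qed (use s in simp_all)
  finally show "(LINT p|lebesgue_on \<Omega>. f p * (if p \<in> K ij then k p else 0)) = (LINT p|lebesgue_on (K ij). f p * k p)" .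
qed

definition "k0 ij = (\<lambda>p :: plane. 1 / sqrt ((X (fst ij) - X (fst ij - 1)) * (Y (snd ij) - Y (snd ij - 1))))"
definition "kx ij = (\<lambda>p :: plane. sqrt (12 / ((X (fst ij) - X (fst ij - 1)) * (Y (snd ij) - Y (snd ij - 1)) * (X (fst ij) - X (fst ij - 1))\<^sup>2))
   * (fst p - (X (fst ij - 1) + X (fst ij)) / 2))"
definition "ky ij = (\<lambda>p :: plane. sqrt (12 / ((Y (snd ij) - Y (snd ij - 1)) * (X (fst ij) - X (fst ij - 1)) * (Y (snd ij) - Y (snd ij - 1))\<^sup>2))
   * (snd p - (Y (snd ij - 1) + Y (snd ij)) / 2))"

text \<open>Four functionals per element, a constant and a linear moment for each component,
  extended by zero. They form the finite family that bounds the dimension of subspaces of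
  \<open>Sigma_h\<close> in \<open>orthonormal_basis_exists\<close>.\<close>

definition "moment d = (let ij = fst d; e = (\<lambda>k p. if p \<in> K ij then k ij p else 0) in
   (\<lambda>p. if snd d = 0 then (e k0 p, 0) else if snd d = 1 then (e kx p, 0) else if snd d = 2 then (0, e k0 p) else (0, e ky p)))"
  for d :: "(nat \<times> nat) \<times> nat"

lemma Sigma_h_norm_moments:
  assumes \<tau>: "\<tau> \<in> Sigma_h \<Omega> G"
  shows "(L2_norm \<Omega> \<tau>)\<^sup>2 = (\<Sum>d\<in>EL \<times> {..<4}. (L2_inner \<Omega> \<tau> (moment d))\<^sup>2)"
proof -
  have L: "\<tau> \<in> L2_space \<Omega>" using \<tau> Sigma_h_subspace L2_subspace_L2 by blast
  note Lf = L2_fst[OF L] and Ls = L2_snd[OF L]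
  have cont: "continuous_on UNIV (k0 ij)" "continuous_on UNIV (kx ij)" "continuous_on UNIV (ky ij)" for ij
    unfolding k0_def kx_def ky_def by (intro continuous_intros)+
  have loc: "(LINT p|lebesgue_on (K ij). (fst (\<tau> p))\<^sup>2) = (LINT p|lebesgue_on (K ij). fst (\<tau> p) * k0 ij p)\<^sup>2 + (LINT p|lebesgue_on (K ij). fst (\<tau> p) * kx ij p)\<^sup>2"
     "(LINT p|lebesgue_on (K ij). (snd (\<tau> p))\<^sup>2) = (LINT p|lebesgue_on (K ij). snd (\<tau> p) * k0 ij p)\<^sup>2 + (LINT p|lebesgue_on (K ij). snd (\<tau> p) * ky ij p)\<^sup>2"
    if ij: "ij \<in> EL" for ij
  proof -
    obtain \<alpha> \<beta> \<gamma> \<delta> where 1: "AE p in lebesgue_on (K ij). \<tau> p = (\<alpha> + \<beta> * fst p, \<gamma> + \<delta> * snd p)"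
      using \<tau> ij unfolding Sigma_h_alt by blast
    have m: "(\<lambda>p. fst (\<tau> p)) \<in> borel_measurable (lebesgue_on (K ij))" "(\<lambda>p. snd (\<tau> p)) \<in> borel_measurable (lebesgue_on (K ij))"
      using L2_measurable L2_K[OF Lf ij] L2_K[OF Ls ij] by blast+
    have mk: "k \<in> borel_measurable (lebesgue_on (K ij))" if "continuous_on UNIV k" for k :: "plane \<Rightarrow> real"
      by (rule continuous_imp_measurable_on_sets_lebesgue[OF continuous_on_subset[OF that subset_UNIV]]) simp
    have mc: "(\<lambda>p. fst p) \<in> borel_measurable (lebesgue_on (K ij))" "(\<lambda>p. snd p) \<in> borel_measurable (lebesgue_on (K ij))"
      by (intro mk continuous_intros)+
    have e1: "(LINT p|lebesgue_on (K ij). (fst (\<tau> p))\<^sup>2) = (LINT p|lebesgue_on (K ij). (\<alpha> + \<beta> * fst p)\<^sup>2)"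
      by (rule integral_cong_AE) (use m mc in measurable, use 1 in eventually_elim, simp)
    have e2: "(LINT p|lebesgue_on (K ij). fst (\<tau> p) * k p) = (LINT p|lebesgue_on (K ij). (\<alpha> + \<beta> * fst p) * k p)" if "continuous_on UNIV k" for k
      by (rule integral_cong_AE) (use m mc mk[OF that] in measurable, use 1 in eventually_elim, simp)
    have e3: "(LINT p|lebesgue_on (K ij). (snd (\<tau> p))\<^sup>2) = (LINT p|lebesgue_on (K ij). (\<gamma> + \<delta> * snd p)\<^sup>2)"
      by (rule integral_cong_AE) (use m mc in measurable, use 1 in eventually_elim, simp)
    have e4: "(LINT p|lebesgue_on (K ij). snd (\<tau> p) * k p) = (LINT p|lebesgue_on (K ij). (\<gamma> + \<delta> * snd p) * k p)" if "continuous_on UNIV k" for k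
      by (rule integral_cong_AE) (use m mc mk[OF that] in measurable, use 1 in eventually_elim, simp)
    show "(LINT p|lebesgue_on (K ij). (fst (\<tau> p))\<^sup>2) = (LINT p|lebesgue_on (K ij). fst (\<tau> p) * k0 ij p)\<^sup>2 + (LINT p|lebesgue_on (K ij). fst (\<tau> p) * kx ij p)\<^sup>2"
      unfolding e1 e2[OF cont(1)] e2[OF cont(2)] unfolding K_def k0_def kx_def
      by (rule xy.affine_norm_moments) (use EL_bounds[OF ij] in auto)
    show "(LINT p|lebesgue_on (K ij). (snd (\<tau> p))\<^sup>2) = (LINT p|lebesgue_on (K ij). snd (\<tau> p) * k0 ij p)\<^sup>2 + (LINT p|lebesgue_on (K ij). snd (\<tau> p) * ky ij p)\<^sup>2"
      unfolding e3 e4[OF cont(1)] e4[OF cont(3)] unfolding K_swap k0_def ky_def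
      by (subst mult.commute[of "X _ - X _"], rule yx.affine_norm_moments) (use EL_bounds[OF ij] in auto)
  qed
  have mom: "L2_inner \<Omega> \<tau> (moment (ij, 0)) = (LINT p|lebesgue_on (K ij). fst (\<tau> p) * k0 ij p)"
     "L2_inner \<Omega> \<tau> (moment (ij, 1)) = (LINT p|lebesgue_on (K ij). fst (\<tau> p) * kx ij p)"
     "L2_inner \<Omega> \<tau> (moment (ij, 2)) = (LINT p|lebesgue_on (K ij). snd (\<tau> p) * k0 ij p)"
     "L2_inner \<Omega> \<tau> (moment (ij, 3)) = (LINT p|lebesgue_on (K ij). snd (\<tau> p) * ky ij p)" if ij: "ij \<in> EL" for ij
    unfolding L2_inner_def moment_def Let_def inner_prod_def
    using K_ext(2)[OF ij cont(1) Lf] K_ext(2)[OF ij cont(2) Lf] K_ext(2)[OF ij cont(1) Ls] K_ext(2)[OF ij cont(3) Ls] by simp_all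
  have "(L2_norm \<Omega> \<tau>)\<^sup>2 = L2_inner \<Omega> (\<lambda>p. fst (\<tau> p)) (\<lambda>p. fst (\<tau> p)) + L2_inner \<Omega> (\<lambda>p. snd (\<tau> p)) (\<lambda>p. snd (\<tau> p))"
    unfolding L2_norm_power2 by (rule L2_inner_components[OF L L])
  also have "\<dots> = (\<Sum>ij\<in>EL. (LINT p|lebesgue_on (K ij). (fst (\<tau> p))\<^sup>2) + (LINT p|lebesgue_on (K ij). (snd (\<tau> p))\<^sup>2))"
    unfolding L2_inner_\<Omega>[OF Lf Lf] L2_inner_\<Omega>[OF Ls Ls] by (simp add: L2_inner_self sum.distrib)
  also have "\<dots> = (\<Sum>ij\<in>EL. \<Sum>m<4. (L2_inner \<Omega> \<tau> (moment (ij, m)))\<^sup>2)"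
  proof (intro sum.cong refl)
    fix ij assume ij: "ij \<in> EL"
    have "{..<4::nat} = {0, 1, 2, 3}" by auto
    then show "(LINT p|lebesgue_on (K ij). (fst (\<tau> p))\<^sup>2) + (LINT p|lebesgue_on (K ij). (snd (\<tau> p))\<^sup>2) = (\<Sum>m<4. (L2_inner \<Omega> \<tau> (moment (ij, m)))\<^sup>2)"
      unfolding loc[OF ij] mom[OF ij, symmetric] by simp
  qed
  also have "\<dots> = (\<Sum>d\<in>EL \<times> {..<4}. (L2_inner \<Omega> \<tau> (moment d))\<^sup>2)"
    by (simp add: sum.cartesian_product case_prod_unfold)
  finally show ?thesis .
qed

lemma moment_L2: "d \<in> EL \<times> {..<4} \<Longrightarrow> moment d \<in> L2_space \<Omega>"
proof -
  assume "d \<in> EL \<times> {..<4}"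
  then have ij: "fst d \<in> EL" by auto
  have cont: "continuous_on UNIV (k0 ij)" "continuous_on UNIV (kx ij)" "continuous_on UNIV (ky ij)" for ij
    unfolding k0_def kx_def ky_def by (intro continuous_intros)+
  show ?thesis unfolding moment_def Let_def
    using K_ext(1)[OF ij cont(1)[of "fst d"]] K_ext(1)[OF ij cont(2)[of "fst d"]] K_ext(1)[OF ij cont(3)[of "fst d"]]
    by (cases "snd d = 0"; cases "snd d = 1"; cases "snd d = 2"; simp add: L2_Pair)
qed

end

section \<open>Relations between the discrete eigenpairs\<close>

locale discrete = meshed +
  fixes N :: nat and lamh :: "nat \<Rightarrow> real" and \<sigma>h :: "nat \<Rightarrow> plane \<Rightarrow> plane" and uh :: "nat \<Rightarrow> plane \<Rightarrow> real"
  assumes es: "eigensystem \<Omega> (Sigma_h \<Omega> G) (V_h \<Omega> G) {1..N} lamh \<sigma>h uh"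
begin

abbreviation dv :: "(plane \<Rightarrow> plane) \<Rightarrow> plane \<Rightarrow> real" where "dv \<tau> \<equiv> weak_div \<Omega> \<tau>"
abbreviation ip :: "(plane \<Rightarrow> 'b::euclidean_space) \<Rightarrow> (plane \<Rightarrow> 'b) \<Rightarrow> real" where "ip f g \<equiv> L2_inner \<Omega> f g"

lemma eig:
  assumes "j \<in> {1..N}"
  shows "\<sigma>h j \<in> Sigma_h \<Omega> G" "uh j \<in> V_h \<Omega> G" "0 < lamh j"
    "\<tau> \<in> Sigma_h \<Omega> G \<Longrightarrow> ip (\<sigma>h j) \<tau> = ip (dv \<tau>) (uh j)"
    "v \<in> V_h \<Omega> G \<Longrightarrow> ip (dv (\<sigma>h j)) v = lamh j * ip (uh j) v"
proof -
  have "mixed_eigenpair \<Omega> (Sigma_h \<Omega> G) (V_h \<Omega> G) (lamh j) (\<sigma>h j) (uh j)" "0 < lamh j"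
    using es assms unfolding eigensystem_def by blast+
  then show "\<sigma>h j \<in> Sigma_h \<Omega> G" "uh j \<in> V_h \<Omega> G" "0 < lamh j"
    "\<tau> \<in> Sigma_h \<Omega> G \<Longrightarrow> ip (\<sigma>h j) \<tau> = ip (dv \<tau>) (uh j)"
    "v \<in> V_h \<Omega> G \<Longrightarrow> ip (dv (\<sigma>h j)) v = lamh j * ip (uh j) v"
    unfolding mixed_eigenpair_def by auto
qed

lemma Sigma_h_L2: "\<tau> \<in> Sigma_h \<Omega> G \<Longrightarrow> \<tau> \<in> L2_space \<Omega>"
  and Sigma_h_H_div: "\<tau> \<in> Sigma_h \<Omega> G \<Longrightarrow> \<tau> \<in> H_div \<Omega>"
  and V_h_L2: "v \<in> V_h \<Omega> G \<Longrightarrow> v \<in> L2_space \<Omega>"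
  using L2_subspace_L2[OF Sigma_h_subspace] L2_subspace_L2[OF V_h_subspace] by (auto simp: Sigma_h_alt)

lemma dv_L2: "\<tau> \<in> Sigma_h \<Omega> G \<Longrightarrow> dv \<tau> \<in> L2_space \<Omega>"
  using weak_div_props(1) Sigma_h_H_div by blast

lemma uh_orthonormal: "orthonormal \<Omega> {1..N} uh"
  using es eig(2) V_h_L2 unfolding eigensystem_def orthonormal_def by auto

text \<open>Both sides lie in \<open>V_h\<close>, so the second discrete equation may be tested with
  their difference. Holding almost everywhere, it can then be tested with arbitrary
  square-integrable functions, in particular with the continuous eigenfunction.\<close>

lemma div_\<sigma>h:
  assumes j: "j \<in> {1..N}"
  shows "AE p in lebesgue_on \<Omega>. dv (\<sigma>h j) p = lamh j * uh j p"
proof -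
  let ?v = "\<lambda>p. dv (\<sigma>h j) p - lamh j *\<^sub>R uh j p"
  have V: "?v \<in> V_h \<Omega> G" "(\<lambda>p. lamh j *\<^sub>R uh j p) \<in> V_h \<Omega> G"
    using weak_div_V_h eig[OF j] L2_subspace_diff[OF V_h_subspace] L2_subspace_scaleR[OF V_h_subspace] by blast+
  have "ip ?v ?v = ip (dv (\<sigma>h j)) ?v - lamh j * ip (uh j) ?v"
    using V eig[OF j] dv_L2 V_h_L2 by (subst L2_inner_diff_left) (auto simp: L2_inner_cmult_left)
  also have "\<dots> = 0" using eig(5)[OF j V(1)] by simp
  finally have "AE p in lebesgue_on \<Omega>. ?v p = 0" using L2_norm_eq_0_iff[OF V_h_L2[OF V(1)]] by (simp add: L2_norm_def)
  then show ?thesis by eventually_elim simp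
qed

lemma ip_dv_\<sigma>h:
  assumes j: "j \<in> {1..N}" and v: "v \<in> L2_space \<Omega>"
  shows "ip (dv (\<sigma>h j)) v = lamh j * ip (uh j) v"
proof -
  have "ip (dv (\<sigma>h j)) v = ip (\<lambda>p. lamh j * uh j p) v"
    using div_\<sigma>h[OF j] v eig[OF j] dv_L2 V_h_L2 by (intro L2_inner_AE_cong) auto
  then show ?thesis by (simp add: L2_inner_cmult_left)
qed

lemma \<sigma>h_inner: "i \<in> {1..N} \<Longrightarrow> j \<in> {1..N} \<Longrightarrow> ip (\<sigma>h i) (\<sigma>h j) = (if i = j then lamh j else 0)"
  using eig(4)[of i "\<sigma>h j"] eig(1)[of j] ip_dv_\<sigma>h[of j "uh i"] uh_orthonormal V_h_L2[OF eig(2)] by (auto simp: orthonormal_def)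

definition "shat j = (\<lambda>p. (1 / sqrt (lamh j)) *\<^sub>R \<sigma>h j p)"

lemma shat_Sigma_h: "j \<in> {1..N} \<Longrightarrow> shat j \<in> Sigma_h \<Omega> G"
  unfolding shat_def using eig(1) L2_subspace_scaleR[OF Sigma_h_subspace] by blast

lemma shat_orthonormal: "orthonormal \<Omega> {1..N} shat"
  unfolding orthonormal_def
proof (intro conjI ballI)
  show "shat i \<in> L2_space \<Omega>" if "i \<in> {1..N}" for i using that shat_Sigma_h Sigma_h_L2 by blast
  show "ip (shat i) (shat j) = (if i = j then 1 else 0)" if "i \<in> {1..N}" "j \<in> {1..N}" for i j
    unfolding shat_def using \<sigma>h_inner[OF that] eig(3)[OF that(2)]
    by (simp add: L2_inner_scaleR_left L2_inner_scaleR_right flip: real_sqrt_mult)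
qed simp

lemma \<sigma>h_shat: "j \<in> {1..N} \<Longrightarrow> ip f (\<sigma>h j) = sqrt (lamh j) * ip f (shat j)"
  unfolding shat_def using eig(3)[of j] by (simp add: L2_inner_scaleR_right)

text \<open>The complement of the discrete fluxes within \<open>Sigma_h\<close>;
  \<open>div_W_zero\<close> shows that all its members are divergence-free.\<close>

definition "W = {\<tau> \<in> Sigma_h \<Omega> G. \<forall>j\<in>{1..N}. ip \<tau> (\<sigma>h j) = 0}"

lemma W_subspace: "L2_subspace \<Omega> W"
  unfolding L2_subspace_def
proof (intro conjI ballI allI)
  note S = Sigma_h_subspace
  show "W \<subseteq> L2_space \<Omega>" using Sigma_h_L2 by (auto simp: W_def)
  show "(\<lambda>_. 0) \<in> W" using L2_subspace_zero[OF S] by (simp add: W_def)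
  show "(\<lambda>p. f p + g p) \<in> W" if fg: "f \<in> W" "g \<in> W" for f g
    unfolding W_def
  proof (intro CollectI conjI ballI)
    show "(\<lambda>p. f p + g p) \<in> Sigma_h \<Omega> G" using fg L2_subspace_add[OF S] by (simp add: W_def)
    show "ip (\<lambda>p. f p + g p) (\<sigma>h j) = 0" if "j \<in> {1..N}" for j
      using fg that Sigma_h_L2 eig(1)[OF that] by (simp add: W_def L2_inner_add_left)
  qed
  show "(\<lambda>p. c *\<^sub>R f p) \<in> W" if "f \<in> W" for f c
    using that L2_subspace_scaleR[OF S] by (auto simp: W_def L2_inner_scaleR_left)
qed

lemma W_component:
  assumes "\<tau> \<in> Sigma_h \<Omega> G"
  shows "(\<lambda>p. \<tau> p - expansion \<Omega> {1..N} shat \<tau> p) \<in> W" "expansion \<Omega> {1..N} shat \<tau> \<in> Sigma_h \<Omega> G"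
proof -
  show E: "expansion \<Omega> {1..N} shat \<tau> \<in> Sigma_h \<Omega> G"
    unfolding expansion_def using shat_Sigma_h by (intro L2_subspace_lincomb[OF Sigma_h_subspace])
  have "ip (\<lambda>p. \<tau> p - expansion \<Omega> {1..N} shat \<tau> p) (\<sigma>h j) = 0" if "j \<in> {1..N}" for j
    using \<sigma>h_shat[OF that] expansion_residual(3)[OF shat_orthonormal Sigma_h_L2[OF assms] that] by simp
  then show "(\<lambda>p. \<tau> p - expansion \<Omega> {1..N} shat \<tau> p) \<in> W"
    using L2_subspace_diff[OF Sigma_h_subspace assms E] by (simp add: W_def)
qed

lemma ip_dv_lincomb:
  assumes "\<And>i. i \<in> I \<Longrightarrow> e i \<in> Sigma_h \<Omega> G" "v \<in> L2_space \<Omega>"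
  shows "ip (dv (\<lambda>p. \<Sum>i\<in>I. c i *\<^sub>R e i p)) v = (\<Sum>i\<in>I. c i * ip (dv (e i)) v)"
  using assms(1)
proof (induction I rule: infinite_finite_induct)
  case (infinite I)
  have "ip (dv (\<lambda>_. 0)) v = ip (\<lambda>_. 0) v"
    using weak_div_zero assms(2) weak_div_props(1) by (intro L2_inner_AE_cong) auto
  then show ?case using infinite by simp
next
  case empty
  have "ip (dv (\<lambda>_. 0)) v = ip (\<lambda>_. 0) v"
    using weak_div_zero assms(2) weak_div_props(1) by (intro L2_inner_AE_cong) auto
  then show ?case by simp
next
  case (insert i I)
  let ?s = "\<lambda>p. \<Sum>i\<in>I. c i *\<^sub>R e i p"
  have s: "?s \<in> Sigma_h \<Omega> G" "e i \<in> Sigma_h \<Omega> G" using insert by (auto intro!: L2_subspace_lincomb[OF Sigma_h_subspace])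
  then have H: "?s \<in> H_div \<Omega>" "e i \<in> H_div \<Omega>" "(\<lambda>p. c i *\<^sub>R e i p) \<in> H_div \<Omega>"
    using Sigma_h_H_div weak_div_scaleR(1) by blast+
  note L = weak_div_props(1)[OF H(1)] weak_div_props(1)[OF H(2)]
  have "AE p in lebesgue_on \<Omega>. dv (\<lambda>p. c i *\<^sub>R e i p + ?s p) p = c i * dv (e i) p + dv ?s p"
    using weak_div_add(2)[OF H(3,1)] weak_div_scaleR(2)[OF H(2), of "c i"] by eventually_elim simp
  then have "ip (dv (\<lambda>p. c i *\<^sub>R e i p + ?s p)) v = ip (\<lambda>p. c i * dv (e i) p + dv ?s p) v"
    using L assms(2) weak_div_props(1)[OF weak_div_add(1)[OF H(3,1)]]
    by (intro L2_inner_AE_cong) (auto intro!: L2_add L2_cmult)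
  also have "\<dots> = c i * ip (dv (e i)) v + ip (dv ?s) v"
    using L assms(2) L2_cmult[OF L(2)] by (subst L2_inner_add_left) (auto simp: L2_inner_cmult_left)
  finally show ?case using insert by simp
qed

lemma dv_diff_ip:
  assumes "\<sigma> \<in> Sigma_h \<Omega> G" "\<tau> \<in> Sigma_h \<Omega> G" "v \<in> L2_space \<Omega>"
  shows "ip (dv (\<lambda>p. \<sigma> p - \<tau> p)) v = ip (dv \<sigma>) v - ip (dv \<tau>) v"
proof -
  note H = Sigma_h_H_div[OF assms(1)] Sigma_h_H_div[OF assms(2)]
  have "ip (dv (\<lambda>p. \<sigma> p - \<tau> p)) v = ip (\<lambda>p. dv \<sigma> p - dv \<tau> p) v"
    using weak_div_diff[OF H] weak_div_props(1) H assms(3) by (intro L2_inner_AE_cong) auto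
  then show ?thesis using dv_L2[OF assms(1)] dv_L2[OF assms(2)] assms(3) by (simp add: L2_inner_diff_left)
qed

text \<open>If the divergence did not vanish on \<open>W\<close>, maximising \<open>(norm (div \<tau>) / norm \<tau>)\<^sup>2\<close> over \<open>W\<close> would
  produce an eigenfunction orthogonal to all those listed.\<close>

lemma div_W_zero:
  assumes "\<tau> \<in> W"
  shows "ip (dv \<tau>) (dv \<tau>) = 0"
proof (rule ccontr)
  assume nz: "ip (dv \<tau>) (dv \<tau>) \<noteq> 0"
  have WS: "\<tau> \<in> Sigma_h \<Omega> G" if "\<tau> \<in> W" for \<tau> using that by (simp add: W_def)
  obtain n :: nat and e where e: "orthonormal \<Omega> {..<n} e" "\<And>i. i < n \<Longrightarrow> e i \<in> W"
    and span: "\<And>x. x \<in> W \<Longrightarrow> AE p in lebesgue_on \<Omega>. x p = expansion \<Omega> {..<n} e x p"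
  proof (rule orthonormal_basis_exists[OF W_subspace, of "EL \<times> {..<4}" moment])
    show "finite (EL \<times> {..<4::nat})" using finite_EL by simp
    show "(L2_norm \<Omega> x)\<^sup>2 \<le> (\<Sum>d\<in>EL \<times> {..<4}. (ip x (moment d))\<^sup>2)" if "x \<in> W" for x
      using Sigma_h_norm_moments[OF WS[OF that]] by simp
  qed (use moment_L2 in auto)
  obtain \<tau>0 \<mu> where t0: "\<tau>0 \<in> W" "\<mu> > 0" "ip \<tau>0 \<tau>0 = 1" and ev: "\<And>z. z \<in> W \<Longrightarrow> ip (dv \<tau>0) (dv z) = \<mu> * ip \<tau>0 z"
  proof (rule form_eigenvector_exists[OF W_subspace e span, of "\<lambda>x z. ip (dv x) (dv z)"])
    fix x y z assume xyz: "x \<in> W" "y \<in> W" "z \<in> W"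
    note H = Sigma_h_H_div[OF WS[OF xyz(1)]] Sigma_h_H_div[OF WS[OF xyz(2)]] Sigma_h_H_div[OF WS[OF xyz(3)]]
    note L = weak_div_props(1)[OF H(1)] weak_div_props(1)[OF H(2)] weak_div_props(1)[OF H(3)]
    have "ip (dv (\<lambda>p. x p + y p)) (dv z) = ip (\<lambda>p. dv x p + dv y p) (dv z)"
      using L weak_div_add[OF H(1,2)] weak_div_props(1) by (intro L2_inner_AE_cong) auto
    then show "ip (dv (\<lambda>p. x p + y p)) (dv z) = ip (dv x) (dv z) + ip (dv y) (dv z)"
      using L by (simp add: L2_inner_add_left)
    assume xy: "AE p in lebesgue_on \<Omega>. x p = y p"
    have "is_weak_div \<Omega> x (dv y)"
      unfolding is_weak_div_def
    proof
      fix \<phi> assume \<phi>: "\<phi> \<in> test_functions \<Omega>"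
      have "ip x (\<lambda>p. (dx \<phi> p, dy \<phi> p)) = ip y (\<lambda>p. (dx \<phi> p, dy \<phi> p))"
        using xy test_function_L2[OF \<phi>] weak_div_props(3)[OF H(1)] weak_div_props(3)[OF H(2)] by (intro L2_inner_AE_cong) auto
      then show "ip x (\<lambda>p. (dx \<phi> p, dy \<phi> p)) = - ip (dv y) \<phi>"
        using weak_div_props(2)[OF H(2)] \<phi> unfolding is_weak_div_def by simp
    qed
    from weak_div_unique[OF weak_div_props(2)[OF H(1)] this L(1,2)]
    show "ip (dv x) (dv z) = ip (dv y) (dv z)" using L by (intro L2_inner_AE_cong) auto
  next
    fix x z and c :: real assume xz: "x \<in> W" "z \<in> W"
    note H = Sigma_h_H_div[OF WS[OF xz(1)]] Sigma_h_H_div[OF WS[OF xz(2)]]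
    note L = weak_div_props(1)[OF H(1)] weak_div_props(1)[OF H(2)]
    have "ip (dv (\<lambda>p. c *\<^sub>R x p)) (dv z) = ip (\<lambda>p. c * dv x p) (dv z)"
      using L weak_div_scaleR[OF H(1)] weak_div_props(1) by (intro L2_inner_AE_cong) auto
    then show "ip (dv (\<lambda>p. c *\<^sub>R x p)) (dv z) = c * ip (dv x) (dv z)" by (simp add: L2_inner_cmult_left)
  next
    show "ip (dv x) (dv y) = ip (dv y) (dv x)" for x y by (rule L2_inner_commute)
    show "\<tau> \<in> W" by fact
    show "ip (dv \<tau>) (dv \<tau>) > 0" using nz L2_inner_self_nonneg[of \<Omega> "dv \<tau>"] by linarith
  qed (use e in auto)
  have tS: "\<tau>0 \<in> Sigma_h \<Omega> G" by (rule WS[OF t0(1)])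
  note tL = dv_L2[OF tS]
  \<comment> \<open>By the first discrete equation, orthogonality of \<open>\<tau>0\<close> to the
    flux \<open>\<sigma>h j\<close> is orthogonality of its divergence to
    \<open>uh j\<close>.\<close>
  have orth: "ip (dv \<tau>0) (uh j) = 0" if j: "j \<in> {1..N}" for j
    using eig(4)[OF j tS] t0(1) j by (simp add: W_def L2_inner_commute)
  \<comment> \<open>The relation is known on \<open>W\<close> only. The part of z spanned by the
    discrete fluxes contributes 0 to both sides, so the relation extends to all of
    \<open>Sigma_h\<close>.\<close>
  have all: "ip (dv \<tau>0) (dv z) = \<mu> * ip \<tau>0 z" if z: "z \<in> Sigma_h \<Omega> G" for z
  proof -
    let ?E = "expansion \<Omega> {1..N} shat z"
    note C = W_component[OF z]
    have 1: "ip (dv ?E) (dv \<tau>0) = 0"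
      unfolding expansion_def
    proof (subst ip_dv_lincomb)
      have "ip (dv (shat i)) (dv \<tau>0) = 0" if i: "i \<in> {1..N}" for i
      proof -
        have "ip (dv (\<lambda>p. \<Sum>i\<in>{i}. (1 / sqrt (lamh i)) *\<^sub>R \<sigma>h i p)) (dv \<tau>0) = 1 / sqrt (lamh i) * ip (dv (\<sigma>h i)) (dv \<tau>0)"
          using ip_dv_lincomb[of "{i}" \<sigma>h "dv \<tau>0" "\<lambda>i. 1 / sqrt (lamh i)"] eig(1)[OF i] tL by simp
        then show ?thesis using ip_dv_\<sigma>h[OF i tL] orth[OF i] by (simp add: shat_def L2_inner_commute)
      qed
      then show "(\<Sum>i\<in>{1..N}. ip z (shat i) * ip (dv (shat i)) (dv \<tau>0)) = 0" by simp
    qed (use shat_Sigma_h tL in auto)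
    have 2: "ip ?E \<tau>0 = 0"
      unfolding expansion_def
    proof (subst L2_inner_lincomb)
      have "ip (shat i) \<tau>0 = 0" if "i \<in> {1..N}" for i
        using t0(1) that by (simp add: W_def shat_def L2_inner_scaleR_left L2_inner_commute)
      then show "(\<Sum>i\<in>{1..N}. ip z (shat i) * ip (shat i) \<tau>0) = 0" by simp
    qed (use shat_Sigma_h Sigma_h_L2 tS in auto)
    have "ip (dv (\<lambda>p. z p - ?E p)) (dv \<tau>0) = \<mu> * ip (\<lambda>p. z p - ?E p) \<tau>0"
      using ev[OF C(1)] by (simp only: L2_inner_commute[of \<Omega> "dv \<tau>0"] L2_inner_commute[of \<Omega> \<tau>0])
    then have "ip (dv z) (dv \<tau>0) - ip (dv ?E) (dv \<tau>0) = \<mu> * (ip z \<tau>0 - ip ?E \<tau>0)"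
      using dv_diff_ip[OF z C(2) tL] L2_inner_diff_left[OF Sigma_h_L2[OF z] Sigma_h_L2[OF C(2)] Sigma_h_L2[OF tS]]
      by simp
    then show ?thesis using 1 2 by (simp add: L2_inner_commute)
  qed
  \<comment> \<open>With this scaling the pair of \<open>\<tau>0\<close> and w solves the discrete
    problem for the eigenvalue \<open>\<mu>\<close>. Hence w would be a combination of listed
    eigenfunctions, although it is orthogonal to each of them.\<close>
  define w where "w = (\<lambda>p. (1 / \<mu>) * dv \<tau>0 p)"
  have wV: "w \<in> V_h \<Omega> G" unfolding w_def
    using L2_subspace_scaleR[OF V_h_subspace weak_div_V_h[OF tS], of "1 / \<mu>"] by simp
  have "ip (dv \<tau>0) (dv \<tau>0) = \<mu>" using all[OF tS] t0 by simp
  then have ww: "ip w w = 1 / \<mu>" unfolding w_def L2_inner_cmult_left L2_inner_cmult_right using t0(2) by simp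
  have "mixed_eigenpair \<Omega> (Sigma_h \<Omega> G) (V_h \<Omega> G) \<mu> \<tau>0 w"
    unfolding mixed_eigenpair_def
  proof (intro conjI ballI)
    show "L2_norm \<Omega> w \<noteq> 0" using ww t0(2) by (simp add: L2_norm_def)
    show "ip \<tau>0 z - ip (dv z) w = 0" if "z \<in> Sigma_h \<Omega> G" for z
      using all[OF that] t0(2) unfolding w_def L2_inner_cmult_right by (simp add: L2_inner_commute[of \<Omega> "dv z"])
    show "ip (dv \<tau>0) v = \<mu> * ip w v" for v
      using t0(2) unfolding w_def L2_inner_cmult_left by simp
  qed (use tS wV in auto)
  then have "w \<in> L2_span \<Omega> uh {j \<in> {1..N}. lamh j = \<mu>}" using es unfolding eigensystem_def by blast
  then obtain c where c: "AE p in lebesgue_on \<Omega>. w p = (\<Sum>j | j \<in> {1..N} \<and> lamh j = \<mu>. c j *\<^sub>R uh j p)"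
    unfolding L2_span_def by auto
  have uL: "uh j \<in> L2_space \<Omega>" if "j \<in> {1..N}" for j using that eig(2) V_h_L2 by blast
  have "ip w w = ip (\<lambda>p. \<Sum>j | j \<in> {1..N} \<and> lamh j = \<mu>. c j *\<^sub>R uh j p) w"
    using c V_h_L2[OF wV] uL by (intro L2_inner_AE_cong) (auto intro!: L2_sum L2_cmult)
  also have "\<dots> = (\<Sum>j | j \<in> {1..N} \<and> lamh j = \<mu>. c j * ip (uh j) w)"
    using V_h_L2[OF wV] uL by (intro L2_inner_lincomb) auto
  also have "\<dots> = 0"
  proof (intro sum.neutral ballI)
    fix j assume "j \<in> {j. j \<in> {1..N} \<and> lamh j = \<mu>}"
    then have "ip (dv \<tau>0) (uh j) = 0" using orth by blast
    then show "c j * ip (uh j) w = 0" unfolding w_def L2_inner_cmult_right by (simp add: L2_inner_commute)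
  qed
  finally show False using ww t0(2) by simp
qed

text \<open>A function \<open>v \<in> V_h\<close> orthogonal to all divergences would be an eigenfunction for the eigenvalue \<open>0\<close>
  (with \<open>\<sigma> = 0\<close>), but all eigenvalues are positive.\<close>

lemma V_h_orthogonal_zero:
  assumes v: "v \<in> V_h \<Omega> G" and orth: "\<And>j. j \<in> {1..N} \<Longrightarrow> ip v (uh j) = 0"
  shows "AE p in lebesgue_on \<Omega>. v p = 0"
proof (rule ccontr)
  assume "\<not> (AE p in lebesgue_on \<Omega>. v p = 0)"
  then have nz: "L2_norm \<Omega> v \<noteq> 0" using L2_norm_eq_0_iff[OF V_h_L2[OF v]] by simp
  note vL = V_h_L2[OF v]
  \<comment> \<open>The component of \<open>\<tau>\<close> in \<open>W\<close> is divergence-free,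
    and the divergence of the remaining part is a combination of the functions
    \<open>uh j\<close>.\<close>
  have z: "ip (dv \<tau>) v = 0" if \<tau>: "\<tau> \<in> Sigma_h \<Omega> G" for \<tau>
  proof -
    let ?E = "expansion \<Omega> {1..N} shat \<tau>" and ?D = "\<lambda>p. \<tau> p - expansion \<Omega> {1..N} shat \<tau> p"
    note C = W_component[OF \<tau>]
    have D: "?D \<in> Sigma_h \<Omega> G" using C(1) by (simp add: W_def)
    have "\<bar>ip (dv ?D) v\<bar> \<le> L2_norm \<Omega> (dv ?D) * L2_norm \<Omega> v" by (rule L2_Cauchy_Schwarz[OF dv_L2[OF D] vL])
    then have 1: "ip (dv ?D) v = 0" using div_W_zero[OF C(1)] by (simp add: L2_norm_def)
    have "ip (dv (shat i)) v = 0" if i: "i \<in> {1..N}" for i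
    proof -
      have "ip (dv (\<lambda>p. \<Sum>i\<in>{i}. (1 / sqrt (lamh i)) *\<^sub>R \<sigma>h i p)) v = 1 / sqrt (lamh i) * ip (dv (\<sigma>h i)) v"
        using ip_dv_lincomb[of "{i}" \<sigma>h v "\<lambda>i. 1 / sqrt (lamh i)"] eig(1)[OF i] vL by simp
      then show ?thesis using ip_dv_\<sigma>h[OF i vL] orth[OF i] by (simp add: shat_def L2_inner_commute)
    qed
    then have 2: "ip (dv ?E) v = 0"
      unfolding expansion_def using ip_dv_lincomb[of "{1..N}" shat v] shat_Sigma_h vL by simp
    show ?thesis using dv_diff_ip[OF \<tau> C(2) vL] 1 2 by simp
  qed
  have "mixed_eigenpair \<Omega> (Sigma_h \<Omega> G) (V_h \<Omega> G) 0 (\<lambda>_. 0) v"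
    unfolding mixed_eigenpair_def
  proof (intro conjI ballI)
    show "(\<lambda>_. 0) \<in> Sigma_h \<Omega> G" by (rule L2_subspace_zero[OF Sigma_h_subspace])
    show "ip (\<lambda>_. 0) \<tau> - ip (dv \<tau>) v = 0" if "\<tau> \<in> Sigma_h \<Omega> G" for \<tau> using z[OF that] by simp
    show "ip (dv (\<lambda>_. 0)) v' = 0 * ip v v'" if "v' \<in> V_h \<Omega> G" for v'
    proof -
      have "ip (dv (\<lambda>_. 0)) v' = ip (\<lambda>_. 0) v'"
        using weak_div_zero V_h_L2[OF that] weak_div_props(1) by (intro L2_inner_AE_cong) auto
      then show ?thesis by simp
    qed
  qed (use v nz in auto)
  then have "v \<in> L2_span \<Omega> uh {j \<in> {1..N}. lamh j = 0}" using es unfolding eigensystem_def by blast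
  moreover have "{j \<in> {1..N}. lamh j = 0} = {}" using eig(3) by force
  ultimately have "v \<in> L2_span \<Omega> uh {}" by (simp only:)
  then have "AE p in lebesgue_on \<Omega>. v p = 0" by (simp add: L2_span_def)
  then show False using nz L2_norm_eq_0_iff[OF vL] by simp
qed

text \<open>The residual of the expansion lies in \<open>V_h\<close> and is orthogonal to every
  \<open>uh j\<close>. This completeness takes the place of a discrete inf-sup condition: norms in
  \<open>V_h\<close> can be estimated coefficient by coefficient.\<close>

theorem V_h_expansion:
  assumes v: "v \<in> V_h \<Omega> G"
  shows "AE p in lebesgue_on \<Omega>. v p = expansion \<Omega> {1..N} uh v p"
    and "(L2_norm \<Omega> v)\<^sup>2 = (\<Sum>j\<in>{1..N}. (ip v (uh j))\<^sup>2)"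
proof -
  note R = expansion_residual[OF uh_orthonormal V_h_L2[OF v]]
  have E: "expansion \<Omega> {1..N} uh v \<in> V_h \<Omega> G"
    unfolding expansion_def using eig(2) by (intro L2_subspace_lincomb[OF V_h_subspace])
  have D: "(\<lambda>p. v p - expansion \<Omega> {1..N} uh v p) \<in> V_h \<Omega> G" by (rule L2_subspace_diff[OF V_h_subspace v E])
  have ae: "AE p in lebesgue_on \<Omega>. v p - expansion \<Omega> {1..N} uh v p = 0"
    by (rule V_h_orthogonal_zero[OF D R(3)])
  then show "AE p in lebesgue_on \<Omega>. v p = expansion \<Omega> {1..N} uh v p" by eventually_elim simp
  have "L2_norm \<Omega> (\<lambda>p. v p - expansion \<Omega> {1..N} uh v p) = 0" using ae L2_norm_eq_0_iff[OF V_h_L2[OF D]] by simp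
  then show "(L2_norm \<Omega> v)\<^sup>2 = (\<Sum>j\<in>{1..N}. (ip v (uh j))\<^sup>2)" using R(1) by simp
qed

end

section \<open>The Raviart-Thomas interpolant\<close>

text \<open>When s is the second coordinate, grid and indices are transposed, so that the first
  index always counts in the direction s. The index map \<open>ix\<close> is an involution between
  the two numberings.\<close>

locale directed = meshed \<Omega> G + coords s t for \<Omega> G s t
begin

definition "S = (if s = fst then X else Y)"
definition "T = (if s = fst then Y else X)"
definition "ns = (if s = fst then nx G else ny G)"
definition "nt = (if s = fst then ny G else nx G)"
definition ix :: "nat \<times> nat \<Rightarrow> nat \<times> nat" where "ix ij = (if s = fst then ij else prod.swap ij)"
definition "E = ix ` EL"
definition "R ij = crect s t (S (fst ij - 1)) (S (fst ij)) (T (snd ij - 1)) (T (snd ij))"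
definition "OR ij = orect s t (S (fst ij - 1)) (S (fst ij)) (T (snd ij - 1)) (T (snd ij))"

lemma cases_st: "(s = fst \<Longrightarrow> t = snd \<Longrightarrow> P) \<Longrightarrow> (s = snd \<Longrightarrow> t = fst \<Longrightarrow> s \<noteq> fst \<Longrightarrow> P) \<Longrightarrow> P"
proof -
  have ne: "(snd :: plane \<Rightarrow> real) \<noteq> fst" by (metis fst_conv snd_conv zero_neq_one)
  assume "s = fst \<Longrightarrow> t = snd \<Longrightarrow> P" "s = snd \<Longrightarrow> t = fst \<Longrightarrow> s \<noteq> fst \<Longrightarrow> P"
  then show P using coords ne by auto
qed

lemma ix_ix [simp]: "ix (ix ij) = ij" by (simp add: ix_def)

lemma ix_E: "ij \<in> E \<longleftrightarrow> ix ij \<in> EL"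
  unfolding E_def by (metis image_iff ix_ix)

lemma R_K: "R ij = K (ix ij)" and OR_OK: "OR ij = OK (ix ij)"
  unfolding R_def OR_def K_def OK_def S_def T_def ix_def crect_def orect_def
  by (rule cases_st; simp add: conj_commute)+

lemma S_less: "i < j \<Longrightarrow> j \<le> ns \<Longrightarrow> S i < S j" and T_less: "i < j \<Longrightarrow> j \<le> nt \<Longrightarrow> T i < T j"
  using X_less Y_less by (auto simp: S_def T_def ns_def nt_def)

lemma S_mono: "i \<le> j \<Longrightarrow> j \<le> ns \<Longrightarrow> S i \<le> S j" and T_mono: "i \<le> j \<Longrightarrow> j \<le> nt \<Longrightarrow> T i \<le> T j"
  using S_less[of i j] T_less[of i j] by (cases "i = j"; force)+

lemma finite_E: "finite E" unfolding E_def using finite_EL by simp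

lemma E_bounds:
  assumes "ij \<in> E"
  shows "1 \<le> fst ij" "fst ij \<le> ns" "1 \<le> snd ij" "snd ij \<le> nt" "S (fst ij - 1) < S (fst ij)" "T (snd ij - 1) < T (snd ij)"
proof -
  have e: "ix ij \<in> EL" using assms ix_E by simp
  show 1: "1 \<le> fst ij" "fst ij \<le> ns" "1 \<le> snd ij" "snd ij \<le> nt"
    using EL_bounds(1-4)[OF e] by (auto simp: ix_def ns_def nt_def split: if_splits)
  then show "S (fst ij - 1) < S (fst ij)" "T (snd ij - 1) < T (snd ij)" using S_less T_less by simp_all
qed

lemma R_sets [simp]: "R ij \<in> sets lebesgue" by (simp add: R_def)

lemma L2_R: "f \<in> L2_space \<Omega> \<Longrightarrow> ij \<in> E \<Longrightarrow> f \<in> L2_space (R ij)"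
  using L2_K ix_E R_K by metis

lemma OR_subset: "ij \<in> E \<Longrightarrow> OR ij \<subseteq> \<Omega>"
  using OK_subset ix_E OR_OK by metis

lemma sum_E: "(\<Sum>ij\<in>EL. g (K ij)) = (\<Sum>ij\<in>E. g (R ij))" for g :: "plane set \<Rightarrow> real"
proof -
  have "inj_on ix EL" by (rule inj_onI) (metis ix_ix)
  then show ?thesis unfolding E_def R_K by (simp add: sum.reindex)
qed

lemma integral_E:
  fixes f :: "plane \<Rightarrow> real"
  assumes "integrable (lebesgue_on \<Omega>) f"
  shows "(LINT p|lebesgue_on \<Omega>. f p) = (\<Sum>ij\<in>E. LINT p|lebesgue_on (R ij). f p)"
  unfolding integral_\<Omega>[OF assms] by (rule sum_E)

lemma closure_OR: "ij \<in> {1..ns} \<times> {1..nt} \<Longrightarrow> closure (OR ij) = R ij"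
proof -
  assume ij: "ij \<in> {1..ns} \<times> {1..nt}"
  then have ST: "S (fst ij - 1) < S (fst ij)" "T (snd ij - 1) < T (snd ij)" using S_less T_less by auto
  have "OR ij = (if s = fst then box (S (fst ij - 1), T (snd ij - 1)) (S (fst ij), T (snd ij)) else box (T (snd ij - 1), S (fst ij - 1)) (T (snd ij), S (fst ij)))"
    unfolding OR_def S_def T_def orect_def
    by (rule cases_st; auto simp: box_def Basis_prod_def inner_prod_def)
  moreover have "box (S (fst ij - 1), T (snd ij - 1)) (S (fst ij), T (snd ij)) \<noteq> {}" "box (T (snd ij - 1), S (fst ij - 1)) (T (snd ij), S (fst ij)) \<noteq> {}"
    using ST by (simp_all add: box_ne_empty Basis_prod_def inner_prod_def)
  ultimately show ?thesis unfolding R_def crect_cbox by (simp only: if_distrib[of closure] closure_box simp_thms)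
qed

lemma \<Omega>_E:
  assumes "z \<in> \<Omega>"
  obtains kl where "kl \<in> E" "z \<in> R kl"
proof -
  obtain kl' where kl': "kl' \<in> EL" "z \<in> K kl'" using assms \<Omega>_subset by blast
  show ?thesis by (rule that[of "ix kl'"]) (use kl' in \<open>simp_all add: ix_E R_K\<close>)
qed

text \<open>An open cell that meets the domain meets an element, and an open and a closed cell of
  one grid meet only if their indices agree; since the domain is open, missing the open cell it
  misses the closed cell too. Test functions therefore vanish on all edges of grid cells that are
  not elements.\<close>

lemma nonelement_disjoint:
  assumes "ij \<in> {1..ns} \<times> {1..nt}" "ij \<notin> E"
  shows "\<Omega> \<inter> R ij = {}"
proof -
  have "\<Omega> \<inter> OR ij = {}"
  proof (rule ccontr)
    assume "\<Omega> \<inter> OR ij \<noteq> {}"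
    then obtain z where z: "z \<in> \<Omega>" "z \<in> OR ij" by blast
    obtain kl where kl: "kl \<in> E" "z \<in> R kl" using \<Omega>_E[OF z(1)] .
    note b = E_bounds[OF kl(1)]
    have lt: "S (fst ij - 1) < S (fst kl)" "S (fst kl - 1) < S (fst ij)" "T (snd ij - 1) < T (snd kl)" "T (snd kl - 1) < T (snd ij)"
      using z(2) kl(2) by (auto simp: OR_def R_def orect_def crect_def)
    have i: "fst ij \<le> ns" "snd ij \<le> nt" "1 \<le> fst ij" "1 \<le> snd ij" using assms(1) by auto
    have "fst ij - 1 < fst kl" "fst kl - 1 < fst ij" "snd ij - 1 < snd kl" "snd kl - 1 < snd ij"
      using S_mono[of "fst kl" "fst ij - 1"] S_mono[of "fst ij" "fst kl - 1"] T_mono[of "snd kl" "snd ij - 1"] T_mono[of "snd ij" "snd kl - 1"] lt i b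
      by (meson diff_le_self le_trans not_le)+
    then have "fst ij = fst kl" "snd ij = snd kl" using i b by linarith+
    then have "ij = kl" by (simp add: prod_eq_iff)
    then show False using assms(2) kl by simp
  qed
  then have "\<Omega> \<inter> closure (OR ij) = {}" using open_Int_closure_eq_empty[OF \<Omega>_open] by blast
  then show ?thesis by (simp add: closure_OR[OF assms(1)])
qed

lemma R_overlap: "ij \<in> E \<Longrightarrow> kl \<in> E \<Longrightarrow> ij \<noteq> kl \<Longrightarrow> negligible (R ij \<inter> R kl)"
  unfolding R_K
  by (rule negligible_K_Int) (use EL_bounds ix_E ix_ix in \<open>auto simp: mem_Times_iff, metis\<close>)

lemma AE_piecewise:
  assumes "ij \<in> E"
  shows "AE z in lebesgue_on (R ij). (\<Sum>kl\<in>E. if z \<in> R kl then q kl z else 0) = (q ij z :: real)"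
proof -
  have "negligible (\<Union>kl\<in>E - {ij}. R ij \<inter> R kl)"
  proof (rule negligible_Union)
    fix N assume "N \<in> (\<lambda>kl. R ij \<inter> R kl) ` (E - {ij})"
    then obtain kl where "kl \<in> E" "ij \<noteq> kl" "N = R ij \<inter> R kl" by blast
    then show "negligible N" using R_overlap[OF assms] by simp
  qed (use finite_E in simp)
  then have "AE z in lebesgue. z \<in> R ij \<longrightarrow> (\<Sum>kl\<in>E. if z \<in> R kl then q kl z else 0) = q ij z"
  proof (rule eventually_mono[OF AE_not_in_negligible], intro impI)
    fix z assume z: "z \<notin> (\<Union>kl\<in>E - {ij}. R ij \<inter> R kl)" "z \<in> R ij"
    have "(\<Sum>kl\<in>E. if z \<in> R kl then q kl z else 0) = (\<Sum>kl\<in>E. if kl = ij then q kl z else 0)"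
      using z by (intro sum.cong) auto
    then show "(\<Sum>kl\<in>E. if z \<in> R kl then q kl z else 0) = q ij z" using finite_E assms by simp
  qed
  then show ?thesis by (simp add: AE_restrict_space_iff)
qed

lemma piecewise_L2:
  assumes "\<And>ij. ij \<in> E \<Longrightarrow> continuous_on UNIV (q ij)"
  shows "(\<lambda>z. \<Sum>kl\<in>E. if z \<in> R kl then q kl z else (0::real)) \<in> L2_space \<Omega>"
  using K_ext(1)[of "ix _" "q _"] assms unfolding R_K by (intro L2_sum) (auto simp: ix_E)

text \<open>Near a point of the open domain there are further points of it on both sides in the
  direction s, and all lie within the closed range of the grid. Hence test functions vanish on the
  outermost grid lines.\<close>

lemma outside: "z \<in> \<Omega> \<Longrightarrow> S 0 < s z \<and> s z < S ns"
proof -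
  assume z: "z \<in> \<Omega>"
  have le: "S 0 \<le> s y \<and> s y \<le> S ns" if y: "y \<in> \<Omega>" for y
  proof -
    obtain kl where kl: "kl \<in> E" "y \<in> R kl" using \<Omega>_E[OF y] .
    have "S 0 \<le> S (fst kl - 1)" "S (fst kl) \<le> S ns"
      using E_bounds[OF kl(1)] by (auto intro!: S_mono)
    then show ?thesis using kl(2) by (auto simp: R_def crect_def)
  qed
  obtain e where e: "e > 0" "ball z e \<subseteq> \<Omega>" using z \<Omega>_open open_contains_ball by blast
  have ball: "pt (s z + r) (t z) \<in> ball z e" if "\<bar>r\<bar> < e" for r
  proof -
    have "dist (pt (s z + r) (t z)) z = \<bar>r\<bar>"
      by (rule cases_st; simp add: pt_def dist_prod_def dist_real_def)
    then show ?thesis using that by (simp add: dist_commute)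
  qed
  have "pt (s z + e / 2) (t z) \<in> \<Omega>" "pt (s z - e / 2) (t z) \<in> \<Omega>"
    using ball[of "e / 2"] ball[of "- (e / 2)"] e by auto
  from le[OF this(1)] le[OF this(2)] show ?thesis using e(1) by simp
qed

end

locale interpolated = directed \<Omega> G s t for \<Omega> G s t +
  fixes f f1 :: "plane \<Rightarrow> real"
  assumes fL: "f \<in> L2_space \<Omega>" and f1L: "f1 \<in> L2_space \<Omega>" and wpf: "weak_partial s t \<Omega> f f1"
begin

definition "area ij = (S (fst ij) - S (fst ij - 1)) * (T (snd ij) - T (snd ij - 1))"
definition "hi ij = ((LINT z|lebesgue_on (R ij). f z) + (LINT z|lebesgue_on (R ij). f1 z * (s z - S (fst ij - 1)))) / area ij"
definition "lo ij = ((LINT z|lebesgue_on (R ij). f z) - (LINT z|lebesgue_on (R ij). f1 z * (S (fst ij) - s z))) / area ij"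
text \<open>Edge i of row j lies on grid line i, between the cells i and i + 1. Its value is taken
  from whichever neighbour is an element, and is 0 if there is none. Consistency when both are
  elements is the content of \<open>edge_left\<close>.\<close>

definition "edge i j = (if (i, j) \<in> E then hi (i, j) else if (i + 1, j) \<in> E then lo (i + 1, j) else 0)"
definition "beta ij = (hi ij - lo ij) / (S (fst ij) - S (fst ij - 1))"
definition "loc ij z = lo ij + beta ij * (s z - S (fst ij - 1))"
text \<open>A sum over elements instead of a choice of the cell containing z: points on common edges
  collect several contributions, but they form a null set.\<close>

definition "field z = (\<Sum>kl\<in>E. if z \<in> R kl then loc kl z else 0)"
definition "field1 z = (\<Sum>kl\<in>E. if z \<in> R kl then beta kl else 0)"

lemma field_L2: "field \<in> L2_space \<Omega>" "field1 \<in> L2_space \<Omega>"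
  unfolding field_def[abs_def] field1_def[abs_def] loc_def by (intro piecewise_L2 continuous_intros continuous_coords)+

lemma field_AE: "ij \<in> E \<Longrightarrow> AE z in lebesgue_on (R ij). field z = loc ij z"
  "ij \<in> E \<Longrightarrow> AE z in lebesgue_on (R ij). field1 z = beta ij"
  unfolding field_def field1_def by (rule AE_piecewise[where q=loc], assumption) (rule AE_piecewise[where q="\<lambda>kl z. beta kl"], assumption)

lemma edge_right: "(i, j) \<in> E \<Longrightarrow> edge i j = hi (i, j)"
  by (simp add: edge_def)

text \<open>For two adjacent elements the interior of their union lies in the domain, so f has its
  weak derivative across the common edge and \<open>flux_continuity\<close> identifies the means
  from both sides.\<close>

lemma edge_left:
  assumes "(i, j) \<in> E"
  shows "edge (i - 1) j = lo (i, j)"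
proof (cases "(i - 1, j) \<in> E")
  case False
  then show ?thesis using assms E_bounds(1)[OF assms] by (simp add: edge_def)
next
  case True
  note b = E_bounds[OF assms] and b' = E_bounds[OF True]
  define a m c k k' where "a = S (i - 1 - 1)" and "m = S (i - 1)" and "c = S i" and "k = T (j - 1)" and "k' = T j"
  have am: "a < m" "m < c" "k < k'" using b b' by (simp_all add: a_def m_def c_def k_def k'_def)
  have R1: "R (i - 1, j) = crect s t a m k k'" "R (i, j) = crect s t m c k k'"
    by (simp_all add: R_def a_def m_def c_def k_def k'_def)
  have "crect s t a c k k' \<subseteq> R (i - 1, j) \<union> R (i, j)" unfolding R1 by (auto simp: crect_def)
  also have "\<dots> \<subseteq> closure \<Omega>" unfolding R_K using EL_bounds(7) assms True ix_E by blast
  finally have sub: "orect s t a c k k' \<subseteq> \<Omega>"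
    using orect_subset_crect[of a c k k'] by (intro open_subset_\<Omega> orect_open) blast
  have neg: "negligible (crect s t a c k k' - \<Omega>)"
  proof -
    have "crect s t a c k k' - \<Omega> \<subseteq> crect s t a c k k' - orect s t a c k k'" using sub by blast
    then show ?thesis by (rule negligible_subset[OF negligible_crect_orect])
  qed
  have "(c - m) * ((LINT z|lebesgue_on (crect s t a m k k'). f z) + (LINT z|lebesgue_on (crect s t a m k k'). f1 z * (s z - a)))
       = (m - a) * ((LINT z|lebesgue_on (crect s t m c k k'). f z) - (LINT z|lebesgue_on (crect s t m c k k'). f1 z * (c - s z)))"
    by (rule flux_continuity[OF am(1,2) weak_partial_mono[OF wpf \<Omega>_sets orect_sets sub]
        L2_mono[OF crect_sets \<Omega>_sets neg fL] L2_mono[OF crect_sets \<Omega>_sets neg f1L]])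
  moreover have "(LINT z|lebesgue_on (crect s t a m k k'). f z) + (LINT z|lebesgue_on (crect s t a m k k'). f1 z * (s z - a)) = hi (i - 1, j) * ((m - a) * (k' - k))"
    using am unfolding hi_def R1 by (simp add: area_def a_def m_def c_def k_def k'_def)
  moreover have "(LINT z|lebesgue_on (crect s t m c k k'). f z) - (LINT z|lebesgue_on (crect s t m c k k'). f1 z * (c - s z)) = lo (i, j) * ((c - m) * (k' - k))"
    using am unfolding lo_def R1 by (simp add: area_def a_def m_def c_def k_def k'_def)
  ultimately have "((c - m) * (m - a) * (k' - k)) * hi (i - 1, j) = ((c - m) * (m - a) * (k' - k)) * lo (i, j)" by (simp add: mult_ac)
  then have "hi (i - 1, j) = lo (i, j)" using am by simp
  then show ?thesis using True by (simp add: edge_def)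
qed

lemma loc_ends:
  assumes "(i, j) \<in> E"
  shows "lo (i, j) + beta (i, j) * (S i - S (i - 1)) = edge i j" "lo (i, j) = edge (i - 1) j"
  using E_bounds(5)[OF assms] edge_right[OF assms] edge_left[OF assms] by (simp_all add: beta_def)

text \<open>Only the continuity of the edge values matters: the boundary terms telescope along each row
  of the grid, since a test function vanishes on the cells outside \<open>\<Omega>\<close>.\<close>

lemma field_ibp:
  assumes \<phi>: "continuous_on UNIV \<phi>" and D: "continuous_on UNIV D"
    and der: "\<And>x y. ((\<lambda>x. \<phi> (pt x y)) has_real_derivative D (pt x y)) (at x)"
    and zero: "\<And>z. z \<notin> \<Omega> \<Longrightarrow> \<phi> z = 0"
  shows "L2_inner \<Omega> field D = - L2_inner \<Omega> field1 \<phi>"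
proof -
  have L: "\<phi> \<in> L2_space \<Omega>" "D \<in> L2_space \<Omega>" using continuous_L2[OF _ \<Omega>_bounded \<Omega>_sets] \<phi> D by blast+
  define P where "P i j = integral {T (j - 1)..T j} (\<lambda>y. \<phi> (pt (S i) y))" for i j
  have c\<phi>: "continuous_on A (\<lambda>y. \<phi> (pt x y))" for A x
  proof -
    have "continuous_on A (\<lambda>y. pt x y)" unfolding pt_def by (cases "s = fst") (auto intro!: continuous_intros)
    then show ?thesis by (rule continuous_on_compose2[OF \<phi>]) simp
  qed
  \<comment> \<open>\<open>loc\<close> is affine in s and takes the two edge values at the ends, so
    integrating the derivative of its product with the test function over the element gives a
    difference of edge terms.\<close>
  have cell: "(LINT z|lebesgue_on (R (i, j)). field z * D z) + (LINT z|lebesgue_on (R (i, j)). field1 z * \<phi> z) = edge i j * P i j - edge (i - 1) j * P (i - 1) j"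
    if ij: "(i, j) \<in> E" for i j
  proof -
    let ?q = "\<lambda>z. loc (i, j) z" and ?b = "beta (i, j)"
    have cq: "continuous_on UNIV ?q" unfolding loc_def by (intro continuous_intros continuous_coords)
    have m: "k \<in> borel_measurable (lebesgue_on (R (i, j)))" if "k \<in> L2_space \<Omega>" for k :: "plane \<Rightarrow> real"
      using L2_measurable[OF L2_R[OF that ij]] .
    have mc: "k \<in> borel_measurable (lebesgue_on (R (i, j)))" if "continuous_on UNIV k" for k :: "plane \<Rightarrow> real"
      by (rule continuous_imp_measurable_on_sets_lebesgue[OF continuous_on_subset[OF that subset_UNIV]]) simp
    have 1: "(LINT z|lebesgue_on (R (i, j)). field z * D z) = (LINT z|lebesgue_on (R (i, j)). ?q z * D z)"
      by (rule integral_cong_AE) (use m[OF field_L2(1)] mc[OF D] mc[OF cq] in measurable, use field_AE(1)[OF ij] in eventually_elim, simp)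
    have 2: "(LINT z|lebesgue_on (R (i, j)). field1 z * \<phi> z) = (LINT z|lebesgue_on (R (i, j)). ?b * \<phi> z)"
      by (rule integral_cong_AE) (use m[OF field_L2(2)] mc[OF \<phi>] in measurable, use field_AE(2)[OF ij] in eventually_elim, simp)
    have i: "integrable (lebesgue_on (R (i, j))) (\<lambda>z. ?q z * D z)" "integrable (lebesgue_on (R (i, j))) (\<lambda>z. ?b * \<phi> z)"
      unfolding R_def by (intro integrable_crect_continuous continuous_intros cq D \<phi>)+
    have "(LINT z|lebesgue_on (R (i, j)). ?q z * D z) + (LINT z|lebesgue_on (R (i, j)). ?b * \<phi> z) = (LINT z|lebesgue_on (R (i, j)). ?q z * D z + ?b * \<phi> z)"
      using i by simp
    also have "\<dots> = integral {T (j - 1)..T j} (\<lambda>y. ?q (pt (S i) y) * \<phi> (pt (S i) y) - ?q (pt (S (i - 1)) y) * \<phi> (pt (S (i - 1)) y))"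
      unfolding R_def fst_conv snd_conv
    proof (rule integral_crect_partial)
      show "S (i - 1) \<le> S i" using E_bounds(5)[OF ij] by simp
      show "continuous_on UNIV (\<lambda>z. ?q z * D z + ?b * \<phi> z)" by (intro continuous_intros cq D \<phi>)
      fix x y
      have "((\<lambda>x. (lo (i, j) + ?b * (x - S (i - 1))) * \<phi> (pt x y)) has_real_derivative ?b * \<phi> (pt x y) + D (pt x y) * (lo (i, j) + ?b * (x - S (i - 1)))) (at x)"
        by (rule DERIV_mult[OF _ der]) (auto intro!: derivative_eq_intros)
      then show "((\<lambda>x. ?q (pt x y) * \<phi> (pt x y)) has_real_derivative ?q (pt x y) * D (pt x y) + ?b * \<phi> (pt x y)) (at x)"
        by (simp add: loc_def algebra_simps)
    qed
    also have "\<dots> = integral {T (j - 1)..T j} (\<lambda>y. edge i j * \<phi> (pt (S i) y) - edge (i - 1) j * \<phi> (pt (S (i - 1)) y))"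
      using loc_ends[OF ij] by (simp add: loc_def)
    also have "\<dots> = edge i j * P i j - edge (i - 1) j * P (i - 1) j"
      unfolding P_def by (subst Henstock_Kurzweil_Integration.integral_diff) (auto intro!: integrable_continuous_interval continuous_intros c\<phi>)
    finally show ?thesis unfolding 1 2 .
  qed
  have P0: "P i j = 0" if "\<And>y. y \<in> {T (j - 1)..T j} \<Longrightarrow> \<phi> (pt (S i) y) = 0" for i j
    unfolding P_def using that by (subst Henstock_Kurzweil_Integration.integral_cong[where g="\<lambda>_. 0"]) auto
  have non: "edge i j * P i j - edge (i - 1) j * P (i - 1) j = 0" if "(i, j) \<in> {1..ns} \<times> {1..nt}" "(i, j) \<notin> E" for i j
  proof -
    have d: "\<Omega> \<inter> R (i, j) = {}" by (rule nonelement_disjoint[OF that])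
    have "S (i - 1) \<le> S i" using S_less[of "i - 1" i] that by auto
    then have "pt (S i) y \<in> R (i, j)" "pt (S (i - 1)) y \<in> R (i, j)" if "y \<in> {T (j - 1)..T j}" for y
      using that by (auto simp: R_def crect_def)
    then have "pt (S i) y \<notin> \<Omega>" "pt (S (i - 1)) y \<notin> \<Omega>" if "y \<in> {T (j - 1)..T j}" for y using d that by blast+
    then have "P i j = 0" "P (i - 1) j = 0" by (intro P0 zero; blast)+
    then show ?thesis by simp
  qed
  have "L2_inner \<Omega> field D + L2_inner \<Omega> field1 \<phi> = (\<Sum>ij\<in>E. (LINT z|lebesgue_on (R ij). field z * D z) + (LINT z|lebesgue_on (R ij). field1 z * \<phi> z))"
    unfolding L2_inner_def using integral_E[OF L2_integrable_mult[OF field_L2(1) L(2)]] integral_E[OF L2_integrable_mult[OF field_L2(2) L(1)]]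
    by (simp add: sum.distrib)
  also have "\<dots> = (\<Sum>ij\<in>E. edge (fst ij) (snd ij) * P (fst ij) (snd ij) - edge (fst ij - 1) (snd ij) * P (fst ij - 1) (snd ij))"
    using cell by (intro sum.cong) auto
  also have "\<dots> = (\<Sum>ij\<in>{1..ns} \<times> {1..nt}. edge (fst ij) (snd ij) * P (fst ij) (snd ij) - edge (fst ij - 1) (snd ij) * P (fst ij - 1) (snd ij))"
    using E_bounds non by (intro sum.mono_neutral_left) (auto simp: mem_Times_iff)
  also have "\<dots> = (\<Sum>j\<in>{1..nt}. \<Sum>i\<in>{1..ns}. edge i j * P i j - edge (i - 1) j * P (i - 1) j)"
    by (subst sum.swap) (simp add: sum.cartesian_product case_prod_unfold)
  also have "\<dots> = (\<Sum>j\<in>{1..nt}. edge ns j * P ns j - edge 0 j * P 0 j)"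
  proof (rule sum.cong[OF refl])
    fix j
    have "(\<Sum>i\<in>{1..n}. edge i j * P i j - edge (i - 1) j * P (i - 1) j) = edge n j * P n j - edge 0 j * P 0 j" for n
      by (induction n) auto
    then show "(\<Sum>i\<in>{1..ns}. edge i j * P i j - edge (i - 1) j * P (i - 1) j) = edge ns j * P ns j - edge 0 j * P 0 j" .
  qed
  also have "\<dots> = 0"
  proof -
    have "pt (S 0) y \<notin> \<Omega>" "pt (S ns) y \<notin> \<Omega>" for y using outside[of "pt (S 0) y"] outside[of "pt (S ns) y"] by auto
    then have "P ns j = 0" "P 0 j = 0" for j by (intro P0 zero; blast)+
    then show ?thesis by simp
  qed
  finally show ?thesis by simp
qed

end

section \<open>Interpolation errors summed over the mesh\<close>

locale interpolated2 = interpolated \<Omega> G s t f f1 for \<Omega> G s t f f1 +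
  fixes f2 :: "plane \<Rightarrow> real"
  assumes f2L: "f2 \<in> L2_space \<Omega>" and wpf1: "weak_partial s t \<Omega> f1 f2"
begin

lemma element_R:
  assumes ij: "ij \<in> E"
  shows "element s t (S (fst ij - 1)) (S (fst ij)) (T (snd ij - 1)) (T (snd ij)) f f1 f2"
proof unfold_locales
  show "S (fst ij - 1) < S (fst ij)" "T (snd ij - 1) < T (snd ij)" by (rule E_bounds[OF ij])+
  show "f \<in> L2_space (crect s t (S (fst ij - 1)) (S (fst ij)) (T (snd ij - 1)) (T (snd ij)))"
    "f1 \<in> L2_space (crect s t (S (fst ij - 1)) (S (fst ij)) (T (snd ij - 1)) (T (snd ij)))"
    "f2 \<in> L2_space (crect s t (S (fst ij - 1)) (S (fst ij)) (T (snd ij - 1)) (T (snd ij)))"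
    using L2_R[OF fL ij] L2_R[OF f1L ij] L2_R[OF f2L ij] unfolding R_def by auto
  note sub = OR_subset[OF ij, unfolded OR_def]
  show "weak_partial s t (orect s t (S (fst ij - 1)) (S (fst ij)) (T (snd ij - 1)) (T (snd ij))) f f1"
    "weak_partial s t (orect s t (S (fst ij - 1)) (S (fst ij)) (T (snd ij - 1)) (T (snd ij))) f1 f2"
    by (rule weak_partial_mono[OF wpf \<Omega>_sets orect_sets sub] weak_partial_mono[OF wpf1 \<Omega>_sets orect_sets sub])+
qed

lemma loc_interp:
  assumes ij: "ij \<in> E"
  shows "loc ij z = element.interp s t (S (fst ij - 1)) (S (fst ij)) (T (snd ij - 1)) (T (snd ij)) f f1 z"
    and "beta ij = (LINT z|lebesgue_on (R ij). f1 z) / area ij"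
proof -
  interpret el: element s t "S (fst ij - 1)" "S (fst ij)" "T (snd ij - 1)" "T (snd ij)" f f1 f2
    by (rule element_R[OF ij])
  have e: "lo ij = el.edge_lo" "hi ij = el.edge_hi"
    unfolding lo_def hi_def el.edge_lo_def el.edge_hi_def by (simp_all add: R_def area_def el.w_def del: One_nat_def)
  show "loc ij z = el.interp z"
    unfolding loc_def beta_def e el.interp_edges el.h_def ..
  have d: "el.edge_hi - el.edge_lo = el.slope * el.h" unfolding el.edges_interp by simp
  have "beta ij = el.slope" unfolding beta_def e d el.h_def[symmetric] using el.hw(1) by simp
  then show "beta ij = (LINT z|lebesgue_on (R ij). f1 z) / area ij"
    by (simp add: el.slope_def area_def el.w_def R_def del: One_nat_def)
qed

text \<open>The commuting property: the slope on an element is the mean of \<open>f1\<close>, so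
  interpolation followed by differentiation agrees with differentiation followed by
  averaging.\<close>

lemma integral_field1: "ij \<in> E \<Longrightarrow> (LINT z|lebesgue_on (R ij). field1 z) = (LINT z|lebesgue_on (R ij). f1 z)"
proof -
  assume ij: "ij \<in> E"
  note b = E_bounds[OF ij]
  have "(LINT z|lebesgue_on (R ij). field1 z) = (LINT z|lebesgue_on (R ij). beta ij)"
    by (rule integral_cong_AE) (use L2_measurable[OF L2_R[OF field_L2(2) ij]] field_AE(2)[OF ij] in auto)
  also have "\<dots> = area ij * beta ij"
    using b by (simp add: R_def measure_restrict_space measure_crect area_def)
  also have "\<dots> = (LINT z|lebesgue_on (R ij). f1 z)" using b by (simp add: loc_interp(2)[OF ij] area_def)
  finally show ?thesis .
qed

definition "err z = f z - field z"

lemma err_L2: "err \<in> L2_space \<Omega>"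
  unfolding err_def[abs_def] by (rule L2_diff[OF fL field_L2(1)])

lemma err_AE: "ij \<in> E \<Longrightarrow> AE z in lebesgue_on (R ij). err z = element.resid s t (S (fst ij - 1)) (S (fst ij)) (T (snd ij - 1)) (T (snd ij)) f f1 z"
proof -
  assume ij: "ij \<in> E"
  interpret el: element s t "S (fst ij - 1)" "S (fst ij)" "T (snd ij - 1)" "T (snd ij)" f f1 f2
    by (rule element_R[OF ij])
  show "AE z in lebesgue_on (R ij). err z = el.resid z"
    using field_AE(1)[OF ij] by eventually_elim (simp add: err_def el.resid_def loc_interp(1)[OF ij] del: One_nat_def)
qed

text \<open>The local estimates carry products of local norms; the Cauchy-Schwarz inequality for the
  sum over the elements collects them into global norms, whatever the number of elements.\<close>

lemma err_affine_bound:
  assumes \<tau>: "\<tau> \<in> L2_space \<Omega>" and aff: "\<And>ij. ij \<in> E \<Longrightarrow> \<exists>\<alpha> \<gamma>. AE z in lebesgue_on (R ij). \<tau> z = \<alpha> + \<gamma> * s z"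
    and H: "\<And>i. 1 \<le> i \<Longrightarrow> i \<le> ns \<Longrightarrow> S i - S (i - 1) \<le> H"
  shows "\<bar>L2_inner \<Omega> err \<tau>\<bar> \<le> H\<^sup>2 * L2_norm \<Omega> f2 * L2_norm \<Omega> \<tau>"
proof -
  have loc: "\<bar>L2_inner (R ij) err \<tau>\<bar> \<le> H\<^sup>2 * (L2_norm (R ij) f2 * L2_norm (R ij) \<tau>)" if ij: "ij \<in> E" for ij
  proof -
    interpret el: element s t "S (fst ij - 1)" "S (fst ij)" "T (snd ij - 1)" "T (snd ij)" f f1 f2
      by (rule element_R[OF ij])
    obtain \<alpha> \<gamma> where ae: "AE z in lebesgue_on (R ij). \<tau> z = \<alpha> + \<gamma> * s z" using aff[OF ij] by blast
    define \<alpha>' where "\<alpha>' = \<alpha> + \<gamma> * el.mid"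
    have ae': "AE z in lebesgue_on el.R. \<tau> z = \<alpha>' + \<gamma> * (s z - el.mid)"
      using ae unfolding R_def by eventually_elim (simp add: \<alpha>'_def algebra_simps)
    have aL: "(\<lambda>z. \<alpha>' + \<gamma> * (s z - el.mid)) \<in> L2_space el.R"
      using el.smooth_L2[of "\<lambda>x. \<alpha>' + \<gamma> * (x - el.mid)"] by simp
    have "L2_inner el.R err \<tau> = L2_inner el.R el.resid (\<lambda>z. \<alpha>' + \<gamma> * (s z - el.mid))"
      using err_AE[OF ij] ae' L2_R[OF err_L2 ij] L2_R[OF \<tau> ij] el.interp_L2(2) aL unfolding R_def
      by (intro L2_inner_AE_cong) auto
    then have "\<bar>L2_inner el.R err \<tau>\<bar> \<le> el.h\<^sup>2 * L2_norm el.R f2 * L2_norm el.R (\<lambda>z. \<alpha>' + \<gamma> * (s z - el.mid))"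
      using el.resid_affine_bound[of \<alpha>' \<gamma>] by (simp add: L2_inner_def)
    also have "L2_norm el.R (\<lambda>z. \<alpha>' + \<gamma> * (s z - el.mid)) = L2_norm el.R \<tau>"
      using ae' L2_R[OF \<tau> ij] aL unfolding R_def by (intro L2_norm_AE_cong) (auto elim: eventually_mono)
    also have "el.h\<^sup>2 * L2_norm el.R f2 * L2_norm el.R \<tau> \<le> H\<^sup>2 * L2_norm el.R f2 * L2_norm el.R \<tau>"
    proof -
      have "el.h \<le> H" using H[of "fst ij"] E_bounds[OF ij] by (simp add: el.h_def del: One_nat_def)
      then have "el.h\<^sup>2 \<le> H\<^sup>2" using el.hw(1) by (intro power_mono) auto
      then show ?thesis by (intro mult_right_mono) auto
    qed
    finally show ?thesis by (simp add: R_def mult.assoc)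
  qed
  have "L2_inner \<Omega> err \<tau> = (\<Sum>ij\<in>E. L2_inner (R ij) err \<tau>)"
    unfolding L2_inner_\<Omega>[OF err_L2 \<tau>] by (rule sum_E)
  then have "\<bar>L2_inner \<Omega> err \<tau>\<bar> \<le> (\<Sum>ij\<in>E. \<bar>L2_inner (R ij) err \<tau>\<bar>)" by simp
  also have "\<dots> \<le> (\<Sum>ij\<in>E. H\<^sup>2 * (L2_norm (R ij) f2 * L2_norm (R ij) \<tau>))" using loc by (rule sum_mono)
  also have "\<dots> = H\<^sup>2 * (\<Sum>ij\<in>E. L2_norm (R ij) f2 * L2_norm (R ij) \<tau>)" by (simp add: sum_distrib_left)
  also have "(\<Sum>ij\<in>E. L2_norm (R ij) f2 * L2_norm (R ij) \<tau>) \<le> L2_norm \<Omega> f2 * L2_norm \<Omega> \<tau>"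
  proof (rule power2_le_imp_le)
    have "(L2_norm \<Omega> k)\<^sup>2 = (\<Sum>ij\<in>E. (L2_norm (R ij) k)\<^sup>2)" if "k \<in> L2_space \<Omega>" for k :: "plane \<Rightarrow> real"
      unfolding L2_norm_power2 L2_inner_\<Omega>[OF that that] by (rule sum_E)
    then show "(\<Sum>ij\<in>E. L2_norm (R ij) f2 * L2_norm (R ij) \<tau>)\<^sup>2 \<le> (L2_norm \<Omega> f2 * L2_norm \<Omega> \<tau>)\<^sup>2"
      unfolding power_mult_distrib using f2L \<tau> Cauchy_Schwarz_ineq_sum by simp
  qed simp
  finally show ?thesis by (simp add: mult_left_mono mult.assoc)
qed

end

locale interpolated4 = interpolated2 \<Omega> G s t f f1 f2 for \<Omega> G s t f f1 f2 +
  fixes f3 f4 g :: "plane \<Rightarrow> real"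
  assumes f34L: "f3 \<in> L2_space \<Omega>" "f4 \<in> L2_space \<Omega>" "g \<in> L2_space \<Omega>"
    and wpf2: "weak_partial s t \<Omega> f2 f3" "weak_partial s t \<Omega> f3 f4" "weak_partial t s \<Omega> f2 g"
begin

text \<open>All terms of the elementwise estimate are integrals or squared norms and hence additive
  over the elements; this is why the residual was left there as a squared norm.\<close>

lemma err_field_bound:
  assumes H: "\<And>i. 1 \<le> i \<Longrightarrow> i \<le> ns \<Longrightarrow> S i - S (i - 1) \<le> H" "\<And>j. 1 \<le> j \<Longrightarrow> j \<le> nt \<Longrightarrow> T j - T (j - 1) \<le> H" "H \<le> 1"
  shows "\<bar>L2_inner \<Omega> err field + 1 / 12 * (\<Sum>ij\<in>E. (S (fst ij) - S (fst ij - 1))\<^sup>2 * (LINT z|lebesgue_on (R ij). f2 z * f z))\<bar>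
    \<le> 3 * H ^ 4 * (L2_inner \<Omega> f f + L2_inner \<Omega> f1 f1 + L2_inner \<Omega> f2 f2 + L2_inner \<Omega> f3 f3 + L2_inner \<Omega> f4 f4 + L2_inner \<Omega> g g)
      + H\<^sup>2 * L2_inner \<Omega> err err"
proof -
  define n where "n r = L2_inner r f f + L2_inner r f1 f1 + L2_inner r f2 f2 + L2_inner r f3 f3 + L2_inner r f4 f4 + L2_inner r g g" for r
  define lead where "lead ij = 1 / 12 * ((S (fst ij) - S (fst ij - 1))\<^sup>2 * (LINT z|lebesgue_on (R ij). f2 z * f z))" for ij
  have loc: "\<bar>L2_inner (R ij) err field + lead ij\<bar> \<le> 3 * H ^ 4 * n (R ij) + H\<^sup>2 * L2_inner (R ij) err err" if ij: "ij \<in> E" for ij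
  proof -
    note sub = OR_subset[OF ij, unfolded OR_def]
    have "smooth_element s t (S (fst ij - 1)) (S (fst ij)) (T (snd ij - 1)) (T (snd ij)) f f1 f2 f3 f4 g"
      unfolding smooth_element_def smooth_element_axioms_def
    proof (intro conjI element_R[OF ij])
      show "f3 \<in> L2_space (crect s t (S (fst ij - 1)) (S (fst ij)) (T (snd ij - 1)) (T (snd ij)))"
        "f4 \<in> L2_space (crect s t (S (fst ij - 1)) (S (fst ij)) (T (snd ij - 1)) (T (snd ij)))"
        "g \<in> L2_space (crect s t (S (fst ij - 1)) (S (fst ij)) (T (snd ij - 1)) (T (snd ij)))"
        using L2_R[OF f34L(1) ij] L2_R[OF f34L(2) ij] L2_R[OF f34L(3) ij] unfolding R_def by auto
    qed (rule weak_partial_mono[OF wpf2(1) \<Omega>_sets orect_sets sub] weak_partial_mono[OF wpf2(2) \<Omega>_sets orect_sets sub]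
        weak_partial_mono[OF wpf2(3) \<Omega>_sets orect_sets sub])+
    then interpret el: smooth_element s t "S (fst ij - 1)" "S (fst ij)" "T (snd ij - 1)" "T (snd ij)" f f1 f2 f3 f4 g .
    have 1: "L2_inner el.R err field = L2_inner el.R el.resid el.interp"
      using err_AE[OF ij] field_AE(1)[OF ij] L2_R[OF err_L2 ij] L2_R[OF field_L2(1) ij] el.interp_L2 loc_interp(1)[OF ij] unfolding R_def
      by (intro L2_inner_AE_cong) auto
    have 2: "L2_inner el.R err err = L2_inner el.R el.resid el.resid"
      using err_AE[OF ij] L2_R[OF err_L2 ij] el.interp_L2 unfolding R_def by (intro L2_inner_AE_cong) auto
    have "el.h \<le> H" "T (snd ij) - T (snd ij - 1) \<le> H" using H(1)[of "fst ij"] H(2)[of "snd ij"] E_bounds[OF ij] by (simp_all add: el.h_def del: One_nat_def)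
    from el.resid_interp_bound[OF this H(3)]
    show ?thesis unfolding R_def lead_def n_def 1 2 by (simp add: L2_inner_def el.h_def del: One_nat_def)
  qed
  have S: "L2_inner \<Omega> k l = (\<Sum>ij\<in>E. L2_inner (R ij) k l)" if "k \<in> L2_space \<Omega>" "l \<in> L2_space \<Omega>" for k l :: "plane \<Rightarrow> real"
    unfolding L2_inner_\<Omega>[OF that] by (rule sum_E)
  have "L2_inner \<Omega> err field + (\<Sum>ij\<in>E. lead ij) = (\<Sum>ij\<in>E. L2_inner (R ij) err field + lead ij)"
    unfolding S[OF err_L2 field_L2(1)] by (simp add: sum.distrib)
  then have "\<bar>L2_inner \<Omega> err field + (\<Sum>ij\<in>E. lead ij)\<bar> \<le> (\<Sum>ij\<in>E. \<bar>L2_inner (R ij) err field + lead ij\<bar>)" by simp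
  also have "\<dots> \<le> (\<Sum>ij\<in>E. 3 * H ^ 4 * n (R ij) + H\<^sup>2 * L2_inner (R ij) err err)" using loc by (rule sum_mono)
  also have "\<dots> = 3 * H ^ 4 * n \<Omega> + H\<^sup>2 * L2_inner \<Omega> err err"
    unfolding n_def S[OF err_L2 err_L2] S[OF fL fL] S[OF f1L f1L] S[OF f2L f2L] S[OF f34L(1) f34L(1)] S[OF f34L(2) f34L(2)] S[OF f34L(3) f34L(3)]
    by (simp add: sum.distrib sum_distrib_left distrib_left)
  finally show ?thesis by (simp add: lead_def n_def sum_distrib_left)
qed

end

section \<open>Supercloseness\<close>

text \<open>If x exceeded M + a + b, then a b \<le> (a + b) x would make the right-hand side smaller
  than x^2. This absorbs the term M x, with x the norm to be estimated.\<close>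

lemma quadratic_bound:
  fixes x M a b :: real
  assumes "x\<^sup>2 \<le> a * b + M * x" "0 \<le> a" "0 \<le> b" "0 \<le> M"
  shows "x \<le> M + a + b"
proof (rule ccontr)
  assume "\<not> x \<le> M + a + b"
  then have x: "x > M + a + b" by simp
  have "a * b \<le> (a + b) * (a + b)" using assms by (intro mult_mono) auto
  also have "\<dots> \<le> (a + b) * x" using assms x by (intro mult_left_mono) auto
  finally have "a * b + M * x \<le> (M + a + b) * x" by (simp add: algebra_simps)
  also have "\<dots> < x * x"
    using assms x by (intro mult_strict_right_mono) auto
  finally show False using assms(1) by (simp add: power2_eq_square)
qed

context discrete
begin

text \<open>All constants are explicit in order to keep track of uniformity in the mesh.
  \<open>A\<close> bounds the distance of \<open>uh k\<close> from the projection of u onto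
  \<open>V_h\<close>: the component along \<open>uh k\<close> contributes half the square of the
  bound for \<open>uh k\<close> - u, the components outside the cluster \<open>C\<close> contribute
  M / \<delta>. The factor sqrt(lamh j) in the gap condition matches the norm of the flux
  \<open>\<sigma>h j\<close>.\<close>

lemma supercloseness:
  fixes \<sigma> \<rho> :: "plane \<Rightarrow> plane" and u :: "plane \<Rightarrow> real" and A B\<^sub>1 B\<^sub>2 M \<delta> \<mu> :: real
  assumes k: "k \<in> {1..N}" and kC: "k \<in> C"
    and \<sigma>L: "\<sigma> \<in> L2_space \<Omega>" and uL: "u \<in> L2_space \<Omega>" and un: "ip u u = 1"
    and \<rho>: "\<rho> \<in> Sigma_h \<Omega> G" and \<mu>: "\<mu> > 0"
    and cont: "\<And>\<tau>. \<tau> \<in> Sigma_h \<Omega> G \<Longrightarrow> ip \<sigma> \<tau> = ip (dv \<tau>) u"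
    and div\<rho>: "\<And>v. v \<in> V_h \<Omega> G \<Longrightarrow> ip (dv \<rho>) v = \<mu> * ip u v"
    and consist: "\<And>\<tau>. \<tau> \<in> Sigma_h \<Omega> G \<Longrightarrow> \<bar>ip (\<lambda>p. \<sigma> p - \<rho> p) \<tau>\<bar> \<le> M * L2_norm \<Omega> \<tau>" and M: "M \<ge> 0"
    and gap: "\<And>j. j \<in> {1..N} \<Longrightarrow> j \<notin> C \<Longrightarrow> \<delta> * sqrt (lamh j) \<le> \<bar>lamh j - \<mu>\<bar>" and \<delta>: "\<delta> > 0"
    and cluster: "\<And>j. j \<in> {1..N} \<Longrightarrow> j \<in> C \<Longrightarrow> j \<noteq> k \<Longrightarrow> ip u (uh j) = 0"
    and B1: "\<bar>lamh k - \<mu>\<bar> \<le> B\<^sub>1" and B2: "L2_norm \<Omega> (\<lambda>p. uh k p - u p) \<le> B\<^sub>2"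
  defines "A \<equiv> B\<^sub>2\<^sup>2 / 2 + M / \<delta>"
  shows "L2_norm \<Omega> (\<lambda>p. \<sigma>h k p - \<rho> p) \<le> M + (lamh k * A + B\<^sub>1) + A"
    and "\<bar>(lamh k - \<mu>) - ip (\<lambda>p. \<sigma> p - \<rho> p) \<rho>\<bar> \<le> B\<^sub>1 * (B\<^sub>2\<^sup>2 / 2) + M * L2_norm \<Omega> (\<lambda>p. \<sigma>h k p - \<rho> p)"
proof -
  define r where "r = (\<lambda>p. \<sigma> p - \<rho> p)"
  define e where "e = (\<lambda>p. \<sigma>h k p - \<rho> p)"
  define \<alpha> where "\<alpha> = ip u (uh k)"
  note \<rho>L = Sigma_h_L2[OF \<rho>]
  note uhL = V_h_L2[OF eig(2)]
  have rL: "r \<in> L2_space \<Omega>" unfolding r_def by (rule L2_diff[OF \<sigma>L \<rho>L])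
  have eS: "e \<in> Sigma_h \<Omega> G" unfolding e_def by (rule L2_subspace_diff[OF Sigma_h_subspace eig(1)[OF k] \<rho>])
  have A0: "A \<ge> 0" using M \<delta> by (simp add: A_def)
  have B10: "B\<^sub>1 \<ge> 0" using B1 by linarith
  have B20: "B\<^sub>2 \<ge> 0" using B2 L2_norm_nonneg order_trans by blast
  have consist': "\<bar>ip r \<tau>\<bar> \<le> M * L2_norm \<Omega> \<tau>" if "\<tau> \<in> Sigma_h \<Omega> G" for \<tau>
    using consist[OF that] by (simp add: r_def)
  \<comment> \<open>Both functions have norm 1, so 1 - \<alpha> is half the squared distance: of
    second order where the distance is of first order.\<close>
  have \<alpha>: "\<bar>1 - \<alpha>\<bar> \<le> B\<^sub>2\<^sup>2 / 2"
  proof -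
    have "(L2_norm \<Omega> (\<lambda>p. uh k p - u p))\<^sup>2 = ip (uh k) (uh k) - 2 * \<alpha> + ip u u"
      unfolding L2_norm_power2 \<alpha>_def using uhL[OF k] uL L2_diff[OF uhL[OF k] uL]
      by (simp add: L2_inner_diff_left L2_inner_diff_right L2_inner_commute[of \<Omega> "uh k" u])
    also have "ip (uh k) (uh k) = 1" using uh_orthonormal k by (simp add: orthonormal_def)
    finally have "1 - \<alpha> = (L2_norm \<Omega> (\<lambda>p. uh k p - u p))\<^sup>2 / 2" using un by simp
    moreover have "(L2_norm \<Omega> (\<lambda>p. uh k p - u p))\<^sup>2 \<le> B\<^sub>2\<^sup>2" using B2 by (intro power_mono) auto
    moreover have "0 \<le> (L2_norm \<Omega> (\<lambda>p. uh k p - u p))\<^sup>2" by simp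
    ultimately show ?thesis by linarith
  qed
  have identity: "(lamh j - \<mu>) * ip u (uh j) = ip r (\<sigma>h j)" if j: "j \<in> {1..N}" for j
  proof -
    have "ip r (\<sigma>h j) = ip \<sigma> (\<sigma>h j) - ip \<rho> (\<sigma>h j)"
      unfolding r_def by (rule L2_inner_diff_left[OF \<sigma>L \<rho>L Sigma_h_L2[OF eig(1)[OF j]]])
    also have "ip \<sigma> (\<sigma>h j) = lamh j * ip (uh j) u" using cont[OF eig(1)[OF j]] ip_dv_\<sigma>h[OF j uL] by simp
    also have "ip \<rho> (\<sigma>h j) = ip (dv \<rho>) (uh j)" using eig(4)[OF j \<rho>] by (simp add: L2_inner_commute)
    also have "\<dots> = \<mu> * ip u (uh j)" by (rule div\<rho>[OF eig(2)[OF j]])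
    finally show ?thesis by (simp add: L2_inner_commute[of \<Omega> "uh j"] left_diff_distrib)
  qed
  \<comment> \<open>\<open>P\<close> is the projection of u onto \<open>V_h\<close>, obtained from
    the divergence of the interpolant.\<close>
  define P where "P = (\<lambda>p. (1 / \<mu>) * dv \<rho> p)"
  have PV: "P \<in> V_h \<Omega> G" unfolding P_def
    using L2_subspace_scaleR[OF V_h_subspace weak_div_V_h[OF \<rho>], of "1 / \<mu>"] by simp
  have P: "ip P v = ip u v" if "v \<in> V_h \<Omega> G" for v
    unfolding P_def L2_inner_cmult_left using div\<rho>[OF that] \<mu> by simp
  note PL = V_h_L2[OF PV]
  define w where "w = (\<lambda>p. P p - uh k p)"
  have wV: "w \<in> V_h \<Omega> G" unfolding w_def by (rule L2_subspace_diff[OF V_h_subspace PV eig(2)[OF k]])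
  note wL = V_h_L2[OF wV]
  have w_coeff: "ip w (uh j) = ip u (uh j) - (if j = k then 1 else 0)" if j: "j \<in> {1..N}" for j
    unfolding w_def using uh_orthonormal k j P[OF eig(2)[OF j]]
    by (subst L2_inner_diff_left[OF PL uhL[OF k] uhL[OF j]]) (auto simp: orthonormal_def)
  have wA: "L2_norm \<Omega> w \<le> A"
  proof (rule power2_le_imp_le[OF _ A0])
    have "(L2_norm \<Omega> w)\<^sup>2 = (\<Sum>j\<in>{1..N}. (ip w (uh j))\<^sup>2)" by (rule V_h_expansion(2)[OF wV])
    also have "\<dots> \<le> (\<Sum>j\<in>{1..N}. (if j = k then (1 - \<alpha>)\<^sup>2 else 0) + (ip r (shat j))\<^sup>2 / \<delta>\<^sup>2)"
    proof (rule sum_mono)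
      fix j assume j: "j \<in> {1..N}"
      have nn: "0 \<le> (ip r (shat j))\<^sup>2 / \<delta>\<^sup>2" by simp
      consider "j = k" | "j \<noteq> k" "j \<in> C" | "j \<notin> C" by blast
      then show "(ip w (uh j))\<^sup>2 \<le> (if j = k then (1 - \<alpha>)\<^sup>2 else 0) + (ip r (shat j))\<^sup>2 / \<delta>\<^sup>2"
      proof cases
        case 1
        then show ?thesis using w_coeff[OF j] nn by (simp add: \<alpha>_def power2_commute)
      next
        case 2
        then show ?thesis using w_coeff[OF j] cluster[OF j] by simp
      next
        case 3
        then have jk: "j \<noteq> k" using kC by blast
        have s: "sqrt (lamh j) > 0" using eig(3)[OF j] by simp
        \<comment> \<open>Cancelling sqrt(lamh j) replaces \<open>\<sigma>h j\<close> by the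
          normalised flux, to which Bessel's inequality applies.\<close>
        have "\<delta> * sqrt (lamh j) * \<bar>ip u (uh j)\<bar> \<le> \<bar>lamh j - \<mu>\<bar> * \<bar>ip u (uh j)\<bar>"
          using gap[OF j 3] by (rule mult_right_mono) simp
        also have "\<dots> = sqrt (lamh j) * \<bar>ip r (shat j)\<bar>"
          using identity[OF j] \<sigma>h_shat[OF j, of r] s by (simp add: abs_mult[symmetric]) (simp add: abs_mult)
        finally have "\<delta> * \<bar>ip u (uh j)\<bar> \<le> \<bar>ip r (shat j)\<bar>" using s by (simp add: mult_ac)
        then have "(\<delta> * \<bar>ip u (uh j)\<bar>)\<^sup>2 \<le> \<bar>ip r (shat j)\<bar>\<^sup>2" using \<delta> by (intro power_mono) auto
        then have "(ip u (uh j))\<^sup>2 \<le> (ip r (shat j))\<^sup>2 / \<delta>\<^sup>2" using \<delta> by (simp add: power_mult_distrib field_simps)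
        then show ?thesis using w_coeff[OF j] jk by simp
      qed
    qed
    also have "\<dots> = (1 - \<alpha>)\<^sup>2 + (\<Sum>j\<in>{1..N}. (ip r (shat j))\<^sup>2) / \<delta>\<^sup>2"
      using k by (simp add: sum.distrib sum_divide_distrib)
    also have "\<dots> \<le> (B\<^sub>2\<^sup>2 / 2)\<^sup>2 + M\<^sup>2 / \<delta>\<^sup>2"
    proof (intro add_mono divide_right_mono)
      have "\<bar>1 - \<alpha>\<bar>\<^sup>2 \<le> (B\<^sub>2\<^sup>2 / 2)\<^sup>2" using \<alpha> by (rule power_mono) simp
      then show "(1 - \<alpha>)\<^sup>2 \<le> (B\<^sub>2\<^sup>2 / 2)\<^sup>2" by simp
      show "(\<Sum>j\<in>{1..N}. (ip r (shat j))\<^sup>2) \<le> M\<^sup>2"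
        by (rule dual_bound_Bessel[OF shat_orthonormal shat_Sigma_h Sigma_h_subspace rL consist' M])
    qed simp
    also have "\<dots> \<le> A\<^sup>2"
    proof -
      have "0 \<le> 2 * (B\<^sub>2\<^sup>2 / 2) * (M / \<delta>)" using M \<delta> by simp
      then show ?thesis unfolding A_def power2_sum power_divide[of M] by linarith
    qed
    finally show "(L2_norm \<Omega> w)\<^sup>2 \<le> A\<^sup>2" .
  qed
  have Pn: "L2_norm \<Omega> P \<le> 1"
  proof -
    have "(L2_norm \<Omega> P)\<^sup>2 = ip u P" unfolding L2_norm_power2 by (rule P[OF PV])
    also have "\<dots> \<le> L2_norm \<Omega> u * L2_norm \<Omega> P" using L2_Cauchy_Schwarz[OF uL PL] by simp
    also have "\<dots> = L2_norm \<Omega> P" using un by (simp add: L2_norm_def[of _ u])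
    finally have "L2_norm \<Omega> P * L2_norm \<Omega> P \<le> 1 * L2_norm \<Omega> P" by (simp add: power2_eq_square)
    then show ?thesis using L2_norm_nonneg[of \<Omega> P] by (cases "L2_norm \<Omega> P = 0") (auto simp: mult_le_cancel_right)
  qed
  \<comment> \<open>With w = P - uh k, the divergence lamh k uh k - \<mu> P of e is rewritten as
    -lamh k w + (lamh k - \<mu>) P.\<close>
  have dve: "L2_norm \<Omega> (dv e) \<le> lamh k * A + B\<^sub>1"
  proof -
    let ?x = "\<lambda>p. (- lamh k) *\<^sub>R w p + (lamh k - \<mu>) *\<^sub>R P p"
    have \<mu>P: "\<mu> * P p = dv \<rho> p" for p using \<mu> by (simp add: P_def)
    have "AE p in lebesgue_on \<Omega>. dv e p = ?x p"
      using weak_div_diff(2)[OF Sigma_h_H_div[OF eig(1)[OF k]] Sigma_h_H_div[OF \<rho>]] div_\<sigma>h[OF k]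
      unfolding e_def by eventually_elim (simp add: w_def right_diff_distrib left_diff_distrib \<mu>P)
    then have "L2_norm \<Omega> (dv e) = L2_norm \<Omega> ?x"
      using dv_L2[OF eS] wL PL by (intro L2_norm_AE_cong) (auto intro!: L2_add L2_cmult)
    also have "\<dots> \<le> L2_norm \<Omega> (\<lambda>p. (- lamh k) *\<^sub>R w p) + L2_norm \<Omega> (\<lambda>p. (lamh k - \<mu>) *\<^sub>R P p)"
      by (intro L2_norm_triangle L2_scaleR wL PL)
    also have "\<dots> = lamh k * L2_norm \<Omega> w + \<bar>lamh k - \<mu>\<bar> * L2_norm \<Omega> P"
      unfolding L2_norm_scaleR using eig(3)[OF k] by simp
    also have "\<dots> \<le> lamh k * A + B\<^sub>1 * 1"
      using wA Pn B1 B10 eig(3)[OF k] by (intro add_mono mult_mono) auto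
    finally show ?thesis by simp
  qed
  \<comment> \<open>An energy argument: after adding and subtracting \<sigma>, the difference of the
    two first equations acts on e through its divergence, where u may be replaced by
    \<open>P\<close> since that divergence lies in \<open>V_h\<close>.\<close>
  have e2: "(L2_norm \<Omega> e)\<^sup>2 \<le> (lamh k * A + B\<^sub>1) * A + M * L2_norm \<Omega> e"
  proof -
    have "ip e e = ip (\<sigma>h k) e - ip \<rho> e"
      using e_def L2_inner_diff_left[OF Sigma_h_L2[OF eig(1)[OF k]] \<rho>L Sigma_h_L2[OF eS]] by simp
    moreover have "ip r e = ip \<sigma> e - ip \<rho> e" unfolding r_def by (rule L2_inner_diff_left[OF \<sigma>L \<rho>L Sigma_h_L2[OF eS]])
    ultimately have "ip e e = (ip (dv e) (uh k) - ip (dv e) u) + ip r e"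
      using eig(4)[OF k eS] cont[OF eS] by simp
    also have "ip (dv e) u = ip (dv e) P" using P[OF weak_div_V_h[OF eS]] by (simp add: L2_inner_commute)
    also have "ip (dv e) (uh k) - ip (dv e) P = - ip (dv e) w"
      unfolding w_def using L2_inner_diff_right[OF PL uhL[OF k] dv_L2[OF eS]] by simp
    finally have "(L2_norm \<Omega> e)\<^sup>2 \<le> \<bar>ip (dv e) w\<bar> + \<bar>ip r e\<bar>" unfolding L2_norm_power2 by linarith
    also have "\<dots> \<le> L2_norm \<Omega> (dv e) * L2_norm \<Omega> w + M * L2_norm \<Omega> e"
      using L2_Cauchy_Schwarz[OF dv_L2[OF eS] wL] consist'[OF eS] by (rule add_mono)
    also have "L2_norm \<Omega> (dv e) * L2_norm \<Omega> w \<le> (lamh k * A + B\<^sub>1) * A"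
      using dve wA eig(3)[OF k] A0 B10 by (intro mult_mono) auto
    finally show ?thesis by simp
  qed
  then show "L2_norm \<Omega> (\<lambda>p. \<sigma>h k p - \<rho> p) \<le> M + (lamh k * A + B\<^sub>1) + A"
    using quadratic_bound[OF e2] eig(3)[OF k] A0 B10 M by (simp add: e_def)
  \<comment> \<open>The identity for j = k is compared with (r, \<rho>); the defect (r, e) is a
    product of the consistency bound M and the superclose norm of e.\<close>
  have "ip r (\<sigma>h k) = ip r \<rho> + ip r e"
    unfolding e_def using L2_inner_diff_right[OF Sigma_h_L2[OF eig(1)[OF k]] \<rho>L rL] by simp
  then have "(lamh k - \<mu>) - ip r \<rho> = (lamh k - \<mu>) * (1 - \<alpha>) + ip r e"
    using identity[OF k] by (simp add: \<alpha>_def right_diff_distrib)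
  then have "\<bar>(lamh k - \<mu>) - ip r \<rho>\<bar> \<le> \<bar>lamh k - \<mu>\<bar> * \<bar>1 - \<alpha>\<bar> + \<bar>ip r e\<bar>"
    by (simp add: abs_mult[symmetric])
  also have "\<dots> \<le> B\<^sub>1 * (B\<^sub>2\<^sup>2 / 2) + M * L2_norm \<Omega> e"
    using B1 \<alpha> B10 consist'[OF eS] by (intro add_mono mult_mono) auto
  finally show "\<bar>(lamh k - \<mu>) - ip (\<lambda>p. \<sigma> p - \<rho> p) \<rho>\<bar> \<le> B\<^sub>1 * (B\<^sub>2\<^sup>2 / 2) + M * L2_norm \<Omega> (\<lambda>p. \<sigma>h k p - \<rho> p)"
    by (simp add: r_def e_def)
qed

end

section \<open>The eigenvalue expansion on one mesh\<close>

context meshed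
begin

text \<open>These fields are admissible in the continuous problem and pick out one component of the
  flux. The derivative of a product of two test functions is integrated over a square around the
  domain, on whose boundary both vanish; no integration by parts on the domain itself is
  involved.\<close>

lemma tensor_fields_weak_div:
  assumes t: "tensor_test fst snd \<Omega> p q"
  defines "\<phi> \<equiv> \<lambda>z :: plane. p (fst z) * q (snd z)"
  shows "is_weak_div \<Omega> (\<lambda>z. (\<phi> z, 0)) (dx \<phi>)" "is_weak_div \<Omega> (\<lambda>z. (0, \<phi> z)) (dy \<phi>)"
proof -
  have \<phi>: "\<phi> \<in> test_functions \<Omega>" unfolding \<phi>_def by (rule tensor_test_fst_snd[OF t])
  obtain r where r: "r > 0" "\<Omega> \<subseteq> ball 0 r"
    using \<Omega>_bounded bounded_subset_ballD[of \<Omega> 0] by blast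
  define B where "B = crect fst snd (- r) r (- r) r"
  have sub: "\<Omega> \<subseteq> B" "\<And>z. z \<in> \<Omega> \<Longrightarrow> \<bar>fst z\<bar> < r \<and> \<bar>snd z\<bar> < r"
  proof -
    show *: "\<bar>fst z\<bar> < r \<and> \<bar>snd z\<bar> < r" if "z \<in> \<Omega>" for z
    proof -
      have "norm z < r" using r that by auto
      moreover have "norm (fst z) \<le> norm z" "norm (snd z) \<le> norm z"
        by (cases z; simp add: norm_Pair real_le_rsqrt)+
      ultimately show ?thesis by simp
    qed
    then show "\<Omega> \<subseteq> B" by (force simp: B_def crect_def)
  qed
  have key: "(LINT z|lebesgue_on \<Omega>. \<phi> z * dx \<psi> z + dx \<phi> z * \<psi> z) = 0" "(LINT z|lebesgue_on \<Omega>. \<phi> z * dy \<psi> z + dy \<phi> z * \<psi> z) = 0"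
    if \<psi>: "\<psi> \<in> test_functions \<Omega>" for \<psi>
  proof -
    note c = test_function_continuous[OF \<phi>] test_function_continuous[OF \<psi>]
    note z = test_function_zero[OF \<phi>] test_function_zero[OF \<psi>]
    have B': "B = crect snd fst (- r) r (- r) r" by (auto simp: B_def crect_def)
    have zb: "\<phi> (r, y) = 0" "\<phi> (- r, y) = 0" "\<phi> (y, r) = 0" "\<phi> (y, - r) = 0" for y
      using sub(2)[of "(r, y)"] sub(2)[of "(- r, y)"] sub(2)[of "(y, r)"] sub(2)[of "(y, - r)"] r(1) z(1) by force+
    have "(LINT z|lebesgue_on B. \<phi> z * dx \<psi> z + dx \<phi> z * \<psi> z) = 0"
      unfolding B_def
    proof (subst xy.integral_crect_partial[where G="\<lambda>z. \<phi> z * \<psi> z"])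
      show "continuous_on UNIV (\<lambda>z. \<phi> z * dx \<psi> z + dx \<phi> z * \<psi> z)" by (intro continuous_intros c)
      fix x y
      show "((\<lambda>x. \<phi> (xy.pt x y) * \<psi> (xy.pt x y)) has_real_derivative \<phi> (xy.pt x y) * dx \<psi> (xy.pt x y) + dx \<phi> (xy.pt x y) * \<psi> (xy.pt x y)) (at x)"
        unfolding xy.pt_def using DERIV_mult[OF test_function_deriv(1)[OF \<phi>, of y x] test_function_deriv(1)[OF \<psi>, of y x]]
        by (simp add: mult.commute add.commute)
    qed (use r zb in \<open>simp_all add: xy.pt_def\<close>)
    moreover have "(LINT z|lebesgue_on B. \<phi> z * dx \<psi> z + dx \<phi> z * \<psi> z) = (LINT z|lebesgue_on \<Omega>. \<phi> z * dx \<psi> z + dx \<phi> z * \<psi> z)"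
      by (rule integral_supported[OF _ \<Omega>_sets sub(1)]) (simp_all add: B_def z)
    ultimately show "(LINT z|lebesgue_on \<Omega>. \<phi> z * dx \<psi> z + dx \<phi> z * \<psi> z) = 0" by simp
    have ne: "(snd :: plane \<Rightarrow> real) \<noteq> fst" by (metis fst_conv snd_conv zero_neq_one)
    have "(LINT z|lebesgue_on B. \<phi> z * dy \<psi> z + dy \<phi> z * \<psi> z) = 0"
      unfolding B'
    proof (subst yx.integral_crect_partial[where G="\<lambda>z. \<phi> z * \<psi> z"])
      show "continuous_on UNIV (\<lambda>z. \<phi> z * dy \<psi> z + dy \<phi> z * \<psi> z)" by (intro continuous_intros c)
      fix x y
      show "((\<lambda>x. \<phi> (yx.pt x y) * \<psi> (yx.pt x y)) has_real_derivative \<phi> (yx.pt x y) * dy \<psi> (yx.pt x y) + dy \<phi> (yx.pt x y) * \<psi> (yx.pt x y)) (at x)"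
        unfolding yx.pt_def using ne DERIV_mult[OF test_function_deriv(2)[OF \<phi>, of y x] test_function_deriv(2)[OF \<psi>, of y x]]
        by (simp add: mult.commute add.commute)
    qed (use r zb ne in \<open>simp_all add: yx.pt_def\<close>)
    moreover have "(LINT z|lebesgue_on B. \<phi> z * dy \<psi> z + dy \<phi> z * \<psi> z) = (LINT z|lebesgue_on \<Omega>. \<phi> z * dy \<psi> z + dy \<phi> z * \<psi> z)"
      by (rule integral_supported[OF _ \<Omega>_sets sub(1)]) (simp_all add: B_def z)
    ultimately show "(LINT z|lebesgue_on \<Omega>. \<phi> z * dy \<psi> z + dy \<phi> z * \<psi> z) = 0" by simp
  qed
  have L: "k \<in> L2_space \<Omega>" if "continuous_on UNIV k" for k :: "plane \<Rightarrow> real"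
    by (rule continuous_L2[OF that \<Omega>_bounded \<Omega>_sets])
  show "is_weak_div \<Omega> (\<lambda>z. (\<phi> z, 0)) (dx \<phi>)"
    unfolding is_weak_div_def
  proof
    fix \<psi> assume \<psi>: "\<psi> \<in> test_functions \<Omega>"
    note c = test_function_continuous[OF \<phi>] test_function_continuous[OF \<psi>]
    show "L2_inner \<Omega> (\<lambda>z. (\<phi> z, 0)) (\<lambda>p. (dx \<psi> p, dy \<psi> p)) = - L2_inner \<Omega> (dx \<phi>) \<psi>"
      using key(1)[OF \<psi>] L2_integrable_mult[OF L[OF c(1)] L[OF c(5)]] L2_integrable_mult[OF L[OF c(2)] L[OF c(4)]]
      by (simp add: L2_inner_def)
  qed
  show "is_weak_div \<Omega> (\<lambda>z. (0, \<phi> z)) (dy \<phi>)"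
    unfolding is_weak_div_def
  proof
    fix \<psi> assume \<psi>: "\<psi> \<in> test_functions \<Omega>"
    note c = test_function_continuous[OF \<phi>] test_function_continuous[OF \<psi>]
    show "L2_inner \<Omega> (\<lambda>z. (0, \<phi> z)) (\<lambda>p. (dx \<psi> p, dy \<psi> p)) = - L2_inner \<Omega> (dy \<phi>) \<psi>"
      using key(2)[OF \<psi>] L2_integrable_mult[OF L[OF c(1)] L[OF c(6)]] L2_integrable_mult[OF L[OF c(3)] L[OF c(4)]]
      by (simp add: L2_inner_def)
  qed
qed

lemma flux_is_gradient:
  assumes ep: "mixed_eigenpair \<Omega> (H_div \<Omega>) (L2_space \<Omega>) \<mu> \<sigma> u"
    and g: "g1 \<in> L2_space \<Omega>" "g2 \<in> L2_space \<Omega>" "is_weak_deriv \<Omega> 1 0 u g1" "is_weak_deriv \<Omega> 0 1 u g2"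
  shows "AE p in lebesgue_on \<Omega>. \<sigma> p = (- g1 p, - g2 p)"
proof -
  have \<sigma>: "\<sigma> \<in> H_div \<Omega>" and uL: "u \<in> L2_space \<Omega>" and eq: "\<And>\<tau>. \<tau> \<in> H_div \<Omega> \<Longrightarrow> L2_inner \<Omega> \<sigma> \<tau> = L2_inner \<Omega> (weak_div \<Omega> \<tau>) u"
    using ep unfolding mixed_eigenpair_def by auto
  note \<sigma>L = weak_div_props(3)[OF \<sigma>]
  note L1 = L2_fst[OF \<sigma>L] and L2 = L2_snd[OF \<sigma>L]
  have "AE p in lebesgue_on \<Omega>. fst (\<sigma> p) + g1 p = 0"
  proof (rule AE_zero_\<Omega>[OF L2_add[OF L1 g(1)]])
    fix p q assume t: "tensor_test fst snd \<Omega> p q"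
    define \<phi> where "\<phi> = (\<lambda>z :: plane. p (fst z) * q (snd z))"
    have \<phi>: "\<phi> \<in> test_functions \<Omega>" unfolding \<phi>_def by (rule tensor_test_fst_snd[OF t])
    note \<phi>L = test_function_L2(1)[OF \<phi>]
    have dL: "dx \<phi> \<in> L2_space \<Omega>" using test_function_L2(2)[OF \<phi>] L2_fst by fastforce
    have "is_weak_div \<Omega> (\<lambda>z. (\<phi> z, 0)) (dx \<phi>)"
      unfolding \<phi>_def by (rule tensor_fields_weak_div(1)[OF t])
    note W = weak_div_AE[OF this dL L2_Pair[OF \<phi>L L2_zero]]
    have "L2_inner \<Omega> (\<lambda>p. fst (\<sigma> p)) \<phi> = L2_inner \<Omega> \<sigma> (\<lambda>z. (\<phi> z, 0))" by (simp add: L2_inner_def inner_prod_def)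
    also have "\<dots> = L2_inner \<Omega> (weak_div \<Omega> (\<lambda>z. (\<phi> z, 0))) u" by (rule eq[OF W(2)])
    also have "\<dots> = L2_inner \<Omega> (dx \<phi>) u" using W dL uL weak_div_props(1) by (intro L2_inner_AE_cong) auto
    also have "\<dots> = - L2_inner \<Omega> g1 \<phi>" using g(3) \<phi> by (simp add: is_weak_deriv_def L2_inner_commute[of \<Omega> _ u])
    finally have "L2_inner \<Omega> (\<lambda>p. fst (\<sigma> p) + g1 p) \<phi> = 0" using L2_inner_add_left[OF L1 g(1) \<phi>L] by simp
    then show "(LINT z|lebesgue_on \<Omega>. (fst (\<sigma> z) + g1 z) * (p (fst z) * q (snd z))) = 0" by (simp add: L2_inner_def \<phi>_def)
  qed
  moreover have "AE p in lebesgue_on \<Omega>. snd (\<sigma> p) + g2 p = 0"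
  proof (rule AE_zero_\<Omega>[OF L2_add[OF L2 g(2)]])
    fix p q assume t: "tensor_test fst snd \<Omega> p q"
    define \<phi> where "\<phi> = (\<lambda>z :: plane. p (fst z) * q (snd z))"
    have \<phi>: "\<phi> \<in> test_functions \<Omega>" unfolding \<phi>_def by (rule tensor_test_fst_snd[OF t])
    note \<phi>L = test_function_L2(1)[OF \<phi>]
    have dL: "dy \<phi> \<in> L2_space \<Omega>" using test_function_L2(2)[OF \<phi>] L2_snd by fastforce
    have "is_weak_div \<Omega> (\<lambda>z. (0, \<phi> z)) (dy \<phi>)"
      unfolding \<phi>_def by (rule tensor_fields_weak_div(2)[OF t])
    note W = weak_div_AE[OF this dL L2_Pair[OF L2_zero \<phi>L]]
    have "L2_inner \<Omega> (\<lambda>p. snd (\<sigma> p)) \<phi> = L2_inner \<Omega> \<sigma> (\<lambda>z. (0, \<phi> z))" by (simp add: L2_inner_def inner_prod_def)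
    also have "\<dots> = L2_inner \<Omega> (weak_div \<Omega> (\<lambda>z. (0, \<phi> z))) u" by (rule eq[OF W(2)])
    also have "\<dots> = L2_inner \<Omega> (dy \<phi>) u" using W dL uL weak_div_props(1) by (intro L2_inner_AE_cong) auto
    also have "\<dots> = - L2_inner \<Omega> g2 \<phi>" using g(4) \<phi> by (simp add: is_weak_deriv_def L2_inner_commute[of \<Omega> _ u])
    finally have "L2_inner \<Omega> (\<lambda>p. snd (\<sigma> p) + g2 p) \<phi> = 0" using L2_inner_add_left[OF L2 g(2) \<phi>L] by simp
    then show "(LINT z|lebesgue_on \<Omega>. (snd (\<sigma> z) + g2 z) * (p (fst z) * q (snd z))) = 0" by (simp add: L2_inner_def \<phi>_def)
  qed
  ultimately show ?thesis by eventually_elim (simp add: prod_eq_iff)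
qed

lemma div_flux:
  assumes ep: "mixed_eigenpair \<Omega> (H_div \<Omega>) (L2_space \<Omega>) \<mu> \<sigma> u"
  shows "AE p in lebesgue_on \<Omega>. weak_div \<Omega> \<sigma> p = \<mu> * u p"
proof -
  have \<sigma>: "\<sigma> \<in> H_div \<Omega>" and uL: "u \<in> L2_space \<Omega>" and eq: "\<And>v. v \<in> L2_space \<Omega> \<Longrightarrow> L2_inner \<Omega> (weak_div \<Omega> \<sigma>) v = \<mu> * L2_inner \<Omega> u v"
    using ep unfolding mixed_eigenpair_def by auto
  let ?v = "\<lambda>p. weak_div \<Omega> \<sigma> p - \<mu> * u p"
  have vL: "?v \<in> L2_space \<Omega>" by (intro L2_diff weak_div_props(1)[OF \<sigma>] L2_cmult uL)
  have "L2_inner \<Omega> ?v ?v = L2_inner \<Omega> (weak_div \<Omega> \<sigma>) ?v - L2_inner \<Omega> (\<lambda>p. \<mu> * u p) ?v"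
    by (rule L2_inner_diff_left[OF weak_div_props(1)[OF \<sigma>] L2_cmult[OF uL] vL])
  also have "\<dots> = 0" unfolding L2_inner_cmult_left using eq[OF vL] by simp
  finally have "AE p in lebesgue_on \<Omega>. ?v p = 0" using L2_norm_eq_0_iff[OF vL] by (simp add: L2_norm_def)
  then show ?thesis by eventually_elim simp
qed

end

section \<open>Interpolation of a smooth eigenpair\<close>

lemma weak_partial_neg: "weak_partial s t U f g \<Longrightarrow> weak_partial s t U (\<lambda>p. - f p) (\<lambda>p. - g p)"
  by (simp add: weak_partial_def)

text \<open>The maximum runs over all grid intervals, with or without elements. It is positive
  because the nonempty domain meets at least one element.\<close>

lemma (in meshed) mesh_size_bounds:
  "1 \<le> i \<Longrightarrow> i \<le> nx G \<Longrightarrow> X i - X (i - 1) \<le> mesh_size G"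
  "1 \<le> j \<Longrightarrow> j \<le> ny G \<Longrightarrow> Y j - Y (j - 1) \<le> mesh_size G"
  "0 < mesh_size G"
proof -
  have fin: "finite (hx G ` {1..nx G} \<union> hy G ` {1..ny G})" by simp
  show x: "X i - X (i - 1) \<le> mesh_size G" if "1 \<le> i" "i \<le> nx G" for i
    unfolding mesh_size_def using that by (intro Max_ge[OF fin] UnI1 image_eqI[of _ _ i]) (auto simp: hx_def X_def)
  show "1 \<le> j \<Longrightarrow> j \<le> ny G \<Longrightarrow> Y j - Y (j - 1) \<le> mesh_size G"
    unfolding mesh_size_def by (intro Max_ge[OF fin] UnI2 image_eqI[of _ _ j]) (auto simp: hy_def Y_def)
  obtain z where "z \<in> \<Omega>" using dom by (auto simp: rect_domain_def)
  then obtain ij where "ij \<in> EL" using \<Omega>_subset by blast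
  then show "0 < mesh_size G" using EL_bounds[of ij] x[of "fst ij"] by linarith
qed

text \<open>\<open>D\<close> stands for any family of weak derivatives up to order five, so that the
  estimates hold for whatever representatives \<open>weak_deriv\<close> picks.\<close>

locale smooth_pair = discrete \<Omega> G N lamh \<sigma>h uh for \<Omega> G N lamh \<sigma>h uh +
  fixes \<mu> :: real and \<sigma> :: "plane \<Rightarrow> plane" and u :: "plane \<Rightarrow> real" and D :: "nat \<Rightarrow> nat \<Rightarrow> plane \<Rightarrow> real"
  assumes ep: "mixed_eigenpair \<Omega> (H_div \<Omega>) (L2_space \<Omega>) \<mu> \<sigma> u" and un: "L2_inner \<Omega> u u = 1"
    and D_L2: "\<And>a b. a + b \<le> 5 \<Longrightarrow> D a b \<in> L2_space \<Omega>"
    and D_weak: "\<And>a b. a + b \<le> 5 \<Longrightarrow> is_weak_deriv \<Omega> a b u (D a b)"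
begin

lemma D_partial_fst: "a + b < 5 \<Longrightarrow> weak_partial fst snd \<Omega> (\<lambda>p. - D a b p) (\<lambda>p. - D (Suc a) b p)"
  and D_partial_snd: "a + b < 5 \<Longrightarrow> weak_partial snd fst \<Omega> (\<lambda>p. - D a b p) (\<lambda>p. - D a (Suc b) p)"
  by (intro weak_partial_neg weak_deriv_weak_partial_fst[OF D_weak D_weak] weak_deriv_weak_partial_snd[OF D_weak D_weak]; simp)+

lemma minus_D_L2: "a + b \<le> 5 \<Longrightarrow> (\<lambda>p. - D a b p) \<in> L2_space \<Omega>"
  by (intro L2_minus D_L2)

text \<open>The component -u_x with its chain of derivatives in x, ending at the fifth derivative of
  u; \<open>D 3 1\<close> supplies the transversal derivative of \<open>D 3 0\<close>.\<close>

sublocale ix: interpolated4 \<Omega> G fst snd "\<lambda>p. - D 1 0 p" "\<lambda>p. - D 2 0 p" "\<lambda>p. - D 3 0 p" "\<lambda>p. - D 4 0 p" "\<lambda>p. - D 5 0 p" "\<lambda>p. - D 3 1 p"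
  by unfold_locales
     (use minus_D_L2[of 1 0] minus_D_L2[of 2 0] minus_D_L2[of 3 0] minus_D_L2[of 4 0] minus_D_L2[of 5 0] minus_D_L2[of 3 1]
       D_partial_fst[of 1 0] D_partial_fst[of 2 0] D_partial_fst[of 3 0] D_partial_fst[of 4 0] D_partial_snd[of 3 0]
       in \<open>simp_all add: eval_nat_numeral\<close>)

sublocale iy: interpolated4 \<Omega> G snd fst "\<lambda>p. - D 0 1 p" "\<lambda>p. - D 0 2 p" "\<lambda>p. - D 0 3 p" "\<lambda>p. - D 0 4 p" "\<lambda>p. - D 0 5 p" "\<lambda>p. - D 1 3 p"
  by unfold_locales
     (use minus_D_L2[of 0 1] minus_D_L2[of 0 2] minus_D_L2[of 0 3] minus_D_L2[of 0 4] minus_D_L2[of 0 5] minus_D_L2[of 1 3]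
       D_partial_snd[of 0 1] D_partial_snd[of 0 2] D_partial_snd[of 0 3] D_partial_snd[of 0 4] D_partial_fst[of 0 3]
       in \<open>simp_all add: eval_nat_numeral\<close>)

declare One_nat_def [simp del]

lemma snd_neq_fst: "(snd :: plane \<Rightarrow> real) \<noteq> fst"
  by (metis fst_conv snd_conv zero_neq_one)

lemma ix_simps: "ix.E = EL" "ix.R ij = K ij" "ix.S = X" "ix.T = Y" "ix.ns = nx G" "ix.nt = ny G"
  by (simp_all add: ix.E_def ix.R_K ix.ix_def ix.S_def ix.T_def ix.ns_def ix.nt_def)

lemma iy_simps: "iy.E = prod.swap ` EL" "iy.R ij = K (prod.swap ij)" "iy.S = Y" "iy.T = X" "iy.ns = ny G" "iy.nt = nx G"
proof -
  have "iy.ix = prod.swap" by (rule ext) (simp add: iy.ix_def snd_neq_fst)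
  then show "iy.E = prod.swap ` EL" "iy.R ij = K (prod.swap ij)" "iy.S = Y" "iy.T = X" "iy.ns = ny G" "iy.nt = nx G"
    using snd_neq_fst by (simp_all add: iy.E_def iy.R_K iy.S_def iy.T_def iy.ns_def iy.nt_def)
qed

lemma swap_iy: "ij \<in> EL \<Longrightarrow> prod.swap ij \<in> iy.E" "iy.R (prod.swap ij) = K ij"
  by (simp_all add: iy_simps)

text \<open>The flux with the components prescribed by \<open>D\<close>. It equals the given flux
  almost everywhere and stands in for it, because the interpolants are built from these
  components.\<close>

definition "sig = (\<lambda>p. (- D 1 0 p, - D 0 1 p))"
definition "rho = (\<lambda>p. (ix.field p, iy.field p))"

lemma \<sigma>_H_div: "\<sigma> \<in> H_div \<Omega>" and uL: "u \<in> L2_space \<Omega>"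
  using ep by (auto simp: mixed_eigenpair_def)

lemma sig_L2: "sig \<in> L2_space \<Omega>"
  unfolding sig_def using minus_D_L2[of 1 0] minus_D_L2[of 0 1] by (intro L2_Pair) simp_all

lemma \<sigma>_sig: "AE p in lebesgue_on \<Omega>. \<sigma> p = sig p"
  unfolding sig_def using D_L2[of 1 0] D_L2[of 0 1] D_weak[of 1 0] D_weak[of 0 1] by (intro flux_is_gradient[OF ep]) simp_all

lemma sig_div: "sig \<in> H_div \<Omega>" "AE p in lebesgue_on \<Omega>. dv sig p = \<mu> * u p"
proof -
  note W = weak_div_props[OF \<sigma>_H_div]
  have "is_weak_div \<Omega> sig (dv \<sigma>)"
    unfolding is_weak_div_def
  proof
    fix \<phi> assume \<phi>: "\<phi> \<in> test_functions \<Omega>"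
    have "L2_inner \<Omega> sig (\<lambda>p. (dx \<phi> p, dy \<phi> p)) = L2_inner \<Omega> \<sigma> (\<lambda>p. (dx \<phi> p, dy \<phi> p))"
      using \<sigma>_sig sig_L2 W(3) test_function_L2(2)[OF \<phi>] by (intro L2_inner_AE_cong) (auto elim: eventually_mono)
    then show "L2_inner \<Omega> sig (\<lambda>p. (dx \<phi> p, dy \<phi> p)) = - L2_inner \<Omega> (dv \<sigma>) \<phi>"
      using W(2) \<phi> by (simp add: is_weak_div_def)
  qed
  note S = weak_div_AE[OF this W(1) sig_L2]
  show "sig \<in> H_div \<Omega>" by (rule S(2))
  show "AE p in lebesgue_on \<Omega>. dv sig p = \<mu> * u p" using S(1) div_flux[OF ep] by eventually_elim simp
qed

lemma sig_eq: "\<tau> \<in> Sigma_h \<Omega> G \<Longrightarrow> ip sig \<tau> = ip (dv \<tau>) u"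
proof -
  assume \<tau>: "\<tau> \<in> Sigma_h \<Omega> G"
  have "ip sig \<tau> = ip \<sigma> \<tau>"
    using \<sigma>_sig sig_L2 weak_div_props(3)[OF \<sigma>_H_div] Sigma_h_L2[OF \<tau>] by (intro L2_inner_AE_cong) (auto elim: eventually_mono)
  also have "\<dots> = ip (dv \<tau>) u" using ep Sigma_h_H_div[OF \<tau>] by (simp add: mixed_eigenpair_def)
  finally show ?thesis .
qed

lemma rho_L2: "rho \<in> L2_space \<Omega>"
  unfolding rho_def by (rule L2_Pair[OF ix.field_L2(1) iy.field_L2(1)])

lemma rho_div: "rho \<in> H_div \<Omega>" "AE p in lebesgue_on \<Omega>. dv rho p = ix.field1 p + iy.field1 p"
proof -
  have "is_weak_div \<Omega> rho (\<lambda>p. ix.field1 p + iy.field1 p)"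
    unfolding is_weak_div_def
  proof
    fix \<phi> assume \<phi>: "\<phi> \<in> test_functions \<Omega>"
    note c = test_function_continuous[OF \<phi>]
    note L = test_function_L2[OF \<phi>]
    have "L2_inner \<Omega> rho (\<lambda>p. (dx \<phi> p, dy \<phi> p)) = L2_inner \<Omega> ix.field (dx \<phi>) + L2_inner \<Omega> iy.field (dy \<phi>)"
      using L2_inner_components[OF rho_L2 L(2)] by (simp add: rho_def)
    also have "L2_inner \<Omega> ix.field (dx \<phi>) = - L2_inner \<Omega> ix.field1 \<phi>"
      by (rule ix.field_ibp[OF c(1,2)]) (simp_all add: xy.pt_def test_function_deriv[OF \<phi>] test_function_zero[OF \<phi>])
    also have "L2_inner \<Omega> iy.field (dy \<phi>) = - L2_inner \<Omega> iy.field1 \<phi>"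
      by (rule iy.field_ibp[OF c(1,3)]) (simp_all add: yx.pt_def snd_neq_fst test_function_deriv[OF \<phi>] test_function_zero[OF \<phi>])
    finally show "L2_inner \<Omega> rho (\<lambda>p. (dx \<phi> p, dy \<phi> p)) = - L2_inner \<Omega> (\<lambda>p. ix.field1 p + iy.field1 p) \<phi>"
      using L2_inner_add_left[OF ix.field_L2(2) iy.field_L2(2) L(1)] by simp
  qed
  from weak_div_AE[OF this L2_add[OF ix.field_L2(2) iy.field_L2(2)] rho_L2]
  show "rho \<in> H_div \<Omega>" "AE p in lebesgue_on \<Omega>. dv rho p = ix.field1 p + iy.field1 p" by auto
qed

lemma rho_Sigma_h: "rho \<in> Sigma_h \<Omega> G"
  unfolding Sigma_h_alt
proof (intro conjI ballI rho_div(1))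
  fix ij assume ij: "ij \<in> EL"
  define \<beta> \<delta> where "\<beta> = ix.beta ij" and "\<delta> = iy.beta (prod.swap ij)"
  have "AE p in lebesgue_on (K ij). ix.field p = ix.loc ij p" using ix.field_AE(1)[of ij] ij unfolding ix_simps by blast
  moreover have "AE p in lebesgue_on (K ij). iy.field p = iy.loc (prod.swap ij) p"
    using iy.field_AE(1)[OF swap_iy(1)[OF ij]] unfolding swap_iy(2) .
  ultimately have "AE p in lebesgue_on (K ij). rho p =
     ((ix.lo ij - \<beta> * ix.S (fst ij - 1)) + \<beta> * fst p, (iy.lo (prod.swap ij) - \<delta> * iy.S (fst (prod.swap ij) - 1)) + \<delta> * snd p)"
    by eventually_elim (simp add: rho_def ix.loc_def iy.loc_def \<beta>_def \<delta>_def algebra_simps)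
  then show "\<exists>\<alpha> \<beta> \<gamma> \<delta>. AE p in lebesgue_on (K ij). rho p = (\<alpha> + \<beta> * fst p, \<gamma> + \<delta> * snd p)" by blast
qed

text \<open>On an element v is constant, so only the means of the divergences matter, and
  interpolation preserves the means of both partial derivatives.\<close>

lemma div_rho:
  assumes v: "v \<in> V_h \<Omega> G"
  shows "ip (dv rho) v = \<mu> * ip u v"
proof -
  note vL = V_h_L2[OF v]
  note rL = dv_L2[OF rho_Sigma_h] and sL = weak_div_props(1)[OF sig_div(1)]
  have D2: "(\<lambda>p. - D 2 0 p) \<in> L2_space \<Omega>" "(\<lambda>p. - D 0 2 p) \<in> L2_space \<Omega>"
    using minus_D_L2[of 2 0] minus_D_L2[of 0 2] by simp_all
  have loc: "L2_inner (K ij) (dv rho) v = L2_inner (K ij) (dv sig) v" if ij: "ij \<in> EL" for ij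
  proof -
    obtain c where c: "AE p in lebesgue_on (K ij). v p = c" using v ij unfolding V_h_alt by blast
    have cL: "(\<lambda>_. c) \<in> L2_space (K ij)" by (rule L2_bounded[OF finite_measure_lebesgue_on[OF K_sets(3)]]) auto
    have fin: "finite_measure (lebesgue_on (K ij))" by (rule finite_measure_lebesgue_on[OF K_sets(3)])
    have m: "L2_inner (K ij) w v = c * (LINT p|lebesgue_on (K ij). w' p)"
      if "AE p in lebesgue_on (K ij). w p = w' p" "w \<in> L2_space (K ij)" "w' \<in> L2_space (K ij)" for w w'
    proof -
      have "L2_inner (K ij) w v = L2_inner (K ij) w' (\<lambda>_. c)"
        using that c cL L2_K[OF vL ij] by (intro L2_inner_AE_cong) auto
      then show ?thesis by (simp add: L2_inner_def)
    qed
    have i: "integrable (lebesgue_on (K ij)) w" if "w \<in> L2_space \<Omega>" for w :: "plane \<Rightarrow> real"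
      by (rule L2_integrable[OF L2_K[OF that ij] fin])
    have "AE p in lebesgue_on (K ij). dv sig p = - D 2 0 p + - D 0 2 p"
    proof (rule weak_div_local[OF sig_div(1) ij L2_K[OF D2(1) ij] L2_K[OF D2(2) ij]])
      show "weak_partial fst snd (OK ij) (\<lambda>p. fst (sig p)) (\<lambda>p. - D 2 0 p)"
        using weak_partial_mono[OF ix.wpf \<Omega>_sets K_sets(2) OK_subset[OF ij]] by (simp add: sig_def)
      show "weak_partial snd fst (OK ij) (\<lambda>p. snd (sig p)) (\<lambda>p. - D 0 2 p)"
        using weak_partial_mono[OF iy.wpf \<Omega>_sets K_sets(2) OK_subset[OF ij]] by (simp add: sig_def)
    qed
    then have "L2_inner (K ij) (dv sig) v = c * (LINT p|lebesgue_on (K ij). - D 2 0 p + - D 0 2 p)"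
      by (rule m[OF _ L2_K[OF sL ij] L2_add[OF L2_K[OF D2(1) ij] L2_K[OF D2(2) ij]]])
    also have "(LINT p|lebesgue_on (K ij). - D 2 0 p + - D 0 2 p) = (LINT p|lebesgue_on (K ij). - D 2 0 p) + (LINT p|lebesgue_on (K ij). - D 0 2 p)"
      by (rule Bochner_Integration.integral_add[OF i[OF D2(1)] i[OF D2(2)]])
    also have "\<dots> = (LINT p|lebesgue_on (K ij). ix.field1 p) + (LINT p|lebesgue_on (K ij). iy.field1 p)"
      using ix.integral_field1[of ij] iy.integral_field1[OF swap_iy(1)[OF ij]] ij by (simp add: ix_simps swap_iy(2))
    also have "\<dots> = (LINT p|lebesgue_on (K ij). ix.field1 p + iy.field1 p)"
      by (rule Bochner_Integration.integral_add[OF i[OF ix.field_L2(2)] i[OF iy.field_L2(2)], symmetric])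
    also have "c * \<dots> = L2_inner (K ij) (dv rho) v"
      by (rule m[OF AE_K[OF rho_div(2) ij] L2_K[OF rL ij] L2_add[OF L2_K[OF ix.field_L2(2) ij] L2_K[OF iy.field_L2(2) ij]], symmetric])
    finally show ?thesis by simp
  qed
  have "ip (dv rho) v = ip (dv sig) v"
    unfolding L2_inner_\<Omega>[OF rL vL] L2_inner_\<Omega>[OF sL vL] using loc by (rule sum.cong[OF refl])
  also have "\<dots> = ip (\<lambda>p. \<mu> * u p) v"
    using sig_div(2) sL L2_cmult[OF uL] vL by (intro L2_inner_AE_cong) auto
  finally show ?thesis by (simp add: L2_inner_cmult_left)
qed

lemma resid_components: "sig p - rho p = (ix.err p, iy.err p)"
  by (simp add: sig_def rho_def ix.err_def iy.err_def)

lemma ip_resid: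
  assumes "\<tau> \<in> L2_space \<Omega>"
  shows "ip (\<lambda>p. sig p - rho p) \<tau> = ip ix.err (\<lambda>p. fst (\<tau> p)) + ip iy.err (\<lambda>p. snd (\<tau> p))"
  using L2_inner_components[OF L2_Pair[OF ix.err_L2 iy.err_L2] assms] by (simp add: resid_components)

lemma component_norms:
  fixes \<tau> :: "plane \<Rightarrow> plane"
  shows "\<tau> \<in> L2_space \<Omega> \<Longrightarrow> L2_norm \<Omega> (\<lambda>p. fst (\<tau> p)) \<le> L2_norm \<Omega> \<tau>"
  and "\<tau> \<in> L2_space \<Omega> \<Longrightarrow> L2_norm \<Omega> (\<lambda>p. snd (\<tau> p)) \<le> L2_norm \<Omega> \<tau>"
  using L2_inner_components[of \<tau> \<Omega> \<tau>] L2_inner_self_nonneg[of \<Omega> "\<lambda>p. fst (\<tau> p)"] L2_inner_self_nonneg[of \<Omega> "\<lambda>p. snd (\<tau> p)"]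
  unfolding L2_norm_def by (simp_all)

lemma consistency:
  assumes \<tau>: "\<tau> \<in> Sigma_h \<Omega> G"
  shows "\<bar>ip (\<lambda>p. sig p - rho p) \<tau>\<bar> \<le> (mesh_size G)\<^sup>2 * (L2_norm \<Omega> (D 3 0) + L2_norm \<Omega> (D 0 3)) * L2_norm \<Omega> \<tau>"
proof -
  note L = Sigma_h_L2[OF \<tau>]
  have n: "L2_norm \<Omega> (\<lambda>p. - f p) = L2_norm \<Omega> f" for f :: "plane \<Rightarrow> real" by (simp add: L2_norm_def L2_inner_self)
  have x: "\<bar>ip ix.err (\<lambda>p. fst (\<tau> p))\<bar> \<le> (mesh_size G)\<^sup>2 * L2_norm \<Omega> (\<lambda>p. - D 3 0 p) * L2_norm \<Omega> (\<lambda>p. fst (\<tau> p))"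
  proof (rule ix.err_affine_bound[OF L2_fst[OF L]])
    fix ij assume "ij \<in> ix.E"
    then have "ij \<in> EL" by (simp add: ix_simps)
    then obtain \<alpha> \<beta> \<gamma> \<delta> where "AE p in lebesgue_on (K ij). \<tau> p = (\<alpha> + \<beta> * fst p, \<gamma> + \<delta> * snd p)"
      using \<tau> unfolding Sigma_h_alt by blast
    then have "AE p in lebesgue_on (K ij). fst (\<tau> p) = \<alpha> + \<beta> * fst p" by eventually_elim simp
    then show "\<exists>\<alpha> \<gamma>. AE z in lebesgue_on (ix.R ij). fst (\<tau> z) = \<alpha> + \<gamma> * fst z" unfolding ix_simps by blast
  qed (use mesh_size_bounds(1) in \<open>simp add: ix_simps\<close>)
  have y: "\<bar>ip iy.err (\<lambda>p. snd (\<tau> p))\<bar> \<le> (mesh_size G)\<^sup>2 * L2_norm \<Omega> (\<lambda>p. - D 0 3 p) * L2_norm \<Omega> (\<lambda>p. snd (\<tau> p))"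
  proof (rule iy.err_affine_bound[OF L2_snd[OF L]])
    fix ij assume "ij \<in> iy.E"
    then have "prod.swap ij \<in> EL" by (auto simp: iy_simps)
    then obtain \<alpha> \<beta> \<gamma> \<delta> where "AE p in lebesgue_on (K (prod.swap ij)). \<tau> p = (\<alpha> + \<beta> * fst p, \<gamma> + \<delta> * snd p)"
      using \<tau> unfolding Sigma_h_alt by blast
    then have "AE p in lebesgue_on (K (prod.swap ij)). snd (\<tau> p) = \<gamma> + \<delta> * snd p" by eventually_elim simp
    then show "\<exists>\<alpha> \<gamma>. AE z in lebesgue_on (iy.R ij). snd (\<tau> z) = \<alpha> + \<gamma> * snd z" unfolding iy_simps by blast
  qed (use mesh_size_bounds(2) in \<open>simp add: iy_simps\<close>)
  have "\<bar>ip (\<lambda>p. sig p - rho p) \<tau>\<bar> \<le> (mesh_size G)\<^sup>2 * L2_norm \<Omega> (D 3 0) * L2_norm \<Omega> (\<lambda>p. fst (\<tau> p)) + (mesh_size G)\<^sup>2 * L2_norm \<Omega> (D 0 3) * L2_norm \<Omega> (\<lambda>p. snd (\<tau> p))"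
    unfolding ip_resid[OF L] using x y by (simp add: n)
  also have "\<dots> \<le> (mesh_size G)\<^sup>2 * L2_norm \<Omega> (D 3 0) * L2_norm \<Omega> \<tau> + (mesh_size G)\<^sup>2 * L2_norm \<Omega> (D 0 3) * L2_norm \<Omega> \<tau>"
    by (intro add_mono mult_left_mono component_norms L) simp_all
  finally show ?thesis by (simp add: algebra_simps)
qed

text \<open>The minus signs of the flux components and of their second derivatives cancel in the
  products.\<close>

definition "lead = (\<Sum>(i, j)\<in>EL. (hx G i)\<^sup>2 * (LINT p|lebesgue_on (K (i, j)). D 3 0 p * D 1 0 p)
    + (hy G j)\<^sup>2 * (LINT p|lebesgue_on (K (i, j)). D 0 3 p * D 0 1 p))"

text \<open>36 arises from two directions, six squared norms bounded by \<open>Q\<^sup>2\<close> in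
  each, and the factor 3 of the elementwise estimate.\<close>

lemma resid_rho_expansion:
  assumes H: "mesh_size G \<le> 1" and Q: "\<And>a b. a + b \<le> 5 \<Longrightarrow> L2_norm \<Omega> (D a b) \<le> Q"
  shows "\<bar>ip (\<lambda>p. sig p - rho p) rho + 1 / 12 * lead\<bar> \<le> 36 * Q\<^sup>2 * mesh_size G ^ 4 + (mesh_size G)\<^sup>2 * (L2_norm \<Omega> (\<lambda>p. sig p - rho p))\<^sup>2"
proof -
  define h where "h = mesh_size G"
  have n: "L2_inner \<Omega> (\<lambda>p. - D a b p) (\<lambda>p. - D a b p) \<le> Q\<^sup>2" if "a + b \<le> 5" for a b
  proof -
    have "L2_inner \<Omega> (\<lambda>p. - D a b p) (\<lambda>p. - D a b p) = (L2_norm \<Omega> (D a b))\<^sup>2" by (simp add: L2_norm_power2 L2_inner_self)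
    also have "\<dots> \<le> Q\<^sup>2" using Q[OF that] by (intro power_mono) auto
    finally show ?thesis .
  qed
  have h0: "0 \<le> h ^ 4" by simp
  define lx ly where "lx = (\<Sum>ij\<in>EL. (X (fst ij) - X (fst ij - 1))\<^sup>2 * (LINT z|lebesgue_on (K ij). D 3 0 z * D 1 0 z))"
    and "ly = (\<Sum>ij\<in>EL. (Y (snd ij) - Y (snd ij - 1))\<^sup>2 * (LINT z|lebesgue_on (K ij). D 0 3 z * D 0 1 z))"
  have "\<bar>ip ix.err ix.field + 1 / 12 * lx\<bar> \<le> 3 * h ^ 4 * (Q\<^sup>2 + Q\<^sup>2 + Q\<^sup>2 + Q\<^sup>2 + Q\<^sup>2 + Q\<^sup>2) + h\<^sup>2 * ip ix.err ix.err"
  proof -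
    have "\<bar>ip ix.err ix.field + 1 / 12 * lx\<bar> \<le> 3 * h ^ 4 * (L2_inner \<Omega> (\<lambda>p. - D 1 0 p) (\<lambda>p. - D 1 0 p) + L2_inner \<Omega> (\<lambda>p. - D 2 0 p) (\<lambda>p. - D 2 0 p)
      + L2_inner \<Omega> (\<lambda>p. - D 3 0 p) (\<lambda>p. - D 3 0 p) + L2_inner \<Omega> (\<lambda>p. - D 4 0 p) (\<lambda>p. - D 4 0 p) + L2_inner \<Omega> (\<lambda>p. - D 5 0 p) (\<lambda>p. - D 5 0 p)
      + L2_inner \<Omega> (\<lambda>p. - D 3 1 p) (\<lambda>p. - D 3 1 p)) + h\<^sup>2 * ip ix.err ix.err"
      using ix.err_field_bound[of h] mesh_size_bounds H unfolding ix_simps h_def lx_def by simp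
    also have "\<dots> \<le> 3 * h ^ 4 * (Q\<^sup>2 + Q\<^sup>2 + Q\<^sup>2 + Q\<^sup>2 + Q\<^sup>2 + Q\<^sup>2) + h\<^sup>2 * ip ix.err ix.err"
      by (intro add_right_mono mult_left_mono add_mono n) simp_all
    finally show ?thesis .
  qed
  moreover have "\<bar>ip iy.err iy.field + 1 / 12 * ly\<bar> \<le> 3 * h ^ 4 * (Q\<^sup>2 + Q\<^sup>2 + Q\<^sup>2 + Q\<^sup>2 + Q\<^sup>2 + Q\<^sup>2) + h\<^sup>2 * ip iy.err iy.err"
  proof -
    have ly: "ly = (\<Sum>ij\<in>iy.E. (iy.S (fst ij) - iy.S (fst ij - 1))\<^sup>2 * (LINT z|lebesgue_on (iy.R ij). - D 0 3 z * - D 0 1 z))"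
      unfolding iy_simps ly_def by (subst sum.reindex) (auto simp: inj_on_def)
    have "\<bar>ip iy.err iy.field + 1 / 12 * ly\<bar> \<le> 3 * h ^ 4 * (L2_inner \<Omega> (\<lambda>p. - D 0 1 p) (\<lambda>p. - D 0 1 p) + L2_inner \<Omega> (\<lambda>p. - D 0 2 p) (\<lambda>p. - D 0 2 p)
      + L2_inner \<Omega> (\<lambda>p. - D 0 3 p) (\<lambda>p. - D 0 3 p) + L2_inner \<Omega> (\<lambda>p. - D 0 4 p) (\<lambda>p. - D 0 4 p) + L2_inner \<Omega> (\<lambda>p. - D 0 5 p) (\<lambda>p. - D 0 5 p)
      + L2_inner \<Omega> (\<lambda>p. - D 1 3 p) (\<lambda>p. - D 1 3 p)) + h\<^sup>2 * ip iy.err iy.err"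
      unfolding ly by (rule iy.err_field_bound) (use mesh_size_bounds H in \<open>simp_all add: iy_simps h_def\<close>)
    also have "\<dots> \<le> 3 * h ^ 4 * (Q\<^sup>2 + Q\<^sup>2 + Q\<^sup>2 + Q\<^sup>2 + Q\<^sup>2 + Q\<^sup>2) + h\<^sup>2 * ip iy.err iy.err"
      by (intro add_right_mono mult_left_mono add_mono n) simp_all
    finally show ?thesis .
  qed
  moreover have "lead = lx + ly"
    unfolding lead_def lx_def ly_def sum.distrib[symmetric]
    by (intro sum.cong refl) (auto simp: hx_def hy_def X_def Y_def)
  moreover have "ip (\<lambda>p. sig p - rho p) rho = ip ix.err ix.field + ip iy.err iy.field"
    unfolding ip_resid[OF rho_L2] by (simp add: rho_def)
  moreover have "(L2_norm \<Omega> (\<lambda>p. sig p - rho p))\<^sup>2 = ip ix.err ix.err + ip iy.err iy.err"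
    unfolding L2_norm_power2 using ip_resid[OF L2_diff[OF sig_L2 rho_L2]] by (simp add: resid_components)
  moreover have "\<bar>a + b + 1 / 12 * (x + y)\<bar> \<le> 36 * q * m + r * (v + w)"
    if "\<bar>a + 1 / 12 * x\<bar> \<le> 3 * m * (q + q + q + q + q + q) + r * v" "\<bar>b + 1 / 12 * y\<bar> \<le> 3 * m * (q + q + q + q + q + q) + r * w"
    for a b x y q m r v w :: real
  proof -
    have "36 * q * m + r * (v + w) = (3 * m * (q + q + q + q + q + q) + r * v) + (3 * m * (q + q + q + q + q + q) + r * w)"
      "a + b + 1 / 12 * (x + y) = (a + 1 / 12 * x) + (b + 1 / 12 * y)"
      by (simp_all add: algebra_simps)
    then show ?thesis using order_trans[OF abs_triangle_ineq add_mono[OF that]] by (simp only:)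
  qed
  ultimately show ?thesis unfolding h_def[symmetric] by simp
qed

text \<open>The four parts of the constant come from (lamh k - \<mu>)(1 - \<alpha>) with \<alpha> =
  (u, uh k), from the residual against \<sigma>_h - \<rho>, from the kernel remainders, and from h^2
  times the squared norm of the residual. All depend only on \<open>c\<close>, \<open>Q\<close>,
  \<open>L\<close> and \<open>\<delta>\<close>, so uniformity in the mesh reduces to uniform bounds
  for these.\<close>

theorem eigenvalue_expansion:
  fixes c Q L \<delta> :: real
  assumes k: "k \<in> {1..N}" "k \<in> C" and \<mu>: "\<mu> > 0"
    and gap: "\<And>j. j \<in> {1..N} \<Longrightarrow> j \<notin> C \<Longrightarrow> \<delta> * sqrt (lamh j) \<le> \<bar>lamh j - \<mu>\<bar>" and \<delta>: "\<delta> > 0"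
    and cluster: "\<And>j. j \<in> {1..N} \<Longrightarrow> j \<in> C \<Longrightarrow> j \<noteq> k \<Longrightarrow> ip u (uh j) = 0"
    and H: "mesh_size G \<le> 1" and Q: "\<And>a b. a + b \<le> 5 \<Longrightarrow> L2_norm \<Omega> (D a b) \<le> Q"
    and c: "\<bar>lamh k - \<mu>\<bar> \<le> c * (mesh_size G)\<^sup>2" "L2_norm \<Omega> (\<lambda>p. uh k p - u p) \<le> c * mesh_size G"
      "L2_norm \<Omega> (\<lambda>p. \<sigma>h k p - \<sigma> p) \<le> c * mesh_size G"
    and L: "lamh k \<le> L"
  defines "A \<equiv> c\<^sup>2 / 2 + 2 * Q / \<delta>"
  defines "e \<equiv> 2 * Q + L * A + c + A"
  shows "\<bar>(lamh k - \<mu>) + 1 / 12 * lead\<bar> \<le> (c ^ 3 / 2 + 2 * Q * e + 36 * Q\<^sup>2 + (c + e)\<^sup>2) * mesh_size G ^ 4"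
proof -
  define h where "h = mesh_size G"
  have h: "0 < h" "h \<le> 1" using mesh_size_bounds(3) H by (simp_all add: h_def)
  have h2: "h\<^sup>2 \<le> h" using h by (simp add: power2_eq_square mult_left_le)
  have Q0: "0 \<le> Q" using Q[of 0 0] L2_norm_nonneg[of \<Omega> "D 0 0"] by linarith
  have c0: "0 \<le> c" using c(2) h L2_norm_nonneg[of \<Omega> "\<lambda>p. uh k p - u p"] unfolding h_def[symmetric]
    by (meson order_trans zero_le_mult_iff not_le order.strict_implies_order less_le_trans)
  have A0: "0 \<le> A" using Q0 \<delta> by (simp add: A_def)
  have L0: "0 \<le> L" using L eig(3)[OF k(1)] by simp
  have e0: "0 \<le> e" using Q0 A0 L0 c0 by (simp add: e_def)
  define M where "M = h\<^sup>2 * (2 * Q)"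
  have M0: "0 \<le> M" using Q0 by (simp add: M_def)
  have cons: "\<bar>ip (\<lambda>p. sig p - rho p) \<tau>\<bar> \<le> M * L2_norm \<Omega> \<tau>" if "\<tau> \<in> Sigma_h \<Omega> G" for \<tau>
  proof -
    have "L2_norm \<Omega> (D 3 0) + L2_norm \<Omega> (D 0 3) \<le> 2 * Q" using Q[of 3 0] Q[of 0 3] by simp
    then have "h\<^sup>2 * (L2_norm \<Omega> (D 3 0) + L2_norm \<Omega> (D 0 3)) * L2_norm \<Omega> \<tau> \<le> h\<^sup>2 * (2 * Q) * L2_norm \<Omega> \<tau>"
      by (intro mult_right_mono mult_left_mono) auto
    then show ?thesis using consistency[OF that] unfolding h_def[symmetric] M_def by linarith
  qed
  \<comment> \<open>Both summands are of second order, through the square of c h and through M, so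
    the abstract bound carries a full factor h^2.\<close>
  define A' where "A' = (c * h)\<^sup>2 / 2 + M / \<delta>"
  have A': "A' = h\<^sup>2 * A" unfolding A'_def A_def M_def by (simp add: power_mult_distrib distrib_left mult_ac)
  define E where "E = L2_norm \<Omega> (\<lambda>p. \<sigma>h k p - rho p)"
  note sc = supercloseness[OF k sig_L2 uL un rho_Sigma_h \<mu> sig_eq div_rho cons M0 gap \<delta> cluster c(1,2)[folded h_def]]
  have "E \<le> M + (lamh k * A' + c * h\<^sup>2) + A'" using sc(1) by (simp add: E_def A'_def)
  also have "\<dots> \<le> h\<^sup>2 * (2 * Q) + (L * (h\<^sup>2 * A) + c * h\<^sup>2) + h\<^sup>2 * A"
    unfolding A' M_def using L A0 by (intro add_mono mult_right_mono order_refl) auto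
  finally have E: "E \<le> e * h\<^sup>2" by (simp add: e_def algebra_simps)
  have main: "\<bar>(lamh k - \<mu>) - ip (\<lambda>p. sig p - rho p) rho\<bar> \<le> (c ^ 3 / 2 + 2 * Q * e) * h ^ 4"
  proof -
    have "\<bar>(lamh k - \<mu>) - ip (\<lambda>p. sig p - rho p) rho\<bar> \<le> c * h\<^sup>2 * ((c * h)\<^sup>2 / 2) + M * E" using sc(2) by (simp add: E_def)
    also have "M * E \<le> M * (e * h\<^sup>2)" by (rule mult_left_mono[OF E M0])
    also have "c * h\<^sup>2 * ((c * h)\<^sup>2 / 2) + M * (e * h\<^sup>2) = (c ^ 3 / 2 + 2 * Q * e) * h ^ 4"
      by (simp add: M_def power2_eq_square power3_eq_cube power4_eq_xxxx algebra_simps)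
    finally show ?thesis by simp
  qed
  \<comment> \<open>A first-order bound suffices for the residual itself, since it enters squared
    and with a factor h^2. It combines the a priori estimate for the flux with
    supercloseness.\<close>
  have rn: "L2_norm \<Omega> (\<lambda>p. sig p - rho p) \<le> (c + e) * h"
  proof -
    have shL: "\<sigma>h k \<in> L2_space \<Omega>" by (rule Sigma_h_L2[OF eig(1)[OF k(1)]])
    note \<sigma>L = weak_div_props(3)[OF \<sigma>_H_div]
    have "L2_norm \<Omega> (\<lambda>p. sig p - rho p) = L2_norm \<Omega> (\<lambda>p. (\<sigma>h k p - rho p) - (\<sigma>h k p - sig p))" by simp
    also have "\<dots> \<le> E + L2_norm \<Omega> (\<lambda>p. \<sigma>h k p - sig p)"
      unfolding E_def by (rule L2_norm_triangle_diff[OF L2_diff[OF shL rho_L2] L2_diff[OF shL sig_L2]])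
    also have "L2_norm \<Omega> (\<lambda>p. \<sigma>h k p - sig p) = L2_norm \<Omega> (\<lambda>p. \<sigma>h k p - \<sigma> p)"
      using \<sigma>_sig shL sig_L2 \<sigma>L by (intro L2_norm_AE_cong L2_diff) (auto elim: eventually_mono)
    finally have "L2_norm \<Omega> (\<lambda>p. sig p - rho p) \<le> e * h\<^sup>2 + c * h" using E c(3) by (simp add: h_def)
    also have "\<dots> \<le> e * h + c * h" using h2 e0 by (intro add_right_mono mult_left_mono)
    finally show ?thesis by (simp add: algebra_simps)
  qed
  have "\<bar>ip (\<lambda>p. sig p - rho p) rho + 1 / 12 * lead\<bar> \<le> 36 * Q\<^sup>2 * h ^ 4 + h\<^sup>2 * (L2_norm \<Omega> (\<lambda>p. sig p - rho p))\<^sup>2"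
    using resid_rho_expansion[OF H Q] by (simp add: h_def)
  also have "\<dots> \<le> 36 * Q\<^sup>2 * h ^ 4 + h\<^sup>2 * ((c + e) * h)\<^sup>2"
    using rn by (intro add_left_mono mult_left_mono power_mono) auto
  also have "\<dots> = (36 * Q\<^sup>2 + (c + e)\<^sup>2) * h ^ 4"
    by (simp add: power_mult_distrib power2_eq_square power4_eq_xxxx algebra_simps)
  finally have "\<bar>ip (\<lambda>p. sig p - rho p) rho + 1 / 12 * lead\<bar> \<le> (36 * Q\<^sup>2 + (c + e)\<^sup>2) * h ^ 4" .
  with main have "\<bar>(lamh k - \<mu>) + 1 / 12 * lead\<bar> \<le> (c ^ 3 / 2 + 2 * Q * e) * h ^ 4 + (36 * Q\<^sup>2 + (c + e)\<^sup>2) * h ^ 4" by linarith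
  then show ?thesis by (simp add: h_def algebra_simps)
qed

end

section \<open>Uniform bounds for the derivatives of eigenfunctions\<close>

lemma weak_deriv_props:
  assumes "v \<in> sobolev_H m \<Omega>" "a + b \<le> m"
  shows "weak_deriv \<Omega> a b v \<in> L2_space \<Omega>" "is_weak_deriv \<Omega> a b v (weak_deriv \<Omega> a b v)"
proof -
  have "\<exists>w. w \<in> L2_space \<Omega> \<and> is_weak_deriv \<Omega> a b v w" using assms by (auto simp: sobolev_H_def)
  from someI_ex[OF this] show "weak_deriv \<Omega> a b v \<in> L2_space \<Omega>" "is_weak_deriv \<Omega> a b v (weak_deriv \<Omega> a b v)"
    by (simp_all add: weak_deriv_def)
qed

lemma L2_span_subspace:
  assumes "\<And>j. j \<in> J \<Longrightarrow> w j \<in> L2_space S"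
  shows "L2_subspace S (L2_span S w J)"
  unfolding L2_subspace_def
proof (intro conjI ballI allI)
  show "L2_span S w J \<subseteq> L2_space S" by (auto simp: L2_span_def)
  show "(\<lambda>_. 0) \<in> L2_span S w J" unfolding L2_span_def by (auto intro!: exI[of _ "\<lambda>_. 0"])
  fix f assume "f \<in> L2_span S w J"
  then obtain c where f: "f \<in> L2_space S" "AE p in lebesgue_on S. f p = (\<Sum>j\<in>J. c j * w j p)" unfolding L2_span_def by blast
  {
    fix g assume "g \<in> L2_span S w J"
    then obtain d where g: "g \<in> L2_space S" "AE p in lebesgue_on S. g p = (\<Sum>j\<in>J. d j * w j p)" unfolding L2_span_def by blast
    have "AE p in lebesgue_on S. f p + g p = (\<Sum>j\<in>J. (c j + d j) * w j p)"
      using f(2) g(2) by eventually_elim (simp add: distrib_right sum.distrib)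
    then show "(\<lambda>p. f p + g p) \<in> L2_span S w J" unfolding L2_span_def using L2_add[OF f(1) g(1)] by (auto intro!: exI[of _ "\<lambda>j. c j + d j"])
  }
  fix r :: real
  have "AE p in lebesgue_on S. r *\<^sub>R f p = (\<Sum>j\<in>J. (r * c j) * w j p)"
    using f(2) by eventually_elim (simp add: sum_distrib_left mult.assoc)
  then show "(\<lambda>p. r *\<^sub>R f p) \<in> L2_span S w J" unfolding L2_span_def using L2_scaleR[OF f(1), of r] by (auto intro!: exI[of _ "\<lambda>j. r * c j"])
qed

text \<open>Parseval's identity on the span: the orthonormal eigenfunctions are a finite family that
  dominates the norm there, as \<open>orthonormal_basis_exists\<close> requires.\<close>

lemma L2_span_norm:
  assumes w: "orthonormal S J w" and v: "v \<in> L2_span S w J"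
  shows "(L2_norm S v)\<^sup>2 = (\<Sum>j\<in>J. (L2_inner S v (w j))\<^sup>2)"
proof -
  obtain c where c: "AE p in lebesgue_on S. v p = (\<Sum>j\<in>J. c j *\<^sub>R w j p)" and vL: "v \<in> L2_space S"
    using v unfolding L2_span_def by auto
  note lL = L2_lincomb[OF w, of c]
  have "L2_inner S v (w j) = c j" if j: "j \<in> J" for j
  proof -
    have wL: "w j \<in> L2_space S" using w j by (auto simp: orthonormal_def)
    have "L2_inner S v (w j) = L2_inner S (\<lambda>p. \<Sum>j\<in>J. c j *\<^sub>R w j p) (w j)"
      by (rule L2_inner_AE_cong[OF c _ vL lL wL wL]) simp
    then show ?thesis using orthonormal_lincomb_coeff[OF w j] by simp
  qed
  moreover have "(L2_norm S v)\<^sup>2 = (\<Sum>j\<in>J. c j * c j)"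
    unfolding L2_norm_power2 L2_inner_AE_cong[OF c c vL lL vL lL] by (rule orthonormal_lincomb_inner[OF w])
  ultimately show ?thesis by (simp add: power2_eq_square)
qed

context meshed
begin

lemma test_function_derivs_L2:
  assumes "\<phi> \<in> test_functions \<Omega>"
  shows "(dx ^^ a) ((dy ^^ b) \<phi>) \<in> L2_space \<Omega>"
proof -
  have step: "\<forall>m. cont_diff m (dx f)" "\<forall>m. cont_diff m (dy f)" if "\<forall>m. cont_diff m f" for f
    using that cont_diff.simps(2) by blast+
  have "\<forall>m. cont_diff m ((dy ^^ b) \<phi>)"
    using assms by (induction b) (simp_all add: test_functions_def step)
  then have "\<forall>m. cont_diff m ((dx ^^ a) ((dy ^^ b) \<phi>))"
    by (induction a) (simp_all add: step)
  then have "continuous_on UNIV ((dx ^^ a) ((dy ^^ b) \<phi>))" using cont_diff.simps(1) by blast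
  then show ?thesis by (rule continuous_L2[OF _ \<Omega>_bounded \<Omega>_sets])
qed

lemma is_weak_deriv_unique:
  assumes "is_weak_deriv \<Omega> a b f v" "is_weak_deriv \<Omega> a b f w" "v \<in> L2_space \<Omega>" "w \<in> L2_space \<Omega>"
  shows "AE p in lebesgue_on \<Omega>. v p = w p"
proof -
  have "AE p in lebesgue_on \<Omega>. v p - w p = 0"
  proof (rule AE_zero_\<Omega>[OF L2_diff[OF assms(3,4)]])
    fix p q assume t: "tensor_test fst snd \<Omega> p q"
    note \<phi> = tensor_test_fst_snd[OF t]
    have "(-1) ^ (a + b) * L2_inner \<Omega> v (\<lambda>z. p (fst z) * q (snd z)) = (-1) ^ (a + b) * L2_inner \<Omega> w (\<lambda>z. p (fst z) * q (snd z))"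
      using assms(1)[unfolded is_weak_deriv_def, rule_format, OF \<phi>] assms(2)[unfolded is_weak_deriv_def, rule_format, OF \<phi>] by (rule trans[OF sym])
    then have "L2_inner \<Omega> v (\<lambda>z. p (fst z) * q (snd z)) = L2_inner \<Omega> w (\<lambda>z. p (fst z) * q (snd z))"
      by (subst (asm) mult_left_cancel) auto
    then have "L2_inner \<Omega> (\<lambda>z. v z - w z) (\<lambda>z. p (fst z) * q (snd z)) = 0"
      using L2_inner_diff_left[OF assms(3,4) test_function_L2(1)[OF \<phi>]] by simp
    then show "(LINT z|lebesgue_on \<Omega>. (v z - w z) * (p (fst z) * q (snd z))) = 0" by (simp add: L2_inner_def)
  qed
  then show ?thesis by eventually_elim simp
qed

lemma is_weak_deriv_lincomb:
  assumes "\<And>i. i \<in> I \<Longrightarrow> is_weak_deriv \<Omega> a b (f i) (g i)" "\<And>i. i \<in> I \<Longrightarrow> f i \<in> L2_space \<Omega>" "\<And>i. i \<in> I \<Longrightarrow> g i \<in> L2_space \<Omega>"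
    and v: "v \<in> L2_space \<Omega>" "AE p in lebesgue_on \<Omega>. v p = (\<Sum>i\<in>I. c i *\<^sub>R f i p)"
  shows "is_weak_deriv \<Omega> a b v (\<lambda>p. \<Sum>i\<in>I. c i *\<^sub>R g i p)"
  unfolding is_weak_deriv_def
proof
  fix \<phi> assume \<phi>: "\<phi> \<in> test_functions \<Omega>"
  note dL = test_function_derivs_L2[OF \<phi>, of a b]
  have "L2_inner \<Omega> v ((dx ^^ a) ((dy ^^ b) \<phi>)) = L2_inner \<Omega> (\<lambda>p. \<Sum>i\<in>I. c i *\<^sub>R f i p) ((dx ^^ a) ((dy ^^ b) \<phi>))"
    by (rule L2_inner_AE_cong[OF v(2) _ v(1) _ dL dL]) (use assms(2) in \<open>auto intro!: L2_sum L2_cmult\<close>)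
  also have "\<dots> = (\<Sum>i\<in>I. c i * L2_inner \<Omega> (f i) ((dx ^^ a) ((dy ^^ b) \<phi>)))"
    by (rule L2_inner_lincomb[OF assms(2) dL])
  also have "\<dots> = (\<Sum>i\<in>I. c i * ((-1) ^ (a + b) * L2_inner \<Omega> (g i) \<phi>))"
    using assms(1) \<phi> by (intro sum.cong refl) (simp add: is_weak_deriv_def)
  also have "\<dots> = (-1) ^ (a + b) * (\<Sum>i\<in>I. c i * L2_inner \<Omega> (g i) \<phi>)"
    by (simp add: sum_distrib_left mult_ac)
  also have "(\<Sum>i\<in>I. c i * L2_inner \<Omega> (g i) \<phi>) = L2_inner \<Omega> (\<lambda>p. \<Sum>i\<in>I. c i *\<^sub>R g i p) \<phi>"
    by (rule L2_inner_lincomb[OF assms(3) test_function_L2(1)[OF \<phi>], symmetric])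
  finally show "L2_inner \<Omega> v ((dx ^^ a) ((dy ^^ b) \<phi>)) = (-1) ^ (a + b) * L2_inner \<Omega> (\<lambda>p. \<Sum>i\<in>I. c i *\<^sub>R g i p) \<phi>" .
qed

lemma sobolev_H_lincomb:
  assumes f: "\<And>i. i \<in> I \<Longrightarrow> f i \<in> sobolev_H m \<Omega>"
  shows "(\<lambda>p. \<Sum>i\<in>I. c i *\<^sub>R f i p) \<in> sobolev_H m \<Omega>"
proof -
  have fL: "f i \<in> L2_space \<Omega>" if "i \<in> I" for i using f[OF that] by (simp add: sobolev_H_def)
  then have L: "(\<lambda>p. \<Sum>i\<in>I. c i *\<^sub>R f i p) \<in> L2_space \<Omega>" by (intro L2_sum L2_scaleR)
  have "\<exists>w\<in>L2_space \<Omega>. is_weak_deriv \<Omega> a b (\<lambda>p. \<Sum>i\<in>I. c i *\<^sub>R f i p) w" if ab: "a + b \<le> m" for a b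
  proof
    show "(\<lambda>p. \<Sum>i\<in>I. c i *\<^sub>R weak_deriv \<Omega> a b (f i) p) \<in> L2_space \<Omega>"
      using weak_deriv_props[OF f ab] by (intro L2_sum L2_scaleR) auto
    show "is_weak_deriv \<Omega> a b (\<lambda>p. \<Sum>i\<in>I. c i *\<^sub>R f i p) (\<lambda>p. \<Sum>i\<in>I. c i *\<^sub>R weak_deriv \<Omega> a b (f i) p)"
      by (rule is_weak_deriv_lincomb[OF weak_deriv_props(2)[OF f ab] fL weak_deriv_props(1)[OF f ab] L]) auto
  qed
  then show ?thesis using L by (simp add: sobolev_H_def)
qed

lemma sobolev_H_subspace: "L2_subspace \<Omega> (sobolev_H m \<Omega>)"
  unfolding L2_subspace_def
proof (intro conjI ballI allI)
  show "sobolev_H m \<Omega> \<subseteq> L2_space \<Omega>" by (auto simp: sobolev_H_def)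
  show "(\<lambda>_. 0) \<in> sobolev_H m \<Omega>" using sobolev_H_lincomb[of "{}"] by simp
  fix f assume f: "f \<in> sobolev_H m \<Omega>"
  show "(\<lambda>p. c *\<^sub>R f p) \<in> sobolev_H m \<Omega>" for c
    using sobolev_H_lincomb[of "{()}" "\<lambda>_. f" m "\<lambda>_. c"] f by simp
  fix g assume g: "g \<in> sobolev_H m \<Omega>"
  show "(\<lambda>p. f p + g p) \<in> sobolev_H m \<Omega>"
    using sobolev_H_lincomb[of "UNIV :: bool set" "\<lambda>i. if i then f else g" m "\<lambda>_. 1"] f g by (simp add: UNIV_bool add.commute)
qed

text \<open>For a multiple eigenvalue the function may change with the mesh, so a bound for each
  single function would not do. The members of the span that lie in \<open>sobolev_H\<close> form a
  finite-dimensional space; a vector of norm at most 1 has coefficients of size at most 1 in an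
  orthonormal basis, and derivatives depend linearly on them. The intersection keeps the basis
  regular even if other members of the span are not.\<close>

lemma weak_deriv_bound_on_span:
  assumes w: "orthonormal \<Omega> J w"
  obtains B where "\<And>v a b. v \<in> sobolev_H m \<Omega> \<Longrightarrow> v \<in> L2_span \<Omega> w J \<Longrightarrow> L2_norm \<Omega> v \<le> 1 \<Longrightarrow> a + b \<le> m
    \<Longrightarrow> L2_norm \<Omega> (weak_deriv \<Omega> a b v) \<le> B"
proof -
  define V where "V = sobolev_H m \<Omega> \<inter> L2_span \<Omega> w J"
  have wL: "w j \<in> L2_space \<Omega>" if "j \<in> J" for j using w that by (auto simp: orthonormal_def)
  have V: "L2_subspace \<Omega> V"
    using sobolev_H_subspace[of m] L2_span_subspace[OF wL, of J] unfolding V_def L2_subspace_def by auto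
  have finJ: "finite J" using w by (simp add: orthonormal_def)
  obtain n :: nat and e where e: "orthonormal \<Omega> {..<n} e" "\<And>i. i < n \<Longrightarrow> e i \<in> V"
    and span: "\<And>x. x \<in> V \<Longrightarrow> AE p in lebesgue_on \<Omega>. x p = expansion \<Omega> {..<n} e x p"
    by (rule orthonormal_basis_exists[OF V finJ wL]) (auto simp: V_def L2_span_norm[OF w])
  define W where "W i = (\<Sum>(a, b)\<in>{..m} \<times> {..m}. L2_norm \<Omega> (weak_deriv \<Omega> a b (e i)))" for i
  show thesis
  proof (rule that[of "\<Sum>i<n. W i"])
    fix v a b assume v: "v \<in> sobolev_H m \<Omega>" "v \<in> L2_span \<Omega> w J" "L2_norm \<Omega> v \<le> 1" and ab: "a + b \<le> m"
    then have vV: "v \<in> V" by (simp add: V_def)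
    define c where "c i = L2_inner \<Omega> v (e i)" for i
    have eH: "e i \<in> sobolev_H m \<Omega>" and eL: "e i \<in> L2_space \<Omega>" if "i < n" for i
      using e(2)[OF that] by (auto simp: V_def sobolev_H_def)
    have vL: "v \<in> L2_space \<Omega>" using v by (simp add: sobolev_H_def)
    have c1: "\<bar>c i\<bar> \<le> 1" if i: "i < n" for i
    proof -
      have "L2_norm \<Omega> (e i) = 1" using e(1) i by (simp add: orthonormal_def L2_norm_def)
      then show ?thesis using L2_Cauchy_Schwarz[OF vL eL[OF i]] v(3) by (simp add: c_def)
    qed
    note D = weak_deriv_props[OF eH ab]
    have sL: "(\<lambda>p. \<Sum>i<n. c i *\<^sub>R weak_deriv \<Omega> a b (e i) p) \<in> L2_space \<Omega>"
      using D by (intro L2_sum L2_scaleR) simp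
    have "is_weak_deriv \<Omega> a b v (\<lambda>p. \<Sum>i<n. c i *\<^sub>R weak_deriv \<Omega> a b (e i) p)"
      using D eL vL span[OF vV] by (intro is_weak_deriv_lincomb[where f=e]) (simp_all add: expansion_def c_def)
    from is_weak_deriv_unique[OF weak_deriv_props(2)[OF v(1) ab] this weak_deriv_props(1)[OF v(1) ab] sL]
    have "L2_norm \<Omega> (weak_deriv \<Omega> a b v) = L2_norm \<Omega> (\<lambda>p. \<Sum>i<n. c i *\<^sub>R weak_deriv \<Omega> a b (e i) p)"
      by (rule L2_norm_AE_cong[OF _ weak_deriv_props(1)[OF v(1) ab] sL])
    also have "\<dots> \<le> (\<Sum>i<n. L2_norm \<Omega> (\<lambda>p. c i *\<^sub>R weak_deriv \<Omega> a b (e i) p))"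
      using D by (intro L2_norm_sum_le L2_scaleR) simp
    also have "\<dots> \<le> (\<Sum>i<n. W i)"
    proof (rule sum_mono)
      fix i assume "i \<in> {..<n}"
      then have "L2_norm \<Omega> (\<lambda>p. c i *\<^sub>R weak_deriv \<Omega> a b (e i) p) \<le> 1 * L2_norm \<Omega> (weak_deriv \<Omega> a b (e i))"
        unfolding L2_norm_scaleR by (intro mult_right_mono c1) auto
      also have "\<dots> \<le> W i"
        unfolding W_def using ab member_le_sum[of "(a, b)" "{..m} \<times> {..m}" "\<lambda>(a, b). L2_norm \<Omega> (weak_deriv \<Omega> a b (e i))"] by auto
      finally show "L2_norm \<Omega> (\<lambda>p. c i *\<^sub>R weak_deriv \<Omega> a b (e i) p) \<le> W i" .
    qed
    finally show "L2_norm \<Omega> (weak_deriv \<Omega> a b v) \<le> (\<Sum>i<n. W i)" .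
  qed
qed

end

section \<open>The spectral gap\<close>

text \<open>(x - \<mu>) / sqrt x increases in x, so beyond \<mu> + \<eta> it is smallest at \<mu> +
  \<eta>. The bound thus covers arbitrarily large discrete eigenvalues.\<close>

lemma sqrt_gap:
  fixes \<mu> \<eta> x :: real
  assumes "0 < \<mu>" "0 < \<eta>" "\<mu> + \<eta> \<le> x"
  shows "\<eta> / sqrt (\<mu> + \<eta>) * sqrt x \<le> x - \<mu>"
proof -
  define r s where "r = sqrt (\<mu> + \<eta>)" and "s = sqrt x"
  have r: "0 < r" "\<mu> + \<eta> = r * r" and s: "r \<le> s" "x = s * s" using assms by (simp_all add: r_def s_def)
  have "\<eta> \<le> r * r" using assms r by simp
  then have "\<eta> * (s - r) \<le> (r * r) * (s - r)" using s by (intro mult_right_mono) auto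
  then have "\<eta> / r * s - \<eta> \<le> r * (s - r)" using r by (simp add: field_simps)
  also have "\<dots> \<le> (s + r) * (s - r)" using r s by (intro mult_right_mono) auto
  also have "\<dots> = x - \<mu> - \<eta>" using r s by (simp add: algebra_simps)
  finally show ?thesis by (simp add: r_def s_def)
qed

text \<open>Convergence is known for each index separately, while the number of discrete eigenvalues
  is not bounded along the family. Monotonicity in the index reduces everything above the cluster to
  the first eigenvalue after it, and everything below to the last one before it.\<close>

lemma spectral_gap:
  fixes lam :: "nat \<Rightarrow> real" and lamh :: "'i \<Rightarrow> nat \<Rightarrow> real"
  assumes mono: "mono_on {1..} lam" and fin: "finite {j\<in>{1..}. lam j = lam k}" and k: "1 \<le> k" and pos: "0 < lam k"
    and conv: "\<And>j. 1 \<le> j \<Longrightarrow> ((\<lambda>t. lamh t j) \<longlongrightarrow> lam j) F"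
    and monoh: "\<And>t. mono_on {1..N t} (lamh t)" and posh: "\<And>t j. j \<in> {1..N t} \<Longrightarrow> 0 < lamh t j"
    and kN: "\<forall>\<^sub>F t in F. k \<in> {1..N t}"
  obtains \<delta> where "\<delta> > 0"
    "\<forall>\<^sub>F t in F. \<forall>j\<in>{1..N t}. lam j \<noteq> lam k \<longrightarrow> \<delta> * sqrt (lamh t j) \<le> \<bar>lamh t j - lam k\<bar>"
proof -
  define J where "J = {j\<in>{1..}. lam j = lam k}"
  have le: "lam i \<le> lam j" if "1 \<le> i" "i \<le> j" for i j using mono that by (auto simp: mono_on_def)
  have finJ: "finite J" and kJ: "k \<in> J" using fin k by (auto simp: J_def)
  then have mx: "Max J \<in> J" "k \<le> Max J" and mn: "Min J \<in> J" "Min J \<le> k" by (auto intro: Max_in Min_in)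
  obtain \<delta>1 where d1: "\<delta>1 > 0"
    "\<forall>\<^sub>F t in F. \<forall>j\<in>{1..N t}. lam k < lam j \<longrightarrow> \<delta>1 * sqrt (lamh t j) \<le> \<bar>lamh t j - lam k\<bar>"
  proof -
    \<comment> \<open>The first index after the cluster. Discrete eigenvalues with a larger index
      lie above \<open>lamh t p\<close>, which eventually exceeds \<open>lam k\<close> by half the
      distance to \<open>lam p\<close>.\<close>
    define p where "p = Suc (Max J)"
    have "p \<notin> J" using Max_ge[OF finJ, of p] unfolding p_def by linarith
    then have p: "lam k < lam p" "1 \<le> p" using le[of k p] k mx by (auto simp: J_def p_def)
    define \<eta> where "\<eta> = (lam p - lam k) / 2"
    have \<eta>: "0 < \<eta>" "lam k + \<eta> < lam p" using p by (simp_all add: \<eta>_def field_simps)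
    show thesis
    proof (rule that[of "\<eta> / sqrt (lam k + \<eta>)"])
      show "\<forall>\<^sub>F t in F. \<forall>j\<in>{1..N t}. lam k < lam j \<longrightarrow> \<eta> / sqrt (lam k + \<eta>) * sqrt (lamh t j) \<le> \<bar>lamh t j - lam k\<bar>"
        using order_tendstoD(1)[OF conv[OF p(2)] \<eta>(2)]
      proof eventually_elim
        case (elim t)
        show ?case
        proof (intro ballI impI)
          fix j assume j: "j \<in> {1..N t}" "lam k < lam j"
          have "Max J < j" using le[of j "Max J"] j mx by (force simp: J_def)
          then have "lamh t p \<le> lamh t j" using monoh[of t] j by (auto simp: mono_on_def p_def)
          then show "\<eta> / sqrt (lam k + \<eta>) * sqrt (lamh t j) \<le> \<bar>lamh t j - lam k\<bar>"
            using sqrt_gap[OF pos \<eta>(1), of "lamh t j"] elim by linarith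
        qed
      qed
    qed (use \<eta> pos in auto)
  qed
  obtain \<delta>2 where d2: "\<delta>2 > 0"
    "\<forall>\<^sub>F t in F. \<forall>j\<in>{1..N t}. lam j < lam k \<longrightarrow> \<delta>2 * sqrt (lamh t j) \<le> \<bar>lamh t j - lam k\<bar>"
  proof (cases "Min J = 1")
    case True
    \<comment> \<open>No index precedes the cluster, so the condition is vacuous and any positive
      constant serves.\<close>
    have "\<not> lam j < lam k" if "1 \<le> j" for j using le[of "Min J" j] that True mn by (auto simp: J_def)
    then show thesis by (intro that[of 1]) auto
  next
    case False
    define q where "q = Min J - 1"
    have q1: "1 \<le> q" "q < Min J" using False mn by (auto simp: J_def q_def)
    then have "q \<notin> J" using Min_le[OF finJ, of q] by linarith
    then have q: "lam q < lam k" using le[of q k] q1 mn by (auto simp: J_def)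
    define \<eta> where "\<eta> = (lam k - lam q) / 2"
    have \<eta>: "0 < \<eta>" "lam q < lam k - \<eta>" using q by (simp_all add: \<eta>_def field_simps)
    show thesis
    proof (rule that[of "\<eta> / sqrt (lam k)"])
      show "\<forall>\<^sub>F t in F. \<forall>j\<in>{1..N t}. lam j < lam k \<longrightarrow> \<eta> / sqrt (lam k) * sqrt (lamh t j) \<le> \<bar>lamh t j - lam k\<bar>"
        using order_tendstoD(2)[OF conv[OF q1(1)] \<eta>(2)] kN
      proof eventually_elim
        case (elim t)
        show ?case
        proof (intro ballI impI)
          fix j assume j: "j \<in> {1..N t}" "lam j < lam k"
          have "j < Min J" using le[of "Min J" j] j mn by (force simp: J_def)
          \<comment> \<open>\<open>q\<close> is an index of a discrete eigenvalue because it lies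
            below k, and k is eventually within the list.\<close>
          then have "j \<le> q" "q \<in> {1..N t}" using elim(2) mn(2) q1 by (auto simp: q_def)
          then have "lamh t j \<le> lamh t q" using monoh[of t] j(1) unfolding mono_on_def by blast
          then have x: "lamh t j \<le> lam k - \<eta>" using elim(1) by linarith
          have "\<eta> / sqrt (lam k) * sqrt (lamh t j) \<le> \<eta> / sqrt (lam k) * sqrt (lam k)"
            using x \<eta>(1) pos by (intro mult_left_mono) auto
          also have "\<dots> = \<eta>" using pos by simp
          finally show "\<eta> / sqrt (lam k) * sqrt (lamh t j) \<le> \<bar>lamh t j - lam k\<bar>" using x by linarith
        qed
      qed
    qed (use \<eta> pos in auto)
  qed
  show thesis
  proof (rule that[of "min \<delta>1 \<delta>2"])
    show "\<forall>\<^sub>F t in F. \<forall>j\<in>{1..N t}. lam j \<noteq> lam k \<longrightarrow> min \<delta>1 \<delta>2 * sqrt (lamh t j) \<le> \<bar>lamh t j - lam k\<bar>"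
      using d1(2) d2(2)
    proof eventually_elim
      case (elim t)
      show ?case
      proof (intro ballI impI)
        fix j assume j: "j \<in> {1..N t}" "lam j \<noteq> lam k"
        have "min \<delta>1 \<delta>2 * sqrt (lamh t j) \<le> d * sqrt (lamh t j)" if "d \<in> {\<delta>1, \<delta>2}" for d
          using posh[OF j(1)] that by (intro mult_right_mono) auto
        then show "min \<delta>1 \<delta>2 * sqrt (lamh t j) \<le> \<bar>lamh t j - lam k\<bar>"
          using elim j by (meson insertI1 insertI2 linorder_neqE_linordered_idom order_trans)
      qed
    qed
  qed (use d1 d2 in simp)
qed

text \<open>The family of meshes is indexed along an arbitrary filter on which the size tends to 0,
  and the continuous pair may depend on the mesh, as it must for multiple eigenvalues.\<close>

theorem theorem5:
  fixes \<Omega> :: "plane set"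
    and F :: "'i filter"
    and \<T> :: "'i \<Rightarrow> grid"
    and lam :: "nat \<Rightarrow> real"
    and \<sigma>s :: "nat \<Rightarrow> plane \<Rightarrow> plane"
    and us :: "nat \<Rightarrow> plane \<Rightarrow> real"
    and N :: "'i \<Rightarrow> nat"
    and lamh :: "'i \<Rightarrow> nat \<Rightarrow> real"
    and \<sigma>h :: "'i \<Rightarrow> nat \<Rightarrow> plane \<Rightarrow> plane"
    and uh :: "'i \<Rightarrow> nat \<Rightarrow> plane \<Rightarrow> real"
    and k :: nat
    and \<sigma> :: "'i \<Rightarrow> plane \<Rightarrow> plane"
    and u :: "'i \<Rightarrow> plane \<Rightarrow> real"
  defines "h \<equiv> \<lambda>t. mesh_size (\<T> t)"
  assumes domain: "rect_domain \<Omega>"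
    and mesh: "\<And>t. rect_mesh \<Omega> (\<T> t)"
    and h_tendsto_0: "(h \<longlongrightarrow> 0) F"
    and continuous_problem:
      "eigensystem \<Omega> (H_div \<Omega>) (L2_space \<Omega>) {1..} lam \<sigma>s us"
    and discrete_problem:
      "\<And>t. eigensystem \<Omega> (Sigma_h \<Omega> (\<T> t)) (V_h \<Omega> (\<T> t)) {1..N t} (lamh t) (\<sigma>h t) (uh t)"
    and k: "1 \<le> k"
    and correspond: "\<forall>\<^sub>F t in F. corresponding \<Omega> lam us (N t) (uh t) k (\<sigma> t) (u t)"
    and regularity: "\<forall>\<^sub>F t in F. u t \<in> sobolev_H 5 \<Omega>"
    and a_priori_convergence: "\<And>j. 1 \<le> j \<Longrightarrow> ((\<lambda>t. lamh t j) \<longlongrightarrow> lam j) F"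
    and a_priori_lambda: "(\<lambda>t. lamh t k - lam k) \<in> O[F](\<lambda>t. h t ^ 2)"
    and a_priori_sigma: "(\<lambda>t. L2_norm \<Omega> (\<lambda>p. \<sigma>h t k p - \<sigma> t p)) \<in> O[F](h)"
    and a_priori_u: "(\<lambda>t. L2_norm \<Omega> (\<lambda>p. uh t k p - u t p)) \<in> O[F](h)"
  shows "(\<lambda>t. (lamh t k - lam k) -
            (- (1 / 12) * (\<Sum>(i, j)\<in>elements \<Omega> (\<T> t).
               (hx (\<T> t) i)\<^sup>2 * (LINT p|lebesgue_on (cell (\<T> t) (i, j)).
                   weak_deriv \<Omega> 3 0 (u t) p * weak_deriv \<Omega> 1 0 (u t) p) +
               (hy (\<T> t) j)\<^sup>2 * (LINT p|lebesgue_on (cell (\<T> t) (i, j)).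
                   weak_deriv \<Omega> 0 3 (u t) p * weak_deriv \<Omega> 0 1 (u t) p))))
         \<in> O[F](\<lambda>t. h t ^ 4)"
proof -
  define J C where "J = {j\<in>{1..}. lam j = lam k}" and "C = {j. lam j = lam k}"
  have lamk: "0 < lam k" and mono: "mono_on {1..} lam" and finJ: "finite {j\<in>{1..}. lam j = lam k}"
    using continuous_problem k unfolding eigensystem_def by auto
  have usJ: "orthonormal \<Omega> J us"
    using continuous_problem unfolding eigensystem_def mixed_eigenpair_def orthonormal_def J_def by auto
  have monoh: "mono_on {1..N t} (lamh t)" and posh: "j \<in> {1..N t} \<Longrightarrow> 0 < lamh t j" for t j
    using discrete_problem[of t] unfolding eigensystem_def by auto
  have kN: "\<forall>\<^sub>F t in F. k \<in> {1..N t}"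
    using correspond by eventually_elim (simp add: corresponding_def)
  \<comment> \<open>One mesh is fixed to have the facts about the domain proved in
    \<open>meshed\<close>; the bound \<open>Q\<close> obtained from it is the same for the whole
    family.\<close>
  obtain G where G: "rect_mesh \<Omega> G" using domain unfolding rect_domain_def by blast
  interpret G: meshed \<Omega> G using domain G by unfold_locales
  obtain Q where Q: "\<And>v a b. v \<in> sobolev_H 5 \<Omega> \<Longrightarrow> v \<in> L2_span \<Omega> us J \<Longrightarrow> L2_norm \<Omega> v \<le> 1 \<Longrightarrow> a + b \<le> 5
      \<Longrightarrow> L2_norm \<Omega> (weak_deriv \<Omega> a b v) \<le> Q"
    by (rule G.weak_deriv_bound_on_span[OF usJ, of 5]) blast
  obtain \<delta> where \<delta>: "\<delta> > 0"
    "\<forall>\<^sub>F t in F. \<forall>j\<in>{1..N t}. lam j \<noteq> lam k \<longrightarrow> \<delta> * sqrt (lamh t j) \<le> \<bar>lamh t j - lam k\<bar>"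
    by (rule spectral_gap[OF mono finJ k lamk a_priori_convergence monoh posh kN])
  obtain c1 c2 c3 where
      c1: "\<forall>\<^sub>F t in F. norm (lamh t k - lam k) \<le> c1 * norm (h t ^ 2)" and
      c2: "\<forall>\<^sub>F t in F. norm (L2_norm \<Omega> (\<lambda>p. \<sigma>h t k p - \<sigma> t p)) \<le> c2 * norm (h t)" and
      c3: "\<forall>\<^sub>F t in F. norm (L2_norm \<Omega> (\<lambda>p. uh t k p - u t p)) \<le> c3 * norm (h t)"
    using a_priori_lambda a_priori_sigma a_priori_u by (elim landau_o.bigE) blast
  \<comment> \<open>A common constant serves the three a priori estimates; \<open>L\<close>
    eventually bounds the discrete eigenvalue from above.\<close>
  define c L where "c = max c1 (max c2 c3)" and "L = lam k + 1"
  define e where "e = 2 * Q + L * (c\<^sup>2 / 2 + 2 * Q / \<delta>) + c + (c\<^sup>2 / 2 + 2 * Q / \<delta>)"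
  have h1: "\<forall>\<^sub>F t in F. h t < 1" using order_tendstoD(2)[OF h_tendsto_0] by simp
  have L: "\<forall>\<^sub>F t in F. lamh t k < L" using order_tendstoD(2)[OF a_priori_convergence[OF k]] by (simp add: L_def)
  show ?thesis
  \<comment> \<open>The rule asks for a positive constant, which the absolute value plus 1
    ensures.\<close>
  proof (rule landau_o.bigI[of "\<bar>c ^ 3 / 2 + 2 * Q * e + 36 * Q\<^sup>2 + (c + e)\<^sup>2\<bar> + 1"])
    show "\<forall>\<^sub>F t in F. norm ((lamh t k - lam k) -
            (- (1 / 12) * (\<Sum>(i, j)\<in>elements \<Omega> (\<T> t).
               (hx (\<T> t) i)\<^sup>2 * (LINT p|lebesgue_on (cell (\<T> t) (i, j)).
                   weak_deriv \<Omega> 3 0 (u t) p * weak_deriv \<Omega> 1 0 (u t) p) +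
               (hy (\<T> t) j)\<^sup>2 * (LINT p|lebesgue_on (cell (\<T> t) (i, j)).
                   weak_deriv \<Omega> 0 3 (u t) p * weak_deriv \<Omega> 0 1 (u t) p))))
         \<le> (\<bar>c ^ 3 / 2 + 2 * Q * e + 36 * Q\<^sup>2 + (c + e)\<^sup>2\<bar> + 1) * norm (h t ^ 4)"
      using correspond regularity kN \<delta>(2) c1 c2 c3 h1 L
    proof eventually_elim
      case (elim t)
      have ep: "mixed_eigenpair \<Omega> (H_div \<Omega>) (L2_space \<Omega>) (lam k) (\<sigma> t) (u t)" and uJ: "u t \<in> L2_span \<Omega> us J"
        and un: "L2_norm \<Omega> (u t) = 1"
        using elim(1) unfolding corresponding_def J_def by blast+
      note W = weak_deriv_props[OF elim(2)]
      interpret S: smooth_pair \<Omega> "\<T> t" "N t" "lamh t" "\<sigma>h t" "uh t" "lam k" "\<sigma> t" "u t" "\<lambda>a b. weak_deriv \<Omega> a b (u t)"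
        by unfold_locales (use domain mesh discrete_problem ep un W in \<open>simp_all add: L2_norm_def\<close>)
      have h0: "0 < h t" using S.mesh_size_bounds(3) by (simp add: h_def)
      have uhL: "uh t j \<in> L2_space \<Omega>" if "j \<in> {1..N t}" for j using S.V_h_L2[OF S.eig(2)[OF that]] .
      \<comment> \<open>By the choice of u, its difference to a multiple of \<open>uh t k\<close> is
        orthogonal to the whole discrete cluster, and \<open>uh t k\<close> is orthogonal to the
        other members of the cluster.\<close>
      have cluster: "L2_inner \<Omega> (u t) (uh t j) = 0" if j: "j \<in> {1..N t}" "j \<in> C" "j \<noteq> k" for j
      proof -
        obtain \<alpha> where \<alpha>: "is_L2_projection \<Omega> (L2_span \<Omega> (uh t) {j\<in>{1..N t}. lam j = lam k}) (u t) (\<lambda>p. \<alpha> * uh t k p)"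
          using elim(1) unfolding corresponding_def by blast
        have "uh t j p = (\<Sum>i\<in>{j\<in>{1..N t}. lam j = lam k}. (if i = j then 1 else 0) * uh t i p)" for p
          using j by (subst sum.mono_neutral_right[of _ "{j}"]) (auto simp: C_def)
        then have "uh t j \<in> L2_span \<Omega> (uh t) {j\<in>{1..N t}. lam j = lam k}"
          unfolding L2_span_def using uhL[OF j(1)] by (auto intro!: exI[of _ "\<lambda>i. if i = j then 1 else 0"])
        then have "L2_inner \<Omega> (\<lambda>p. u t p - \<alpha> * uh t k p) (uh t j) = 0"
          using \<alpha> unfolding is_L2_projection_def by blast
        then have "L2_inner \<Omega> (u t) (uh t j) = \<alpha> * L2_inner \<Omega> (uh t k) (uh t j)"
          using L2_inner_diff_left[OF S.uL L2_cmult[OF uhL[OF elim(3)]] uhL[OF j(1)]] by (simp add: L2_inner_cmult_left)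
        then show ?thesis using S.uh_orthonormal elim(3) j by (simp add: orthonormal_def)
      qed
      have le: "z \<le> c * y" if "z \<le> x * y" "x \<le> c" "0 \<le> y" for x y z
        using that mult_right_mono[of x c y] by linarith
      have c: "\<bar>lamh t k - lam k\<bar> \<le> c * (mesh_size (\<T> t))\<^sup>2" "L2_norm \<Omega> (\<lambda>p. uh t k p - u t p) \<le> c * mesh_size (\<T> t)"
        "L2_norm \<Omega> (\<lambda>p. \<sigma>h t k p - \<sigma> t p) \<le> c * mesh_size (\<T> t)"
        using elim(5-7) h0 unfolding h_def
        by (intro le[of _ c1] le[of _ c3] le[of _ c2]; simp add: c_def)+
      have "\<bar>(lamh t k - lam k) + 1 / 12 * S.lead\<bar> \<le> (c ^ 3 / 2 + 2 * Q * e + 36 * Q\<^sup>2 + (c + e)\<^sup>2) * mesh_size (\<T> t) ^ 4"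
        unfolding e_def
      proof (rule S.eigenvalue_expansion[OF elim(3) _ lamk _ \<delta>(1) cluster _ _ c])
        show "k \<in> C" by (simp add: C_def)
        show "\<delta> * sqrt (lamh t j) \<le> \<bar>lamh t j - lam k\<bar>" if "j \<in> {1..N t}" "j \<notin> C" for j
          using elim(4) that by (simp add: C_def)
        show "L2_norm \<Omega> (weak_deriv \<Omega> a b (u t)) \<le> Q" if "a + b \<le> 5" for a b
          using Q[OF elim(2) uJ _ that] un by simp
      qed (use elim(8,9) in \<open>simp_all add: h_def\<close>)
      also have "\<dots> \<le> (\<bar>c ^ 3 / 2 + 2 * Q * e + 36 * Q\<^sup>2 + (c + e)\<^sup>2\<bar> + 1) * h t ^ 4"
        unfolding h_def by (intro mult_right_mono) auto
      finally show ?case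
        using h0 unfolding S.lead_def S.EL_def S.cell_K by simp
    qed
  qed simp
qed


end
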